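(* Let $S_1,\dots,S_m\subset R$ be a finite collection of multiplicative subsets in a commutative ring $R$. Assume that, for every subset of indices $J\subset\{1,\dots,m\}$, the projective dimension of the $R$-module $S_J^{-1}R$ does not exceed $1$. Assume furthermore that for every $j=1,\dots,m$ one of the following two possibilities holds: either $S_j$ is countable, or the $S_j$-torsion in $R$ is bounded. Then a flat $R$-module $F$ is $\mathbf S^\times$-strongly flat if and only if the $R_{J,\mathbf s}$-module $R_{J,\mathbf s}\otimes_R F$ is projective for every subset of indices $J\subset\{1,\dots,m\}$ and every choice of elements $s_k\in S_k$, $k\in\{1,\dots,m\}\setminus J$.
   Context: Multiplicative subsets may contain zero-divisors; "countable" means at most countable. The $S$-torsion in $R$ is bounded if there exists $s_0\in S$ such that, whenever $sr=0$ for some $s\in S$ and $r\in R$, one has $s_0r=0$. For $J\subset\{1,\dots,m\}$, $S_J=\prod_{j\in J}S_j\subset R$ denotes the multiplicative subset generated by all the $S_j$, $j\in J$ (so $S_\varnothing=\{1\}$). Write $\mathbf S^\times=\{S_J\mid J\subset\{1,\dots,m\}\}$. An $R$-module $C$ is $\mathbf S^\times$-weakly cotorsion if $\operatorname{Ext}^1_R(S_J^{-1}R,C)=0$ for all $J\subset\{1,\dots,m\}$. An $R$-module $F$ is $\mathbf S^\times$-strongly flat if $\operatorname{Ext}^1_R(F,C)=0$ for all $\mathbf S^\times$-weakly cotorsion $R$-modules $C$. For $J\subset\{1,\dots,m\}$ with complement $K=\{1,\dots,m\}\setminus J$ and a collection of elements $\mathbf s=(s_k\in S_k)_{k\in K}$,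 $R_{J,\mathbf s}$ denotes the quotient ring of $S_J^{-1}R$ by the ideal generated by (the images of) all the elements $s_k$, $k\in K$. *)

theory Defs
  imports "HOL-Library.Countable_Set" "HOL-Library.Equipollence" "HOL-Algebra.Module" "HOL-Algebra.QuotRing"
begin

section \<open>Modules over a commutative ring\<close>

text \<open>
  Modules are those of \<^locale>\<open>Module.module\<close>. The fields \<^const>\<open>mult\<close> and \<^const>\<open>one\<close> of the module
  record play no role for modules. They are left \<^const>\<open>undefined\<close> in the constructions below.
\<close>

subsection \<open>Homomorphisms\<close>

definition mod_hom ::
    "('r, 'x) ring_scheme \<Rightarrow> ('r, 'm, 'y) module_scheme \<Rightarrow> ('r, 'n, 'z) module_scheme \<Rightarrow> ('m \<Rightarrow> 'n) set"
  where "mod_hom R M N =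
    {f \<in> carrier M \<rightarrow>\<^sub>E carrier N.
       (\<forall>x\<in>carrier M. \<forall>y\<in>carrier M. f (x \<oplus>\<^bsub>M\<^esub> y) = f x \<oplus>\<^bsub>N\<^esub> f y) \<and>
       (\<forall>r\<in>carrier R. \<forall>x\<in>carrier M. f (r \<odot>\<^bsub>M\<^esub> x) = r \<odot>\<^bsub>N\<^esub> f x)}"

definition hom_module ::
    "('r, 'x) ring_scheme \<Rightarrow> ('r, 'm, 'y) module_scheme \<Rightarrow> ('r, 'n, 'z) module_scheme
      \<Rightarrow> ('r, 'm \<Rightarrow> 'n) module"
  where "hom_module R M N =
    \<lparr>carrier = mod_hom R M N, mult = undefined, one = undefined,
     zero = (\<lambda>x\<in>carrier M. \<zero>\<^bsub>N\<^esub>),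
     add = (\<lambda>f g. \<lambda>x\<in>carrier M. f x \<oplus>\<^bsub>N\<^esub> g x),
     smult = (\<lambda>r f. \<lambda>x\<in>carrier M. r \<odot>\<^bsub>N\<^esub> f x)\<rparr>"

definition mod_ker :: "('r, 'm, 'y) module_scheme \<Rightarrow> ('r, 'n, 'z) module_scheme \<Rightarrow> ('m \<Rightarrow> 'n) \<Rightarrow> 'm set"
  where "mod_ker M N f = {x \<in> carrier M. f x = \<zero>\<^bsub>N\<^esub>}"

subsection \<open>Generated submodules and quotient modules\<close>

definition gen_submodule :: "('r, 'x) ring_scheme \<Rightarrow> ('r, 'm, 'y) module_scheme \<Rightarrow> 'm set \<Rightarrow> 'm set"
  where "gen_submodule R M X = \<Inter>{H. submodule H R M \<and> X \<subseteq> H}"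

definition quotient_module :: "('r, 'm, 'y) module_scheme \<Rightarrow> 'm set \<Rightarrow> ('r, 'm set) module"
  where "quotient_module M H =
    \<lparr>carrier = a_rcosets\<^bsub>M\<^esub> H, mult = undefined, one = undefined, zero = H, add = set_add M,
     smult = (\<lambda>r X. \<Union>x\<in>X. H +>\<^bsub>M\<^esub> (r \<odot>\<^bsub>M\<^esub> x))\<rparr>"

subsection \<open>Free modules\<close>

definition free_module :: "('r, 'x) ring_scheme \<Rightarrow> 'i set \<Rightarrow> ('r, 'i \<Rightarrow> 'r) module"
  where "free_module R X =
    \<lparr>carrier = {p. (\<forall>x. p x \<in> carrier R) \<and> (\<forall>x. x \<notin> X \<longrightarrow> p x = \<zero>\<^bsub>R\<^esub>) \<and> finite {x. p x \<noteq> \<zero>\<^bsub>R\<^esub>}},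
     mult = undefined, one = undefined,
     zero = (\<lambda>x. \<zero>\<^bsub>R\<^esub>),
     add = (\<lambda>p q x. p x \<oplus>\<^bsub>R\<^esub> q x),
     smult = (\<lambda>r p x. r \<otimes>\<^bsub>R\<^esub> p x)\<rparr>"

definition free_gen :: "('r, 'x) ring_scheme \<Rightarrow> 'i \<Rightarrow> ('i \<Rightarrow> 'r)"
  where "free_gen R x = (\<lambda>y. if y = x then \<one>\<^bsub>R\<^esub> else \<zero>\<^bsub>R\<^esub>)"

text \<open>The linear map from the free module on \<open>X\<close> to \<open>M\<close> which takes the generator of \<open>x\<close> to \<open>v x\<close>:\<close>

definition free_lift ::
    "('r, 'x) ring_scheme \<Rightarrow> 'i set \<Rightarrow> ('r, 'm, 'y) module_scheme \<Rightarrow> ('i \<Rightarrow> 'm) \<Rightarrow> ('i \<Rightarrow> 'r) \<Rightarrow> 'm"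
  where "free_lift R X M v =
    (\<lambda>p\<in>carrier (free_module R X). \<Oplus>\<^bsub>M\<^esub>x\<in>{x. p x \<noteq> \<zero>\<^bsub>R\<^esub>}. p x \<odot>\<^bsub>M\<^esub> v x)"

subsection \<open>Projective modules, projective dimension at most one\<close>

text \<open>
  The lifting property. A definition cannot quantify over types, so the types of the test modules
  \<open>M\<close> and \<open>N\<close> are fixed. They admit the canonical surjection from the free module on the set
  \<^term>\<open>carrier P\<close> onto \<open>P\<close>. A lift of the identity along it makes \<open>P\<close> a direct summand of a free
  module, and so the lifting property follows for modules of arbitrary types.
\<close>

definition projective_module :: "('r, 'x) ring_scheme \<Rightarrow> ('r, 'p, 'y) module_scheme \<Rightarrow> bool"
  where "projective_module R P \<longleftrightarrow> module R P \<and>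
    (\<forall>(M :: ('r, 'p \<Rightarrow> 'r) module) (N :: ('r, 'p) module) g f.
       module R M \<longrightarrow> module R N \<longrightarrow>
       g \<in> mod_hom R M N \<longrightarrow> g ` carrier M = carrier N \<longrightarrow> f \<in> mod_hom R P N \<longrightarrow>
       (\<exists>h\<in>mod_hom R P M. \<forall>x\<in>carrier P. g (h x) = f x))"

text \<open>
  Existence of a projective resolution \<open>0 \<rightarrow> P1 \<rightarrow> P0 \<rightarrow> M \<rightarrow> 0\<close>. The type of \<open>P0\<close> and \<open>P1\<close> is that of
  the free module on the set \<^term>\<open>carrier M\<close>. This loses no generality: by Schanuel's lemma, if
  there is any such resolution, then the kernel of the canonical map from this free module onto \<open>M\<close>
  is projective.
\<close>

definition proj_dim_le_one :: "('r, 'x) ring_scheme \<Rightarrow> ('r, 'm, 'y) module_scheme \<Rightarrow> bool"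
  where "proj_dim_le_one R M \<longleftrightarrow>
    (\<exists>(P0 :: ('r, 'm \<Rightarrow> 'r) module) (P1 :: ('r, 'm \<Rightarrow> 'r) module) e d.
       projective_module R P0 \<and> projective_module R P1 \<and>
       e \<in> mod_hom R P0 M \<and> e ` carrier P0 = carrier M \<and>
       d \<in> mod_hom R P1 P0 \<and> inj_on d (carrier P1) \<and> d ` carrier P1 = mod_ker P0 M e)"

subsection \<open>The first Ext module\<close>

text \<open>
  \<open>Ext\<^sup>1\<close> of \<open>M\<close> and \<open>N\<close> is the first cohomology of \<open>Hom(P\<^sub>\<bullet>, N)\<close>, where \<open>P2 \<rightarrow> P1 \<rightarrow> P0 \<rightarrow> M \<rightarrow> 0\<close> is the
  beginning of the standard free resolution: \<open>P0\<close> is free on the set \<open>M\<close>, and each further term is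
  free on the set of all elements of the preceding kernel.
\<close>

definition std_res0 :: "('r, 'x) ring_scheme \<Rightarrow> ('r, 'm, 'y) module_scheme \<Rightarrow> ('r, 'm \<Rightarrow> 'r) module"
  where "std_res0 R M = free_module R (carrier M)"

definition std_ker0 :: "('r, 'x) ring_scheme \<Rightarrow> ('r, 'm, 'y) module_scheme \<Rightarrow> ('m \<Rightarrow> 'r) set"
  where "std_ker0 R M = mod_ker (std_res0 R M) M (free_lift R (carrier M) M (\<lambda>x. x))"

definition std_res1 ::
    "('r, 'x) ring_scheme \<Rightarrow> ('r, 'm, 'y) module_scheme \<Rightarrow> ('r, ('m \<Rightarrow> 'r) \<Rightarrow> 'r) module"
  where "std_res1 R M = free_module R (std_ker0 R M)"

definition std_diff1 ::
    "('r, 'x) ring_scheme \<Rightarrow> ('r, 'm, 'y) module_scheme \<Rightarrow> (('m \<Rightarrow> 'r) \<Rightarrow> 'r) \<Rightarrow> ('m \<Rightarrow> 'r)"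
  where "std_diff1 R M = free_lift R (std_ker0 R M) (std_res0 R M) (\<lambda>x. x)"

definition std_ker1 ::
    "('r, 'x) ring_scheme \<Rightarrow> ('r, 'm, 'y) module_scheme \<Rightarrow> (('m \<Rightarrow> 'r) \<Rightarrow> 'r) set"
  where "std_ker1 R M = mod_ker (std_res1 R M) (std_res0 R M) (std_diff1 R M)"

definition std_res2 ::
    "('r, 'x) ring_scheme \<Rightarrow> ('r, 'm, 'y) module_scheme \<Rightarrow> ('r, (('m \<Rightarrow> 'r) \<Rightarrow> 'r) \<Rightarrow> 'r) module"
  where "std_res2 R M = free_module R (std_ker1 R M)"

definition std_diff2 ::
    "('r, 'x) ring_scheme \<Rightarrow> ('r, 'm, 'y) module_scheme
      \<Rightarrow> ((('m \<Rightarrow> 'r) \<Rightarrow> 'r) \<Rightarrow> 'r) \<Rightarrow> (('m \<Rightarrow> 'r) \<Rightarrow> 'r)"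
  where "std_diff2 R M = free_lift R (std_ker1 R M) (std_res1 R M) (\<lambda>x. x)"

definition ext1_cocycles ::
    "('r, 'x) ring_scheme \<Rightarrow> ('r, 'm, 'y) module_scheme \<Rightarrow> ('r, 'n, 'z) module_scheme
      \<Rightarrow> ((('m \<Rightarrow> 'r) \<Rightarrow> 'r) \<Rightarrow> 'n) set"
  where "ext1_cocycles R M N =
    {f \<in> mod_hom R (std_res1 R M) N. \<forall>p\<in>carrier (std_res2 R M). f (std_diff2 R M p) = \<zero>\<^bsub>N\<^esub>}"

definition ext1_coboundaries ::
    "('r, 'x) ring_scheme \<Rightarrow> ('r, 'm, 'y) module_scheme \<Rightarrow> ('r, 'n, 'z) module_scheme
      \<Rightarrow> ((('m \<Rightarrow> 'r) \<Rightarrow> 'r) \<Rightarrow> 'n) set"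
  where "ext1_coboundaries R M N =
    (\<lambda>g. \<lambda>p\<in>carrier (std_res1 R M). g (std_diff1 R M p)) ` mod_hom R (std_res0 R M) N"

definition Ext1 ::
    "('r, 'x) ring_scheme \<Rightarrow> ('r, 'm, 'y) module_scheme \<Rightarrow> ('r, 'n, 'z) module_scheme
      \<Rightarrow> ('r, ((('m \<Rightarrow> 'r) \<Rightarrow> 'r) \<Rightarrow> 'n) set) module"
  where "Ext1 R M N =
    quotient_module ((hom_module R (std_res1 R M) N)\<lparr>carrier := ext1_cocycles R M N\<rparr>)
      (ext1_coboundaries R M N)"

definition Ext1_vanishes ::
    "('r, 'x) ring_scheme \<Rightarrow> ('r, 'm, 'y) module_scheme \<Rightarrow> ('r, 'n, 'z) module_scheme \<Rightarrow> bool"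
  where "Ext1_vanishes R M N \<longleftrightarrow> carrier (Ext1 R M N) = {\<zero>\<^bsub>Ext1 R M N\<^esub>}"

subsection \<open>Tensor products and flatness\<close>

text \<open>A ring \<open>A\<close>, regarded as a module via a ring homomorphism \<open>\<phi>\<close> into \<open>A\<close>:\<close>

definition ring_as_module :: "('a, 'x) ring_scheme \<Rightarrow> ('r \<Rightarrow> 'a) \<Rightarrow> ('r, 'a) module"
  where "ring_as_module A \<phi> =
    \<lparr>carrier = carrier A, mult = mult A, one = \<one>\<^bsub>A\<^esub>, zero = \<zero>\<^bsub>A\<^esub>, add = add A,
     smult = (\<lambda>r x. \<phi> r \<otimes>\<^bsub>A\<^esub> x)\<rparr>"

text \<open>
  For a ring homomorphism \<open>\<phi> : R \<rightarrow> A\<close>, an \<open>A\<close>-module \<open>M\<close> and an \<open>R\<close>-module \<open>N\<close>, the \<open>A\<close>-module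
  \<open>M \<otimes>\<^sub>R N\<close>, with \<open>A\<close> acting on the first factor: the universal target of maps on \<open>M \<times> N\<close> which are
  \<open>A\<close>-linear in the first and \<open>R\<close>-linear in the second argument. For \<open>A = R\<close> and \<open>\<phi> = id\<close> it is the
  usual tensor product of two \<open>R\<close>-modules, and for \<open>M = A\<close> it is the extension of scalars
  \<open>A \<otimes>\<^sub>R N\<close>.
\<close>

definition tensor_rels ::
    "('r, 'x) ring_scheme \<Rightarrow> ('a, 'w) ring_scheme \<Rightarrow> ('r \<Rightarrow> 'a)
      \<Rightarrow> ('a, 'm, 'y) module_scheme \<Rightarrow> ('r, 'n, 'z) module_scheme \<Rightarrow> ('m \<times> 'n \<Rightarrow> 'a) set"
  where "tensor_rels R A \<phi> M N =
    (let L = free_module A (carrier M \<times> carrier N); \<delta> = (\<lambda>x y. free_gen A (x, y)) in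
       {\<delta> (x \<oplus>\<^bsub>M\<^esub> x') y \<ominus>\<^bsub>L\<^esub> (\<delta> x y \<oplus>\<^bsub>L\<^esub> \<delta> x' y) | x x' y.
          x \<in> carrier M \<and> x' \<in> carrier M \<and> y \<in> carrier N} \<union>
       {\<delta> x (y \<oplus>\<^bsub>N\<^esub> y') \<ominus>\<^bsub>L\<^esub> (\<delta> x y \<oplus>\<^bsub>L\<^esub> \<delta> x y') | x y y'.
          x \<in> carrier M \<and> y \<in> carrier N \<and> y' \<in> carrier N} \<union>
       {\<delta> (a \<odot>\<^bsub>M\<^esub> x) y \<ominus>\<^bsub>L\<^esub> (a \<odot>\<^bsub>L\<^esub> \<delta> x y) | a x y.
          a \<in> carrier A \<and> x \<in> carrier M \<and> y \<in> carrier N} \<union>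
       {\<delta> (\<phi> r \<odot>\<^bsub>M\<^esub> x) y \<ominus>\<^bsub>L\<^esub> \<delta> x (r \<odot>\<^bsub>N\<^esub> y) | r x y.
          r \<in> carrier R \<and> x \<in> carrier M \<and> y \<in> carrier N})"

definition tensor ::
    "('r, 'x) ring_scheme \<Rightarrow> ('a, 'w) ring_scheme \<Rightarrow> ('r \<Rightarrow> 'a)
      \<Rightarrow> ('a, 'm, 'y) module_scheme \<Rightarrow> ('r, 'n, 'z) module_scheme \<Rightarrow> ('a, ('m \<times> 'n \<Rightarrow> 'a) set) module"
  where "tensor R A \<phi> M N =
    (let L = free_module A (carrier M \<times> carrier N) in
       quotient_module L (gen_submodule A L (tensor_rels R A \<phi> M N)))"

definition pure_tensor ::
    "('r, 'x) ring_scheme \<Rightarrow> ('a, 'w) ring_scheme \<Rightarrow> ('r \<Rightarrow> 'a)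
      \<Rightarrow> ('a, 'm, 'y) module_scheme \<Rightarrow> ('r, 'n, 'z) module_scheme
      \<Rightarrow> 'm \<Rightarrow> 'n \<Rightarrow> ('m \<times> 'n \<Rightarrow> 'a) set"
  where "pure_tensor R A \<phi> M N x y =
    (let L = free_module A (carrier M \<times> carrier N) in
       gen_submodule A L (tensor_rels R A \<phi> M N) +>\<^bsub>L\<^esub> free_gen A (x, y))"

abbreviation tensorR ::
    "('r, 'x) ring_scheme \<Rightarrow> ('r, 'm, 'y) module_scheme \<Rightarrow> ('r, 'n, 'z) module_scheme
      \<Rightarrow> ('r, ('m \<times> 'n \<Rightarrow> 'r) set) module"
  where "tensorR R M N \<equiv> tensor R R (\<lambda>r. r) M N"

text \<open>
  The map \<open>h \<otimes> F\<close> for a homomorphism \<open>h : M \<rightarrow> M'\<close>. It takes a coset \<open>X\<close> to the common image of its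
  representatives under the linear map which takes the generator of \<open>(x, y)\<close> to \<open>h x \<otimes> y\<close>.
\<close>

definition tensor_map ::
    "('r, 'x) ring_scheme \<Rightarrow> ('r, 'm, 'y) module_scheme \<Rightarrow> ('r, 'n, 'z) module_scheme
      \<Rightarrow> ('r, 'f, 'w) module_scheme \<Rightarrow> ('m \<Rightarrow> 'n)
      \<Rightarrow> ('m \<times> 'f \<Rightarrow> 'r) set \<Rightarrow> ('n \<times> 'f \<Rightarrow> 'r) set"
  where "tensor_map R M M' F h =
    (\<lambda>X\<in>carrier (tensorR R M F).
       the_elem (free_lift R (carrier M \<times> carrier F) (tensorR R M' F)
                   (\<lambda>(x, y). pure_tensor R R (\<lambda>r. r) M' F (h x) y) ` X))"

text \<open>
  Flatness with respect to all \<open>R\<close>-modules whose carrier consists of elements of the type \<open>'u\<close>. This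
  is flatness as soon as \<open>R\<close> embeds as a set into \<open>'u\<close>, since the inclusions of ideals into \<open>R\<close>
  are then covered.
\<close>

definition flat_module ::
    "'u itself \<Rightarrow> ('r, 'x) ring_scheme \<Rightarrow> ('r, 'f, 'y) module_scheme \<Rightarrow> bool"
  where "flat_module T R F \<longleftrightarrow> module R F \<and>
    (\<forall>(M :: ('r, 'u) module) (M' :: ('r, 'u) module) h.
       module R M \<longrightarrow> module R M' \<longrightarrow> h \<in> mod_hom R M M' \<longrightarrow> inj_on h (carrier M) \<longrightarrow>
       inj_on (tensor_map R M M' F h) (carrier (tensorR R M F)))"

section \<open>Localizations\<close>

text \<open>
  \<open>S\<close> may contain zero-divisors, hence the factor \<open>t\<close> in the equality of the fractions \<open>r / s\<close> and
  \<open>r' / s'\<close>.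
\<close>

definition fraction :: "('r, 'x) ring_scheme \<Rightarrow> 'r set \<Rightarrow> 'r \<Rightarrow> 'r \<Rightarrow> ('r \<times> 'r) set"
  where "fraction R S r s =
    {(r', s'). r' \<in> carrier R \<and> s' \<in> S \<and>
       (\<exists>t\<in>S. t \<otimes>\<^bsub>R\<^esub> (s' \<otimes>\<^bsub>R\<^esub> r) = t \<otimes>\<^bsub>R\<^esub> (s \<otimes>\<^bsub>R\<^esub> r'))}"

definition localization :: "('r, 'x) ring_scheme \<Rightarrow> 'r set \<Rightarrow> (('r \<times> 'r) set) ring"
  where "localization R S =
    \<lparr>carrier = {fraction R S r s | r s. r \<in> carrier R \<and> s \<in> S},
     mult = (\<lambda>X Y. \<Union>(r, s)\<in>X. \<Union>(r', s')\<in>Y. fraction R S (r \<otimes>\<^bsub>R\<^esub> r') (s \<otimes>\<^bsub>R\<^esub> s')),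
     one = fraction R S \<one>\<^bsub>R\<^esub> \<one>\<^bsub>R\<^esub>,
     zero = fraction R S \<zero>\<^bsub>R\<^esub> \<one>\<^bsub>R\<^esub>,
     add = (\<lambda>X Y. \<Union>(r, s)\<in>X. \<Union>(r', s')\<in>Y.
              fraction R S ((s' \<otimes>\<^bsub>R\<^esub> r) \<oplus>\<^bsub>R\<^esub> (s \<otimes>\<^bsub>R\<^esub> r')) (s \<otimes>\<^bsub>R\<^esub> s'))\<rparr>"

definition loc_map :: "('r, 'x) ring_scheme \<Rightarrow> 'r set \<Rightarrow> 'r \<Rightarrow> ('r \<times> 'r) set"
  where "loc_map R S r = fraction R S r \<one>\<^bsub>R\<^esub>"

definition loc_module :: "('r, 'x) ring_scheme \<Rightarrow> 'r set \<Rightarrow> ('r, ('r \<times> 'r) set) module"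
  where "loc_module R S = ring_as_module (localization R S) (loc_map R S)"

section \<open>Finite collections of multiplicative subsets\<close>

definition mult_prod :: "('r, 'x) ring_scheme \<Rightarrow> (nat \<Rightarrow> 'r set) \<Rightarrow> nat set \<Rightarrow> 'r set"
  where "mult_prod R S J = \<Inter>{T. submonoid T R \<and> (\<Union>j\<in>J. S j) \<subseteq> T}"

definition bounded_torsion :: "('r, 'x) ring_scheme \<Rightarrow> 'r set \<Rightarrow> bool"
  where "bounded_torsion R S \<longleftrightarrow>
    (\<exists>s0\<in>S. \<forall>s\<in>S. \<forall>r\<in>carrier R. s \<otimes>\<^bsub>R\<^esub> r = \<zero>\<^bsub>R\<^esub> \<longrightarrow> s0 \<otimes>\<^bsub>R\<^esub> r = \<zero>\<^bsub>R\<^esub>)"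

definition weakly_cotorsion ::
    "nat \<Rightarrow> ('r, 'x) ring_scheme \<Rightarrow> (nat \<Rightarrow> 'r set) \<Rightarrow> ('r, 'c, 'y) module_scheme \<Rightarrow> bool"
  where "weakly_cotorsion m R S C \<longleftrightarrow>
    module R C \<and> (\<forall>J\<subseteq>{1..m}. Ext1_vanishes R (loc_module R (mult_prod R S J)) C)"

text \<open>
  Strong flatness with respect to all weakly cotorsion modules whose carrier consists of elements of
  the type \<open>'u\<close>. As for \<^const>\<open>flat_module\<close>, the type \<open>'u\<close> plays the role of a universe. Every
  module is isomorphic to one with carrier in a sufficiently large \<open>'u\<close>. Under the assumptions of the
  theorem it is enough that \<open>'u\<close> is infinite and that \<open>R\<close> and \<open>F\<close> embed into it as sets: every
  module over one of the rings \<open>R\<^bsub>J,s\<^esub>\<close> is weakly cotorsion, and projectivity of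
  \<open>R\<^bsub>J,s\<^esub> \<otimes> F\<close> is detected by a single such module, the kernel of the canonical map onto
  \<open>R\<^bsub>J,s\<^esub> \<otimes> F\<close> from the free \<open>R\<^bsub>J,s\<^esub>\<close>-module on its elements, whose cardinality is bounded in
  terms of those of \<open>R\<close>, \<open>F\<close> and the set of natural numbers.
\<close>

definition strongly_flat ::
    "'u itself \<Rightarrow> nat \<Rightarrow> ('r, 'x) ring_scheme \<Rightarrow> (nat \<Rightarrow> 'r set) \<Rightarrow> ('r, 'f, 'y) module_scheme \<Rightarrow> bool"
  where "strongly_flat T m R S F \<longleftrightarrow> module R F \<and>
    (\<forall>C :: ('r, 'u) module. weakly_cotorsion m R S C \<longrightarrow> Ext1_vanishes R F C)"

definition RJs_ideal ::
    "nat \<Rightarrow> ('r, 'x) ring_scheme \<Rightarrow> (nat \<Rightarrow> 'r set) \<Rightarrow> nat set \<Rightarrow> (nat \<Rightarrow> 'r) \<Rightarrow> ('r \<times> 'r) set set"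
  where "RJs_ideal m R S J s =
    (let T = mult_prod R S J in
       genideal (localization R T) ((\<lambda>k. loc_map R T (s k)) ` ({1..m} - J)))"

definition RJs ::
    "nat \<Rightarrow> ('r, 'x) ring_scheme \<Rightarrow> (nat \<Rightarrow> 'r set) \<Rightarrow> nat set \<Rightarrow> (nat \<Rightarrow> 'r)
      \<Rightarrow> (('r \<times> 'r) set set) ring"
  where "RJs m R S J s = localization R (mult_prod R S J) Quot RJs_ideal m R S J s"

definition RJs_map ::
    "nat \<Rightarrow> ('r, 'x) ring_scheme \<Rightarrow> (nat \<Rightarrow> 'r set) \<Rightarrow> nat set \<Rightarrow> (nat \<Rightarrow> 'r)
      \<Rightarrow> 'r \<Rightarrow> ('r \<times> 'r) set set"
  where "RJs_map m R S J s r =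
    RJs_ideal m R S J s +>\<^bsub>localization R (mult_prod R S J)\<^esub> loc_map R (mult_prod R S J) r"

definition RJs_tensor ::
    "nat \<Rightarrow> ('r, 'x) ring_scheme \<Rightarrow> (nat \<Rightarrow> 'r set) \<Rightarrow> nat set \<Rightarrow> (nat \<Rightarrow> 'r)
      \<Rightarrow> ('r, 'f, 'y) module_scheme
      \<Rightarrow> (('r \<times> 'r) set set, (('r \<times> 'r) set set \<times> 'f \<Rightarrow> ('r \<times> 'r) set set) set) module"
  where "RJs_tensor m R S J s F =
    (let A = RJs m R S J s in tensor R A (RJs_map m R S J s) (ring_as_module A (\<lambda>a. a)) F)"

end

theory Submission
  imports Defs
begin

text \<open>The vanishing of \<open>Ext\<^sup>1(F, C)\<close> is read off from a free resolution of \<open>F\<close> with syzygies \<open>K n\<close>: all linear maps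
 from \<open>K 0\<close> to \<open>C\<close> extend to the free module \<open>\<Phi>\<close>. For a localization \<open>U\<^sup>-\<^sup>1R\<close>, take the free module with generators
 \<open>e\<^sub>u\<close>, where \<open>e\<^sub>u\<close> stands for \<open>1/u\<close>; the first syzygy is spanned by the relations \<open>e\<^sub>s - t e\<^sub>s\<^sub>t\<close>. So maps from it
 to \<open>C\<close> are cocycles \<open>g s t\<close>, and \<open>C\<close> is cotorsion for \<open>U\<close> if every cocycle has the form \<open>c s - t c (st)\<close>. The
 hypothesis on the projective dimension gives a linear section, which writes each relation as a combination of
 these particular ones.

 A strongly flat module has projective base changes: each module \<open>D\<close> over \<open>A = R\<^sub>J\<^sub>,\<^sub>s\<close> is cotorsion for all
 products of the \<open>S j\<close>, since such a product acts bijectively on \<open>D\<close> or contains an element which kills \<open>D\<close>. Apply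
 this to the \<open>A\<close>-span \<open>D\<close> of \<open>K 0\<close> in \<open>A \<otimes> \<Phi>\<close>. As \<open>Ext\<^sup>1(F, D)\<close> is zero, the map from \<open>K 0\<close> to \<open>D\<close> extends to \<open>\<Phi>\<close>.
 The extension is a retraction of \<open>A \<otimes> \<Phi>\<close> onto \<open>D\<close>, and so its quotient \<open>A \<otimes> F\<close> is projective
 (\<open>strongly_flat_projective\<close>).

 Conversely, let all base changes be projective. Call an index \<open>i\<close> split for a module \<open>C\<close> if \<open>S i\<close> acts bijectively
 on \<open>C\<close> or an element of \<open>S i\<close> kills \<open>C\<close>. If all indices are split, then \<open>C\<close> is a module over one of the rings
 \<open>R\<^sub>J\<^sub>,\<^sub>s\<close>. Since \<open>F\<close> is flat, the base change of its resolution to this ring is exact, and by projectivity its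
 syzygies are direct summands, so that all maps from \<open>K n\<close> to \<open>C\<close> extend (\<open>split_extends\<close>). The general case is
 reduced to this one by induction over the set of the other indices (\<open>extends_induct\<close>). The claim is that all maps
 from \<open>K n\<close> to \<open>C\<close> extend, where for \<open>n = 0\<close> the module \<open>C\<close> is cotorsion. Let \<open>a\<close> be an index which is not split,
 put \<open>U = S a\<close>, and let \<open>E\<close> be the module of all maps from \<open>K n\<close> to \<open>C\<close> modulo those which extend. The index \<open>a\<close> is
 split for \<open>C/sC\<close> and the annihilator of \<open>s\<close>, where \<open>s\<close> is in \<open>U\<close>, and for the modules \<open>Hom(U\<^sup>-\<^sup>1R, C)\<close> and
 \<open>Ext\<^sup>1(U\<^sup>-\<^sup>1R, C)\<close>. The hypothesis of the induction is applied to these four.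

 With the first two, \<open>E\<close> is divisible by \<open>U\<close>. Next, in a module which is divisible by \<open>U\<close>, every element is the
 value at \<open>1\<close> of a homomorphism from \<open>U\<^sup>-\<^sup>1R\<close> (\<open>divisible_countable\<close>, \<open>divisible_bounded\<close>). For a countable \<open>U\<close> the
 elements of \<open>U\<close> are divided out one after the other. If the torsion is bounded, then \<open>U\<^sup>-\<^sup>1R\<close> is exhausted by a
 transfinite chain of subrings which are compatible with the section and have countably generated steps, and the
 homomorphism is constructed along this chain. Hence the class of a map \<open>f\<close> from \<open>K n\<close> to \<open>C\<close> belongs to a family
 of maps which represents a homomorphism from \<open>U\<^sup>-\<^sup>1R\<close> to \<open>E\<close>. The obstruction to making this family compatible, as
 maps and not only as classes, comes from \<open>Ext\<^sup>1(U\<^sup>-\<^sup>1R, C)\<close>. It vanishes by cotorsion for \<open>n = 0\<close> and by induction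
 otherwise (\<open>extend_step\<close>). A compatible family is a map from \<open>K n\<close> to \<open>Hom(U\<^sup>-\<^sup>1R, C)\<close>. By induction, this map
 extends to \<open>\<Phi>\<close>, and so does \<open>f\<close>.

 The induction needs to know that the auxiliary modules are cotorsion. Quotients inherit this property, as the
 projective dimensions are at most one; \<open>Hom(U\<^sup>-\<^sup>1R, C)\<close> inherits it by an explicit formula, and \<open>Ext\<^sup>1(U\<^sup>-\<^sup>1R, C)\<close>
 has it since \<open>Ext\<^sup>2(T\<^sup>-\<^sup>1R, C) = 0\<close> for the products \<open>T\<close>.\<close>

text \<open>Structure arguments, such as the module \<open>M\<close> in \<open>x \<oplus>\<^sub>M y\<close>, are written as plain subscripts.\<close>

syntax "_index" :: "logic => index"  ("\<^sub>_" [1000] 1000)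

abbreviation elem :: "'a => ('a, 'b) partial_object_scheme => bool"  (infix "\<in>:" 50)
 where "x \<in>: M \<equiv> x \<in> carrier M"

abbreviation submod :: "('r, 'm, 'y) module_scheme => 'm set => ('r, 'm, 'y) module_scheme"  (infixl "|:" 75)
 where "M |: H \<equiv> M\<lparr>carrier := H\<rparr>"

abbreviation (in cring) FM :: "'i set => ('a, 'i => 'a) module" where "FM \<equiv> free_module R"
abbreviation (in cring) gen :: "'i => 'i => 'a" where "gen \<equiv> free_gen R"

section \<open>Linear maps, submodules and quotients\<close>

lemma (in abelian_group) minus_zero': "\<ominus> \<zero> = \<zero>"
 using r_neg[OF zero_closed] l_zero[OF a_inv_closed[OF zero_closed]] by simp

lemma (in abelian_group) minus_self [simp]: "x \<in>: G ==> x \<ominus> x = \<zero>"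
 by (simp add: minus_eq r_neg)

lemma (in abelian_group) minus_eq_zero_iff:
 "x \<in>: G ==> y \<in>: G ==> x \<ominus> y = \<zero> \<longleftrightarrow> x = y"
 by (metis minus_eq minus_self a_inv_closed minus_minus minus_equality)

text \<open>With these rules the method \<open>algebra\<close> proves identities which mix the operations of a ring and of a module
 over it.\<close>

lemmas (in module) module_simprules
 [algebra add: module "zero M" "add M" "a_inv M" "a_minus M" "zero R" "one R" "mult R" "smult M"] =
 R.a_closed R.zero_closed R.a_inv_closed R.minus_closed R.m_closed R.one_closed
 R.a_assoc R.l_zero R.l_neg R.a_comm R.m_assoc R.l_one R.l_distr R.m_comm R.minus_eq
 R.r_zero R.r_neg R.r_neg2 R.r_neg1 R.minus_add R.minus_minus R.minus_zero
 R.a_lcomm R.m_lcomm R.r_distr R.l_null R.r_null R.l_minus R.r_minus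
 M.a_closed M.zero_closed M.a_inv_closed M.minus_closed
 M.a_assoc M.l_zero M.l_neg M.a_comm M.minus_eq
 M.r_zero M.r_neg M.r_neg2 M.r_neg1 M.minus_add M.minus_minus M.minus_zero' M.a_lcomm
 smult_closed smult_l_distr smult_r_distr smult_assoc1[symmetric] smult_one
 smult_l_null smult_r_null smult_l_minus smult_r_minus

text \<open>Unlike the members of \<^const>\<open>mod_hom\<close>, a linear map may take any values outside of the carrier, so that composites
 and restrictions of linear maps need no adjustment.\<close>

definition lin :: "('r, 'x) ring_scheme => ('r, 'm, 'y) module_scheme => ('r, 'n, 'z) module_scheme
  => ('m => 'n) => bool"
 where "lin R M N f \<longleftrightarrow> (\<forall>x\<in>carrier M. f x \<in>: N) \<and>
  (\<forall>x\<in>carrier M. \<forall>y\<in>carrier M. f (x \<oplus>\<^sub>M y) = f x \<oplus>\<^sub>N f y) \<and>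
  (\<forall>r\<in>carrier R. \<forall>x\<in>carrier M. f (r \<odot>\<^sub>M x) = r \<odot>\<^sub>N f x)"

lemma linI:
 assumes "\<And>x. x \<in>: M ==> f x \<in>: N"
  and "\<And>x y. x \<in>: M ==> y \<in>: M ==> f (x \<oplus>\<^sub>M y) = f x \<oplus>\<^sub>N f y"
  and "\<And>r x. r \<in>: R ==> x \<in>: M ==> f (r \<odot>\<^sub>M x) = r \<odot>\<^sub>N f x"
 shows "lin R M N f"
 using assms by (auto simp: lin_def)

lemma linD:
 assumes "lin R M N f"
 shows "x \<in>: M ==> f x \<in>: N"
  and "x \<in>: M ==> y \<in>: M ==> f (x \<oplus>\<^sub>M y) = f x \<oplus>\<^sub>N f y"
  and "r \<in>: R ==> x \<in>: M ==> f (r \<odot>\<^sub>M x) = r \<odot>\<^sub>N f x"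
 using assms by (auto simp: lin_def)

lemma mod_hom_lin: "f \<in> mod_hom R M N ==> lin R M N f"
 by (auto simp: mod_hom_def lin_def)

lemma lin_mod_hom:
 "module R M ==> lin R M N f ==> restrict f (carrier M) \<in> mod_hom R M N"
 by (auto simp: mod_hom_def lin_def module_def abelian_group_def abelian_monoid.a_closed module.smult_closed)

lemma (in module) smult_m1: "x \<in>: M ==> (\<ominus>\<^sub>R \<one>\<^sub>R) \<odot>\<^sub>M x = \<ominus>\<^sub>M x"
 by (simp add: smult_l_minus)

lemma submoduleI':
 assumes M: "module R M" and "H \<subseteq> carrier M" "\<zero>\<^sub>M \<in> H"
  and "\<And>a b. a \<in> H ==> b \<in> H ==> a \<oplus>\<^sub>M b \<in> H"
  and s: "\<And>a x. a \<in>: R ==> x \<in> H ==> a \<odot>\<^sub>M x \<in> H"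
 shows "submodule H R M"
proof -
 interpret M: module R M by fact
 have "\<ominus>\<^sub>M x \<in> H" if "x \<in> H" for x
  using s[of "\<ominus>\<^sub>R \<one>\<^sub>R" x] that assms(2) by (metis M.smult_m1 M.R.a_inv_closed M.R.one_closed subsetD)
 then show ?thesis using assms by (intro M.submoduleI) auto
qed

lemma submoduleD:
 assumes "submodule H R M" "module R M"
 shows "x \<in> H ==> x \<in>: M" "\<zero>\<^sub>M \<in> H"
  "x \<in> H ==> y \<in> H ==> x \<oplus>\<^sub>M y \<in> H" "r \<in>: R ==> x \<in> H ==> r \<odot>\<^sub>M x \<in> H"
  "x \<in> H ==> \<ominus>\<^sub>M x \<in> H" "x \<in> H ==> y \<in> H ==> x \<ominus>\<^sub>M y \<in> H"
proof -
 interpret M: module R M by fact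
 note E = M.submoduleE[OF assms(1)]
 show "x \<in> H ==> x \<in>: M" "\<zero>\<^sub>M \<in> H"
  "x \<in> H ==> y \<in> H ==> x \<oplus>\<^sub>M y \<in> H" "r \<in>: R ==> x \<in> H ==> r \<odot>\<^sub>M x \<in> H"
  "x \<in> H ==> \<ominus>\<^sub>M x \<in> H" "x \<in> H ==> y \<in> H ==> x \<ominus>\<^sub>M y \<in> H"
  using E M.add.one_closed subgroup.one_closed[OF submodule.axioms(1)[OF assms(1)]]
  by (auto simp: M.minus_eq)
qed

lemma sub_module: "submodule H R M ==> module R M ==> module R (M |: H)"
 by (rule submodule.submodule_is_module)

lemma lin_sub:
 assumes "lin R (M |: H) N f" "module R M" "module R N" "submodule H R M"
 shows "x \<in> H ==> f x \<in>: N" "x \<in> H ==> y \<in> H ==> f (x \<oplus>\<^sub>M y) = f x \<oplus>\<^sub>N f y"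
  "r \<in>: R ==> x \<in> H ==> f (r \<odot>\<^sub>M x) = r \<odot>\<^sub>N f x"
  "f \<zero>\<^sub>M = \<zero>\<^sub>N" "x \<in> H ==> f (\<ominus>\<^sub>M x) = \<ominus>\<^sub>N f x"
  "x \<in> H ==> y \<in> H ==> f (x \<ominus>\<^sub>M y) = f x \<ominus>\<^sub>N f y"
proof -
 interpret M: module R M by fact
 interpret N: module R N by fact
 note H = submoduleD[OF assms(4,2)]
 show 1: "x \<in> H ==> f x \<in>: N" for x using assms(1) by (auto simp: lin_def)
 show 2: "x \<in> H ==> y \<in> H ==> f (x \<oplus>\<^sub>M y) = f x \<oplus>\<^sub>N f y" for x y
  using assms(1) by (auto simp: lin_def)
 show 3: "r \<in>: R ==> x \<in> H ==> f (r \<odot>\<^sub>M x) = r \<odot>\<^sub>N f x" for r x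
  using assms(1) by (auto simp: lin_def)
 show "f \<zero>\<^sub>M = \<zero>\<^sub>N"
  using 3[of "\<zero>\<^sub>R" "\<zero>\<^sub>M"] 1[OF H(2)] H(2) by simp
 show 4: "x \<in> H ==> f (\<ominus>\<^sub>M x) = \<ominus>\<^sub>N f x" for x
  using 3[of "\<ominus>\<^sub>R \<one>\<^sub>R" x] 1[of x] H(1)[of x] by (simp add: M.smult_m1 N.smult_m1)
 show "x \<in> H ==> y \<in> H ==> f (x \<ominus>\<^sub>M y) = f x \<ominus>\<^sub>N f y"
  using H(5) by (simp add: M.minus_eq N.minus_eq 2 4)
qed

lemma lin_all:
 assumes "lin R M N f" "module R M" "module R N"
 shows "x \<in>: M ==> f x \<in>: N"
  "x \<in>: M ==> y \<in>: M ==> f (x \<oplus>\<^sub>M y) = f x \<oplus>\<^sub>N f y"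
  "r \<in>: R ==> x \<in>: M ==> f (r \<odot>\<^sub>M x) = r \<odot>\<^sub>N f x"
  "f \<zero>\<^sub>M = \<zero>\<^sub>N" "x \<in>: M ==> f (\<ominus>\<^sub>M x) = \<ominus>\<^sub>N f x"
  "x \<in>: M ==> y \<in>: M ==> f (x \<ominus>\<^sub>M y) = f x \<ominus>\<^sub>N f y"
 using lin_sub[where H = "carrier M" and M = M and R = R and N = N and f = f] assms module.carrier_is_submodule[OF assms(2)] by simp_all

lemma lin_cong: "(\<And>x. x \<in>: M ==> f x = g x) ==> module R M ==> lin R M N f \<longleftrightarrow> lin R M N g"
 by (auto simp: lin_def module_def abelian_group_def abelian_monoid.a_closed module.smult_closed)

lemma lin_comp: "lin R M N f ==> lin R N P g ==> lin R M P (\<lambda>x. g (f x))"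
 by (auto simp: lin_def)

lemma lin_plus:
 assumes "lin R M N f" "lin R M N g" "module R N"
 shows "lin R M N (\<lambda>x. f x \<oplus>\<^sub>N g x)"
proof -
 interpret N: module R N by fact
 show ?thesis using assms(1,2) by (auto simp: lin_def N.smult_r_distr N.add.m_ac)
qed

lemma lin_scale:
 assumes "lin R M N f" "r \<in>: R" "module R N"
 shows "lin R M N (\<lambda>x. r \<odot>\<^sub>N f x)"
proof -
 interpret N: module R N by fact
 show ?thesis using assms(1,2)
  by (auto simp: lin_def N.smult_r_distr N.smult_assoc1[symmetric] N.R.m_comm)
qed

lemma lin_diff:
 assumes "lin R M N f" "lin R M N g" "module R N"
 shows "lin R M N (\<lambda>x. f x \<ominus>\<^sub>N g x)"
proof -
 interpret N: module R N by fact
 have "lin R M N (\<lambda>x. f x \<oplus>\<^sub>N (\<ominus>\<^sub>R \<one>\<^sub>R) \<odot>\<^sub>N g x)"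
  using assms by (intro lin_plus lin_scale) auto
 then show ?thesis using assms(2) by (auto simp: lin_def N.smult_m1 N.minus_eq)
qed

lemma lin_zero: "module R N ==> lin R M N (\<lambda>_. \<zero>\<^sub>N)"
proof -
 assume "module R N"
 then interpret N: module R N .
 show ?thesis by (auto simp: lin_def)
qed

lemma lin_id: "lin R M M (\<lambda>x. x)"
 by (auto simp: lin_def)

lemma lin_restrict: "lin R M N f ==> H \<subseteq> carrier M ==> lin R (M |: H) N f"
 by (simp add: lin_def subset_iff)

lemma lin_into: "lin R M N f ==> (\<And>x. x \<in>: M ==> f x \<in> H) ==> lin R M (N |: H) f"
 by (auto simp: lin_def)

lemma lin_outof: "lin R M (N |: H) f ==> H \<subseteq> carrier N ==> lin R M N f"
 by (auto simp: lin_def)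

lemma preimage_submodule:
 assumes "lin R M N f" "module R M" "module R N" "submodule H R N"
 shows "submodule {x \<in> carrier M. f x \<in> H} R M"
proof -
 interpret M: module R M by fact
 note f = lin_all[OF assms(1-3)] and H = submoduleD[OF assms(4,3)]
 show ?thesis by (rule submoduleI'[OF assms(2)]) (auto simp: f H)
qed

lemma zero_submodule: "module R M ==> submodule {\<zero>\<^sub>M} R M"
proof -
 assume M: "module R M"
 then interpret M: module R M .
 show ?thesis by (rule submoduleI'[OF M]) auto
qed

lemma ker_submodule:
 assumes "lin R M N f" "module R M" "module R N"
 shows "submodule (mod_ker M N f) R M"
 using preimage_submodule[OF assms zero_submodule[OF assms(3)]] by (simp add: mod_ker_def)

lemma image_submodule:
 assumes "lin R M N f" "module R M" "module R N"
 shows "submodule (f ` carrier M) R N"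
proof -
 interpret M: module R M by fact
 note f = lin_all[OF assms]
 show ?thesis
 proof (rule submoduleI'[OF assms(3)])
  show "\<zero>\<^sub>N \<in> f ` carrier M" using f(4) by (metis M.zero_closed imageI)
  show "a \<oplus>\<^sub>N b \<in> f ` carrier M" if "a \<in> f ` carrier M" "b \<in> f ` carrier M" for a b
   using that f(2) by (metis (no_types, lifting) M.a_closed imageE imageI)
  show "r \<odot>\<^sub>N a \<in> f ` carrier M" if "r \<in>: R" "a \<in> f ` carrier M" for a r
   using that f(3) by (metis (no_types, lifting) M.smult_closed imageE imageI)
 qed (auto simp: f)
qed

lemma gen_submodule:
 assumes "module R M" "X \<subseteq> carrier M"
 shows "submodule (gen_submodule R M X) R M" "X \<subseteq> gen_submodule R M X"
  "submodule H R M ==> X \<subseteq> H ==> gen_submodule R M X \<subseteq> H"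
proof -
 interpret M: module R M by fact
 have c: "gen_submodule R M X \<subseteq> carrier M"
  using M.carrier_is_submodule assms(2) by (auto simp: gen_submodule_def)
 show "submodule (gen_submodule R M X) R M"
  by (rule submoduleI'[OF assms(1) c]) (auto simp: gen_submodule_def submoduleD[OF _ assms(1)])
qed (auto simp: gen_submodule_def)

text \<open>Used to show that two linear maps agree if they agree on generators.\<close>

lemma equalizer_submodule:
 assumes "lin R M N f" "lin R M N g" "module R M" "module R N"
 shows "submodule {x \<in> carrier M. f x = g x} R M"
proof -
 interpret M: module R M by fact
 note f = lin_all[OF assms(1,3,4)] and g = lin_all[OF assms(2,3,4)]
 show ?thesis by (rule submoduleI'[OF assms(3)]) (auto simp: f g)
qed

lemma factor_through_surjection:
 assumes p: "lin R P M p" "p ` carrier P = carrier M" and h: "lin R P N h"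
  and k: "\<And>x. x \<in>: P ==> p x = \<zero>\<^sub>M ==> h x = \<zero>\<^sub>N"
  and mods: "module R P" "module R M" "module R N"
 shows "\<exists>h'. lin R M N h' \<and> (\<forall>x\<in>carrier P. h' (p x) = h x)"
proof -
 interpret P: module R P by fact
 interpret M: module R M by fact
 interpret N: module R N by fact
 note pr = lin_all[OF p(1) mods(1,2)] and hr = lin_all[OF h mods(1,3)]
 define h' where "h' y = h (SOME x. x \<in>: P \<and> p x = y)" for y
 have e: "h' (p x) = h x" if x: "x \<in>: P" for x
 proof -
  define z where "z = (SOME z. z \<in>: P \<and> p z = p x)"
  have z: "z \<in>: P \<and> p z = p x"
   unfolding z_def by (rule someI[of _ x]) (use x in auto)
  have "h (z \<ominus>\<^sub>P x) = \<zero>\<^sub>N"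
   using z x by (intro k) (auto simp: pr)
  then have "h z = h x" using z x by (simp add: hr N.minus_eq_zero_iff)
  then show ?thesis by (simp add: h'_def z_def)
 qed
 have "lin R M N h'"
 proof (rule linI)
  show "h' y \<in>: N" if "y \<in>: M" for y
   using that p(2)[symmetric] by (auto simp: e hr)
  show "h' (r \<odot>\<^sub>M y) = r \<odot>\<^sub>N h' y" if r: "r \<in>: R" and y: "y \<in>: M" for r y
  proof -
   obtain x where x: "x \<in>: P" "y = p x" using p(2)[symmetric] y by auto
   show ?thesis using x r e[of "r \<odot>\<^sub>P x"] by (simp add: e hr pr)
  qed
  show "h' (y \<oplus>\<^sub>M y') = h' y \<oplus>\<^sub>N h' y'" if y: "y \<in>: M" "y' \<in>: M" for y y'
  proof -
   obtain x x' where x: "x \<in>: P" "y = p x" "x' \<in>: P" "y' = p x'" using p(2)[symmetric] y by auto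
   show ?thesis using x e[of "x \<oplus>\<^sub>P x'"] by (simp add: e hr pr)
  qed
 qed
 then show ?thesis using e by auto
qed

subsection \<open>Quotient modules\<close>

lemma quotient_coset:
 assumes M: "module R M" and H: "submodule H R M"
 shows "carrier (quotient_module M H) = (\<lambda>x. H +>\<^sub>M x) ` carrier M"
  and "x \<in>: M ==> y \<in>: M ==> (H +>\<^sub>M x = H +>\<^sub>M y) \<longleftrightarrow> x \<ominus>\<^sub>M y \<in> H"
  and "x \<in>: M ==> y \<in>: M ==>
   (H +>\<^sub>M x) \<oplus>\<^bsub>quotient_module M H\<^esub> (H +>\<^sub>M y) = H +>\<^sub>M (x \<oplus>\<^sub>M y)"
  and "r \<in>: R ==> x \<in>: M ==>
   r \<odot>\<^bsub>quotient_module M H\<^esub> (H +>\<^sub>M x) = H +>\<^sub>M (r \<odot>\<^sub>M x)"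
  and "\<zero>\<^bsub>quotient_module M H\<^esub> = H +>\<^sub>M \<zero>\<^sub>M"
  and "x \<in>: M ==> y \<in> H +>\<^sub>M x \<longleftrightarrow> y \<in>: M \<and> y \<ominus>\<^sub>M x \<in> H"
proof -
 interpret M: module R M by fact
 note Hr = submoduleD[OF H M]
 interpret H: abelian_subgroup H M
  by (rule abelian_subgroupI3) (auto simp: M.abelian_group_axioms additive_subgroup_def submodule.axioms(1)[OF H])
 show 1: "carrier (quotient_module M H) = (\<lambda>x. H +>\<^sub>M x) ` carrier M"
  by (auto simp: quotient_module_def A_RCOSETS_def')
 show mem: "y \<in> H +>\<^sub>M x \<longleftrightarrow> y \<in>: M \<and> y \<ominus>\<^sub>M x \<in> H" if x: "x \<in>: M" for x y
 proof -
  have "y \<in> H +>\<^sub>M x \<longleftrightarrow> (\<exists>h\<in>H. y = h \<oplus>\<^sub>M x)" by (auto simp: a_r_coset_def')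
  also have "\<dots> \<longleftrightarrow> y \<in>: M \<and> y \<ominus>\<^sub>M x \<in> H"
  proof
   assume "\<exists>h\<in>H. y = h \<oplus>\<^sub>M x"
   then obtain h where h: "h \<in> H" "y = h \<oplus>\<^sub>M x" by blast
   have "h \<in>: M" using h Hr by auto
   then have "y \<ominus>\<^sub>M x = h" using x unfolding h(2) by algebra
   then show "y \<in>: M \<and> y \<ominus>\<^sub>M x \<in> H" using h x \<open>h \<in>: M\<close> by auto
  next
   assume a: "y \<in>: M \<and> y \<ominus>\<^sub>M x \<in> H"
   then have "y = (y \<ominus>\<^sub>M x) \<oplus>\<^sub>M x" using x by algebra
   then show "\<exists>h\<in>H. y = h \<oplus>\<^sub>M x" using a by blast
  qed
  finally show ?thesis .
 qed
 show eq: "(H +>\<^sub>M x = H +>\<^sub>M y) \<longleftrightarrow> x \<ominus>\<^sub>M y \<in> H" if x: "x \<in>: M" and y: "y \<in>: M" for x y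
 proof
  assume "H +>\<^sub>M x = H +>\<^sub>M y"
  then have "x \<in> H +>\<^sub>M y" using mem[OF x, of x] x Hr(2) by simp
  then show "x \<ominus>\<^sub>M y \<in> H" using mem[OF y] by auto
 next
  assume a: "x \<ominus>\<^sub>M y \<in> H"
  have "z \<ominus>\<^sub>M x \<in> H \<longleftrightarrow> z \<ominus>\<^sub>M y \<in> H" if z: "z \<in>: M" for z
  proof -
   have e: "z \<ominus>\<^sub>M y = (z \<ominus>\<^sub>M x) \<oplus>\<^sub>M (x \<ominus>\<^sub>M y)" "z \<ominus>\<^sub>M x = (z \<ominus>\<^sub>M y) \<ominus>\<^sub>M (x \<ominus>\<^sub>M y)"
    using x y z by algebra+
   show ?thesis using e(1) e(2) Hr(3)[OF _ a] Hr(6)[OF _ a] by metis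
  qed
  then show "H +>\<^sub>M x = H +>\<^sub>M y" using mem[OF x] mem[OF y] by blast
 qed
 show "(H +>\<^sub>M x) \<oplus>\<^bsub>quotient_module M H\<^esub> (H +>\<^sub>M y) = H +>\<^sub>M (x \<oplus>\<^sub>M y)"
  if "x \<in>: M" "y \<in>: M" for x y
  using H.a_rcos_sum[OF that] by (simp add: quotient_module_def)
 show "\<zero>\<^bsub>quotient_module M H\<^esub> = H +>\<^sub>M \<zero>\<^sub>M"
 proof -
  have "y \<ominus>\<^sub>M \<zero>\<^sub>M = y" if "y \<in>: M" for y using that by algebra
  then have "y \<in> H +>\<^sub>M \<zero>\<^sub>M \<longleftrightarrow> y \<in> H" for y using mem[OF M.zero_closed, of y] Hr(1)[of y] by metis
  then have "H +>\<^sub>M \<zero>\<^sub>M = H" by blast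
  then show ?thesis by (simp add: quotient_module_def)
 qed
 show "r \<odot>\<^bsub>quotient_module M H\<^esub> (H +>\<^sub>M x) = H +>\<^sub>M (r \<odot>\<^sub>M x)"
  if r: "r \<in>: R" and x: "x \<in>: M" for r x
 proof -
  have c: "H +>\<^sub>M (r \<odot>\<^sub>M y) = H +>\<^sub>M (r \<odot>\<^sub>M x)" if y: "y \<in> H +>\<^sub>M x" for y
  proof -
   have yc: "y \<in>: M" "y \<ominus>\<^sub>M x \<in> H" using mem[OF x] y by auto
   have "r \<odot>\<^sub>M y \<ominus>\<^sub>M r \<odot>\<^sub>M x = r \<odot>\<^sub>M (y \<ominus>\<^sub>M x)" using yc(1) x r by algebra
   then show ?thesis using Hr(4)[OF r yc(2)] r x yc by (simp add: eq)
  qed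
  have "x \<in> H +>\<^sub>M x" using mem[OF x] x Hr(2) by simp
  moreover have "(\<Union>y\<in>H +>\<^sub>M x. H +>\<^sub>M (r \<odot>\<^sub>M y)) = (\<Union>y\<in>H +>\<^sub>M x. H +>\<^sub>M (r \<odot>\<^sub>M x))"
   using c by (rule SUP_cong[OF refl])
  ultimately show ?thesis by (auto simp add: quotient_module_def simp del: UN_simps)
 qed
qed

lemma quotient_is_module:
 assumes M: "module R M" and H: "submodule H R M"
 shows "module R (quotient_module M H)"
proof -
 interpret M: module R M by fact
 note q = quotient_coset[OF M H]
 show ?thesis
 proof (rule moduleI)
  show "abelian_group (quotient_module M H)"
  proof (rule abelian_groupI)
   fix X assume "X \<in>: quotient_module M H"
   then obtain x where x: "x \<in>: M" "X = H +>\<^sub>M x" by (auto simp: q)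
   have "(H +>\<^sub>M (\<ominus>\<^sub>M x)) \<oplus>\<^bsub>quotient_module M H\<^esub> X = \<zero>\<^bsub>quotient_module M H\<^esub>"
    using x by (simp add: q(3) q(5) M.l_neg)
   then show "\<exists>y\<in>carrier (quotient_module M H). y \<oplus>\<^bsub>quotient_module M H\<^esub> X = \<zero>\<^bsub>quotient_module M H\<^esub>"
    using x by (auto simp: q(1))
  qed (auto simp: q(1,3,5) M.add.m_ac)
 qed (auto simp: q(1,3,4,5) M.R.is_cring M.smult_r_distr M.smult_l_distr M.smult_assoc1)
qed

lemma quotient_proj:
 assumes "module R M" "submodule H R M"
 shows "lin R M (quotient_module M H) (\<lambda>x. H +>\<^sub>M x)"
  and "(\<lambda>x. H +>\<^sub>M x) ` carrier M = carrier (quotient_module M H)"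
  and "x \<in>: M ==> (H +>\<^sub>M x = \<zero>\<^bsub>quotient_module M H\<^esub>) \<longleftrightarrow> x \<in> H"
proof -
 interpret M: module R M by fact
 note q = quotient_coset[OF assms]
 show "lin R M (quotient_module M H) (\<lambda>x. H +>\<^sub>M x)" by (rule linI) (auto simp: q)
 show "(\<lambda>x. H +>\<^sub>M x) ` carrier M = carrier (quotient_module M H)" by (simp add: q)
 show "x \<in>: M ==> (H +>\<^sub>M x = \<zero>\<^bsub>quotient_module M H\<^esub>) \<longleftrightarrow> x \<in> H"
  by (simp add: q(2,5) M.minus_eq M.minus_zero')
qed

lemma quotient_lift:
 assumes "module R M" "submodule H R M" "module R N" "lin R M N h" "\<And>x. x \<in> H ==> h x = \<zero>\<^sub>N"
 shows "\<exists>h'. lin R (quotient_module M H) N h' \<and> (\<forall>x\<in>carrier M. h' (H +>\<^sub>M x) = h x)"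
 using assms quotient_proj[OF assms(1,2)] quotient_is_module[OF assms(1,2)]
 by (intro factor_through_surjection) auto

subsection \<open>Modules of functions and of homomorphisms\<close>

text \<open>The modules of homomorphisms, of families indexed by a localization, and so on are submodules of modules of
 functions; the module axioms are checked once, here.\<close>

definition fun_module :: "'i set => ('r, 'n, 'z) module_scheme => ('r, 'i => 'n) module"
 where "fun_module X N = \<lparr>carrier = X \<rightarrow>\<^sub>E carrier N, mult = undefined, one = undefined, zero = (\<lambda>x\<in>X. \<zero>\<^sub>N),
  add = (\<lambda>f g. \<lambda>x\<in>X. f x \<oplus>\<^sub>N g x), smult = (\<lambda>r f. \<lambda>x\<in>X. r \<odot>\<^sub>N f x)\<rparr>"

lemma fun_module:
 assumes N: "module R N"
 shows "module R (fun_module X N)"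
proof -
 interpret N: module R N by fact
 have e: "f x = undefined" if "f \<in> extensional X" "x \<notin> X" for f x using that by (simp add: extensional_def)
 have v: "f x \<in>: N" if "f \<in> X \<rightarrow>\<^sub>E carrier N" "x \<in> X" for f x using that by auto
 show ?thesis
 proof (rule moduleI)
  show "abelian_group (fun_module X N)"
  proof (rule abelian_groupI)
   show "\<exists>g\<in>carrier (fun_module X N). g \<oplus>\<^bsub>fun_module X N\<^esub> f = \<zero>\<^bsub>fun_module X N\<^esub>" if "f \<in>: fun_module X N" for f
    using that by (intro bexI[of _ "\<lambda>x\<in>X. \<ominus>\<^sub>N f x"]) (auto simp: fun_module_def N.l_neg v intro!: restrict_ext)
  qed (auto simp: fun_module_def fun_eq_iff v N.add.m_ac e PiE_iff)
 qed (auto simp: fun_module_def fun_eq_iff v N.R.is_cring N.smult_r_distr N.smult_l_distr N.smult_assoc1 e PiE_iff)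
qed

lemma lin_into_fun_module:
 assumes A: "\<And>p. p \<in>: M ==> \<Psi> p \<in> A" "A \<subseteq> extensional X" and M: "module R M"
  and l: "\<And>x. x \<in> X ==> lin R M C (\<lambda>p. \<Psi> p x)"
 shows "lin R M (fun_module X C |: A) \<Psi>"
proof -
 interpret M: module R M by fact
 have e: "\<Psi> p = (\<lambda>x\<in>X. \<Psi> p x)" if "p \<in>: M" for p
  using extensional_restrict[of "\<Psi> p" X] A that by (metis subsetD)
 show ?thesis
 proof (rule linI)
  show "\<Psi> (p \<oplus>\<^sub>M q) = \<Psi> p \<oplus>\<^bsub>fun_module X C |: A\<^esub> \<Psi> q" if "p \<in>: M" "q \<in>: M" for p q
   by (subst e) (use that linD(2)[OF l, of _ p q] in \<open>auto simp: fun_module_def intro!: restrict_ext\<close>)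
  show "\<Psi> (r \<odot>\<^sub>M p) = r \<odot>\<^bsub>fun_module X C |: A\<^esub> \<Psi> p" if "r \<in>: R" "p \<in>: M" for r p
   by (subst e) (use that linD(3)[OF l, of _ r p] in \<open>auto simp: fun_module_def intro!: restrict_ext\<close>)
 qed (simp add: A(1))
qed

lemma hom_module_eq: "hom_module R M N = fun_module (carrier M) N |: mod_hom R M N"
 by (simp add: hom_module_def fun_module_def)

lemma hom_is_module:
 assumes M: "module R M" and N: "module R N"
 shows "module R (hom_module R M N)"
proof -
 interpret M: module R M by fact
 interpret N: module R N by fact
 have v: "f x \<in>: N" if "f \<in> carrier M \<rightarrow>\<^sub>E carrier N" "x \<in>: M" for f x using that by auto
 have "submodule (mod_hom R M N) R (fun_module (carrier M) N)"
  by (rule submoduleI'[OF fun_module[OF N]]) 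
   (auto simp: fun_module_def mod_hom_def v M.R.m_comm N.add.m_ac N.smult_r_distr N.smult_assoc1[symmetric])
 then show ?thesis unfolding hom_module_eq by (rule sub_module[OF _ fun_module[OF N]])
qed

lemma hom_module_carrier:
 assumes "module R M"
 shows "f \<in>: hom_module R M N ==> lin R M N f"
  and "lin R M N f ==> restrict f (carrier M) \<in>: hom_module R M N"
 using assms by (auto simp: hom_module_def mod_hom_lin lin_mod_hom)

lemma hom_module_apply:
 "x \<in>: M ==> (f \<oplus>\<^bsub>hom_module R M N\<^esub> g) x = f x \<oplus>\<^sub>N g x"
 "x \<in>: M ==> (r \<odot>\<^bsub>hom_module R M N\<^esub> f) x = r \<odot>\<^sub>N f x"
 "x \<in>: M ==> \<zero>\<^bsub>hom_module R M N\<^esub> x = \<zero>\<^sub>N"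
 by (simp_all add: hom_module_def)

subsection \<open>Free modules\<close>

text \<open>The linear combination with coefficients \<open>p\<close> of the vectors \<open>v\<close>.\<close>

definition lc :: "('r, 'x) ring_scheme => ('r, 'm, 'y) module_scheme => ('i => 'm) => ('i => 'r) => 'm"
 where "lc R M v p = (\<Oplus>\<^sub>M x\<in>{x. p x \<noteq> \<zero>\<^sub>R}. p x \<odot>\<^sub>M v x)"

lemma free_lift_lc: "p \<in>: free_module R X ==> free_lift R X M v p = lc R M v p"
 by (simp add: free_lift_def lc_def)

context cring begin

lemma free_is_module: "module R (FM X)"
proof -
 have fin: "finite {x. p x \<oplus> q x \<noteq> \<zero>}" if "finite {x. p x \<noteq> \<zero>}" "finite {x. q x \<noteq> \<zero>}" for p q :: "'c => 'a"
  by (rule finite_subset[OF _ finite_UnI[OF that]]) (auto)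
 have fin2: "finite {x. r \<otimes> p x \<noteq> \<zero>}" if "finite {x. p x \<noteq> \<zero>}" "r \<in>: R" for p :: "'c => 'a" and r
  by (rule finite_subset[OF _ that(1)]) (use that in auto)
 show ?thesis
 proof (rule moduleI)
  show "abelian_group (FM X)"
  proof (rule abelian_groupI)
   fix p assume p: "p \<in>: FM X"
   have "(\<lambda>x. (\<ominus> \<one>) \<otimes> p x) \<in>: FM X"
    using p fin2[of p "\<ominus> \<one>"] by (auto simp: free_module_def)
   moreover have "(\<lambda>x. (\<ominus> \<one>) \<otimes> p x) \<oplus>\<^bsub>FM X\<^esub> p = \<zero>\<^bsub>FM X\<^esub>"
    using p by (auto simp: free_module_def l_minus l_neg)
   ultimately show "\<exists>y\<in>carrier (FM X). y \<oplus>\<^bsub>FM X\<^esub> p = \<zero>\<^bsub>FM X\<^esub>"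
    by blast
  qed (auto simp: free_module_def fin a_ac)
 qed (auto simp: free_module_def fin2 is_cring l_distr r_distr m_assoc)
qed

lemma free_gen_closed [simp]: "x \<in> X ==> gen x \<in>: FM X"
 by (auto simp: free_module_def free_gen_def)

lemma free_mono: "X \<subseteq> Y ==> carrier (FM X) \<subseteq> carrier (FM Y)"
 by (auto simp: free_module_def)

lemma free_ops:
 "p \<oplus>\<^bsub>FM X\<^esub> q = (\<lambda>x. p x \<oplus> q x)" "r \<odot>\<^bsub>FM X\<^esub> p = (\<lambda>x. r \<otimes> p x)"
 "\<zero>\<^bsub>FM X\<^esub> = (\<lambda>x. \<zero>)"
 by (auto simp: free_module_def)

lemma lc_superset:
 assumes "module R M" "p \<in>: FM X" "\<And>x. x \<in> X ==> v x \<in>: M"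
  and "finite A" "{x. p x \<noteq> \<zero>} \<subseteq> A" "A \<subseteq> X"
 shows "lc R M v p = (\<Oplus>\<^sub>M x\<in>A. p x \<odot>\<^sub>M v x)"
proof -
 interpret M: module R M by fact
 have "p x \<in>: R" for x using assms(2) by (simp add: free_module_def)
 then show ?thesis unfolding lc_def
  using assms by (intro M.add.finprod_mono_neutral_cong_left) auto
qed

lemma lc_closed:
 assumes "module R M" "p \<in>: FM X" "\<And>x. x \<in> X ==> v x \<in>: M"
 shows "lc R M v p \<in>: M"
proof -
 interpret M: module R M by fact
 show ?thesis using assms unfolding lc_def
  by (intro M.finsum_closed) (auto simp: free_module_def)
qed

lemma lc_lin:
 assumes M: "module R M" and v: "\<And>x. x \<in> X ==> v x \<in>: M"
 shows "lin R (FM X) M (lc R M v)"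
proof -
 interpret M: module R M by fact
 interpret P: module R "FM X" by (rule free_is_module)
 have supp: "finite {x. p x \<noteq> \<zero>}" "{x. p x \<noteq> \<zero>} \<subseteq> X" "\<And>x. p x \<in>: R"
  if "p \<in>: FM X" for p
  using that by (auto simp: free_module_def)
 show ?thesis
 proof (rule linI)
  show "lc R M v p \<in>: M" if "p \<in>: FM X" for p
   using lc_closed[OF M that v] .
 next
  fix p q assume p: "p \<in>: FM X" and q: "q \<in>: FM X"
  note sp = supp[OF p] and sq = supp[OF q]
  let ?A = "{x. p x \<noteq> \<zero>} \<union> {x. q x \<noteq> \<zero>}"
  have A: "finite ?A" "?A \<subseteq> X" using sp sq by auto
  have "lc R M v (p \<oplus>\<^bsub>FM X\<^esub> q) = (\<Oplus>\<^sub>M x\<in>?A. (p x \<oplus> q x) \<odot>\<^sub>M v x)"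
  proof -
   have "{x. (p \<oplus>\<^bsub>FM X\<^esub> q) x \<noteq> \<zero>} \<subseteq> ?A" by (auto simp: free_ops)
   then show ?thesis using lc_superset[OF M P.a_closed[OF p q], of v, OF v A(1) _ A(2)] by (simp add: free_ops)
  qed
  also have "\<dots> = (\<Oplus>\<^sub>M x\<in>?A. p x \<odot>\<^sub>M v x \<oplus>\<^sub>M q x \<odot>\<^sub>M v x)"
   using A v sp sq by (intro M.finsum_cong') (auto simp: M.smult_l_distr)
  also have "\<dots> = (\<Oplus>\<^sub>M x\<in>?A. p x \<odot>\<^sub>M v x) \<oplus>\<^sub>M (\<Oplus>\<^sub>M x\<in>?A. q x \<odot>\<^sub>M v x)"
   using A v sp sq by (intro M.finsum_addf) auto
  also have "\<dots> = lc R M v p \<oplus>\<^sub>M lc R M v q"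
   using lc_superset[OF M p, of v, OF v A(1) _ A(2)] lc_superset[OF M q, of v, OF v A(1) _ A(2)] by simp
  finally show "lc R M v (p \<oplus>\<^bsub>FM X\<^esub> q) = lc R M v p \<oplus>\<^sub>M lc R M v q" .
 next
  fix r p assume r: "r \<in>: R" and p: "p \<in>: FM X"
  note sp = supp[OF p]
  let ?A = "{x. p x \<noteq> \<zero>}"
  have "lc R M v (r \<odot>\<^bsub>FM X\<^esub> p) = (\<Oplus>\<^sub>M x\<in>?A. (r \<otimes> p x) \<odot>\<^sub>M v x)"
  proof -
   have "{x. (r \<odot>\<^bsub>FM X\<^esub> p) x \<noteq> \<zero>} \<subseteq> ?A" using r by (auto simp: free_ops)
   then show ?thesis using lc_superset[OF M P.smult_closed[OF r p], of v, OF v sp(1) _ sp(2)] by (simp add: free_ops)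
  qed
  also have "\<dots> = (\<Oplus>\<^sub>M x\<in>?A. r \<odot>\<^sub>M (p x \<odot>\<^sub>M v x))"
   using sp v r by (intro M.finsum_cong') (auto simp: M.smult_assoc1)
  also have "\<dots> = r \<odot>\<^sub>M lc R M v p"
   unfolding lc_def using sp v r by (intro M.finsum_smult_ldistr[symmetric]) auto
  finally show "lc R M v (r \<odot>\<^bsub>FM X\<^esub> p) = r \<odot>\<^sub>M lc R M v p" .
 qed
qed

lemma lc_gen:
 assumes "module R M" "v x \<in>: M"
 shows "lc R M v (gen x) = v x"
proof -
 interpret M: module R M by fact
 show ?thesis
 proof (cases "\<one> = \<zero>")
  case True
  then have "gen x = (\<lambda>_. \<zero>)" by (auto simp: free_gen_def)
  moreover have "v x = \<zero>\<^sub>M" using M.smult_one[OF assms(2)] True assms(2) by simp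
  ultimately show ?thesis by (simp add: lc_def)
 next
  case False
  then have e: "{y. gen x y \<noteq> \<zero>} = {x}" by (auto simp: free_gen_def)
  show ?thesis unfolding lc_def e using assms M.finsum_insert[of "{}" x] by (simp add: free_gen_def)
 qed
qed

lemma free_submodule_all:
 assumes H: "submodule H R (FM X)" and g: "\<And>x. x \<in> X ==> gen x \<in> H"
 shows "H = carrier (FM X)"
proof -
 interpret P: module R "FM X" by (rule free_is_module)
 note Hr = submoduleD[OF H P.module_axioms]
 have *: "p \<in> H" if "finite A" "A \<subseteq> X" "p \<in>: FM X" "{x. p x \<noteq> \<zero>} \<subseteq> A" for A p
  using that
 proof (induction A arbitrary: p rule: finite_induct)
  case empty
  then have "p = \<zero>\<^bsub>FM X\<^esub>" by (auto simp: free_ops)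
  then show ?case using Hr by simp
 next
  case (insert a A)
  have pc: "p x \<in>: R" for x using insert.prems by (simp add: free_module_def)
  let ?q = "p \<oplus>\<^bsub>FM X\<^esub> (\<ominus> p a) \<odot>\<^bsub>FM X\<^esub> gen a"
  have q: "?q \<in>: FM X" using insert.prems pc by auto
  have "?q \<in> H"
  proof (rule insert.IH[OF _ q])
   show "A \<subseteq> X" using insert.prems by auto
   show "{x. ?q x \<noteq> \<zero>} \<subseteq> A" using insert.prems pc by (auto simp: free_ops free_gen_def r_neg)
  qed
  moreover have "p = ?q \<oplus>\<^bsub>FM X\<^esub> p a \<odot>\<^bsub>FM X\<^esub> gen a"
   using pc by (auto simp: free_ops free_gen_def fun_eq_iff a_assoc l_neg)
  ultimately show ?case using Hr(3)[of ?q "p a \<odot>\<^bsub>FM X\<^esub> gen a"] Hr(4)[OF pc g] insert.prems by simp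
 qed
 show ?thesis
 proof (intro equalityI subsetI)
  fix p assume p: "p \<in>: FM X"
  then show "p \<in> H" by (intro *[of "{x. p x \<noteq> \<zero>}"]) (auto simp: free_module_def)
 qed (rule Hr(1))
qed

lemma lc_in_submodule:
 assumes M: "module R M" and H: "submodule H R M" and p: "p \<in>: FM X"
  and v: "\<And>x. x \<in> X ==> v x \<in>: M" and h: "\<And>x. x \<in> X ==> p x \<odot>\<^sub>M v x \<in> H"
 shows "lc R M v p \<in> H"
proof -
 interpret M: module R M by fact
 note Hr = submoduleD[OF H M]
 have fin: "finite {x. p x \<noteq> \<zero>}" and sub: "{x. p x \<noteq> \<zero>} \<subseteq> X" using p by (auto simp: free_module_def)
 have "(\<Oplus>\<^sub>M x\<in>A. p x \<odot>\<^sub>M v x) \<in> H" if "finite A" "A \<subseteq> X" for A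
  using that
 proof (induction A rule: finite_induct)
  case (insert a A)
  then have "(\<lambda>x. p x \<odot>\<^sub>M v x) \<in> A \<rightarrow> carrier M" using h Hr(1) by blast
  then show ?case using insert h Hr(1) Hr(3) by (subst M.finsum_insert) auto
 qed (simp add: Hr(2))
 then show ?thesis unfolding lc_def using fin sub by blast
qed

lemma lc_zero:
 assumes M: "module R M" and p: "p \<in>: FM X" and e: "\<And>x. p x \<noteq> \<zero> ==> v x = \<zero>\<^sub>M"
 shows "lc R M v p = \<zero>\<^sub>M"
proof -
 interpret M: module R M by fact
 have "p x \<in>: R" for x using p by (auto simp: free_module_def)
 then show ?thesis unfolding lc_def by (intro M.add.finprod_one_eqI) (auto simp: e)
qed

lemma lc_cong:
 assumes M: "module R M" and p: "p \<in>: FM X" and v: "\<And>x. x \<in> X ==> v x \<in>: M"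
  and e: "\<And>x. x \<in> X ==> p x \<noteq> \<zero> ==> v' x = v x"
 shows "lc R M v' p = lc R M v p"
proof -
 interpret M: module R M by fact
 have sub: "x \<in> X" "p x \<in>: R" if "p x \<noteq> \<zero>" for x using p that by (auto simp: free_module_def)
 show ?thesis unfolding lc_def
  by (rule M.finsum_cong') (use sub v e in auto)
qed

lemma free_ext:
 assumes "lin R (FM X) M f" "lin R (FM X) M g" "module R M"
  and "\<And>x. x \<in> X ==> f (gen x) = g (gen x)" "p \<in>: FM X"
 shows "f p = g p"
 using free_submodule_all[OF equalizer_submodule[OF assms(1,2) free_is_module assms(3)]] assms(4,5) by auto

lemma free_projective:
 assumes g: "lin R M N g" "g ` carrier M = carrier N" and f: "lin R (FM X) N f"
  and "module R M" "module R N"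
 shows "\<exists>h. lin R (FM X) M h \<and> (\<forall>p\<in>carrier (FM X). g (h p) = f p)"
proof -
 have "\<forall>x\<in>X. \<exists>m\<in>carrier M. g m = f (gen x)"
 proof
  fix x assume "x \<in> X"
  then have "f (gen x) \<in> g ` carrier M" using linD(1)[OF f] g(2) by simp
  then show "\<exists>m\<in>carrier M. g m = f (gen x)" by (metis imageE)
 qed
 then obtain v where v: "\<And>x. x \<in> X ==> v x \<in>: M \<and> g (v x) = f (gen x)" by metis
 have l: "lin R (FM X) M (lc R M v)" by (intro lc_lin assms(4)) (simp add: v)
 have "g (lc R M v p) = f p" if "p \<in>: FM X" for p
  by (rule free_ext[OF lin_comp[OF l g(1)] f assms(5) _ that]) (simp add: v lc_gen assms(4))
 then show ?thesis using l by blast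
qed

end

section \<open>The first Ext module and extension of linear maps\<close>

text \<open>For a projective \<open>M\<close>, this says that \<open>Ext\<^sup>1(M/K, C)\<close> vanishes.\<close>

definition extends :: "('r, 'x) ring_scheme => ('r, 'm, 'y) module_scheme => 'm set => ('r, 'n, 'z) module_scheme => bool"
 where "extends R M K C \<longleftrightarrow>
  (\<forall>f. lin R (M |: K) C f --> (\<exists>g. lin R M C g \<and> (\<forall>x\<in>K. g x = f x)))"

text \<open>If \<open>g\<close> extends \<open>f h\<close> from the kernel of \<open>p\<close>, then \<open>f (x - h y) + g y\<close>, for any \<open>y\<close> with \<open>p y = q x\<close>, depends
 only on \<open>x\<close>.\<close>

lemma extends_transfer:
 assumes mods: "module R P" "module R X" "module R M" "module R C"
  and p: "lin R P M p" "p ` carrier P = carrier M" and q: "lin R X M q"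
  and h: "lin R P X h" "\<And>y. y \<in>: P ==> q (h y) = p y"
  and ext: "extends R P (mod_ker P M p) C"
 shows "extends R X (mod_ker X M q) C"
 unfolding extends_def
proof (intro allI impI)
 interpret P: module R P by fact
 interpret X: module R X by fact
 interpret C: module R C by fact
 interpret M: module R M by fact
 let ?N = "mod_ker X M q" and ?K = "mod_ker P M p"
 note pr = lin_all[OF p(1) mods(1,3)] and qr = lin_all[OF q mods(2,3)] and hr = lin_all[OF h(1) mods(1,2)]
 note N = ker_submodule[OF q mods(2,3)]
 fix f assume f: "lin R (X |: ?N) C f"
 note fr = lin_sub[OF f mods(2,4) N]
 have "lin R (P |: ?K) C (\<lambda>y. f (h y))"
  using hr fr by (intro linI) (auto simp: mod_ker_def h(2))
 then obtain g where g: "lin R P C g" "\<And>y. y \<in> ?K ==> g y = f (h y)"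
  using ext unfolding extends_def by blast
 note gr = lin_all[OF g(1) mods(1,4)]
 define g' where "g' x = (let y = SOME y. y \<in>: P \<and> p y = q x in f (x \<ominus>\<^sub>X h y) \<oplus>\<^sub>C g y)" for x
 have val: "g' x = f (x \<ominus>\<^sub>X h y) \<oplus>\<^sub>C g y" if x: "x \<in>: X" and y: "y \<in>: P" "p y = q x" for x y
 proof -
  define z where "z = (SOME y. y \<in>: P \<and> p y = q x)"
  have z: "z \<in>: P" "p z = q x"
   using someI[of "\<lambda>y. y \<in>: P \<and> p y = q x" y] y unfolding z_def by auto
  have k: "y \<ominus>\<^sub>P z \<in> ?K" using y z qr x by (auto simp: mod_ker_def pr)
  have N1: "x \<ominus>\<^sub>X h y \<in> ?N" "x \<ominus>\<^sub>X h z \<in> ?N" "h (y \<ominus>\<^sub>P z) \<in> ?N"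
   using x y z k by (auto simp: mod_ker_def qr hr h(2))
  have "x \<ominus>\<^sub>X h z = (x \<ominus>\<^sub>X h y) \<oplus>\<^sub>X h (y \<ominus>\<^sub>P z)"
  proof -
   have "h y \<in>: X" "h z \<in>: X" using y z by (auto simp: hr)
   then show ?thesis using x y z unfolding hr(6)[OF y(1) z(1)] by algebra
  qed
  then have "f (x \<ominus>\<^sub>X h z) = f (x \<ominus>\<^sub>X h y) \<oplus>\<^sub>C g (y \<ominus>\<^sub>P z)" using N1 k by (simp add: fr g(2))
  also have "\<dots> = f (x \<ominus>\<^sub>X h y) \<oplus>\<^sub>C (g y \<ominus>\<^sub>C g z)" using y z by (simp add: gr)
  finally have *: "f (x \<ominus>\<^sub>X h z) = f (x \<ominus>\<^sub>X h y) \<oplus>\<^sub>C (g y \<ominus>\<^sub>C g z)" .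
  have "f (x \<ominus>\<^sub>X h y) \<in>: C" "g y \<in>: C" "g z \<in>: C" using N1 y z by (auto simp: fr gr)
  then have "f (x \<ominus>\<^sub>X h y) \<oplus>\<^sub>C (g y \<ominus>\<^sub>C g z) \<oplus>\<^sub>C g z = f (x \<ominus>\<^sub>X h y) \<oplus>\<^sub>C g y" by algebra
  then show ?thesis using * by (simp add: g'_def z_def[symmetric] Let_def)
 qed
 have ex: "\<exists>y\<in>carrier P. p y = q x \<and> x \<ominus>\<^sub>X h y \<in> ?N" if x: "x \<in>: X" for x
 proof -
  have "q x \<in> p ` carrier P" using p(2) x by (simp add: qr)
  then obtain y where "y \<in>: P" "p y = q x" by (metis imageE)
  then show ?thesis using x qr by (intro bexI[of _ y]) (auto simp: mod_ker_def hr h(2))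
 qed
 have "lin R X C g'"
 proof (rule linI)
  fix x assume x: "x \<in>: X"
  obtain y where y: "y \<in>: P" "p y = q x" "x \<ominus>\<^sub>X h y \<in> ?N" using ex[OF x] by auto
  show "g' x \<in>: C" using val[OF x y(1,2)] y by (simp add: fr gr)
 next
  fix x r assume x: "x \<in>: X" and r: "r \<in>: R"
  obtain y where y: "y \<in>: P" "p y = q x" "x \<ominus>\<^sub>X h y \<in> ?N" using ex[OF x] by auto
  have hy: "h y \<in>: X" using y by (simp add: hr)
  have e: "r \<odot>\<^sub>X x \<ominus>\<^sub>X h (r \<odot>\<^sub>P y) = r \<odot>\<^sub>X (x \<ominus>\<^sub>X h y)"
   unfolding hr(3)[OF r y(1)] using x hy r by algebra
  show "g' (r \<odot>\<^sub>X x) = r \<odot>\<^sub>C g' x"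
   using val[of "r \<odot>\<^sub>X x" "r \<odot>\<^sub>P y"] val[OF x y(1,2)] x y r
   by (simp add: e qr pr fr gr C.smult_r_distr)
 next
  fix x x' assume x: "x \<in>: X" and x': "x' \<in>: X"
  obtain y where y: "y \<in>: P" "p y = q x" "x \<ominus>\<^sub>X h y \<in> ?N" using ex[OF x] by auto
  obtain y' where y': "y' \<in>: P" "p y' = q x'" "x' \<ominus>\<^sub>X h y' \<in> ?N" using ex[OF x'] by auto
  have hy: "h y \<in>: X" "h y' \<in>: X" using y y' by (simp_all add: hr)
  have e: "(x \<oplus>\<^sub>X x') \<ominus>\<^sub>X h (y \<oplus>\<^sub>P y') = (x \<ominus>\<^sub>X h y) \<oplus>\<^sub>X (x' \<ominus>\<^sub>X h y')"
   unfolding hr(2)[OF y(1) y'(1)] using x x' hy by algebra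
  show "g' (x \<oplus>\<^sub>X x') = g' x \<oplus>\<^sub>C g' x'"
   using val[of "x \<oplus>\<^sub>X x'" "y \<oplus>\<^sub>P y'"] val[OF x y(1,2)] val[OF x' y'(1,2)] x y x' y'
   by (simp add: e qr pr fr gr C.add.m_ac)
 qed
 moreover have "g' x = f x" if x: "x \<in> ?N" for x
 proof -
  have xc: "x \<in>: X" "q x = \<zero>\<^sub>M" using x by (auto simp: mod_ker_def)
  have "x \<ominus>\<^sub>X \<zero>\<^sub>X = x" using xc by (simp add: X.minus_eq X.minus_zero')
  then show ?thesis using val[of x "\<zero>\<^sub>P"] x xc by (simp add: pr gr hr fr)
 qed
 ultimately show "\<exists>g. lin R X C g \<and> (\<forall>x\<in>?N. g x = f x)" by blast
qed

context cring begin

text \<open>The free module on the elements of \<open>M\<close> is a presentation which is available for every module.\<close>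

lemma Ext1_vanishes_std:
 assumes M: "module R M" and C: "module R C"
 shows "Ext1_vanishes R M C \<longleftrightarrow>
  extends R (FM (carrier M)) (mod_ker (FM (carrier M)) M (lc R M (\<lambda>x. x))) C"
proof -
 interpret C: module R C by fact
 interpret M: module R M by fact
 let ?P = "FM (carrier M)"
 let ?K = "mod_ker ?P M (lc R M (\<lambda>x. x))"
 let ?L = "FM ?K" and ?d = "lc R ?P (\<lambda>x. x)"
 interpret P: module R ?P by (rule free_is_module)
 interpret L: module R ?L by (rule free_is_module)
 have p: "lin R ?P M (lc R M (\<lambda>x. x))" by (rule lc_lin[OF M])
 have K: "submodule ?K R ?P" by (rule ker_submodule[OF p P.module_axioms M])
 note Kr = submoduleD[OF K P.module_axioms]
 have d: "lin R ?L ?P ?d" by (rule lc_lin[OF P.module_axioms]) (rule Kr(1))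
 have dK: "?d y \<in> ?K" if "y \<in>: ?L" for y
 proof -
  have "{y \<in> carrier ?L. ?d y \<in> ?K} = carrier ?L"
   by (rule free_submodule_all[OF preimage_submodule[OF d L.module_axioms P.module_axioms K]])
    (simp add: lc_gen[OF P.module_axioms] Kr(1))
  then show ?thesis using that by blast
 qed
 have dgen: "?d (gen x) = x" if "x \<in> ?K" for x
  using lc_gen[OF P.module_axioms, of "\<lambda>x. x"] Kr(1)[OF that] by simp
 have surj: "?d ` carrier ?L = ?K"
 proof (intro equalityI subsetI)
  fix x assume "x \<in> ?K"
  then show "x \<in> ?d ` carrier ?L" using dgen[of x] by (metis free_gen_closed imageI)
 qed (use dK in blast)
 have k0: "std_ker0 R M = ?K"
  by (auto simp: std_ker0_def std_res0_def mod_ker_def free_lift_lc)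
 have r1: "std_res1 R M = ?L" by (simp add: std_res1_def k0)
 have d1: "std_diff1 R M y = ?d y" if "y \<in>: ?L" for y
  using that by (simp add: std_diff1_def k0 std_res0_def free_lift_lc)
 have k1: "std_ker1 R M = mod_ker ?L ?P ?d"
  by (auto simp: std_ker1_def mod_ker_def r1 d1 std_res0_def)
 let ?K1 = "mod_ker ?L ?P ?d"
 have K1: "submodule ?K1 R ?L" by (rule ker_submodule[OF d L.module_axioms P.module_axioms])
 have d2: "std_diff2 R M y = lc R ?L (\<lambda>x. x) y" if "y \<in>: FM ?K1" for y
  using that by (simp add: std_diff2_def k1 r1 free_lift_lc)
 have cocyc: "ext1_cocycles R M C = {f \<in> mod_hom R ?L C. \<forall>x\<in>?K1. f x = \<zero>\<^sub>C}"
 proof -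
  have "(\<forall>y\<in>carrier (FM ?K1). f (lc R ?L (\<lambda>x. x) y) = \<zero>\<^sub>C) \<longleftrightarrow> (\<forall>x\<in>?K1. f x = \<zero>\<^sub>C)"
   if f: "f \<in> mod_hom R ?L C" for f
  proof
   note K1r = submoduleD[OF K1 L.module_axioms]
   assume a: "\<forall>y\<in>carrier (FM ?K1). f (lc R ?L (\<lambda>x. x) y) = \<zero>\<^sub>C"
   show "\<forall>x\<in>?K1. f x = \<zero>\<^sub>C"
    using a lc_gen[OF L.module_axioms, of "\<lambda>x. x"] K1r(1) by (metis free_gen_closed)
  next
   note K1r = submoduleD[OF K1 L.module_axioms]
   assume a: "\<forall>x\<in>?K1. f x = \<zero>\<^sub>C"
   have l: "lin R (FM ?K1) ?L (lc R ?L (\<lambda>x. x))" by (rule lc_lin[OF L.module_axioms]) (rule K1r(1))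
   have "f (lc R ?L (\<lambda>x. x) y) = \<zero>\<^sub>C" if "y \<in>: FM ?K1" for y
    using free_ext[OF lin_comp[OF l mod_hom_lin[OF f]] lin_zero[OF C] C _ that] a
    by (simp add: lc_gen[OF L.module_axioms] K1r(1))
   then show "\<forall>y\<in>carrier (FM ?K1). f (lc R ?L (\<lambda>x. x) y) = \<zero>\<^sub>C" by blast
  qed
  then show ?thesis by (auto simp: ext1_cocycles_def r1 std_res2_def k1 d2)
 qed
 have cobd: "ext1_coboundaries R M C = (\<lambda>g. \<lambda>y\<in>carrier ?L. g (?d y)) ` mod_hom R ?P C"
  by (auto simp: ext1_coboundaries_def r1 std_res0_def d1 cong: restrict_cong)
 let ?H = "hom_module R ?L C"
 interpret H: module R ?H by (rule hom_is_module) (rule L.module_axioms, rule C)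
 have Hc: "carrier ?H = mod_hom R ?L C" by (simp add: hom_module_def)
 let ?Z = "ext1_cocycles R M C" and ?B = "ext1_coboundaries R M C"
 have Z: "submodule ?Z R ?H"
  by (rule submoduleI'[OF H.module_axioms])
   (use H.a_closed H.zero_closed H.smult_closed submoduleD(1)[OF K1 L.module_axioms] in
    \<open>auto simp: cocyc Hc hom_module_apply\<close>)
 have ZM: "module R (?H |: ?Z)" by (rule sub_module[OF Z H.module_axioms])
 have HP: "module R (hom_module R ?P C)" by (rule hom_is_module[OF P.module_axioms C])
 have B: "submodule ?B R (?H |: ?Z)"
 proof -
  have "lin R (hom_module R ?P C) (?H |: ?Z) (\<lambda>g. \<lambda>y\<in>carrier ?L. g (?d y))"
  proof (rule linI)
   fix g assume "g \<in>: hom_module R ?P C"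
   then have g: "lin R ?P C g" by (rule hom_module_carrier(1)[OF P.module_axioms])
   show "(\<lambda>y\<in>carrier ?L. g (?d y)) \<in>: ?H |: ?Z"
    using lin_mod_hom[OF L.module_axioms lin_comp[OF d g]] lin_all(4)[OF g P.module_axioms C]
    by (auto simp: cocyc mod_ker_def)
  qed (auto simp: hom_module_def linD(1)[OF d] intro!: restrict_ext)
  from image_submodule[OF this HP ZM] show ?thesis by (simp add: cobd hom_module_def)
 qed
 have "Ext1_vanishes R M C \<longleftrightarrow> ?Z \<subseteq> ?B"
 proof -
  have e: "Ext1 R M C = quotient_module (?H |: ?Z) ?B" by (simp add: Ext1_def r1)
  let ?q = "\<lambda>f. ?B +>\<^bsub>?H |: ?Z\<^esub> f"
  note q = quotient_proj[OF ZM B, folded e, simplified]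
  have "carrier (Ext1 R M C) = {\<zero>\<^bsub>Ext1 R M C\<^esub>} \<longleftrightarrow> (\<forall>f\<in>?Z. ?q f = \<zero>\<^bsub>Ext1 R M C\<^esub>)"
   unfolding q(2)[symmetric] using submoduleD(2)[OF Z H.module_axioms] by blast
  then show ?thesis using q(3) by (auto simp: Ext1_vanishes_def)
 qed
 also have "\<dots> \<longleftrightarrow> extends R ?P ?K C"
 proof
  assume ZB: "?Z \<subseteq> ?B"
  show "extends R ?P ?K C" unfolding extends_def
  proof (intro allI impI)
   fix f assume f: "lin R (?P |: ?K) C f"
   have l: "lin R ?L C (\<lambda>y. f (?d y))" using lin_comp[OF lin_into[OF d dK] f] .
   let ?f = "restrict (\<lambda>y. f (?d y)) (carrier ?L)"
   have "?f \<in> ?Z"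
    using lin_mod_hom[OF L.module_axioms l] lin_sub(4)[OF f P.module_axioms C K] by (auto simp: cocyc mod_ker_def)
   then obtain g where g: "g \<in> mod_hom R ?P C" "?f = (\<lambda>y\<in>carrier ?L. g (?d y))" using ZB by (auto simp: cobd)
   have "g x = f x" if x: "x \<in> ?K" for x
    using fun_cong[OF g(2), of "gen x"] x by (simp add: dgen)
   then show "\<exists>g. lin R ?P C g \<and> (\<forall>x\<in>?K. g x = f x)" using mod_hom_lin[OF g(1)] by blast
  qed
 next
  assume ext: "extends R ?P ?K C"
  show "?Z \<subseteq> ?B"
  proof
   fix f assume f: "f \<in> ?Z"
   have "\<exists>h'. lin R (?P |: ?K) C h' \<and> (\<forall>x\<in>carrier ?L. h' (?d x) = f x)"
    using f surj by (intro factor_through_surjection sub_module[OF K] lin_into[OF d dK] mod_hom_lin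
      L.module_axioms P.module_axioms C) (auto simp: cocyc mod_ker_def)
   then obtain h' where h': "lin R (?P |: ?K) C h'" "\<And>x. x \<in>: ?L ==> h' (?d x) = f x" by blast
   then obtain g where g: "lin R ?P C g" "\<And>x. x \<in> ?K ==> g x = h' x" using ext unfolding extends_def by blast
   have "f = (\<lambda>y\<in>carrier ?L. restrict g (carrier ?P) (?d y))"
   proof (rule extensionalityI[of _ "carrier ?L"])
    show "f \<in> extensional (carrier ?L)" using f by (simp add: cocyc mod_hom_def PiE_def)
    fix y assume y: "y \<in>: ?L"
    then show "f y = (\<lambda>y\<in>carrier ?L. restrict g (carrier ?P) (?d y)) y"
     using h'(2)[OF y] g(2)[OF dK[OF y]] Kr(1)[OF dK[OF y]] by simp
   qed simp
   then show "f \<in> ?B" unfolding cobd using lin_mod_hom[OF P.module_axioms g(1)] by (rule image_eqI)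
  qed
 qed
 finally show ?thesis .
qed

lemma carrier_presentation:
 assumes "module R M"
 shows "lin R (FM (carrier M)) M (lc R M (\<lambda>x. x))"
  and "lc R M (\<lambda>x. x) ` carrier (FM (carrier M)) = carrier M"
proof -
 show l: "lin R (FM (carrier M)) M (lc R M (\<lambda>x. x))" by (rule lc_lin[OF assms])
 have "x \<in> lc R M (\<lambda>x. x) ` carrier (FM (carrier M))" if "x \<in>: M" for x
  using lc_gen[OF assms, of "\<lambda>x. x" x] that by (metis free_gen_closed imageI)
 then show "lc R M (\<lambda>x. x) ` carrier (FM (carrier M)) = carrier M"
  using linD(1)[OF l] by auto
qed

text \<open>By projectivity of free modules, the presentation by the elements of \<open>M\<close> maps to each epimorphism onto \<open>M\<close>,
 and the extension property is carried along.\<close>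

lemma Ext1_vanishes_extends:
 assumes "module R M" "module R C" "module R X" "lin R X M q" "q ` carrier X = carrier M"
  and "Ext1_vanishes R M C"
 shows "extends R X (mod_ker X M q) C"
proof -
 note p = carrier_presentation[OF assms(1)]
 obtain h where "lin R (FM (carrier M)) X h"
  "\<And>y. y \<in>: FM (carrier M) ==> q (h y) = lc R M (\<lambda>x. x) y"
  using free_projective[OF assms(4,5) p(1) assms(3,1)] by blast
 then show ?thesis
  using extends_transfer[OF free_is_module assms(3,1,2) p assms(4)] Ext1_vanishes_std[OF assms(1,2)] assms(6)
  by blast
qed

lemma Ext1_vanishes_free_presentation:
 assumes M: "module R M" and C: "module R C" and q: "lin R (FM I) M q"
  "q ` carrier (FM I) = carrier M"
 shows "Ext1_vanishes R M C \<longleftrightarrow> extends R (FM I) (mod_ker (FM I) M q) C"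
proof
 assume "extends R (FM I) (mod_ker (FM I) M q) C"
 note p = carrier_presentation[OF M]
 obtain h where "lin R (FM I) (FM (carrier M)) h"
  "\<And>y. y \<in>: FM I ==> lc R M (\<lambda>x. x) (h y) = q y"
  using free_projective[OF p q(1) free_is_module M] by blast
 then show "Ext1_vanishes R M C"
  using extends_transfer[OF free_is_module free_is_module M C q p(1)] Ext1_vanishes_std[OF M C]
   \<open>extends R (FM I) _ C\<close> by blast
qed (rule Ext1_vanishes_extends[OF M C free_is_module q])

end

section \<open>Localizations\<close>

locale localized = cring R for R (structure) +
 fixes T assumes T: "submonoid T R"
begin

lemma T_closed [simp]: "t \<in> T ==> t \<in>: R"
 using submonoid.mem_carrier[OF T] .

lemma T_one [simp]: "\<one> \<in> T"
 using submonoid.one_closed[OF T] .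

lemma T_mult [simp]: "s \<in> T ==> t \<in> T ==> s \<otimes> t \<in> T"
 using submonoid.m_closed[OF T] .

abbreviation fr :: "'a => 'a => ('a \<times> 'a) set" where "fr \<equiv> fraction R T"
abbreviation Q :: "('a \<times> 'a) set ring" where "Q \<equiv> localization R T"

lemma frac_self: "r \<in>: R ==> s \<in> T ==> (r, s) \<in> fr r s"
 by (auto simp: fraction_def intro!: bexI[of _ \<one>])

lemma frac_trans:
 assumes "r \<in>: R" "s \<in> T" "r' \<in>: R" "s' \<in> T" "r'' \<in>: R" "s'' \<in> T"
  and "\<exists>t\<in>T. t \<otimes> (s' \<otimes> r) = t \<otimes> (s \<otimes> r')" "\<exists>t\<in>T. t \<otimes> (s'' \<otimes> r') = t \<otimes> (s' \<otimes> r'')"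
 shows "\<exists>t\<in>T. t \<otimes> (s'' \<otimes> r) = t \<otimes> (s \<otimes> r'')"
proof -
 obtain t t' where t: "t \<in> T" "t \<otimes> (s' \<otimes> r) = t \<otimes> (s \<otimes> r')" "t' \<in> T" "t' \<otimes> (s'' \<otimes> r') = t' \<otimes> (s' \<otimes> r'')"
  using assms(7,8) by blast
 have c: "s \<in>: R" "s' \<in>: R" "s'' \<in>: R" "t \<in>: R" "t' \<in>: R" using assms t by auto
 have "(t \<otimes> t' \<otimes> s') \<otimes> (s'' \<otimes> r) = (t' \<otimes> s'') \<otimes> (t \<otimes> (s' \<otimes> r))" using assms(1,3,5) c by algebra
 also have "\<dots> = (t \<otimes> s) \<otimes> (t' \<otimes> (s'' \<otimes> r'))" unfolding t(2) using assms(1,3,5) c by algebra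
 also have "\<dots> = (t \<otimes> t' \<otimes> s') \<otimes> (s \<otimes> r'')" unfolding t(4) using assms(1,3,5) c by algebra
 finally show ?thesis using t assms by (intro bexI[of _ "t \<otimes> t' \<otimes> s'"]) auto
qed

lemma frac_eq_iff:
 assumes "r \<in>: R" "s \<in> T" "r' \<in>: R" "s' \<in> T"
 shows "fr r s = fr r' s' \<longleftrightarrow> (\<exists>t\<in>T. t \<otimes> (s' \<otimes> r) = t \<otimes> (s \<otimes> r'))"
proof
 assume "fr r s = fr r' s'"
 then have "(r', s') \<in> fr r s" using frac_self assms by simp
 then show "\<exists>t\<in>T. t \<otimes> (s' \<otimes> r) = t \<otimes> (s \<otimes> r')" by (simp add: fraction_def)
next
 assume a: "\<exists>t\<in>T. t \<otimes> (s' \<otimes> r) = t \<otimes> (s \<otimes> r')"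
 then have b: "\<exists>t\<in>T. t \<otimes> (s \<otimes> r') = t \<otimes> (s' \<otimes> r)" by metis
 show "fr r s = fr r' s'"
 proof (intro equalityI subsetI)
  show "x \<in> fr r' s'" if "x \<in> fr r s" for x
   using that frac_trans[OF assms(3,4,1,2) _ _ b] by (cases x) (simp add: fraction_def)
  show "x \<in> fr r s" if "x \<in> fr r' s'" for x
   using that frac_trans[OF assms _ _ a] by (cases x) (simp add: fraction_def)
 qed
qed

lemma frac_eqI:
 assumes "r \<in>: R" "s \<in> T" "r' \<in>: R" "s' \<in> T" "s' \<otimes> r = s \<otimes> r'"
 shows "fr r s = fr r' s'"
 using assms by (subst frac_eq_iff) (auto intro!: bexI[of _ \<one>])

lemma loc_carrier: "carrier Q = {fr r s | r s. r \<in>: R \<and> s \<in> T}"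
 by (simp add: localization_def)

lemma frac_closed [simp]: "r \<in>: R ==> s \<in> T ==> fr r s \<in>: Q"
 by (auto simp: loc_carrier)

lemma loc_cases: "X \<in>: Q ==> (\<And>r s. r \<in>: R ==> s \<in> T ==> X = fr r s ==> P) ==> P"
 by (auto simp: loc_carrier)

lemma UN2_const: "(a, b) \<in> X ==> (c, d) \<in> Y ==> (\<And>a b c d. (a, b) \<in> X ==> (c, d) \<in> Y ==> f a b c d = Z) ==>
  (\<Union>(a, b)\<in>X. \<Union>(c, d)\<in>Y. f a b c d) = Z"
 by fastforce

lemma loc_add:
 assumes "r \<in>: R" "s \<in> T" "r' \<in>: R" "s' \<in> T"
 shows "fr r s \<oplus>\<^sub>Q fr r' s' = fr ((s' \<otimes> r) \<oplus> (s \<otimes> r')) (s \<otimes> s')"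
 unfolding localization_def ring_record_simps
proof (rule UN2_const[OF frac_self[OF assms(1,2)] frac_self[OF assms(3,4)]])
 fix a b a' b' assume "(a, b) \<in> fr r s" "(a', b') \<in> fr r' s'"
 then obtain t t' where a: "a \<in>: R" "b \<in> T" "t \<in> T" "t \<otimes> (b \<otimes> r) = t \<otimes> (s \<otimes> a)"
  "a' \<in>: R" "b' \<in> T" "t' \<in> T" "t' \<otimes> (b' \<otimes> r') = t' \<otimes> (s' \<otimes> a')" by (auto simp: fraction_def)
 note c = assms(1,3) a(1,5) T_closed[OF assms(2)] T_closed[OF assms(4)] T_closed[OF a(2)] T_closed[OF a(3)]
  T_closed[OF a(6)] T_closed[OF a(7)]
 have "(t \<otimes> t') \<otimes> ((s \<otimes> s') \<otimes> ((b' \<otimes> a) \<oplus> (b \<otimes> a')))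
   = (t' \<otimes> s' \<otimes> b') \<otimes> (t \<otimes> (s \<otimes> a)) \<oplus> (t \<otimes> s \<otimes> b) \<otimes> (t' \<otimes> (s' \<otimes> a'))" using c by algebra
 also have "\<dots> = (t \<otimes> t') \<otimes> ((b \<otimes> b') \<otimes> ((s' \<otimes> r) \<oplus> (s \<otimes> r')))"
  unfolding a(4)[symmetric] a(8)[symmetric] using c by algebra
 finally have "(t \<otimes> t') \<otimes> ((s \<otimes> s') \<otimes> ((b' \<otimes> a) \<oplus> (b \<otimes> a'))) = (t \<otimes> t') \<otimes> ((b \<otimes> b') \<otimes> ((s' \<otimes> r) \<oplus> (s \<otimes> r')))" .
 then show "fr ((b' \<otimes> a) \<oplus> (b \<otimes> a')) (b \<otimes> b') = fr ((s' \<otimes> r) \<oplus> (s \<otimes> r')) (s \<otimes> s')"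
  using assms a by (subst frac_eq_iff) (auto intro!: bexI[of _ "t \<otimes> t'"])
qed

lemma loc_mult:
 assumes "r \<in>: R" "s \<in> T" "r' \<in>: R" "s' \<in> T"
 shows "fr r s \<otimes>\<^sub>Q fr r' s' = fr (r \<otimes> r') (s \<otimes> s')"
 unfolding localization_def ring_record_simps monoid.simps
proof (rule UN2_const[OF frac_self[OF assms(1,2)] frac_self[OF assms(3,4)]])
 fix a b a' b' assume "(a, b) \<in> fr r s" "(a', b') \<in> fr r' s'"
 then obtain t t' where a: "a \<in>: R" "b \<in> T" "t \<in> T" "t \<otimes> (b \<otimes> r) = t \<otimes> (s \<otimes> a)"
  "a' \<in>: R" "b' \<in> T" "t' \<in> T" "t' \<otimes> (b' \<otimes> r') = t' \<otimes> (s' \<otimes> a')" by (auto simp: fraction_def)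
 note c = assms(1,3) a(1,5) T_closed[OF assms(2)] T_closed[OF assms(4)] T_closed[OF a(2)] T_closed[OF a(3)]
  T_closed[OF a(6)] T_closed[OF a(7)]
 have "(t \<otimes> t') \<otimes> ((s \<otimes> s') \<otimes> (a \<otimes> a')) = (t \<otimes> (s \<otimes> a)) \<otimes> (t' \<otimes> (s' \<otimes> a'))" using c by algebra
 also have "\<dots> = (t \<otimes> t') \<otimes> ((b \<otimes> b') \<otimes> (r \<otimes> r'))"
  unfolding a(4)[symmetric] a(8)[symmetric] using c by algebra
 finally have "(t \<otimes> t') \<otimes> ((s \<otimes> s') \<otimes> (a \<otimes> a')) = (t \<otimes> t') \<otimes> ((b \<otimes> b') \<otimes> (r \<otimes> r'))" .
 then show "fr (a \<otimes> a') (b \<otimes> b') = fr (r \<otimes> r') (s \<otimes> s')"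
  using assms a by (subst frac_eq_iff) (auto intro!: bexI[of _ "t \<otimes> t'"])
qed

lemma loc_zero: "\<zero>\<^sub>Q = fr \<zero> \<one>" and loc_one: "\<one>\<^sub>Q = fr \<one> \<one>"
 by (simp_all add: localization_def)

lemma frac_zero: "s \<in> T ==> fr \<zero> s = \<zero>\<^sub>Q"
 by (simp add: loc_zero frac_eqI)

lemma frac_eq_zero: "r \<in>: R ==> s \<in> T ==> fr r s = \<zero>\<^sub>Q \<longleftrightarrow> (\<exists>t\<in>T. t \<otimes> r = \<zero>)"
 by (simp add: loc_zero frac_eq_iff)

lemma loc_cring: "cring Q"
proof (rule cringI)
 show "abelian_group Q"
 proof (rule abelian_groupI)
  fix X assume X: "X \<in>: Q"
  then show "\<zero>\<^sub>Q \<oplus>\<^sub>Q X = X" by (elim loc_cases) (simp add: loc_zero loc_add)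
  obtain r s where X: "r \<in>: R" "s \<in> T" "X = fr r s" using X by (rule loc_cases)
  have "fr (\<ominus> r) s \<oplus>\<^sub>Q X = \<zero>\<^sub>Q" using X by (simp add: loc_add r_minus l_neg frac_zero)
  then show "\<exists>Y\<in>carrier Q. Y \<oplus>\<^sub>Q X = \<zero>\<^sub>Q" using X by (intro bexI[of _ "fr (\<ominus> r) s"]) auto
  fix Y assume Y: "Y \<in>: Q"
  show "X \<oplus>\<^sub>Q Y = Y \<oplus>\<^sub>Q X"
   using X Y by (elim loc_cases) (simp add: loc_add a_ac m_comm)
  show "X \<oplus>\<^sub>Q Y \<in>: Q" using X Y by (elim loc_cases) (simp add: loc_add)
  fix Z assume Z: "Z \<in>: Q"
  show "X \<oplus>\<^sub>Q Y \<oplus>\<^sub>Q Z = X \<oplus>\<^sub>Q (Y \<oplus>\<^sub>Q Z)"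
   using X Y Z by (elim loc_cases) (simp add: loc_add r_distr a_assoc m_ac)
 qed (simp add: loc_zero)
 show "Group.comm_monoid Q"
 proof (rule comm_monoidI)
  fix X Y Z assume X: "X \<in>: Q" and Y: "Y \<in>: Q" and Z: "Z \<in>: Q"
  show "X \<otimes>\<^sub>Q Y \<in>: Q" using X Y by (elim loc_cases) (simp add: loc_mult)
  show "X \<otimes>\<^sub>Q Y = Y \<otimes>\<^sub>Q X" using X Y by (elim loc_cases) (simp add: loc_mult m_comm)
  show "X \<otimes>\<^sub>Q Y \<otimes>\<^sub>Q Z = X \<otimes>\<^sub>Q (Y \<otimes>\<^sub>Q Z)"
   using X Y Z by (elim loc_cases) (simp add: loc_mult m_ac)
  show "\<one>\<^sub>Q \<otimes>\<^sub>Q X = X" using X by (elim loc_cases) (simp add: loc_one loc_mult)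
 qed (simp add: loc_one)
 fix X Y Z assume "X \<in>: Q" "Y \<in>: Q" "Z \<in>: Q"
 then obtain r s r' s' r'' s'' where *: "r \<in>: R" "s \<in> T" "X = fr r s" "r' \<in>: R" "s' \<in> T"
  "Y = fr r' s'" "r'' \<in>: R" "s'' \<in> T" "Z = fr r'' s''" by (auto simp: loc_carrier)
 note c = *(1,4,7) T_closed[OF *(2)] T_closed[OF *(5)] T_closed[OF *(8)]
 have "s \<otimes> s'' \<otimes> (s' \<otimes> s'') \<otimes> ((s' \<otimes> r \<oplus> s \<otimes> r') \<otimes> r'')
   = (s \<otimes> s' \<otimes> s'') \<otimes> (s' \<otimes> s'' \<otimes> (r \<otimes> r'') \<oplus> s \<otimes> s'' \<otimes> (r' \<otimes> r''))" using c by algebra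
 then show "(X \<oplus>\<^sub>Q Y) \<otimes>\<^sub>Q Z = X \<otimes>\<^sub>Q Z \<oplus>\<^sub>Q Y \<otimes>\<^sub>Q Z"
  using * by (simp add: loc_add loc_mult) (intro frac_eqI, auto)
qed

lemma loc_map_hom: "loc_map R T \<in> ring_hom R Q"
 by (rule ring_hom_memI) (simp_all add: loc_map_def loc_mult loc_add loc_one)

lemma loc_map_mult: "r \<in>: R ==> r' \<in>: R ==> s \<in> T ==> loc_map R T r \<otimes>\<^sub>Q fr r' s = fr (r \<otimes> r') s"
 by (simp add: loc_map_def loc_mult)

end

definition restrict_scalars :: "('r => 'a) => ('a, 'm, 'y) module_scheme => ('r, 'm) module"
 where "restrict_scalars \<phi> D = \<lparr>carrier = carrier D, mult = mult D, one = \<one>\<^sub>D, zero = \<zero>\<^sub>D, add = add D,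
   smult = (\<lambda>r x. \<phi> r \<odot>\<^sub>D x)\<rparr>"

lemma restrict_scalars_simps [simp]:
 "carrier (restrict_scalars \<phi> D) = carrier D" "\<zero>\<^bsub>restrict_scalars \<phi> D\<^esub> = \<zero>\<^sub>D"
 "x \<oplus>\<^bsub>restrict_scalars \<phi> D\<^esub> y = x \<oplus>\<^sub>D y" "r \<odot>\<^bsub>restrict_scalars \<phi> D\<^esub> x = \<phi> r \<odot>\<^sub>D x"
 "x \<ominus>\<^bsub>restrict_scalars \<phi> D\<^esub> y = x \<ominus>\<^sub>D y"
 by (simp_all add: restrict_scalars_def a_minus_def a_inv_def m_inv_def)

lemma restrict_scalars_module:
 assumes "cring R" "\<phi> \<in> ring_hom R A" "module A D"
 shows "module R (restrict_scalars \<phi> D)"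
proof -
 interpret D: module A D by fact
 note h = ring_hom_closed[OF assms(2)] ring_hom_mult[OF assms(2)] ring_hom_add[OF assms(2)] ring_hom_one[OF assms(2)]
 have "abelian_group (restrict_scalars \<phi> D)"
 proof (rule abelian_groupI)
  show "\<exists>y\<in>carrier (restrict_scalars \<phi> D). y \<oplus>\<^bsub>restrict_scalars \<phi> D\<^esub> x = \<zero>\<^bsub>restrict_scalars \<phi> D\<^esub>"
   if "x \<in>: restrict_scalars \<phi> D" for x
   using that D.l_neg by (intro bexI[of _ "\<ominus>\<^sub>D x"]) auto
 qed (auto simp: D.M.add.m_ac)
 then show ?thesis
  by (intro moduleI assms(1)) (auto simp: h D.smult_l_distr D.smult_r_distr D.smult_assoc1)
qed

lemma ring_as_module_self: "cring A ==> module A (ring_as_module A (\<lambda>a. a))"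
proof -
 assume "cring A"
 then interpret A: cring A .
 have "abelian_group (ring_as_module A (\<lambda>a. a))"
 proof (rule abelian_groupI)
  show "\<exists>y\<in>carrier (ring_as_module A (\<lambda>a. a)). y \<oplus>\<^bsub>ring_as_module A (\<lambda>a. a)\<^esub> x = \<zero>\<^bsub>ring_as_module A (\<lambda>a. a)\<^esub>"
   if "x \<in>: ring_as_module A (\<lambda>a. a)" for x
   using that A.l_neg by (intro bexI[of _ "\<ominus>\<^sub>A x"]) (auto simp: ring_as_module_def)
 qed (auto simp: ring_as_module_def A.a_ac)
 then show ?thesis
  by (intro moduleI A.is_cring) (auto simp: ring_as_module_def A.l_distr A.r_distr A.m_assoc)
qed

text \<open>The projection of the free module on \<open>T\<close> onto the localization, which takes the generator of \<open>t\<close> to \<open>1/t\<close>,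
 its kernel, and the relations between the fractions \<open>1/s\<close> and \<open>1/(st)\<close>.\<close>

definition loc_proj :: "('r, 'x) ring_scheme => 'r set => ('r => 'r) => ('r \<times> 'r) set"
 where "loc_proj R T = lc R (loc_module R T) (\<lambda>t. fraction R T \<one>\<^sub>R t)"

definition loc_ker :: "('r, 'x) ring_scheme => 'r set => ('r => 'r) set"
 where "loc_ker R T = mod_ker (free_module R T) (loc_module R T) (loc_proj R T)"

definition rel :: "('r, 'x) ring_scheme => 'r => 'r => 'r => 'r"
 where "rel R s t = (\<lambda>x. free_gen R s x \<ominus>\<^sub>R t \<otimes>\<^sub>R free_gen R (s \<otimes>\<^sub>R t) x)"

definition loc_cotorsion :: "('r, 'x) ring_scheme => 'r set => ('r, 'c, 'y) module_scheme => bool"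
 where "loc_cotorsion R T C \<longleftrightarrow> extends R (free_module R T) (loc_ker R T) C"

lemma (in cring) free_minus:
 assumes "p \<in>: FM X" "q \<in>: FM X"
 shows "p \<ominus>\<^bsub>FM X\<^esub> q = (\<lambda>x. p x \<ominus> q x)" "\<ominus>\<^bsub>FM X\<^esub> q = (\<lambda>x. \<ominus> q x)"
proof -
 interpret P: module R "FM X" by (rule free_is_module)
 have q: "q x \<in>: R" "p x \<in>: R" for x using assms by (auto simp: free_module_def)
 show e: "\<ominus>\<^bsub>FM X\<^esub> q = (\<lambda>x. \<ominus> q x)"
  using P.smult_m1[OF assms(2)] q by (auto simp: free_ops l_minus fun_eq_iff)
 show "p \<ominus>\<^bsub>FM X\<^esub> q = (\<lambda>x. p x \<ominus> q x)" by (simp add: P.M.minus_eq e free_ops minus_eq)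
qed

context localized begin

abbreviation G where "G \<equiv> free_module R T"
abbreviation L where "L \<equiv> loc_ker R T"
abbreviation \<pi> where "\<pi> \<equiv> loc_proj R T"
abbreviation QM where "QM \<equiv> loc_module R T"

lemma loc_module_eq: "QM = restrict_scalars (loc_map R T) (ring_as_module Q (\<lambda>a. a))"
 by (simp add: loc_module_def ring_as_module_def restrict_scalars_def)

lemma loc_module: "module R QM"
 unfolding loc_module_eq
 by (rule restrict_scalars_module[OF is_cring loc_map_hom ring_as_module_self[OF loc_cring]])

lemma loc_module_simps:
 "carrier QM = carrier Q" "\<zero>\<^sub>QM = \<zero>\<^sub>Q"
 "x \<oplus>\<^sub>QM y = x \<oplus>\<^sub>Q y" "r \<odot>\<^sub>QM x = loc_map R T r \<otimes>\<^sub>Q x"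
 by (simp_all add: loc_module_def ring_as_module_def)

lemma free_T: "module R G" by (rule free_is_module)

lemma loc_proj_lin: "lin R G QM \<pi>"
 unfolding loc_proj_def by (rule lc_lin[OF loc_module]) (simp add: loc_module_simps)

lemmas loc_proj_simps = lin_all[OF loc_proj_lin free_T loc_module]

lemma loc_proj_gen [simp]: "t \<in> T ==> \<pi> (gen t) = fr \<one> t"
 unfolding loc_proj_def by (rule lc_gen[OF loc_module]) (simp add: loc_module_simps)

lemma loc_proj_gen_smult:
 "r \<in>: R ==> t \<in> T ==> \<pi> (r \<odot>\<^sub>G gen t) = fr r t"
 by (simp add: loc_proj_simps loc_module_simps loc_map_mult)

lemma loc_proj_surj: "\<pi> ` carrier G = carrier QM"
proof -
 interpret P: module R "G" by (rule free_T)
 have "fr r t \<in> \<pi> ` carrier G" if "r \<in>: R" "t \<in> T" for r t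
  using loc_proj_gen_smult[OF that] that by (metis P.smult_closed free_gen_closed imageI)
 then show ?thesis using loc_proj_simps(1) by (auto simp: loc_module_simps loc_carrier)
qed

lemma loc_ker_submodule: "submodule L R G"
 unfolding loc_ker_def by (rule ker_submodule[OF loc_proj_lin free_T loc_module])

lemma ker_diff_iff:
 assumes "p \<in>: G" "q \<in>: G"
 shows "p \<ominus>\<^sub>G q \<in> L \<longleftrightarrow> \<pi> p = \<pi> q"
proof -
 interpret G: module R G by (rule free_T)
 interpret QM: module R QM by (rule loc_module)
 show ?thesis using assms loc_proj_simps(1)[of p] loc_proj_simps(1)[of q]
  by (simp add: loc_ker_def mod_ker_def loc_proj_simps QM.minus_eq_zero_iff)
qed

lemma loc_cotorsion_Ext1:
 assumes "module R C"
 shows "Ext1_vanishes R QM C \<longleftrightarrow> loc_cotorsion R T C"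
 unfolding loc_cotorsion_def loc_ker_def
 by (rule Ext1_vanishes_free_presentation[OF loc_module assms loc_proj_lin loc_proj_surj])

lemma rel_eq: "s \<in> X ==> s \<otimes> t \<in> X ==> t \<in>: R ==>
  rel R s t = gen s \<ominus>\<^bsub>FM X\<^esub> t \<odot>\<^bsub>FM X\<^esub> gen (s \<otimes> t)"
proof -
 interpret P: module R "FM X" by (rule free_is_module)
 assume "s \<in> X" "s \<otimes> t \<in> X" "t \<in>: R"
 then have "gen s \<in>: FM X"
  "t \<odot>\<^bsub>FM X\<^esub> gen (s \<otimes> t) \<in>: FM X" by simp_all
 then show ?thesis by (simp only: free_minus rel_def free_ops)
qed

lemma rel_closed: "s \<in> X ==> s \<otimes> t \<in> X ==> t \<in>: R ==> rel R s t \<in>: FM X"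
proof -
 interpret P: module R "FM X" by (rule free_is_module)
 show "s \<in> X ==> s \<otimes> t \<in> X ==> t \<in>: R ==> rel R s t \<in>: FM X"
  by (subst rel_eq[of s X t]) auto
qed

lemma rel_in_ker: "s \<in> T ==> t \<in> T ==> rel R s t \<in> L"
proof -
 interpret G: module R G by (rule free_T)
 show "s \<in> T ==> t \<in> T ==> rel R s t \<in> L"
  using frac_eqI[of \<one> s t "s \<otimes> t"] by (simp add: rel_eq[of s T t] ker_diff_iff loc_proj_gen_smult)
qed

lemma common_multiple:
 assumes Z: "submonoid Z R" and X: "finite X" "X \<subseteq> Z"
 shows "\<exists>z\<in>Z. \<exists>w. \<forall>x\<in>X. w x \<in> Z \<and> x \<otimes> w x = z"
 using X
proof (induction X rule: finite_induct)
 case (insert a X)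
 then obtain z w where z: "z \<in> Z" "\<forall>x\<in>X. w x \<in> Z \<and> x \<otimes> w x = z" by auto
 have c: "x \<in>: R" if "x \<in> Z" for x using submonoid.mem_carrier[OF Z that] .
 have "(if x = a then z else w x \<otimes> a) \<in> Z \<and> x \<otimes> (if x = a then z else w x \<otimes> a) = a \<otimes> z" if x: "x \<in> insert a X" for x
  using x z insert.prems submonoid.m_closed[OF Z] by (cases "x = a") (auto simp: subset_iff m_lcomm m_comm c)
 then show ?case using z(1) insert.prems submonoid.m_closed[OF Z]
  by (intro bexI[of _ "a \<otimes> z"] exI[of _ "\<lambda>x. if x = a then z else w x \<otimes> a"]) auto
qed (use submonoid.one_closed[OF Z] in blast)

text \<open>Modulo the relations, every generator is a multiple of the generator which belongs to a common denominator.\<close>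

lemma common_denominator:
 assumes Z: "submonoid Z R" "Z \<subseteq> T" and p: "p \<in>: FM Z"
 shows "\<exists>z\<in>Z. \<exists>r\<in>carrier R. p \<ominus>\<^sub>G r \<odot>\<^sub>G gen z \<in> gen_submodule R G {rel R s t | s t. s \<in> Z \<and> t \<in> Z}"
proof -
 interpret G: module R G by (rule free_T)
 let ?B = "{rel R s t | s t. s \<in> Z \<and> t \<in> Z}" and ?RM = "ring_as_module R (\<lambda>r. r)"
 have zT: "z \<in> T" if "z \<in> Z" for z using that Z(2) by auto
 have "?B \<subseteq> carrier G" using zT by (auto intro!: rel_closed)
 note \<Gamma> = gen_submodule[OF free_T this]
 have "finite {x. p x \<noteq> \<zero>}" "{x. p x \<noteq> \<zero>} \<subseteq> Z" using p by (auto simp: free_module_def)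
 from common_multiple[OF Z(1) this] obtain z w
  where z: "z \<in> Z" "\<And>x. p x \<noteq> \<zero> ==> w x \<in> Z \<and> x \<otimes> w x = z" by auto
 define v where "v x = (if p x = \<zero> then \<zero> else w x)" for x
 have v: "v x \<in>: R" for x using z(2)[of x] zT[of "w x"] by (simp add: v_def)
 have gz: "gen z \<in>: G" using zT[OF z(1)] by simp
 have RM: "module R ?RM" by (rule ring_as_module_self[OF is_cring])
 have vg: "lc R ?RM v (gen x) = v x" for x by (rule lc_gen[OF RM]) (simp add: ring_as_module_def v)
 have vl: "lin R (FM Z) ?RM (lc R ?RM v)" by (rule lc_lin[OF RM]) (simp add: ring_as_module_def v)
 have il: "lin R (FM Z) G (\<lambda>q. q)" using free_mono[OF Z(2)] by (auto simp: lin_def free_ops)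
 have sl: "lin R ?RM G (\<lambda>r. r \<odot>\<^sub>G gen z)"
  using gz by (intro linI) (simp_all add: ring_as_module_def G.smult_l_distr G.smult_assoc1)
 let ?v = "\<lambda>x. gen x \<ominus>\<^sub>G v x \<odot>\<^sub>G gen z"
 have vc: "?v x \<in>: G" if "x \<in> Z" for x using zT[OF that] v gz by simp
 have "lc R G ?v p = p \<ominus>\<^sub>G lc R ?RM v p \<odot>\<^sub>G gen z"
  by (rule free_ext[OF lc_lin[OF free_T vc] lin_diff[OF il lin_comp[OF vl sl] free_T] free_T _ p])
   (simp_all add: lc_gen[OF free_T, of ?v] vg vc)
 moreover have "lc R G ?v p \<in> gen_submodule R G ?B"
 proof (rule lc_in_submodule[OF free_T \<Gamma>(1) p vc])
  fix x assume x: "x \<in> Z"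
  have pc: "p x \<in>: R" using p by (simp add: free_module_def)
  show "p x \<odot>\<^sub>G ?v x \<in> gen_submodule R G ?B"
  proof (cases "p x = \<zero>")
   case True
   then show ?thesis using vc[OF x] submoduleD(2)[OF \<Gamma>(1) free_T] by simp
  next
   case False
   have "?v x = rel R x (w x)" using z(2)[OF False] False zT[OF x] zT[OF z(1)] v[of x] by (simp add: v_def rel_eq[of x T "w x"])
   then show ?thesis using submoduleD(4)[OF \<Gamma>(1) free_T pc] \<Gamma>(2) x z(2)[OF False] by auto
  qed
 qed
 ultimately show ?thesis using z(1) linD(1)[OF vl p] by (intro bexI[of _ z] bexI[of _ "lc R ?RM v p"]) (simp_all add: ring_as_module_def)
qed

lemma rels_closed: "{rel R s t | s t. s \<in> T \<and> t \<in> T} \<subseteq> carrier G"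
 by (auto intro!: rel_closed)

text \<open>By passing to a common denominator a relation becomes a multiple \<open>r e\<^sub>z\<close> of one generator; as \<open>r/z = 0\<close>, some
 \<open>t\<close> satisfies \<open>r t = 0\<close>, and then \<open>r e\<^sub>z = r (e\<^sub>z - t e\<^sub>z\<^sub>t)\<close>.\<close>

lemma loc_ker_generated:
 "L = gen_submodule R G {rel R s t | s t. s \<in> T \<and> t \<in> T}" (is "_ = ?G")
proof
 interpret F: module R "G" by (rule free_is_module)
 interpret M: module R "QM" by (rule loc_module)
 note G = gen_submodule[OF F.module_axioms rels_closed]
 note Gr = submoduleD[OF G(1) F.module_axioms] and Kr = submoduleD[OF loc_ker_submodule F.module_axioms]
 show GK: "?G \<subseteq> L" by (rule G(3)[OF loc_ker_submodule]) (auto intro: rel_in_ker)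
 show "L \<subseteq> ?G"
 proof
  fix p assume p: "p \<in> L"
  then have pc: "p \<in>: G" by (rule Kr(1))
  obtain z r where z: "z \<in> T" "r \<in>: R"
   "p \<ominus>\<^sub>G r \<odot>\<^sub>G gen z \<in> ?G"
   using common_denominator[OF T _ pc] by auto
  let ?g = "r \<odot>\<^sub>G gen z"
  have gc: "?g \<in>: G" using z by simp
  have "\<pi> ?g = \<zero>\<^sub>Q" using ker_diff_iff[OF pc gc] GK z(3) p by (auto simp: loc_ker_def mod_ker_def loc_module_simps)
  then have "fr r z = \<zero>\<^sub>Q" using z by (simp add: loc_proj_gen_smult)
  then obtain u where u: "u \<in> T" "u \<otimes> r = \<zero>" using z by (auto simp: frac_eq_zero)
  have "?g = r \<odot>\<^sub>G rel R z u"
  proof -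
   have g: "gen z \<in>: G" "gen (z \<otimes> u) \<in>: G" "u \<in>: R" using z u by auto
   have "r \<odot>\<^sub>G rel R z u = ?g \<ominus>\<^sub>G (u \<otimes> r) \<odot>\<^sub>G gen (z \<otimes> u)"
    using z(1) u(1) g unfolding rel_eq[of z T u, OF z(1) T_mult[OF z(1) u(1)] g(3)] using z(2) by algebra
   then show ?thesis using u g gc by (simp add: F.minus_eq F.minus_zero')
  qed
  also have "\<dots> \<in> ?G" using Gr(4)[OF z(2)] G(2) z u by auto
  finally have g: "?g \<in> ?G" .
  have "p = (p \<ominus>\<^sub>G ?g) \<oplus>\<^sub>G ?g" using pc gc by algebra
  then show "p \<in> ?G" using Gr(3)[OF z(3) g] by simp
 qed
qed

end

lemma (in cring) localizedI: "submonoid T R ==> localized R T"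
 by (rule localized.intro[OF is_cring localized_axioms.intro])

section \<open>Projective modules\<close>

text \<open>The definition of projectivity quantifies over modules in one type only. The lifting property for all modules
 follows, since a projective module is a direct summand of the free module on its elements.\<close>

lemma projective_lift:
 assumes P: "projective_module R P" and M: "module R M" and N: "module R N"
  and g: "lin R M N g" "g ` carrier M = carrier N" and f: "lin R P N f"
 shows "\<exists>h. lin R P M h \<and> (\<forall>x\<in>carrier P. g (h x) = f x)"
proof -
 have Pm: "module R P" using P by (simp add: projective_module_def)
 interpret P: module R P by fact
 let ?F = "free_module R (carrier P)" and ?N = "restrict_scalars (\<lambda>r. r) P"
 interpret F: module R ?F by (rule P.free_is_module)
 have Nm: "module R ?N" by (rule restrict_scalars_module[OF P.is_cring _ Pm]) (auto intro: ring_hom_memI)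
 note p = P.carrier_presentation[OF Pm]
 have l: "lin R ?F ?N (lc R P (\<lambda>x. x))" using p(1) by (simp add: lin_def)
 have "restrict (lc R P (\<lambda>x. x)) (carrier ?F) \<in> mod_hom R ?F ?N" by (rule lin_mod_hom[OF F.module_axioms l])
 moreover have "restrict (lc R P (\<lambda>x. x)) (carrier ?F) ` carrier ?F = carrier ?N" using p(2) by simp
 moreover have "restrict (\<lambda>x. x) (carrier P) \<in> mod_hom R P ?N"
  by (rule lin_mod_hom[OF Pm]) (simp add: lin_def)
 ultimately obtain j where j: "j \<in> mod_hom R P ?F"
  "\<And>x. x \<in>: P ==> restrict (lc R P (\<lambda>x. x)) (carrier ?F) (j x) = restrict (\<lambda>x. x) (carrier P) x"
  using P F.module_axioms Nm unfolding projective_module_def by blast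
 have jl: "lin R P ?F j" by (rule mod_hom_lin[OF j(1)])
 have jx: "lc R P (\<lambda>x. x) (j x) = x" if "x \<in>: P" for x using j(2)[OF that] linD(1)[OF jl that] that by simp
 obtain h where h: "lin R ?F M h" "\<And>y. y \<in>: ?F ==> g (h y) = f (lc R P (\<lambda>x. x) y)"
  using P.free_projective[OF g lin_comp[OF p(1) f] M N] by blast
 show ?thesis using lin_comp[OF jl h(1)] h(2) jx linD(1)[OF jl] by (intro exI[of _ "\<lambda>x. h (j x)"]) auto
qed

text \<open>The free module on the pairs \<open>(s, t)\<close> maps onto the module of relations, and \<open>loc_section\<close> is a linear
 section of this map. Such a section is the form in which a bound on the projective dimension is used.\<close>

definition relations :: "('r, 'x) ring_scheme => 'r set => ('r \<times> 'r => 'r) => 'r => 'r"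
 where "relations R T = lc R (free_module R T) (\<lambda>(s, t). rel R s t)"

definition loc_section :: "('r, 'x) ring_scheme => 'r set => (('r => 'r) => 'r \<times> 'r => 'r) => bool"
 where "loc_section R T \<sigma> \<longleftrightarrow> lin R ((free_module R T) |: loc_ker R T) (free_module R (T \<times> T)) \<sigma> \<and>
  (\<forall>l\<in>loc_ker R T. relations R T (\<sigma> l) = l)"

context localized begin

lemma relations_lin: "lin R (FM (T \<times> T)) G (relations R T)"
 unfolding relations_def by (rule lc_lin[OF free_T]) (auto intro!: rel_closed)

lemma relations_gen: "s \<in> T ==> t \<in> T ==> relations R T (gen (s, t)) = rel R s t"
 unfolding relations_def using lc_gen[OF free_T, of "\<lambda>(s, t). rel R s t" "(s, t)"] by (simp add: rel_closed)

lemma relations_in_ker: "q \<in>: FM (T \<times> T) ==> relations R T q \<in> L"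
 using free_submodule_all[OF preimage_submodule[OF relations_lin free_is_module free_T loc_ker_submodule]]
 by (auto simp: relations_gen rel_in_ker)

lemma relations_lin': "lin R (FM (T \<times> T)) (G |: L) (relations R T)"
 by (rule lin_into[OF relations_lin relations_in_ker])

lemma ker_module: "module R (G |: L)"
 by (rule sub_module[OF loc_ker_submodule free_T])

lemma relations_surj: "relations R T ` carrier (FM (T \<times> T)) = L"
proof
 have "L \<subseteq> relations R T ` carrier (FM (T \<times> T))"
  unfolding loc_ker_generated
 proof (rule gen_submodule(3)[OF free_T rels_closed])
  show "submodule (relations R T ` carrier (FM (T \<times> T))) R G"
   by (rule image_submodule[OF relations_lin free_is_module free_T])
  have "rel R s t \<in> relations R T ` carrier (FM (T \<times> T))" if "s \<in> T" "t \<in> T" for s t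
   using relations_gen[OF that] that by (metis free_gen_closed imageI mem_Sigma_iff)
  then show "{rel R s t |s t. s \<in> T \<and> t \<in> T} \<subseteq> relations R T ` carrier (FM (T \<times> T))" by auto
 qed
 then show "L \<subseteq> relations R T ` carrier (FM (T \<times> T))" .
qed (auto simp: relations_in_ker)

lemma loc_ker_ext:
 assumes "lin R (G |: L) C f" "lin R (G |: L) C g"
  "module R C" "\<And>s t. s \<in> T ==> t \<in> T ==> f (rel R s t) = g (rel R s t)" "l \<in> L"
 shows "f l = g l"
proof -
 have "l \<in> relations R T ` carrier (FM (T \<times> T))" using assms(5) relations_surj by simp
 then obtain q where q: "q \<in>: FM (T \<times> T)" "l = relations R T q" by auto
 show ?thesis unfolding q(2)
  by (rule free_ext[OF lin_comp[OF relations_lin' assms(1)] lin_comp[OF relations_lin' assms(2)] assms(3) _ q(1)])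
   (auto simp: relations_gen assms(4))
qed

text \<open>Projective dimension at most one makes the module of relations projective (this is Schanuel's lemma), so that
 it is a direct summand of the free module on the pairs \<open>(s, t)\<close>.\<close>

lemma proj_dim_section:
 assumes "proj_dim_le_one R QM"
 shows "\<exists>\<sigma>. loc_section R T \<sigma>"
proof -
 let ?G = "G" and ?L = "L" and ?F = "FM (T \<times> T)"
 interpret G: module R ?G by (rule free_T)
 interpret Q: module R "QM" by (rule loc_module)
 interpret F: module R ?F by (rule free_is_module)
 obtain P0 P1 :: "('a, ('a \<times> 'a) set => 'a) module" and e d where
  P: "projective_module R P0" "projective_module R P1" "e \<in> mod_hom R P0 QM"
  "e ` carrier P0 = carrier QM" "d \<in> mod_hom R P1 P0" "inj_on d (carrier P1)"
  "d ` carrier P1 = mod_ker P0 QM e"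
  using assms unfolding proj_dim_le_one_def by (elim exE conjE) (rule that)
 have P0m: "module R P0" and P1m: "module R P1" using P by (auto simp: projective_module_def)
 interpret P0: module R P0 by fact
 interpret P1: module R P1 by fact
 have el: "lin R P0 QM e" and dl: "lin R P1 P0 d"
  by (rule mod_hom_lin[OF P(3)], rule mod_hom_lin[OF P(5)])
 obtain a where a: "lin R ?G P0 a" "\<And>x. x \<in>: ?G ==> e (a x) = \<pi> x"
  using free_projective[OF el P(4) loc_proj_lin P0m loc_module] by blast
 obtain b where b: "lin R P0 ?G b" "\<And>x. x \<in>: P0 ==> \<pi> (b x) = e x"
  using projective_lift[OF P(1) free_T loc_module loc_proj_lin loc_proj_surj el] by blast
 note ar = lin_all[OF a(1) free_T P0m] and br = lin_all[OF b(1) P0m free_T] and dr = lin_all[OF dl P1m P0m]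
  and er = lin_all[OF el P0m loc_module]
 define \<delta> where "\<delta> x = the_inv_into (carrier P1) d (a x)" for x
 have \<delta>: "\<delta> l \<in>: P1" "d (\<delta> l) = a l" if l: "l \<in> ?L" for l
 proof -
  have "a l \<in> d ` carrier P1" unfolding P(7)
   using l ar(1)[of l] by (auto simp: loc_ker_def mod_ker_def a(2))
  then show "\<delta> l \<in>: P1" "d (\<delta> l) = a l" unfolding \<delta>_def
   by (rule the_inv_into_into[OF P(6) _ subset_refl], rule f_the_inv_into_f[OF P(6)])
 qed
 note Lr = submoduleD[OF loc_ker_submodule free_T]
 have \<delta>l: "lin R (?G |: ?L) P1 \<delta>"
 proof (rule linI)
  fix x assume x: "x \<in>: (?G |: ?L)"
  then have x: "x \<in> ?L" "x \<in>: ?G" using Lr(1) by simp_all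
  show "\<delta> x \<in>: P1" using \<delta>(1)[OF x(1)] .
  show "\<delta> (r \<odot>\<^bsub>?G |: ?L\<^esub> x) = r \<odot>\<^sub>P1 \<delta> x" if r: "r \<in>: R" for r
  proof (rule inj_onD[OF P(6)])
   show "d (\<delta> (r \<odot>\<^bsub>?G |: ?L\<^esub> x)) = d (r \<odot>\<^sub>P1 \<delta> x)"
    using \<delta>(2)[OF Lr(4)[OF r x(1)]] r x \<delta>[OF x(1)] by (simp add: dr(3) ar(3))
  qed (use \<delta>(1)[OF Lr(4)[OF r x(1)]] \<delta>(1)[OF x(1)] r in simp_all)
  fix y assume y: "y \<in>: (?G |: ?L)"
  then have y: "y \<in> ?L" "y \<in>: ?G" using Lr(1) by simp_all
  show "\<delta> (x \<oplus>\<^bsub>?G |: ?L\<^esub> y) = \<delta> x \<oplus>\<^sub>P1 \<delta> y"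
  proof (rule inj_onD[OF P(6)])
   show "d (\<delta> (x \<oplus>\<^bsub>?G |: ?L\<^esub> y)) = d (\<delta> x \<oplus>\<^sub>P1 \<delta> y)"
    using \<delta>(2)[OF Lr(3)[OF x(1) y(1)]] x y \<delta>[OF x(1)] \<delta>[OF y(1)] by (simp add: dr(2) ar(2))
  qed (use \<delta>(1)[OF Lr(3)[OF x(1) y(1)]] \<delta>(1)[OF x(1)] \<delta>(1)[OF y(1)] in simp_all)
 qed
 have 1: "lin R ?G (?G |: ?L) (\<lambda>x. x \<ominus>\<^sub>?G b (a x))"
 proof (rule lin_into[OF lin_diff[OF lin_id lin_comp[OF a(1) b(1)] free_T]])
  fix x assume x: "x \<in>: ?G"
  show "x \<ominus>\<^sub>?G b (a x) \<in> ?L"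
   using x ar(1)[OF x] br(1)[OF ar(1)[OF x]] loc_proj_simps(1)[OF x]
   by (auto simp: loc_ker_def mod_ker_def loc_proj_simps(6) b(2) a(2))
 qed
 obtain \<sigma>1 where s1: "lin R ?G ?F \<sigma>1" "\<And>x. x \<in>: ?G ==> relations R T (\<sigma>1 x) = x \<ominus>\<^sub>?G b (a x)"
  using free_projective[OF relations_lin' _ 1 free_is_module ker_module] relations_surj by auto
 have 2: "lin R P1 (?G |: ?L) (\<lambda>x. b (d x))"
 proof (rule lin_into[OF lin_comp[OF dl b(1)]])
  fix x assume x: "x \<in>: P1"
  then have "d x \<in> mod_ker P0 QM e" using P(7) by auto
  then show "b (d x) \<in> ?L" by (auto simp: loc_ker_def mod_ker_def b(2) br)
 qed
 obtain \<sigma>2 where s2: "lin R P1 ?F \<sigma>2" "\<And>x. x \<in>: P1 ==> relations R T (\<sigma>2 x) = b (d x)"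
  using projective_lift[OF P(2) free_is_module ker_module relations_lin' _ 2] relations_surj by auto
 let ?\<sigma> = "\<lambda>l. \<sigma>1 l \<oplus>\<^sub>?F \<sigma>2 (\<delta> l)"
 have "lin R (?G |: ?L) ?F ?\<sigma>"
  by (rule lin_plus[OF lin_restrict[OF s1(1)] lin_comp[OF \<delta>l s2(1)] free_is_module]) (rule subsetI, rule Lr(1))
 moreover have "relations R T (?\<sigma> l) = l" if l: "l \<in> ?L" for l
 proof -
  have "relations R T (?\<sigma> l) = (l \<ominus>\<^sub>?G b (a l)) \<oplus>\<^sub>?G b (a l)"
   using l Lr(1)[OF l] linD(1)[OF s1(1)] linD(1)[OF s2(1)]
   by (simp add: lin_all(2)[OF relations_lin free_is_module free_T] s1 s2 \<delta>)
  also have "\<dots> = l" using Lr(1)[OF l] br(1)[OF ar(1)[OF Lr(1)[OF l]]] by algebra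
  finally show ?thesis .
 qed
 ultimately show ?thesis unfolding loc_section_def by blast
qed

section \<open>Modules which are cotorsion for a localization\<close>

lemma loc_cotorsionI:
 assumes C: "module R C" and "\<And>f. lin R (G |: L) C f ==>
  \<exists>c. (\<forall>s\<in>T. c s \<in>: C) \<and> (\<forall>s\<in>T. \<forall>t\<in>T. f (rel R s t) = c s \<ominus>\<^sub>C t \<odot>\<^sub>C c (s \<otimes> t))"
 shows "loc_cotorsion R T C"
 unfolding loc_cotorsion_def extends_def
proof (intro allI impI)
 interpret G: module R "G" by (rule free_T)
 fix f assume f: "lin R (G |: L) C f"
 obtain c where c: "\<And>s. s \<in> T ==> c s \<in>: C"
  "\<And>s t. s \<in> T ==> t \<in> T ==> f (rel R s t) = c s \<ominus>\<^sub>C t \<odot>\<^sub>C c (s \<otimes> t)" using assms(2)[OF f] by blast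
 have g: "lin R G C (lc R C c)" by (rule lc_lin[OF C c(1)])
 note gr = lin_all[OF g free_T C]
 have "lc R C c l = f l" if "l \<in> L" for l
 proof (rule loc_ker_ext[OF lin_restrict[OF g] f C _ that])
  show "lc R C c (rel R s t) = f (rel R s t)" if "s \<in> T" "t \<in> T" for s t
   using that by (subst c(2)) (simp_all add: rel_eq[of s T t] gr lc_gen[OF C] c(1))
 qed (use submoduleD(1)[OF loc_ker_submodule free_T] in blast)
 then show "\<exists>g. lin R G C g \<and> (\<forall>x\<in>L. g x = f x)" using g by blast
qed

lemma loc_cotorsionD:
 assumes C: "module R C" and "loc_cotorsion R T C" and "lin R (G |: L) C f"
 obtains c where "\<And>s. s \<in> T ==> c s \<in>: C"
  "\<And>s t. s \<in> T ==> t \<in> T ==> f (rel R s t) = c s \<ominus>\<^sub>C t \<odot>\<^sub>C c (s \<otimes> t)"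
proof -
 interpret G: module R "G" by (rule free_T)
 obtain g where g: "lin R G C g" "\<And>x. x \<in> L ==> g x = f x"
  using assms(2,3) unfolding loc_cotorsion_def extends_def by blast
 note gr = lin_all[OF g(1) free_T C]
 have "f (rel R s t) = g (gen s) \<ominus>\<^sub>C t \<odot>\<^sub>C g (gen (s \<otimes> t))" if "s \<in> T" "t \<in> T" for s t
  unfolding g(2)[OF rel_in_ker[OF that], symmetric] using that by (simp add: rel_eq[of s T t] gr)
 then show thesis by (intro that[of "\<lambda>s. g (gen s)"]) (auto simp: gr)
qed

text \<open>Different ways to pass from the denominator \<open>s\<close> to \<open>s t u\<close> give identities between relations.\<close>

lemma rel_mult:
 assumes "s \<in> T" "t \<in> T" "u \<in> T"
 shows "rel R s (t \<otimes> u) = rel R s t \<oplus>\<^sub>G t \<odot>\<^sub>G rel R (s \<otimes> t) u"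
proof -
 interpret G: module R "G" by (rule free_T)
 have alg: "a \<ominus>\<^sub>G (t \<otimes> u) \<odot>\<^sub>G c = (a \<ominus>\<^sub>G t \<odot>\<^sub>G b)
   \<oplus>\<^sub>G t \<odot>\<^sub>G (b \<ominus>\<^sub>G u \<odot>\<^sub>G c)"
  if "a \<in>: G" "b \<in>: G" "c \<in>: G" "t \<in>: R" "u \<in>: R"
  for a b c t u using that by algebra
 show ?thesis using assms by (simp add: rel_eq[of _ T] m_assoc[symmetric] alg)
qed

lemma rel_swap:
 assumes "s \<in> T" "t \<in> T" "u \<in> T"
 shows "rel R s t \<oplus>\<^sub>G t \<odot>\<^sub>G rel R (s \<otimes> t) u =
  rel R s u \<oplus>\<^sub>G u \<odot>\<^sub>G rel R (s \<otimes> u) t"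
 using rel_mult[OF assms] rel_mult[OF assms(1,3,2)] assms by (simp add: m_comm)

text \<open>A linear map on the relations is determined by its values \<open>g s t\<close> on \<open>e\<^sub>s - t e\<^sub>s\<^sub>t\<close>. The only condition on
 these values comes from the identity \<open>e\<^sub>s - t u e\<^sub>s\<^sub>t\<^sub>u = (e\<^sub>s - t e\<^sub>s\<^sub>t) + t (e\<^sub>s\<^sub>t - u e\<^sub>s\<^sub>t\<^sub>u)\<close>: on finitely
 many denominators, such a family is a coboundary, since they have a common multiple.\<close>

definition cocycle :: "('a, 'c, 'y) module_scheme => ('a => 'a => 'c) => bool"
 where "cocycle C g \<longleftrightarrow> (\<forall>s\<in>T. \<forall>t\<in>T. g s t \<in>: C) \<and>
  (\<forall>s\<in>T. \<forall>t\<in>T. \<forall>u\<in>T. g s (t \<otimes> u) = g s t \<oplus>\<^sub>C t \<odot>\<^sub>C g (s \<otimes> t) u)"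

lemma cocycleD:
 assumes "cocycle C g" "s \<in> T" "t \<in> T"
 shows "g s t \<in>: C" "u \<in> T ==> g s (t \<otimes> u) = g s t \<oplus>\<^sub>C t \<odot>\<^sub>C g (s \<otimes> t) u"
 using assms by (auto simp: cocycle_def)

lemma cocycle_coboundary_on_finite:
 assumes C: "module R C" and g: "cocycle C g" and X: "finite X" "X \<subseteq> T"
 shows "\<exists>h. (\<forall>s\<in>X. h s \<in>: C) \<and> (\<forall>s\<in>X. \<forall>t\<in>T. s \<otimes> t \<in> X --> g s t = h s \<ominus>\<^sub>C t \<odot>\<^sub>C h (s \<otimes> t))"
proof -
 interpret C: module R C by fact
 obtain z w where z: "z \<in> T" "\<And>x. x \<in> X ==> w x \<in> T" "\<And>x. x \<in> X ==> x \<otimes> w x = z" using common_multiple[OF T X] by blast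
 have "g s t = g s (w s \<otimes> z) \<ominus>\<^sub>C t \<odot>\<^sub>C g (s \<otimes> t) (w (s \<otimes> t) \<otimes> z)" if st: "s \<in> X" "t \<in> T" "s \<otimes> t \<in> X" for s t
 proof -
  have sT: "s \<in> T" "w s \<in> T" "w (s \<otimes> t) \<in> T" "s \<otimes> t \<in> T" using st X z by auto
  have c: "s \<in>: R" "t \<in>: R" "w s \<in>: R" "w (s \<otimes> t) \<in>: R" using sT st by auto
  have "t \<otimes> (w (s \<otimes> t) \<otimes> z) = t \<otimes> w (s \<otimes> t) \<otimes> (s \<otimes> w s)" using z st c by (simp add: m_assoc)
  also have "\<dots> = s \<otimes> t \<otimes> w (s \<otimes> t) \<otimes> w s" using c by algebra
  finally have "g s (w s \<otimes> z) = g s t \<oplus>\<^sub>C t \<odot>\<^sub>C g (s \<otimes> t) (w (s \<otimes> t) \<otimes> z)"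
   using cocycleD(2)[OF g sT(1) st(2), of "w (s \<otimes> t) \<otimes> z"] z(1,3) st c sT by (simp add: m_comm)
  moreover have "a = (a \<oplus>\<^sub>C t \<odot>\<^sub>C b) \<ominus>\<^sub>C t \<odot>\<^sub>C b" if "a \<in>: C" "b \<in>: C" for a b using that c by algebra
  ultimately show ?thesis using cocycleD(1)[OF g] sT st z by simp
 qed
 moreover have "g s (w s \<otimes> z) \<in>: C" if "s \<in> X" for s using that X(2) z cocycleD(1)[OF g, of s "w s \<otimes> z"] by auto
 ultimately show ?thesis by (intro exI[of _ "\<lambda>s. g s (w s \<otimes> z)"]) simp
qed

text \<open>On the free module on the pairs \<open>(s, t)\<close>, the cocycle defines a linear map. If a combination of pairs
 represents the zero relation, it involves finitely many denominators, on which the cocycle is a coboundary; so the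
 map takes it to zero and descends to the relations.\<close>

lemma cocycle_linear:
 assumes C: "module R C" and g: "cocycle C g"
 shows "\<exists>f. lin R (G |: L) C f \<and> (\<forall>s\<in>T. \<forall>t\<in>T. f (rel R s t) = g s t)"
proof -
 interpret C: module R C by fact
 interpret G: module R G by (rule free_T)
 let ?g = "\<lambda>i. g (fst i) (snd i)" and ?F = "FM (T \<times> T)"
 have gc: "?g i \<in>: C" if "i \<in> T \<times> T" for i using that cocycleD(1)[OF g] by auto
 have "lc R C ?g q = \<zero>\<^sub>C" if q: "q \<in>: ?F" "relations R T q = \<zero>\<^sub>G" for q
 proof -
  define X where "X = (\<Union>i\<in>{i. q i \<noteq> \<zero>}. {fst i, fst i \<otimes> snd i})"
  have "i \<in> T \<times> T" if "q i \<noteq> \<zero>" for i using that q(1) by (cases i) (auto simp: free_module_def)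
  then have "X \<subseteq> T" unfolding X_def by fastforce
  moreover have "finite X" using q(1) by (auto simp: X_def free_module_def)
  ultimately have "finite X" "X \<subseteq> T" by blast+
  from cocycle_coboundary_on_finite[OF C g this] obtain h where h: "\<And>s. s \<in> X ==> h s \<in>: C"
   "\<And>s t. s \<in> X ==> t \<in> T ==> s \<otimes> t \<in> X ==> g s t = h s \<ominus>\<^sub>C t \<odot>\<^sub>C h (s \<otimes> t)"
 by blast
  define k where "k s = (if s \<in> X then h s else \<zero>\<^sub>C)" for s
  have kl: "lin R G C (lc R C k)" by (rule lc_lin[OF C]) (auto simp: k_def h(1))
  note kr = lin_all[OF kl free_T C]
  have kc: "k s \<in>: C" for s by (simp add: k_def h(1))
  have kg: "lc R C k (rel R s t) = k s \<ominus>\<^sub>C t \<odot>\<^sub>C k (s \<otimes> t)" if "s \<in> T" "t \<in> T" for s t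
   using that by (simp add: rel_eq[of s T t] kr lc_gen[OF C] kc)
  let ?k = "\<lambda>i. lc R C k (rel R (fst i) (snd i))"
  have kic: "?k i \<in>: C" if "i \<in> T \<times> T" for i using that kr(1) by (auto simp: rel_closed)
  have "?g i = ?k i" if i: "i \<in> T \<times> T" "q i \<noteq> \<zero>" for i
  proof -
   have "fst i \<in> X" "fst i \<otimes> snd i \<in> X" using i(2) unfolding X_def by blast+
   then show ?thesis using kg[of "fst i" "snd i"] h(2)[of "fst i" "snd i"] i by (auto simp: k_def)
  qed
  then have "lc R C ?g q = lc R C ?k q" by (intro lc_cong[OF C q(1) kic])
  also have "\<dots> = lc R C k (relations R T q)"
   using free_ext[OF lc_lin[OF C kic] lin_comp[OF relations_lin kl] C _ q(1)]
   by (auto simp: lc_gen[OF C] kic relations_gen)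
  finally show ?thesis using q(2) kr(4) by simp
 qed
 then obtain f where "lin R (G |: L) C f" "\<forall>q\<in>carrier ?F. f (relations R T q) = lc R C ?g q"
  using factor_through_surjection[OF relations_lin' _ lc_lin[OF C, of "T \<times> T" ?g, OF gc] _ free_is_module ker_module C]
   relations_surj by auto
 moreover have "lc R C ?g (gen (s, t)) = g s t" if "s \<in> T" "t \<in> T" for s t
  using lc_gen[OF C, of ?g "(s, t)"] gc[of "(s, t)"] that by simp
 ultimately have "f (rel R s t) = g s t" if "s \<in> T" "t \<in> T" for s t using that by (simp flip: relations_gen)
 then show ?thesis using \<open>lin R (G |: L) C f\<close> by blast
qed

lemma loc_cotorsion_iff:
 assumes C: "module R C"
 shows "loc_cotorsion R T C \<longleftrightarrow> (\<forall>g. cocycle C g -->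
  (\<exists>c. (\<forall>s\<in>T. c s \<in>: C) \<and> (\<forall>s\<in>T. \<forall>t\<in>T. g s t = c s \<ominus>\<^sub>C t \<odot>\<^sub>C c (s \<otimes> t))))" (is "_ \<longleftrightarrow> ?r")
proof
 assume ct: "loc_cotorsion R T C"
 show ?r
 proof (intro allI impI)
  fix g assume "cocycle C g"
  from cocycle_linear[OF C this] obtain f where f: "lin R (G |: L) C f" "\<forall>s\<in>T. \<forall>t\<in>T. f (rel R s t) = g s t" by blast
  show "\<exists>c. (\<forall>s\<in>T. c s \<in>: C) \<and> (\<forall>s\<in>T. \<forall>t\<in>T. g s t = c s \<ominus>\<^sub>C t \<odot>\<^sub>C c (s \<otimes> t))"
   by (rule loc_cotorsionD[OF C ct f(1)]) (use f(2) in auto)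
 qed
next
 assume r: ?r
 show "loc_cotorsion R T C"
 proof (rule loc_cotorsionI[OF C])
  fix f assume f: "lin R (G |: L) C f"
  note fr = lin_sub[OF f free_T C loc_ker_submodule]
  have "cocycle C (\<lambda>s t. f (rel R s t))"
   using rel_in_ker submoduleD(4)[OF loc_ker_submodule free_T] by (auto simp: cocycle_def fr rel_mult)
  then show "\<exists>c. (\<forall>s\<in>T. c s \<in>: C) \<and> (\<forall>s\<in>T. \<forall>t\<in>T. f (rel R s t) = c s \<ominus>\<^sub>C t \<odot>\<^sub>C c (s \<otimes> t))" using r by blast
 qed
qed

text \<open>Since the module of relations is projective, quotients inherit cotorsion.\<close>

lemma loc_cotorsion_quotient:
 assumes \<sigma>: "loc_section R T \<sigma>" and C: "loc_cotorsion R T C" and mods: "module R C" "module R C'"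
  and q: "lin R C C' q" "q ` carrier C = carrier C'"
 shows "loc_cotorsion R T C'"
 unfolding loc_cotorsion_def extends_def
proof (intro allI impI)
 fix f assume f: "lin R (G |: L) C' f"
 have s: "lin R (G |: L) (FM (T \<times> T)) \<sigma>"
  "\<And>l. l \<in> L ==> relations R T (\<sigma> l) = l" using \<sigma> by (auto simp: loc_section_def)
 obtain h where h: "lin R (FM (T \<times> T)) C h" "\<And>y. y \<in>: FM (T \<times> T) ==> q (h y) = f (relations R T y)"
  using free_projective[OF q lin_comp[OF relations_lin' f] mods] by blast
 obtain g where g: "lin R G C g" "\<And>l. l \<in> L ==> g l = h (\<sigma> l)"
  using C lin_comp[OF s(1) h(1)] unfolding loc_cotorsion_def extends_def by blast
 have "q (g l) = f l" if "l \<in> L" for l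
  using that linD(1)[OF s(1)] by (simp add: g(2) h(2) s(2))
 then show "\<exists>g. lin R G C' g \<and> (\<forall>l\<in>L. g l = f l)"
  using lin_comp[OF g(1) q(1)] by blast
qed

end

definition acts_bij :: "('r, 'm, 'y) module_scheme => 'r set => bool"
 where "acts_bij C T \<longleftrightarrow> (\<forall>t\<in>T. bij_betw (\<lambda>x. t \<odot>\<^sub>C x) (carrier C) (carrier C))"

lemma acts_bijD:
 assumes "acts_bij C T" "t \<in> T"
 shows "x \<in>: C ==> \<exists>y\<in>carrier C. t \<odot>\<^sub>C y = x"
  "x \<in>: C ==> y \<in>: C ==> t \<odot>\<^sub>C x = t \<odot>\<^sub>C y ==> x = y"
proof -
 have b: "inj_on (\<lambda>x. t \<odot>\<^sub>C x) (carrier C)" "(\<lambda>x. t \<odot>\<^sub>C x) ` carrier C = carrier C"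
  using assms by (auto simp: acts_bij_def bij_betw_def)
 show "\<exists>y\<in>carrier C. t \<odot>\<^sub>C y = x" if "x \<in>: C"
 proof -
  have "x \<in> (\<lambda>x. t \<odot>\<^sub>C x) ` carrier C" using b(2) that by simp
  then show ?thesis by blast
 qed
 show "x \<in>: C ==> y \<in>: C ==> t \<odot>\<^sub>C x = t \<odot>\<^sub>C y ==> x = y"
  using b(1) by (rule inj_onD)
qed

lemma acts_bijI:
 assumes "module R C" "T \<subseteq> carrier R" "\<And>t x. t \<in> T ==> x \<in>: C ==> \<exists>y\<in>carrier C. t \<odot>\<^sub>C y = x"
  "\<And>t x. t \<in> T ==> x \<in>: C ==> t \<odot>\<^sub>C x = \<zero>\<^sub>C ==> x = \<zero>\<^sub>C"
 shows "acts_bij C T"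
 unfolding acts_bij_def
proof
 interpret C: module R C by fact
 fix t assume t: "t \<in> T"
 have tR: "t \<in>: R" using t assms(2) by auto
 have "x = y" if "x \<in>: C" "y \<in>: C" "t \<odot>\<^sub>C x = t \<odot>\<^sub>C y" for x y
 proof -
  have "t \<odot>\<^sub>C (x \<ominus>\<^sub>C y) = t \<odot>\<^sub>C x \<ominus>\<^sub>C t \<odot>\<^sub>C y" using that(1,2) tR by algebra
  then have "x \<ominus>\<^sub>C y = \<zero>\<^sub>C" using assms(4)[OF t] that tR by simp
  then show ?thesis using that by (simp add: C.minus_eq_zero_iff)
 qed
 then show "bij_betw (\<lambda>x. t \<odot>\<^sub>C x) (carrier C) (carrier C)"
  using assms(3)[OF t] tR by (force simp: bij_betw_def inj_on_def image_iff)
qed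

context localized begin

text \<open>Modules over \<open>T\<^sup>-\<^sup>1R\<close> are cotorsion: normalise the family by \<open>c 1 = 0\<close>.\<close>

lemma loc_cotorsion_bij:
 assumes C: "module R C" and b: "acts_bij C T"
 shows "loc_cotorsion R T C"
 unfolding loc_cotorsion_iff[OF C]
proof (intro allI impI)
 interpret C: module R C by fact
 fix g assume g: "cocycle C g"
 note gc = cocycleD(1)[OF g]
 have "\<forall>s\<in>T. \<exists>c\<in>carrier C. s \<odot>\<^sub>C c = \<ominus>\<^sub>C g \<one> s" using acts_bijD(1)[OF b] gc by auto
 then obtain c where c: "\<And>s. s \<in> T ==> c s \<in>: C" "\<And>s. s \<in> T ==> s \<odot>\<^sub>C c s = \<ominus>\<^sub>C g \<one> s" by metis
 have "g s t = c s \<ominus>\<^sub>C t \<odot>\<^sub>C c (s \<otimes> t)" if st: "s \<in> T" "t \<in> T" for s t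
 proof (rule acts_bijD(2)[OF b st(1)])
  have cc: "c s \<in>: C" "c (s \<otimes> t) \<in>: C" "s \<in>: R" "t \<in>: R" using c st by auto
  have "s \<odot>\<^sub>C (c s \<ominus>\<^sub>C t \<odot>\<^sub>C c (s \<otimes> t)) = s \<odot>\<^sub>C c s \<ominus>\<^sub>C (s \<otimes> t) \<odot>\<^sub>C c (s \<otimes> t)" using cc by algebra
  also have "\<dots> = \<ominus>\<^sub>C g \<one> s \<ominus>\<^sub>C \<ominus>\<^sub>C (g \<one> s \<oplus>\<^sub>C s \<odot>\<^sub>C g s t)" using c st cocycleD(2)[OF g T_one st] by simp
  also have "\<dots> = s \<odot>\<^sub>C g s t"
  proof -
   have "\<ominus>\<^sub>C a \<ominus>\<^sub>C \<ominus>\<^sub>C (a \<oplus>\<^sub>C s \<odot>\<^sub>C b) = s \<odot>\<^sub>C b" if "a \<in>: C" "b \<in>: C" for a b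
    using that cc(3) by algebra
   then show ?thesis using gc st by simp
  qed
  finally show "s \<odot>\<^sub>C g s t = s \<odot>\<^sub>C (c s \<ominus>\<^sub>C t \<odot>\<^sub>C c (s \<otimes> t))" by simp
 qed (use gc c st in auto)
 then show "\<exists>c. (\<forall>s\<in>T. c s \<in>: C) \<and> (\<forall>s\<in>T. \<forall>t\<in>T. g s t = c s \<ominus>\<^sub>C t \<odot>\<^sub>C c (s \<otimes> t))"
  using c by blast
qed

text \<open>A cocycle \<open>g\<close> is trivialized by \<open>c s = g s z\<close>, as \<open>g s (t z) = g s t + t g (st) z\<close> and \<open>g s (z t) = g s z + z
 g (sz) t = g s z\<close>.\<close>

lemma loc_cotorsion_killed:
 assumes C: "module R C" and z: "z \<in> T" "\<And>x. x \<in>: C ==> z \<odot>\<^sub>C x = \<zero>\<^sub>C"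
 shows "loc_cotorsion R T C"
 unfolding loc_cotorsion_iff[OF C]
proof (intro allI impI)
 interpret C: module R C by fact
 fix g assume g: "cocycle C g"
 note gc = cocycleD(1)[OF g]
 have "g s t = g s z \<ominus>\<^sub>C t \<odot>\<^sub>C g (s \<otimes> t) z" if st: "s \<in> T" "t \<in> T" for s t
 proof -
  have "g s z = g s t \<oplus>\<^sub>C t \<odot>\<^sub>C g (s \<otimes> t) z"
   using cocycleD(2)[OF g st z(1)] cocycleD(2)[OF g st(1) z(1) st(2)] z gc st by (simp add: m_comm)
  moreover have "a = (a \<oplus>\<^sub>C t \<odot>\<^sub>C b) \<ominus>\<^sub>C t \<odot>\<^sub>C b" if "a \<in>: C" "b \<in>: C" for a b
   using that T_closed[OF st(2)] by algebra
  ultimately show ?thesis using gc st z by simp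
 qed
 then show "\<exists>c. (\<forall>s\<in>T. c s \<in>: C) \<and> (\<forall>s\<in>T. \<forall>t\<in>T. g s t = c s \<ominus>\<^sub>C t \<odot>\<^sub>C c (s \<otimes> t))"
  using gc[OF _ z(1)] by - (rule exI[of _ "\<lambda>s. g s z"], blast)
qed

text \<open>If \<open>U\<close> acts bijectively on \<open>C\<close>, then cotorsion for the product \<open>M = TU\<close> implies cotorsion for \<open>T\<close>. Choose a
 factorization \<open>x = s\<^sub>x u\<^sub>x\<close> of every \<open>x\<close> in \<open>M\<close>, with \<open>s\<^sub>x = x\<close> for \<open>x\<close> in \<open>T\<close>. Since \<open>1/x\<close> should have the image
 \<open>c\<^sub>s / u\<^sub>x\<close> for \<open>s = s\<^sub>x\<close>, a map \<open>f\<close> on the relations of \<open>T\<close> extends to those of \<open>M\<close> by its value on \<open>u\<^sub>x\<^sub>y e\<^sub>s -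
 y u\<^sub>x e\<^sub>r\<close>, where \<open>r = s\<^sub>x\<^sub>y\<close>, divided by \<open>u\<^sub>x u\<^sub>x\<^sub>y\<close>.\<close>

lemma loc_cotorsion_factor:
 assumes M: "submonoid M R" "T \<subseteq> M" and U: "submonoid U R" and fac: "\<And>x. x \<in> M ==> \<exists>s\<in>T. \<exists>u\<in>U. x = s \<otimes> u"
  and C: "module R C" and b: "acts_bij C U" and ct: "loc_cotorsion R M C"
 shows "loc_cotorsion R T C"
proof (rule loc_cotorsionI[OF C])
 interpret M: localized R M by (rule localizedI[OF M(1)])
 interpret U: localized R U by (rule localizedI[OF U])
 interpret C: module R C by fact
 interpret G: module R G by (rule free_T)
 interpret QM: module R QM by (rule loc_module)
 note Lr = submoduleD[OF loc_ker_submodule free_T]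
 fix f assume f: "lin R (G |: L) C f"
 note fr = lin_sub[OF f free_T C loc_ker_submodule]
 have "\<exists>s u. s \<in> T \<and> u \<in> U \<and> x = s \<otimes> u \<and> (x \<in> T --> s = x \<and> u = \<one>)" if "x \<in> M" for x
 proof (cases "x \<in> T")
  case True
  then show ?thesis by (intro exI[of _ x] exI[of _ \<one>]) auto
 qed (use fac[OF that] in blast)
 then have "\<forall>x\<in>M. \<exists>S u. S \<in> T \<and> u \<in> U \<and> x = S \<otimes> u \<and> (x \<in> T --> S = x \<and> u = \<one>)" by blast
 then obtain S u where "\<forall>x\<in>M. S x \<in> T \<and> u x \<in> U \<and> x = S x \<otimes> u x \<and> (x \<in> T --> S x = x \<and> u x = \<one>)" by metis
 then have su: "\<And>x. x \<in> M ==> S x \<in> T" "\<And>x. x \<in> M ==> u x \<in> U" "\<And>x. x \<in> M ==> S x \<otimes> u x = x"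
  "\<And>x. x \<in> T ==> S x = x \<and> u x = \<one>" using M(2) by auto
 define k where "k x y = u (x \<otimes> y) \<odot>\<^sub>G gen (S x) \<ominus>\<^sub>G (y \<otimes> u x) \<odot>\<^sub>G gen (S (x \<otimes> y))" for x y
 have kL: "k x y \<in> L" if xy: "x \<in> M" "y \<in> M" for x y
 proof -
  have xyM: "x \<otimes> y \<in> M" using xy by simp
  have c: "S x \<in> T" "S (x \<otimes> y) \<in> T" "S x \<in>: R" "S (x \<otimes> y) \<in>: R" "u x \<in>: R" "u (x \<otimes> y) \<in>: R" "y \<in>: R"
   using su(1,2)[OF xy(1)] su(1,2)[OF xyM] xy by auto
  have "S x \<otimes> (y \<otimes> u x) = S (x \<otimes> y) \<otimes> u (x \<otimes> y)" using su(3)[OF xy(1)] su(3)[OF xyM] c by (metis m_assoc m_comm)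
  then have "fr (u (x \<otimes> y)) (S x) = fr (y \<otimes> u x) (S (x \<otimes> y))" using c by (intro frac_eqI) auto
  then show ?thesis using c
   by (simp add: k_def ker_diff_iff loc_proj_gen_smult)
 qed
 have "\<forall>x\<in>M. \<forall>y\<in>M. \<exists>h\<in>carrier C. (u x \<otimes> u (x \<otimes> y)) \<odot>\<^sub>C h = f (k x y)"
  using su(2) fr(1) kL by (intro ballI acts_bijD(1)[OF b]) auto
 then obtain g where gc: "\<And>x y. x \<in> M ==> y \<in> M ==> g x y \<in>: C"
  and g: "\<And>x y. x \<in> M ==> y \<in> M ==> (u x \<otimes> u (x \<otimes> y)) \<odot>\<^sub>C g x y = f (k x y)" by metis
 have "M.cocycle C g"
  unfolding M.cocycle_def
 proof (intro conjI ballI)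
  fix x y z assume xyz: "x \<in> M" "y \<in> M" "z \<in> M"
  define a b d where "a = u x" and "b = u (x \<otimes> y)" and "d = u (x \<otimes> y \<otimes> z)"
  have xy: "x \<otimes> y \<in> M" "x \<otimes> y \<otimes> z \<in> M" "y \<otimes> z \<in> M" using xyz by auto
  have U: "a \<in> U" "b \<in> U" "d \<in> U" using su(2) xyz xy by (auto simp: a_def b_def d_def)
  then have R: "a \<in>: R" "b \<in>: R" "d \<in>: R" "y \<in>: R" "z \<in>: R" using xyz by auto
  have xe: "x \<otimes> (y \<otimes> z) = x \<otimes> y \<otimes> z" using xyz by (simp add: m_assoc)
  note gg = g[OF xyz(1,2), folded a_def b_def] g[OF xy(1) xyz(3), folded b_def d_def]
   g[OF xyz(1) xy(3), unfolded xe, folded a_def d_def]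
  note gC = gc[OF xyz(1,2)] gc[OF xy(1) xyz(3)] gc[OF xyz(1) xy(3)]
  note kk = kL[OF xyz(1,2)] kL[OF xy(1) xyz(3)] kL[OF xyz(1) xy(3)]
  show "g x (y \<otimes> z) = g x y \<oplus>\<^sub>C y \<odot>\<^sub>C g (x \<otimes> y) z"
  proof (rule acts_bijD(2)[OF b])
   show "a \<otimes> b \<otimes> d \<in> U" using U by simp
   have "b \<odot>\<^sub>G (d \<odot>\<^sub>G p \<ominus>\<^sub>G (y \<otimes> z \<otimes> a) \<odot>\<^sub>G r) = d \<odot>\<^sub>G (b \<odot>\<^sub>G p \<ominus>\<^sub>G (y \<otimes> a) \<odot>\<^sub>G q) \<oplus>\<^sub>G (y \<otimes> a) \<odot>\<^sub>G (d \<odot>\<^sub>G q \<ominus>\<^sub>G (z \<otimes> b) \<odot>\<^sub>G r)"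
    if "p \<in>: G" "q \<in>: G" "r \<in>: G" for p q r using that R by algebra
   then have "b \<odot>\<^sub>G k x (y \<otimes> z) = d \<odot>\<^sub>G k x y \<oplus>\<^sub>G (y \<otimes> a) \<odot>\<^sub>G k (x \<otimes> y) z"
    using su(1) xyz xy by (simp add: k_def xe a_def b_def d_def)
   then have e: "b \<odot>\<^sub>C f (k x (y \<otimes> z)) = d \<odot>\<^sub>C f (k x y) \<oplus>\<^sub>C (y \<otimes> a) \<odot>\<^sub>C f (k (x \<otimes> y) z)"
    using fr(2,3) Lr(4) kk R by (metis m_closed)
   have "(a \<otimes> b \<otimes> d) \<odot>\<^sub>C g x (y \<otimes> z) = b \<odot>\<^sub>C ((a \<otimes> d) \<odot>\<^sub>C g x (y \<otimes> z))" using R gC by algebra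
   also have "\<dots> = d \<odot>\<^sub>C ((a \<otimes> b) \<odot>\<^sub>C g x y) \<oplus>\<^sub>C (y \<otimes> a) \<odot>\<^sub>C ((b \<otimes> d) \<odot>\<^sub>C g (x \<otimes> y) z)"
    unfolding gg e ..
   also have "\<dots> = (a \<otimes> b \<otimes> d) \<odot>\<^sub>C (g x y \<oplus>\<^sub>C y \<odot>\<^sub>C g (x \<otimes> y) z)" using R gC by algebra
   finally show "(a \<otimes> b \<otimes> d) \<odot>\<^sub>C g x (y \<otimes> z) = (a \<otimes> b \<otimes> d) \<odot>\<^sub>C (g x y \<oplus>\<^sub>C y \<odot>\<^sub>C g (x \<otimes> y) z)" .
  qed (use gC R in auto)
 qed (rule gc)
 then obtain c where c: "\<And>x. x \<in> M ==> c x \<in>: C" "\<And>x y. x \<in> M ==> y \<in> M ==> g x y = c x \<ominus>\<^sub>C y \<odot>\<^sub>C c (x \<otimes> y)"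
  using ct M.loc_cotorsion_iff[OF C] by blast
 have TM: "t \<in> M" if "t \<in> T" for t using that M(2) by auto
 have "f (rel R s t) = g s t" if st: "s \<in> T" "t \<in> T" for s t
 proof -
  have "k s t = rel R s t" using st su(4)[of s] su(4)[of "s \<otimes> t"] by (simp add: k_def rel_eq[of s T t])
  then show ?thesis using g[of s t] st su(4)[of s] su(4)[of "s \<otimes> t"] gc[of s t] by (simp add: TM)
 qed
 then show "\<exists>c. (\<forall>s\<in>T. c s \<in>: C) \<and> (\<forall>s\<in>T. \<forall>t\<in>T. f (rel R s t) = c s \<ominus>\<^sub>C t \<odot>\<^sub>C c (s \<otimes> t))"
  using c TM by (intro exI[of _ c]) auto
qed

end

text \<open>The module \<open>Hom(T\<^sup>-\<^sup>1R, C)\<close>: a homomorphism is determined by the images \<open>c t\<close> of the fractions \<open>1/t\<close>.\<close>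

definition loc_hom :: "('r, 'x) ring_scheme => 'r set => ('r, 'c, 'y) module_scheme => ('r, 'r => 'c) module"
 where "loc_hom R T C =
  \<lparr>carrier = {c \<in> T \<rightarrow>\<^sub>E carrier C. \<forall>s\<in>T. \<forall>t\<in>T. c s = t \<odot>\<^sub>C c (s \<otimes>\<^sub>R t)}, mult = undefined, one = undefined,
   zero = (\<lambda>t\<in>T. \<zero>\<^sub>C), add = (\<lambda>c d. \<lambda>t\<in>T. c t \<oplus>\<^sub>C d t), smult = (\<lambda>r c. \<lambda>t\<in>T. r \<odot>\<^sub>C c t)\<rparr>"

text \<open>For a submodule \<open>K\<close> of \<open>M\<close>, the linear maps from \<open>K\<close> to \<open>C\<close> modulo those which extend to \<open>M\<close>. For projective
 \<open>M\<close> this is \<open>Ext\<^sup>1(M/K, C)\<close>.\<close>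

definition restrictions :: "('r, 'x) ring_scheme => ('r, 'm, 'y) module_scheme => 'm set => ('r, 'n, 'z) module_scheme => ('m => 'n) set"
 where "restrictions R M K C = {restrict g K | g. lin R M C g}"

definition ext_mod :: "('r, 'x) ring_scheme => ('r, 'm, 'y) module_scheme => 'm set => ('r, 'n, 'z) module_scheme => ('r, ('m => 'n) set) module"
 where "ext_mod R M K C = quotient_module (hom_module R (M |: K) C) (restrictions R M K C)"

definition ext_class :: "('r, 'x) ring_scheme => ('r, 'm, 'y) module_scheme => 'm set => ('r, 'n, 'z) module_scheme => ('m => 'n) => ('m => 'n) set"
 where "ext_class R M K C f = restrictions R M K C +>\<^bsub>hom_module R (M |: K) C\<^esub> restrict f K"

text \<open>Division by an element which acts bijectively is linear; this transfers bijectivity from \<open>C\<close> to modules of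
 maps into \<open>C\<close>.\<close>

lemma divide_lin:
 assumes M: "module R M" and C: "module R C" and b: "acts_bij C S" "s \<in> S" "s \<in>: R" and f: "lin R M C f"
 shows "\<exists>f'. lin R M C f' \<and> (\<forall>x\<in>carrier M. s \<odot>\<^sub>C f' x = f x)"
proof -
 interpret M: module R M by fact
 interpret C: module R C by fact
 note fr = lin_all[OF f M C]
 have "\<forall>x\<in>carrier M. \<exists>y\<in>carrier C. s \<odot>\<^sub>C y = f x" using acts_bijD(1)[OF b(1,2)] fr(1) by blast
 then obtain f' where f': "\<And>x. x \<in>: M ==> f' x \<in>: C" "\<And>x. x \<in>: M ==> s \<odot>\<^sub>C f' x = f x" by metis
 have "lin R M C f'"
 proof (rule linI)
  show "f' (x \<oplus>\<^sub>M y) = f' x \<oplus>\<^sub>C f' y" if "x \<in>: M" "y \<in>: M" for x y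
   by (rule acts_bijD(2)[OF b(1,2)]) (use that f' b(3) in \<open>auto simp: fr C.smult_r_distr\<close>)
  show "f' (r \<odot>\<^sub>M x) = r \<odot>\<^sub>C f' x" if rx: "r \<in>: R" "x \<in>: M" for r x
  proof (rule acts_bijD(2)[OF b(1,2)])
   have "s \<odot>\<^sub>C (r \<odot>\<^sub>C f' x) = r \<odot>\<^sub>C (s \<odot>\<^sub>C f' x)"
    using C.smult_assoc1[of s r "f' x"] C.smult_assoc1[of r s "f' x"] rx f'(1) b(3) by (simp add: M.m_comm)
   then show "s \<odot>\<^sub>C f' (r \<odot>\<^sub>M x) = s \<odot>\<^sub>C (r \<odot>\<^sub>C f' x)" using rx f'(2) by (simp add: fr)
  qed (use rx f' in auto)
 qed (rule f'(1))
 then show ?thesis using f'(2) by blast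
qed

context
 fixes R :: "('r, 'x) ring_scheme" and M :: "('r, 'm, 'y) module_scheme" and C :: "('r, 'c, 'z) module_scheme" and K :: "'m set"
 assumes M: "module R M" and C: "module R C" and K: "submodule K R M"
begin

private abbreviation "S \<equiv> M |: K"
private abbreviation "H \<equiv> hom_module R S C"
private abbreviation "B \<equiv> restrictions R M K C"
private abbreviation "E \<equiv> ext_mod R M K C"
private abbreviation "cl \<equiv> ext_class R M K C"

lemma ext_mod:
 shows "module R E"
  and "lin R S C f ==> cl f \<in>: E"
  and "X \<in>: E ==> \<exists>f. lin R S C f \<and> f \<in> extensional K \<and> X = cl f"
  and "lin R S C f ==> cl f = \<zero>\<^sub>E \<longleftrightarrow> (\<exists>g. lin R M C g \<and> (\<forall>x\<in>K. g x = f x))"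
  and "lin R S C f ==> lin R S C g ==>
   cl (\<lambda>x. f x \<oplus>\<^sub>C g x) = cl f \<oplus>\<^sub>E cl g"
  and "lin R S C f ==> r \<in>: R ==>
   cl (\<lambda>x. r \<odot>\<^sub>C f x) = r \<odot>\<^sub>E cl f"
  and "lin R S C f ==> lin R S C g ==>
   cl (\<lambda>x. f x \<ominus>\<^sub>C g x) = cl f \<ominus>\<^sub>E cl g"
  and "(\<And>x. x \<in> K ==> f x = f' x) ==> cl f = cl f'"
proof -
 interpret M: module R M by fact
 interpret C: module R C by fact
 have S: "module R S" by (rule sub_module[OF K M])
 interpret S: module R S by (rule S)
 interpret H: module R H by (rule hom_is_module[OF S C])
 have KM: "K \<subseteq> carrier M" using submoduleD(1)[OF K M] by blast
 have rl: "restrict g K \<in>: H" if "lin R S C g" for g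
  using hom_module_carrier(2)[OF S that] by simp
 have B: "submodule (B) R H"
 proof (rule submoduleI'[OF H.module_axioms])
  show "B \<subseteq> carrier H"
   using rl lin_restrict[OF _ KM] by (auto simp: restrictions_def)
  show "\<zero>\<^sub>H \<in> B"
   using lin_zero[OF C] by (auto simp: restrictions_def hom_module_def)
  show "a \<oplus>\<^sub>H b \<in> B" if ab: "a \<in> B" "b \<in> B" for a b
  proof -
   obtain g g' where g: "lin R M C g" "lin R M C g'" "a = restrict g K" "b = restrict g' K"
    using ab by (auto simp: restrictions_def)
   have "a \<oplus>\<^sub>H b = restrict (\<lambda>x. g x \<oplus>\<^sub>C g' x) K" by (auto simp: hom_module_def g intro!: restrict_ext)
   then show ?thesis using lin_plus[OF g(1,2) C] unfolding restrictions_def by blast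
  qed
  show "r \<odot>\<^sub>H a \<in> B" if ra: "r \<in>: R" "a \<in> B" for r a
  proof -
   obtain g where g: "lin R M C g" "a = restrict g K" using ra by (auto simp: restrictions_def)
   have "r \<odot>\<^sub>H a = restrict (\<lambda>x. r \<odot>\<^sub>C g x) K" by (auto simp: hom_module_def g intro!: restrict_ext)
   then show ?thesis using lin_scale[OF g(1) ra(1) C] unfolding restrictions_def by blast
  qed
 qed
 note q = quotient_proj[OF H.module_axioms B, folded ext_mod_def]
 show E: "module R E" unfolding ext_mod_def by (rule quotient_is_module[OF H.module_axioms B])
 interpret E: module R "E" by (rule E)
 note qr = lin_all[OF q(1) H.module_axioms E]
 show 1: "cl f \<in>: E" if "lin R S C f" for f
  unfolding ext_class_def using qr(1) rl[OF that] by simp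
 show "\<exists>f. lin R S C f \<and> f \<in> extensional K \<and> X = cl f" if X: "X \<in>: E" for X
 proof -
  have "X \<in> (\<lambda>x. B +>\<^sub>H x) ` carrier H" using X q(2) by simp
  then obtain f where f: "f \<in>: H" "X = B +>\<^sub>H f" by (rule imageE) simp
  then have fe: "f \<in> extensional K" by (simp add: hom_module_def mod_hom_def PiE_def)
  then have "restrict f K = f" by (rule extensional_restrict)
  then show ?thesis using hom_module_carrier(1)[OF S f(1)] fe f(2) by (intro exI[of _ f]) (simp add: ext_class_def)
 qed
 show "cl f = \<zero>\<^sub>E \<longleftrightarrow> (\<exists>g. lin R M C g \<and> (\<forall>x\<in>K. g x = f x))" if f: "lin R S C f"
 proof -
  have "cl f = \<zero>\<^sub>E \<longleftrightarrow> restrict f K \<in> B"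
   unfolding ext_class_def using q(3)[OF rl[OF f]] .
  also have "\<dots> \<longleftrightarrow> (\<exists>g. lin R M C g \<and> (\<forall>x\<in>K. g x = f x))"
  proof
   assume "restrict f K \<in> B"
   then obtain g where g: "lin R M C g" "restrict f K = restrict g K" by (auto simp: restrictions_def)
   have "g x = f x" if "x \<in> K" for x using fun_cong[OF g(2), of x] that by simp
   then show "\<exists>g. lin R M C g \<and> (\<forall>x\<in>K. g x = f x)" using g(1) by blast
  next
   assume "\<exists>g. lin R M C g \<and> (\<forall>x\<in>K. g x = f x)"
   then obtain g where g: "lin R M C g" "\<forall>x\<in>K. g x = f x" by blast
   then have "restrict f K = restrict g K" by (auto intro!: restrict_ext)
   then show "restrict f K \<in> B" using g(1) by (auto simp: restrictions_def)
  qed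
  finally show ?thesis .
 qed
 show add: "cl (\<lambda>x. f x \<oplus>\<^sub>C g x) = cl f \<oplus>\<^sub>E cl g"
  if f: "lin R S C f" and g: "lin R S C g" for f g
 proof -
  have "restrict (\<lambda>x. f x \<oplus>\<^sub>C g x) K = restrict f K \<oplus>\<^sub>H restrict g K"
   by (auto simp: hom_module_def intro!: restrict_ext)
  then show ?thesis unfolding ext_class_def using qr(2)[OF rl[OF f] rl[OF g]] by simp
 qed
 show sc: "cl (\<lambda>x. r \<odot>\<^sub>C f x) = r \<odot>\<^sub>E cl f"
  if f: "lin R S C f" and r: "r \<in>: R" for f r
 proof -
  have "restrict (\<lambda>x. r \<odot>\<^sub>C f x) K = r \<odot>\<^sub>H restrict f K"
   by (auto simp: hom_module_def intro!: restrict_ext)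
  then show ?thesis unfolding ext_class_def using qr(3)[OF r rl[OF f]] by simp
 qed
 show cong: "cl f = cl f'" if "\<And>x. x \<in> K ==> f x = f' x" for f f'
 proof -
  have "restrict f K = restrict f' K" using that by (auto intro!: restrict_ext)
  then show ?thesis by (simp add: ext_class_def)
 qed
 show "cl (\<lambda>x. f x \<ominus>\<^sub>C g x) = cl f \<ominus>\<^sub>E cl g"
  if f: "lin R S C f" and g: "lin R S C g"
 proof -
  have gc: "g x \<in>: C" if "x \<in> K" for x using linD(1)[OF g] that by simp
  have "cl (\<lambda>x. f x \<ominus>\<^sub>C g x) = cl (\<lambda>x. f x \<oplus>\<^sub>C (\<ominus>\<^sub>R \<one>\<^sub>R) \<odot>\<^sub>C g x)"
   by (rule cong) (simp add: C.smult_m1 gc C.M.minus_eq)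
  also have "\<dots> = cl f \<oplus>\<^sub>E (\<ominus>\<^sub>R \<one>\<^sub>R) \<odot>\<^sub>E cl g"
   using add[OF f lin_scale[OF g _ C]] sc[OF g] by simp
  finally show ?thesis using 1[OF g] by (simp add: E.smult_m1 E.M.minus_eq)
 qed
qed

lemma ext_class_lin:
 shows "lin R H E (cl)"
  and "cl ` carrier H = carrier E"
proof -
 note e = ext_mod
 have S: "module R S" by (rule sub_module[OF K M])
 note hl = hom_module_carrier[OF S]
 show "lin R H E (cl)"
 proof (rule linI)
  fix f assume f: "f \<in>: H"
  show "cl f \<in>: E" using e(2)[OF hl(1)[OF f]] .
  show "cl (r \<odot>\<^sub>H f) = r \<odot>\<^sub>E cl f" if r: "r \<in>: R" for r
   unfolding e(6)[OF hl(1)[OF f] r, symmetric] by (rule e(8)) (simp add: hom_module_apply)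
  fix g assume g: "g \<in>: H"
  show "cl (f \<oplus>\<^sub>H g) = cl f \<oplus>\<^sub>E cl g"
   unfolding e(5)[OF hl(1)[OF f] hl(1)[OF g], symmetric] by (rule e(8)) (simp add: hom_module_apply)
 qed
 show "cl ` carrier H = carrier E"
 proof (intro equalityI subsetI)
  fix X assume "X \<in>: E"
  then obtain f where f: "lin R S C f" "f \<in> extensional K" "X = cl f" using e(3) by blast
  have "restrict f K = f" using f(2) by (rule extensional_restrict)
  then have "f \<in>: H" using hl(2)[OF f(1)] by simp
  then show "X \<in> cl ` carrier H" using f(3) by blast
 qed (use e(2) hl(1) in auto)
qed

lemma ext_mod_acts_bij:
 assumes b: "acts_bij C U" and U: "U \<subseteq> carrier R"
 shows "acts_bij E U"
proof (rule acts_bijI[OF ext_mod(1) U])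
 note e = ext_mod
 have SM: "module R S" by (rule sub_module[OF K M])
 fix s X assume s: "s \<in> U" and X: "X \<in>: E"
 then have sR: "s \<in>: R" using U by auto
 obtain f where f: "lin R S C f" "X = cl f" using e(3)[OF X] by blast
 obtain f' where f': "lin R S C f'" "\<And>x. x \<in> K ==> s \<odot>\<^sub>C f' x = f x"
  using divide_lin[OF SM C b s sR f(1)] by auto
 have "s \<odot>\<^sub>E cl f' = X"
  unfolding f(2) e(6)[OF f'(1) sR, symmetric] by (rule e(8)) (rule f'(2))
 then show "\<exists>Y\<in>carrier E. s \<odot>\<^sub>E Y = X" using e(2)[OF f'(1)] by blast
next
 note e = ext_mod
 fix s X assume s: "s \<in> U" and X: "X \<in>: E" "s \<odot>\<^sub>E X = \<zero>\<^sub>E"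
 then have sR: "s \<in>: R" using U by auto
 obtain f where f: "lin R S C f" "X = cl f" using e(3)[OF X(1)] by blast
 have "cl (\<lambda>x. s \<odot>\<^sub>C f x) = \<zero>\<^sub>E" using X(2) by (simp add: f(2) e(6)[OF f(1) sR])
 then obtain g where g: "lin R M C g" "\<forall>x\<in>K. g x = s \<odot>\<^sub>C f x" using e(4)[OF lin_scale[OF f(1) sR C]] by auto
 obtain g' where g': "lin R M C g'" "\<And>x. x \<in>: M ==> s \<odot>\<^sub>C g' x = g x" using divide_lin[OF M C b s sR g(1)] by auto
 have "g' x = f x" if x: "x \<in> K" for x
 proof (rule acts_bijD(2)[OF b s])
  have xM: "x \<in>: M" using submoduleD(1)[OF K M x] .
  show "g' x \<in>: C" "f x \<in>: C" using linD(1)[OF g'(1) xM] linD(1)[OF f(1)] x by auto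
  show "s \<odot>\<^sub>C g' x = s \<odot>\<^sub>C f x" using g'(2)[OF xM] g(2) x by simp
 qed
 then show "X = \<zero>\<^sub>E" unfolding f(2) using e(4)[OF f(1)] g'(1) by blast
qed

lemma ext_mod_killed:
 assumes s: "s \<in>: R"
  and k: "\<And>x. x \<in>: C ==> s \<odot>\<^sub>C x = \<zero>\<^sub>C" and X: "X \<in>: E"
 shows "s \<odot>\<^sub>E X = \<zero>\<^sub>E"
proof -
 note e = ext_mod
 obtain f where f: "lin R S C f" "X = cl f" using e(3)[OF X] by blast
 have "\<exists>g. lin R M C g \<and> (\<forall>x\<in>K. g x = s \<odot>\<^sub>C f x)"
  using lin_zero[OF C, of M] k linD(1)[OF f(1)] by (intro exI[of _ "\<lambda>_. \<zero>\<^sub>C"]) auto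
 then show ?thesis unfolding f(2) e(6)[OF f(1) s, symmetric] using e(4)[OF lin_scale[OF f(1) s C]] by blast
qed

end

context localized begin

lemma loc_hom_mem_iff: "c \<in>: loc_hom R T C \<longleftrightarrow>
  c \<in> T \<rightarrow>\<^sub>E carrier C \<and> (\<forall>s\<in>T. \<forall>t\<in>T. c s = t \<odot>\<^sub>C c (s \<otimes> t))"
 by (simp add: loc_hom_def)

lemma loc_hom_closed: "c \<in>: loc_hom R T C ==> t \<in> T ==> c t \<in>: C"
 unfolding loc_hom_mem_iff by blast

lemma loc_hom_compat: "c \<in>: loc_hom R T C ==> s \<in> T ==> t \<in> T ==> c s = t \<odot>\<^sub>C c (s \<otimes> t)"
 unfolding loc_hom_mem_iff by blast

lemma loc_hom_memI:
 assumes "\<And>t. t \<in> T ==> c t \<in>: C" "\<And>s t. s \<in> T ==> t \<in> T ==> c s = t \<odot>\<^sub>C c (s \<otimes> t)"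
 shows "restrict c T \<in>: loc_hom R T C"
 unfolding loc_hom_mem_iff using assms(1) by (auto intro!: assms(2))

lemma loc_hom_simps:
 "t \<in> T ==> (c \<oplus>\<^bsub>loc_hom R T C\<^esub> d) t = c t \<oplus>\<^sub>C d t" "t \<in> T ==> (r \<odot>\<^bsub>loc_hom R T C\<^esub> c) t = r \<odot>\<^sub>C c t"
 "t \<in> T ==> \<zero>\<^bsub>loc_hom R T C\<^esub> t = \<zero>\<^sub>C"
 by (simp_all add: loc_hom_def)

lemma loc_hom_eqI:
 "c \<in>: loc_hom R T C ==> d \<in>: loc_hom R T C ==> (\<And>t. t \<in> T ==> c t = d t) ==> c = d"
 unfolding loc_hom_mem_iff by (blast intro: PiE_ext)

lemma loc_hom_eq: "loc_hom R T C = fun_module T C |: carrier (loc_hom R T C)"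
 by (simp add: loc_hom_def fun_module_def)

lemma loc_hom_module:
 assumes C: "module R C"
 shows "module R (loc_hom R T C)"
proof -
 interpret C: module R C by fact
 note cl = loc_hom_closed[of _ C] and cp = loc_hom_compat[of _ C]
 have "submodule (carrier (loc_hom R T C)) R (fun_module T C)"
 proof (rule submoduleI'[OF fun_module[OF C]])
  show "c \<oplus>\<^bsub>fun_module T C\<^esub> d \<in>: loc_hom R T C" if c: "c \<in>: loc_hom R T C" and d: "d \<in>: loc_hom R T C" for c d
  proof -
   have "t \<odot>\<^sub>C (c (s \<otimes> t) \<oplus>\<^sub>C d (s \<otimes> t)) = c s \<oplus>\<^sub>C d s" if "s \<in> T" "t \<in> T" for s t
    using that cl[OF c, of "s \<otimes> t"] cl[OF d, of "s \<otimes> t"] cp[OF c that] cp[OF d that] by (simp add: C.smult_r_distr)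
   then show ?thesis using loc_hom_memI[of "\<lambda>t. c t \<oplus>\<^sub>C d t" C, OF C.M.a_closed[OF cl[OF c] cl[OF d]]] by (simp add: fun_module_def)
  qed
  show "r \<odot>\<^bsub>fun_module T C\<^esub> c \<in>: loc_hom R T C" if r: "r \<in>: R" and c: "c \<in>: loc_hom R T C" for r c
  proof -
   have "t \<odot>\<^sub>C (r \<odot>\<^sub>C c (s \<otimes> t)) = r \<odot>\<^sub>C c s" if "s \<in> T" "t \<in> T" for s t
    using r that cl[OF c, of "s \<otimes> t"] cp[OF c that] by (simp add: C.smult_assoc1[symmetric] m_comm)
   then show ?thesis using loc_hom_memI[of "\<lambda>t. r \<odot>\<^sub>C c t" C, OF C.smult_closed[OF r cl[OF c]]] by (simp add: fun_module_def)
  qed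
 qed (auto simp: loc_hom_def fun_module_def)
 then show ?thesis by (subst loc_hom_eq) (rule sub_module[OF _ fun_module[OF C]])
qed

lemma loc_hom_minus:
 assumes C: "module R C" and cd: "c \<in>: loc_hom R T C" "d \<in>: loc_hom R T C" and t: "t \<in> T"
 shows "(c \<ominus>\<^bsub>loc_hom R T C\<^esub> d) t = c t \<ominus>\<^sub>C d t"
proof -
 interpret C: module R C by fact
 interpret H: module R "loc_hom R T C" by (rule loc_hom_module[OF C])
 show ?thesis using H.smult_m1[OF cd(2), symmetric] loc_hom_closed[OF cd(2) t] t
  by (simp add: H.M.minus_eq loc_hom_simps C.smult_m1 C.M.minus_eq)
qed

lemma loc_hom_eval: "s \<in> T ==> lin R (loc_hom R T C) C (\<lambda>c. c s)"
 by (rule linI) (auto simp: loc_hom_closed loc_hom_simps)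

lemma loc_hom_acts_bij:
 assumes C: "module R C"
 shows "acts_bij (loc_hom R T C) T"
proof (rule acts_bijI[OF loc_hom_module[OF C]])
 interpret C: module R C by fact
 interpret H: module R "loc_hom R T C" by (rule loc_hom_module[OF C])
 note cl = loc_hom_closed[of _ C] and cp = loc_hom_compat[of _ C]
 show "T \<subseteq> carrier R" by auto
 fix t c assume t: "t \<in> T" and c: "c \<in>: loc_hom R T C"
 have d: "restrict (\<lambda>s. c (s \<otimes> t)) T \<in>: loc_hom R T C"
 proof (rule loc_hom_memI)
  fix s s' assume s: "s \<in> T" "s' \<in> T"
  have "s \<otimes> s' \<otimes> t = s \<otimes> t \<otimes> s'" using s t by (simp add: m_ac)
  then show "c (s \<otimes> t) = s' \<odot>\<^sub>C c (s \<otimes> s' \<otimes> t)" using cp[OF c, of "s \<otimes> t" s'] s t by simp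
 qed (use cl c t in simp)
 have "t \<odot>\<^bsub>loc_hom R T C\<^esub> restrict (\<lambda>s. c (s \<otimes> t)) T = c"
  using t c by (intro loc_hom_eqI[OF H.smult_closed[OF _ d]]) (simp_all add: loc_hom_simps cp[OF c, symmetric])
 then show "\<exists>d\<in>carrier (loc_hom R T C). t \<odot>\<^bsub>loc_hom R T C\<^esub> d = c" using d by blast
next
 interpret C: module R C by fact
 interpret H: module R "loc_hom R T C" by (rule loc_hom_module[OF C])
 fix t c assume t: "t \<in> T" and c: "c \<in>: loc_hom R T C" "t \<odot>\<^bsub>loc_hom R T C\<^esub> c = \<zero>\<^bsub>loc_hom R T C\<^esub>"
 show "c = \<zero>\<^bsub>loc_hom R T C\<^esub>"
 proof (rule loc_hom_eqI[OF c(1) H.zero_closed])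
  fix s assume s: "s \<in> T"
  have "c s = (t \<odot>\<^bsub>loc_hom R T C\<^esub> c) (s \<otimes> t)"
   using loc_hom_compat[OF c(1) s t] s t by (simp add: loc_hom_simps)
  then show "c s = \<zero>\<^bsub>loc_hom R T C\<^esub> s" using s t by (simp add: c(2) loc_hom_simps)
 qed
qed

lemma loc_hom_acts_bij_inherit:
 assumes C: "module R C" and b: "acts_bij C U" and U: "U \<subseteq> carrier R"
 shows "acts_bij (loc_hom R T C) U"
proof (rule acts_bijI[OF loc_hom_module[OF C] U])
 interpret C: module R C by fact
 interpret H: module R "loc_hom R T C" by (rule loc_hom_module[OF C])
 fix u c assume u: "u \<in> U" and c: "c \<in>: loc_hom R T C"
 have uR: "u \<in>: R" using u U by auto
 have "\<forall>t\<in>T. \<exists>y\<in>carrier C. u \<odot>\<^sub>C y = c t" using acts_bijD(1)[OF b u] loc_hom_closed[OF c] by blast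
 then obtain d where d: "\<And>t. t \<in> T ==> d t \<in>: C" "\<And>t. t \<in> T ==> u \<odot>\<^sub>C d t = c t" by metis
 have dm: "restrict d T \<in>: loc_hom R T C"
 proof (rule loc_hom_memI[OF d(1)])
  fix s t assume st: "s \<in> T" "t \<in> T"
  have "u \<odot>\<^sub>C (t \<odot>\<^sub>C d (s \<otimes> t)) = t \<odot>\<^sub>C (u \<odot>\<^sub>C d (s \<otimes> t))"
   using C.smult_assoc1[of t u "d (s \<otimes> t)"] C.smult_assoc1[of u t "d (s \<otimes> t)"] uR st d(1) by (simp add: m_comm)
  then have "u \<odot>\<^sub>C d s = u \<odot>\<^sub>C (t \<odot>\<^sub>C d (s \<otimes> t))" using st d(2) loc_hom_compat[OF c st] by simp
  then show "d s = t \<odot>\<^sub>C d (s \<otimes> t)" by (rule acts_bijD(2)[OF b u, rotated 2]) (use st d in auto)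
 qed
 have "u \<odot>\<^bsub>loc_hom R T C\<^esub> restrict d T = c"
  using uR d by (intro loc_hom_eqI[OF H.smult_closed[OF _ dm] c]) (simp_all add: loc_hom_simps)
 then show "\<exists>d\<in>carrier (loc_hom R T C). u \<odot>\<^bsub>loc_hom R T C\<^esub> d = c" using dm by blast
next
 interpret C: module R C by fact
 interpret H: module R "loc_hom R T C" by (rule loc_hom_module[OF C])
 fix u c assume u: "u \<in> U" and c: "c \<in>: loc_hom R T C" "u \<odot>\<^bsub>loc_hom R T C\<^esub> c = \<zero>\<^bsub>loc_hom R T C\<^esub>"
 have uR: "u \<in>: R" using u U by auto
 show "c = \<zero>\<^bsub>loc_hom R T C\<^esub>"
 proof (rule loc_hom_eqI[OF c(1) H.zero_closed])
  fix t assume t: "t \<in> T"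
  have "u \<odot>\<^sub>C c t = u \<odot>\<^sub>C \<zero>\<^sub>C" using fun_cong[OF c(2), of t] t uR by (simp add: loc_hom_simps)
  then have "c t = \<zero>\<^sub>C" by (rule acts_bijD(2)[OF b u, rotated 2]) (use t loc_hom_closed[OF c(1)] in auto)
  then show "c t = \<zero>\<^bsub>loc_hom R T C\<^esub> t" using t by (simp add: loc_hom_simps)
 qed
qed

text \<open>\<open>Hom(U\<^sup>-\<^sup>1R, C)\<close> inherits cotorsion for \<open>T \<supseteq> U\<close>. If \<open>c\<close> trivializes the values at \<open>1\<close> of a cocycle \<open>g\<close>, then
 \<open>g\<close> is trivialized by the families \<open>u \<mapsto> c (x u) + g x u u\<close>: the value at \<open>u\<close> belonging to \<open>1/x\<close> is that at \<open>1\<close>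
 belonging to \<open>1/(xu)\<close>, up to the cocycle.\<close>

lemma loc_cotorsion_loc_hom:
 assumes U: "submonoid U R" "U \<subseteq> T" and C: "module R C" and ct: "loc_cotorsion R T C"
 shows "loc_cotorsion R T (loc_hom R U C)"
proof -
 interpret U: localized R U by (rule localizedI[OF U(1)])
 interpret C: module R C by fact
 let ?H = "loc_hom R U C"
 have H: "module R ?H" by (rule U.loc_hom_module[OF C])
 interpret H: module R ?H by (rule H)
 have UT: "u \<in> T" if "u \<in> U" for u using that U(2) by auto
 show ?thesis
  unfolding loc_cotorsion_iff[OF H]
 proof (intro allI impI)
  fix g assume g: "cocycle ?H g"
  note gH = cocycleD(1)[OF g]
  have gc: "g s t u \<in>: C" if "s \<in> T" "t \<in> T" "u \<in> U" for s t u using U.loc_hom_closed[OF gH] that by blast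
  have gm: "g s (t \<otimes> t') u = g s t u \<oplus>\<^sub>C t \<odot>\<^sub>C g (s \<otimes> t) t' u" if "s \<in> T" "t \<in> T" "t' \<in> T" "u \<in> U" for s t t' u
   using that cocycleD(2)[OF g] by (simp add: U.loc_hom_simps)
  have g1: "g s t \<one> = u \<odot>\<^sub>C g s t u" if "s \<in> T" "t \<in> T" "u \<in> U" for s t u
   using U.loc_hom_compat[OF gH[OF that(1,2)] U.T_one that(3)] that by simp
  have "cocycle C (\<lambda>s t. g s t \<one>)" using gc gm by (auto simp: cocycle_def)
  then obtain c where c: "\<And>s. s \<in> T ==> c s \<in>: C" "\<And>s t. s \<in> T ==> t \<in> T ==> g s t \<one> = c s \<ominus>\<^sub>C t \<odot>\<^sub>C c (s \<otimes> t)"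
   using ct loc_cotorsion_iff[OF C] by blast
  define h where "h x = restrict (\<lambda>u. c (x \<otimes> u) \<oplus>\<^sub>C g x u u) U" for x
  have hc: "h x \<in>: ?H" if x: "x \<in> T" for x
   unfolding h_def
  proof (rule U.loc_hom_memI)
   fix u v assume uv: "u \<in> U" "v \<in> U"
   note uvT = UT[OF uv(1)] UT[OF uv(2)]
   have "v \<odot>\<^sub>C g x (u \<otimes> v) (u \<otimes> v) = g x (u \<otimes> v) u" using U.loc_hom_compat[OF gH[of x "u \<otimes> v"] uv] x uvT by simp
   also have "\<dots> = g x u u \<oplus>\<^sub>C (c (x \<otimes> u) \<ominus>\<^sub>C v \<odot>\<^sub>C c (x \<otimes> (u \<otimes> v)))"
    using gm[OF x uvT uv(1)] g1[of "x \<otimes> u" v u] c(2)[of "x \<otimes> u" v] x uv uvT by (simp add: m_assoc)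
   finally have *: "v \<odot>\<^sub>C g x (u \<otimes> v) (u \<otimes> v) = \<dots>" .
   have "a \<oplus>\<^sub>C b = v \<odot>\<^sub>C d \<oplus>\<^sub>C (b \<oplus>\<^sub>C (a \<ominus>\<^sub>C v \<odot>\<^sub>C d))" if "a \<in>: C" "b \<in>: C" "d \<in>: C" for a b d
    using that T_closed[OF uvT(2)] by algebra
   then show "c (x \<otimes> u) \<oplus>\<^sub>C g x u u = v \<odot>\<^sub>C (c (x \<otimes> (u \<otimes> v)) \<oplus>\<^sub>C g x (u \<otimes> v) (u \<otimes> v))"
    using x uv uvT c(1) gc by (simp add: C.smult_r_distr *)
  qed (use x UT c(1) gc in auto)
  have "g x t = h x \<ominus>\<^sub>?H t \<odot>\<^sub>?H h (x \<otimes> t)" if xt: "x \<in> T" "t \<in> T" for x t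
  proof (rule U.loc_hom_eqI[OF gH[OF xt]])
   have hh: "h x \<in>: ?H" "t \<odot>\<^sub>?H h (x \<otimes> t) \<in>: ?H" using hc xt by auto
   then show "h x \<ominus>\<^sub>?H t \<odot>\<^sub>?H h (x \<otimes> t) \<in>: ?H" by simp
   fix u assume u: "u \<in> U"
   note uT = UT[OF u]
   have *: "g x t u \<oplus>\<^sub>C t \<odot>\<^sub>C g (x \<otimes> t) u u = g x u u \<oplus>\<^sub>C (c (x \<otimes> u) \<ominus>\<^sub>C t \<odot>\<^sub>C c (x \<otimes> t \<otimes> u))"
    using gm[OF xt uT u] gm[OF xt(1) uT xt(2) u] g1[of "x \<otimes> u" t u] c(2)[of "x \<otimes> u" t] xt u uT by (simp add: m_ac)
   have "a = (d \<oplus>\<^sub>C b') \<ominus>\<^sub>C t \<odot>\<^sub>C (d' \<oplus>\<^sub>C b)" if e: "a \<oplus>\<^sub>C t \<odot>\<^sub>C b = b' \<oplus>\<^sub>C (d \<ominus>\<^sub>C t \<odot>\<^sub>C d')"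
    and c: "a \<in>: C" "b \<in>: C" "b' \<in>: C" "d \<in>: C" "d' \<in>: C" for a b b' d d'
   proof -
    have "a = (a \<oplus>\<^sub>C t \<odot>\<^sub>C b) \<ominus>\<^sub>C t \<odot>\<^sub>C b" using c T_closed[OF xt(2)] by algebra
    also have "\<dots> = (d \<oplus>\<^sub>C b') \<ominus>\<^sub>C t \<odot>\<^sub>C (d' \<oplus>\<^sub>C b)" unfolding e using c T_closed[OF xt(2)] by algebra
    finally show ?thesis .
   qed
   from this[OF *] have "g x t u = (c (x \<otimes> u) \<oplus>\<^sub>C g x u u) \<ominus>\<^sub>C t \<odot>\<^sub>C (c (x \<otimes> t \<otimes> u) \<oplus>\<^sub>C g (x \<otimes> t) u u)"
    using xt u uT c(1) gc by simp
   then show "g x t u = (h x \<ominus>\<^sub>?H t \<odot>\<^sub>?H h (x \<otimes> t)) u"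
    unfolding U.loc_hom_minus[OF C hh u] using u by (simp add: U.loc_hom_simps) (simp add: h_def)
  qed
  then show "\<exists>h. (\<forall>s\<in>T. h s \<in>: ?H) \<and> (\<forall>s\<in>T. \<forall>t\<in>T. g s t = h s \<ominus>\<^sub>?H t \<odot>\<^sub>?H h (s \<otimes> t))"
   using hc by blast
 qed
qed

end

context localized begin

lemma T_sub: "T \<subseteq> carrier R" by auto

text \<open>\<open>T\<close> acts bijectively on \<open>Ext\<^sup>1(T\<^sup>-\<^sup>1R, C)\<close>: the inverse of \<open>u\<close> is induced by the shift which takes the
 generator of \<open>s\<close> to that of \<open>su\<close>, since \<open>e\<^sub>s - u e\<^sub>s\<^sub>u\<close> is a relation.\<close>

lemma loc_ext_acts_bij:
 assumes C: "module R C"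
 shows "acts_bij (ext_mod R G L C) T"
proof -
 let ?D = "ext_mod R G L C" and ?cl = "ext_class R G L C"
 interpret C: module R C by fact
 interpret G: module R G by (rule free_T)
 note e = ext_mod[OF free_T C loc_ker_submodule]
 note Lr = submoduleD[OF loc_ker_submodule free_T]
 have res: "lin R (G |: L) C g" if "lin R G C g" for g by (rule lin_restrict[OF that]) (use Lr(1) in auto)
 have key: "\<exists>f' g. lin R (G |: L) C f' \<and> lin R G C g \<and> (\<forall>l\<in>L. f l = u \<odot>\<^sub>C f' l \<oplus>\<^sub>C g l) \<and>
   (\<forall>h. lin R G C h --> (\<forall>l\<in>L. h l = u \<odot>\<^sub>C f l) --> (\<exists>k. lin R G C k \<and> (\<forall>l\<in>L. k l = u \<odot>\<^sub>C f' l)))"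
  if u: "u \<in> T" and f: "lin R (G |: L) C f" for u f
 proof -
  note fr = lin_sub[OF f free_T C loc_ker_submodule]
  have fm: "f (rel R s (t \<otimes> t')) = f (rel R s t) \<oplus>\<^sub>C t \<odot>\<^sub>C f (rel R (s \<otimes> t) t')" if "s \<in> T" "t \<in> T" "t' \<in> T" for s t t'
   using that rel_in_ker Lr(4) by (simp add: rel_mult fr)
  have "cocycle C (\<lambda>s t. f (rel R (s \<otimes> u) t))"
   unfolding cocycle_def
  proof (intro conjI ballI)
   fix s t t' assume st: "s \<in> T" "t \<in> T" "t' \<in> T"
   have "s \<otimes> u \<otimes> t = s \<otimes> t \<otimes> u" using st u by (simp add: m_ac)
   then show "f (rel R (s \<otimes> u) (t \<otimes> t')) = f (rel R (s \<otimes> u) t) \<oplus>\<^sub>C t \<odot>\<^sub>C f (rel R (s \<otimes> t \<otimes> u) t')"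
    using fm[of "s \<otimes> u" t t'] st u by simp
  qed (use u fr rel_in_ker in simp)
  then obtain f' where f': "lin R (G |: L) C f'" "\<And>s t. s \<in> T ==> t \<in> T ==> f' (rel R s t) = f (rel R (s \<otimes> u) t)"
   using cocycle_linear[OF C] by blast
  define g where "g = lc R C (\<lambda>s. f (rel R s u))"
  have g: "lin R G C g" unfolding g_def by (rule lc_lin[OF C]) (simp add: u fr rel_in_ker)
  have gg: "g (gen s) = f (rel R s u)" if "s \<in> T" for s
   unfolding g_def using lc_gen[OF C, of "\<lambda>s. f (rel R s u)" s] that u by (simp add: fr rel_in_ker)
  have "f l = u \<odot>\<^sub>C f' l \<oplus>\<^sub>C g l" if l: "l \<in> L" for l
  proof (rule loc_ker_ext[OF f lin_plus[OF lin_scale[OF f'(1) _ C] res[OF g] C] C _ l])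
   fix s t assume st: "s \<in> T" "t \<in> T"
   have "f (rel R s t) \<oplus>\<^sub>C t \<odot>\<^sub>C f (rel R (s \<otimes> t) u) = f (rel R s u) \<oplus>\<^sub>C u \<odot>\<^sub>C f (rel R (s \<otimes> u) t)"
    using fm[OF st u] fm[OF st(1) u st(2)] st u by (simp add: m_comm)
   moreover have "g (rel R s t) = f (rel R s u) \<ominus>\<^sub>C t \<odot>\<^sub>C f (rel R (s \<otimes> t) u)"
    using st u by (simp add: rel_eq[of s T t] lin_all[OF g free_T C] gg)
   moreover have "a = (a \<oplus>\<^sub>C b) \<ominus>\<^sub>C b" "(c \<oplus>\<^sub>C d) \<ominus>\<^sub>C b = d \<oplus>\<^sub>C (c \<ominus>\<^sub>C b)"
    if "a \<in>: C" "b \<in>: C" "c \<in>: C" "d \<in>: C" for a b c d using that by algebra+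
   ultimately show "f (rel R s t) = u \<odot>\<^sub>C f' (rel R s t) \<oplus>\<^sub>C g (rel R s t)"
    using st u rel_in_ker by (simp add: f'(2) fr) (metis C.smult_closed T_closed T_mult fr(1))
  qed (use u in simp)
  moreover have "\<exists>k. lin R G C k \<and> (\<forall>l\<in>L. k l = u \<odot>\<^sub>C f' l)" if h: "lin R G C h" "\<forall>l\<in>L. h l = u \<odot>\<^sub>C f l" for h
  proof -
   note hr = lin_all[OF h(1) free_T C]
   let ?k = "lc R C (\<lambda>s. h (gen (s \<otimes> u)))"
   have k: "lin R G C ?k" by (rule lc_lin[OF C]) (simp add: u hr)
   have kg: "?k (gen s) = h (gen (s \<otimes> u))" if "s \<in> T" for s
    using lc_gen[OF C, of "\<lambda>s. h (gen (s \<otimes> u))" s] that u by (simp add: hr)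
   have "?k l = u \<odot>\<^sub>C f' l" if l: "l \<in> L" for l
   proof (rule loc_ker_ext[OF res[OF k] lin_scale[OF f'(1) _ C] C _ l])
    fix s t assume st: "s \<in> T" "t \<in> T"
    have su: "s \<otimes> u \<otimes> t = s \<otimes> t \<otimes> u" using st u by (simp add: m_ac)
    have "?k (rel R s t) = h (rel R (s \<otimes> u) t)"
     using st u by (simp add: rel_eq[of s T t] rel_eq[of "s \<otimes> u" T t] su lin_all[OF k free_T C] hr kg)
    then show "?k (rel R s t) = u \<odot>\<^sub>C f' (rel R s t)" using h(2) rel_in_ker[of "s \<otimes> u" t] st u f'(2) by simp
   qed (use u in simp)
   then show ?thesis using k by blast
  qed
  ultimately show ?thesis using f'(1) g by blast
 qed
 show ?thesis
 proof (rule acts_bijI[OF e(1) T_sub])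
  interpret D: module R ?D by (rule e(1))
  fix u X assume u: "u \<in> T" and X: "X \<in>: ?D"
  obtain f where f: "lin R (G |: L) C f" "X = ?cl f" using e(3)[OF X] by blast
  obtain f' g where k: "lin R (G |: L) C f'" "lin R G C g" "\<forall>l\<in>L. f l = u \<odot>\<^sub>C f' l \<oplus>\<^sub>C g l"
   using key[OF u f(1)] by blast
  have g0: "?cl g = \<zero>\<^sub>?D" using e(4)[OF res[OF k(2)]] k(2) by blast
  have "X = ?cl (\<lambda>l. u \<odot>\<^sub>C f' l \<oplus>\<^sub>C g l)" unfolding f(2) by (rule e(8)) (use k(3) in auto)
  also have "\<dots> = u \<odot>\<^sub>?D ?cl f'"
   using e(5)[OF lin_scale[OF k(1) _ C] res[OF k(2)], of u] e(6)[OF k(1), of u] e(2)[OF k(1)] u by (simp add: g0)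
  finally show "\<exists>Y\<in>carrier ?D. u \<odot>\<^sub>?D Y = X" using e(2)[OF k(1)] by blast
 next
  fix u X assume u: "u \<in> T" and X: "X \<in>: ?D" "u \<odot>\<^sub>?D X = \<zero>\<^sub>?D"
  obtain f where f: "lin R (G |: L) C f" "X = ?cl f" using e(3)[OF X(1)] by blast
  have uR: "u \<in>: R" using u by simp
  have "?cl (\<lambda>x. u \<odot>\<^sub>C f x) = \<zero>\<^sub>?D" using X(2) by (simp add: f(2) e(6)[OF f(1) uR])
  then obtain h where h: "lin R G C h" "\<forall>x\<in>L. h x = u \<odot>\<^sub>C f x" using e(4)[OF lin_scale[OF f(1) uR C]] by auto
  then obtain f' g k where k: "lin R G C k" "\<forall>l\<in>L. k l = u \<odot>\<^sub>C f' l" "lin R G C g" "\<forall>l\<in>L. f l = u \<odot>\<^sub>C f' l \<oplus>\<^sub>C g l"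
   using key[OF u f(1)] by blast
  have "lin R G C (\<lambda>x. k x \<oplus>\<^sub>C g x)" "\<forall>x\<in>L. k x \<oplus>\<^sub>C g x = f x" using lin_plus[OF k(1,3) C] k(2,4) by auto
  then show "X = \<zero>\<^sub>?D" unfolding f(2) using e(4)[OF f(1)] by blast
 qed
qed

text \<open>\<open>Ext\<^sup>1(U\<^sup>-\<^sup>1R, C)\<close> is cotorsion for \<open>T \<supseteq> U\<close>: as \<open>T\<^sup>-\<^sup>1R \<otimes> U\<^sup>-\<^sup>1R = T\<^sup>-\<^sup>1R\<close>, the group \<open>Ext\<^sup>1(T\<^sup>-\<^sup>1R,
 Ext\<^sup>1(U\<^sup>-\<^sup>1R, C))\<close> is a subquotient of \<open>Ext\<^sup>2(T\<^sup>-\<^sup>1R, C)\<close>, which vanishes. A map from the relations of \<open>T\<close> lifts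
 to a pairing \<open>b\<close> of the relations of \<open>T\<close> with those of \<open>U\<close>. The formula for \<open>w\<close> comes from the homotopy which
 contracts the tensor product of the resolutions of \<open>T\<^sup>-\<^sup>1R\<close> and \<open>U\<^sup>-\<^sup>1R\<close> onto the former.\<close>

lemma loc_cotorsion_loc_ext:
 assumes U: "submonoid U R" "U \<subseteq> T" and C: "module R C"
  and \<sigma>: "loc_section R T \<sigma>" and \<tau>: "loc_section R U \<tau>"
 shows "loc_cotorsion R T (ext_mod R (FM U) (loc_ker R U) C)"
proof -
 interpret U: localized R U by (rule localizedI[OF U(1)])
 interpret C: module R C by fact
 let ?G = "G" and ?L = "L" and ?GU = "FM U" and ?LU = "loc_ker R U"
 let ?D = "ext_mod R ?GU ?LU C" and ?cl = "ext_class R ?GU ?LU C" and ?H = "hom_module R (?GU |: ?LU) C"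
 interpret G: module R ?G by (rule free_T)
 interpret GU: module R ?GU by (rule free_is_module)
 note e = ext_mod[OF U.free_T C U.loc_ker_submodule] and q = ext_class_lin[OF U.free_T C U.loc_ker_submodule]
 interpret D: module R ?D by (rule e(1))
 have H: "module R ?H" by (rule hom_is_module[OF U.ker_module C])
 note Lr = submoduleD[OF loc_ker_submodule free_T] and LUr = submoduleD[OF U.loc_ker_submodule U.free_T]
 have UT: "u \<in> T" if "u \<in> U" for u using that U(2) by auto
 have s: "lin R (?G |: ?L) (FM (T \<times> T)) \<sigma>"
  "\<And>l. l \<in> ?L ==> relations R T (\<sigma> l) = l" using \<sigma> by (auto simp: loc_section_def)
 have t: "lin R (?GU |: ?LU) (FM (U \<times> U)) \<tau>"
  "\<And>l. l \<in> ?LU ==> relations R U (\<tau> l) = l" using \<tau> by (auto simp: loc_section_def)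
 show ?thesis
 proof (rule loc_cotorsionI[OF e(1)])
  fix f assume f: "lin R (?G |: ?L) ?D f"
  obtain F where F: "lin R (FM (T \<times> T)) ?H F" "\<And>y. y \<in>: FM (T \<times> T) ==> ?cl (F y) = f (relations R T y)"
   using free_projective[OF q lin_comp[OF relations_lin' f] H e(1)] by blast
  define b where "b l = F (\<sigma> l)" for l
  have bl: "lin R (?G |: ?L) ?H b" unfolding b_def by (rule lin_comp[OF s(1) F(1)])
  note br = lin_sub[OF bl free_T H loc_ker_submodule]
  have bf: "?cl (b l) = f l" if "l \<in> ?L" for l
   unfolding b_def using that linD(1)[OF s(1), of l] by (simp add: F(2) s(2))
  have bm: "lin R (?GU |: ?LU) C (b l)" if "l \<in> ?L" for l
   by (rule hom_module_carrier(1)[OF U.ker_module br(1)[OF that]])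
  have bmr: "b l (x \<oplus>\<^sub>?GU r \<odot>\<^sub>?GU y) = b l x \<oplus>\<^sub>C r \<odot>\<^sub>C b l y" if "l \<in> ?L" "x \<in> ?LU" "y \<in> ?LU" "r \<in>: R" for l x y r
   using that lin_sub[OF bm[OF that(1)] U.free_T C U.loc_ker_submodule] LUr(4) by simp
  have blr: "b (l \<oplus>\<^sub>?G r \<odot>\<^sub>?G l') m = b l m \<oplus>\<^sub>C r \<odot>\<^sub>C b l' m" if "l \<in> ?L" "l' \<in> ?L" "m \<in> ?LU" "r \<in>: R" for l l' m r
   using that Lr(4) by (simp add: br hom_module_apply)
  have bc: "b l m \<in>: C" if "l \<in> ?L" "m \<in> ?LU" for l m
   using linD(1)[OF bm[OF that(1)]] that(2) by simp
  define w where "w x = (\<lambda>(v, t). b (rel R x v) (rel R v t) \<oplus>\<^sub>C b (rel R (x \<otimes> v) t) (rel R \<one> (v \<otimes> t)))" for x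
  have wc: "w x vt \<in>: C" if "x \<in> T" "vt \<in> U \<times> U" for x vt
   using that by (auto simp: w_def UT intro!: C.M.a_closed bc rel_in_ker U.rel_in_ker)
  define h where "h x m = lc R C (w x) (\<tau> m)" for x m
  have wl: "lin R (FM (U \<times> U)) C (lc R C (w x))" if "x \<in> T" for x by (rule lc_lin[OF C]) (rule wc[OF that])
  have hl: "lin R (?GU |: ?LU) C (h x)" if "x \<in> T" for x
   unfolding h_def by (rule lin_comp[OF t(1) wl[OF that]])
  have "f (rel R x t') = ?cl (h x) \<ominus>\<^sub>?D t' \<odot>\<^sub>?D ?cl (h (x \<otimes> t'))" if xt: "x \<in> T" "t' \<in> T" for x t'
  proof -
   have t'R: "t' \<in>: R" using xt by simp
   have xt': "x \<otimes> t' \<in> T" using xt by simp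
   define ww where "ww u = b (rel R (x \<otimes> u) t') (rel R \<one> u)" for u
   have wwc: "ww u \<in>: C" if "u \<in> U" for u
    unfolding ww_def using that xt by (intro bc rel_in_ker U.rel_in_ker) (auto simp: UT)
   have wwl: "lin R ?GU C (lc R C ww)" by (rule lc_lin[OF C]) (rule wwc)
   have wwr: "lin R (?GU |: ?LU) C (lc R C ww)" by (rule lin_restrict[OF wwl]) (use LUr(1) in auto)
   have bx: "lin R (?GU |: ?LU) C (b (rel R x t'))" by (rule bm[OF rel_in_ker[OF xt]])
   have main: "lc R C (w x) y \<ominus>\<^sub>C t' \<odot>\<^sub>C lc R C (w (x \<otimes> t')) y = b (rel R x t') (relations R U y) \<oplus>\<^sub>C lc R C ww (relations R U y)"
    if y: "y \<in>: FM (U \<times> U)" for y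
   proof (rule free_ext[OF lin_diff[OF wl[OF xt(1)] lin_scale[OF wl[OF xt'] t'R C] C]
      lin_plus[OF lin_comp[OF U.relations_lin' bx] lin_comp[OF U.relations_lin' wwr] C] C _ y])
    fix vt assume "vt \<in> U \<times> U"
    then obtain v t where vt: "vt = (v, t)" "v \<in> U" "t \<in> U" by auto
    note vT = UT[OF vt(2)] UT[OF vt(3)]
    have R: "v \<in>: R" "t \<in>: R" using vt by auto
    let ?m = "rel R v t" and ?n = "rel R \<one> (v \<otimes> t)"
    have mn: "?m \<in> ?LU" "?n \<in> ?LU" "rel R \<one> v \<in> ?LU" using vt by (auto intro!: U.rel_in_ker)
    have i: "b (rel R x v) ?m \<oplus>\<^sub>C v \<odot>\<^sub>C b (rel R (x \<otimes> v) t') ?m = b (rel R x t') ?m \<oplus>\<^sub>C t' \<odot>\<^sub>C b (rel R (x \<otimes> t') v) ?m"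
     using arg_cong[OF rel_swap[OF xt(1) vT(1) xt(2)], of "\<lambda>l. b l ?m"] xt vT mn by (simp add: blr rel_in_ker)
    have xe: "x \<otimes> v \<otimes> t' = x \<otimes> t' \<otimes> v" using xt vT by (simp add: m_ac)
    have ii: "b (rel R (x \<otimes> v) t) ?n \<oplus>\<^sub>C t \<odot>\<^sub>C b (rel R (x \<otimes> v \<otimes> t) t') ?n = b (rel R (x \<otimes> v) t') ?n \<oplus>\<^sub>C t' \<odot>\<^sub>C b (rel R (x \<otimes> t' \<otimes> v) t) ?n"
     using arg_cong[OF rel_swap[of "x \<otimes> v" t t'], of "\<lambda>l. b l ?n"] xt vT mn by (simp add: blr rel_in_ker xe)
    have iii: "b (rel R (x \<otimes> v) t') ?n = ww v \<oplus>\<^sub>C v \<odot>\<^sub>C b (rel R (x \<otimes> v) t') ?m"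
     unfolding ww_def using U.rel_mult[of \<one> v t] vt xt vT mn by (simp add: bmr rel_in_ker)
    have iv: "lc R C ww ?m = ww v \<ominus>\<^sub>C t \<odot>\<^sub>C b (rel R (x \<otimes> v \<otimes> t) t') ?n"
    proof -
     have "lc R C ww ?m = ww v \<ominus>\<^sub>C t \<odot>\<^sub>C ww (v \<otimes> t)"
      using vt by (simp add: U.rel_eq[of v U t] lin_all[OF wwl U.free_T C] lc_gen[OF C] wwc)
     then show ?thesis using xt vT by (simp add: ww_def m_assoc)
    qed
    have alg: "(A \<oplus>\<^sub>C F) \<ominus>\<^sub>C t' \<odot>\<^sub>C (E \<oplus>\<^sub>C I) = Cc \<oplus>\<^sub>C (J \<ominus>\<^sub>C t \<odot>\<^sub>C G)"
     if 1: "A \<oplus>\<^sub>C v \<odot>\<^sub>C B = Cc \<oplus>\<^sub>C t' \<odot>\<^sub>C E" and 2: "F \<oplus>\<^sub>C t \<odot>\<^sub>C G = H0 \<oplus>\<^sub>C t' \<odot>\<^sub>C I" and 3: "H0 = J \<oplus>\<^sub>C v \<odot>\<^sub>C B"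
      and c: "A \<in>: C" "B \<in>: C" "Cc \<in>: C" "E \<in>: C" "F \<in>: C" "G \<in>: C"
      "I \<in>: C" "J \<in>: C" for A B Cc E F G H0 I J
    proof -
     have "A = (A \<oplus>\<^sub>C v \<odot>\<^sub>C B) \<ominus>\<^sub>C v \<odot>\<^sub>C B" using c R t'R by algebra
     then have A: "A = (Cc \<oplus>\<^sub>C t' \<odot>\<^sub>C E) \<ominus>\<^sub>C v \<odot>\<^sub>C B" by (simp only: 1)
     have "F = (F \<oplus>\<^sub>C t \<odot>\<^sub>C G) \<ominus>\<^sub>C t \<odot>\<^sub>C G" using c R t'R by algebra
     then have F: "F = ((J \<oplus>\<^sub>C v \<odot>\<^sub>C B) \<oplus>\<^sub>C t' \<odot>\<^sub>C I) \<ominus>\<^sub>C t \<odot>\<^sub>C G" by (simp only: 2 3)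
     have "(((Cc \<oplus>\<^sub>C t' \<odot>\<^sub>C E) \<ominus>\<^sub>C v \<odot>\<^sub>C B) \<oplus>\<^sub>C (((J \<oplus>\<^sub>C v \<odot>\<^sub>C B) \<oplus>\<^sub>C t' \<odot>\<^sub>C I) \<ominus>\<^sub>C t \<odot>\<^sub>C G)) \<ominus>\<^sub>C t' \<odot>\<^sub>C (E \<oplus>\<^sub>C I)
      = Cc \<oplus>\<^sub>C (J \<ominus>\<^sub>C t \<odot>\<^sub>C G)" using c R t'R by algebra
     then show ?thesis by (simp only: A[symmetric] F[symmetric])
    qed
    have "w x vt \<ominus>\<^sub>C t' \<odot>\<^sub>C w (x \<otimes> t') vt = b (rel R x t') ?m \<oplus>\<^sub>C lc R C ww ?m"
     unfolding vt(1) w_def prod.case iv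
     by (rule alg[OF i ii iii]) (use xt vT vt mn wwc in \<open>auto intro!: bc rel_in_ker\<close>)
    then show "lc R C (w x) (gen vt) \<ominus>\<^sub>C t' \<odot>\<^sub>C lc R C (w (x \<otimes> t')) (gen vt)
      = b (rel R x t') (relations R U (gen vt)) \<oplus>\<^sub>C lc R C ww (relations R U (gen vt))"
     using lc_gen[OF C, of "w x", OF wc[OF xt(1) \<open>vt \<in> U \<times> U\<close>]] lc_gen[OF C, of "w (x \<otimes> t')", OF wc[OF xt' \<open>vt \<in> U \<times> U\<close>]] U.relations_gen[OF vt(2,3)]
     by (simp add: vt(1))
   qed
   have "?cl (h x) \<ominus>\<^sub>?D t' \<odot>\<^sub>?D ?cl (h (x \<otimes> t')) = ?cl (\<lambda>m. h x m \<ominus>\<^sub>C t' \<odot>\<^sub>C h (x \<otimes> t') m)"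
    using e(7)[OF hl[OF xt(1)] lin_scale[OF hl[OF xt'] t'R C]] e(6)[OF hl[OF xt'] t'R] by simp
   also have "\<dots> = ?cl (\<lambda>m. b (rel R x t') m \<oplus>\<^sub>C lc R C ww m)"
   proof (rule e(8))
    fix m assume m: "m \<in> ?LU"
    show "h x m \<ominus>\<^sub>C t' \<odot>\<^sub>C h (x \<otimes> t') m = b (rel R x t') m \<oplus>\<^sub>C lc R C ww m"
     unfolding h_def using main[of "\<tau> m"] linD(1)[OF t(1), of m] t(2)[OF m] m by simp
   qed
   also have "\<dots> = ?cl (b (rel R x t')) \<oplus>\<^sub>?D ?cl (lc R C ww)" by (rule e(5)[OF bx wwr])
   also have "?cl (lc R C ww) = \<zero>\<^sub>?D" using e(4)[OF wwr] wwl by blast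
   finally show ?thesis using e(2)[OF bx] bf[OF rel_in_ker[OF xt]] by simp
  qed
  then show "\<exists>c. (\<forall>s\<in>T. c s \<in>: ?D) \<and> (\<forall>s\<in>T. \<forall>t\<in>T. f (rel R s t) = c s \<ominus>\<^sub>?D t \<odot>\<^sub>?D c (s \<otimes> t))"
   using e(2)[OF hl] by (intro exI[of _ "\<lambda>x. ?cl (h x)"]) blast
 qed
qed

end

section \<open>Transport along bijections\<close>

definition iso_lin :: "('r, 'x) ring_scheme => ('r, 'm, 'y) module_scheme => ('r, 'n, 'z) module_scheme => ('m => 'n) => bool"
 where "iso_lin R C C' j \<longleftrightarrow> lin R C C' j \<and> bij_betw j (carrier C) (carrier C')"

lemma iso_lin_inverse:
 assumes C: "module R C" and j: "iso_lin R C C' j"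
 shows "iso_lin R C' C (the_inv_into (carrier C) j)"
proof -
 interpret C: module R C by fact
 let ?k = "the_inv_into (carrier C) j"
 have b: "inj_on j (carrier C)" "j ` carrier C = carrier C'" and l: "lin R C C' j"
  using j by (auto simp: iso_lin_def bij_betw_def)
 have k: "?k y \<in>: C" "j (?k y) = y" if "y \<in>: C'" for y
  using the_inv_into_into[OF b(1) _ subset_refl] f_the_inv_into_f[OF b(1)] that b(2) by auto
 have kj: "?k (j x) = x" if "x \<in>: C" for x using the_inv_into_f_f[OF b(1) that] .
 have "lin R C' C ?k"
 proof (rule linI)
  fix y assume y: "y \<in>: C'"
  show "?k y \<in>: C" using k(1)[OF y] .
  show "?k (r \<odot>\<^sub>C' y) = r \<odot>\<^sub>C ?k y" if r: "r \<in>: R" for r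
   using kj[of "r \<odot>\<^sub>C ?k y"] linD(3)[OF l r k(1)[OF y]] k[OF y] r by simp
  fix y' assume y': "y' \<in>: C'"
  show "?k (y \<oplus>\<^sub>C' y') = ?k y \<oplus>\<^sub>C ?k y'"
   using kj[of "?k y \<oplus>\<^sub>C ?k y'"] linD(2)[OF l k(1)[OF y] k(1)[OF y']] k[OF y] k[OF y'] by simp
 qed
 then show ?thesis using bij_betw_the_inv_into[of j "carrier C" "carrier C'"] j by (simp add: iso_lin_def)
qed

lemma extends_iso:
 assumes C: "module R C" and j: "iso_lin R C C' j" and e: "extends R M K C'"
 shows "extends R M K C"
 unfolding extends_def
proof (intro allI impI)
 fix f assume f: "lin R (M |: K) C f"
 let ?k = "the_inv_into (carrier C) j"
 have k: "lin R C' C ?k" using iso_lin_inverse[OF C j] by (simp add: iso_lin_def)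
 have jl: "lin R C C' j" and inj: "inj_on j (carrier C)" using j by (auto simp: iso_lin_def bij_betw_def)
 obtain g where g: "lin R M C' g" "\<forall>x\<in>K. g x = j (f x)" using e lin_comp[OF f jl] unfolding extends_def by blast
 have "\<forall>x\<in>K. ?k (g x) = f x" using g(2) the_inv_into_f_f[OF inj] linD(1)[OF f] by simp
 then show "\<exists>g. lin R M C g \<and> (\<forall>x\<in>K. g x = f x)" using lin_comp[OF g(1) k] by blast
qed

text \<open>Strong flatness is tested on modules in one fixed type. By transport of structure, it applies to every module
 that embeds into this type.\<close>

definition transport :: "('m => 'n) => ('r, 'm, 'y) module_scheme => ('r, 'n) module"
 where "transport i C = (let k = the_inv_into (carrier C) i in
  \<lparr>carrier = i ` carrier C, mult = undefined, one = undefined, zero = i \<zero>\<^sub>C,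
   add = (\<lambda>x y. i (k x \<oplus>\<^sub>C k y)), smult = (\<lambda>r x. i (r \<odot>\<^sub>C k x))\<rparr>)"

lemma transport:
 assumes C: "module R C" and i: "inj_on i (carrier C)"
 shows "module R (transport i C)" "iso_lin R C (transport i C) i"
proof -
 interpret C: module R C by fact
 have k: "the_inv_into (carrier C) i (i x) = x" if "x \<in>: C" for x using the_inv_into_f_f[OF i that] .
 have s: "carrier (transport i C) = i ` carrier C" "\<zero>\<^bsub>transport i C\<^esub> = i \<zero>\<^sub>C"
  "\<And>x y. x \<in>: C ==> y \<in>: C ==> i x \<oplus>\<^bsub>transport i C\<^esub> i y = i (x \<oplus>\<^sub>C y)"
  "\<And>r x. x \<in>: C ==> r \<odot>\<^bsub>transport i C\<^esub> i x = i (r \<odot>\<^sub>C x)"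
  by (simp_all add: transport_def Let_def k)
 show "module R (transport i C)"
 proof (rule moduleI)
  show "abelian_group (transport i C)"
  proof (rule abelian_groupI)
   fix y assume "y \<in>: transport i C"
   then obtain x where x: "x \<in>: C" "y = i x" by (auto simp: s)
   show "\<exists>z\<in>carrier (transport i C). z \<oplus>\<^bsub>transport i C\<^esub> y = \<zero>\<^bsub>transport i C\<^esub>"
    using x by (intro bexI[of _ "i (\<ominus>\<^sub>C x)"]) (auto simp: s C.M.l_neg)
  qed (auto simp: s C.M.add.m_ac)
 qed (auto simp: s C.R.is_cring C.smult_l_distr C.smult_r_distr C.smult_assoc1)
 show "iso_lin R C (transport i C) i"
  using i by (auto simp: iso_lin_def bij_betw_def s intro!: linI)
qed

lemma acts_bij_iso:
 assumes C: "module R C" and C': "module R C'" and j: "iso_lin R C C' j" and b: "acts_bij C S" and S: "S \<subseteq> carrier R"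
 shows "acts_bij C' S"
proof (rule acts_bijI[OF C' S])
 have l: "lin R C C' j" "inj_on j (carrier C)" and im: "\<And>y. y \<in>: C' ==> \<exists>x\<in>carrier C. y = j x"
  using j unfolding iso_lin_def bij_betw_def by blast+
 interpret C: module R C by fact
 note lr = lin_all[OF l(1) C C']
 fix s y assume s: "s \<in> S" and y: "y \<in>: C'"
 have sR: "s \<in>: R" using S s by auto
 obtain x where x: "x \<in>: C" "y = j x" using im[OF y] by auto
 obtain z where z: "z \<in>: C" "s \<odot>\<^sub>C z = x" using acts_bijD(1)[OF b s x(1)] by auto
 show "\<exists>z\<in>carrier C'. s \<odot>\<^sub>C' z = y" using z lr(3)[OF sR z(1)] lr(1)[OF z(1)] x by auto
next
 have l: "lin R C C' j" "inj_on j (carrier C)" and im: "\<And>y. y \<in>: C' ==> \<exists>x\<in>carrier C. y = j x"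
  using j unfolding iso_lin_def bij_betw_def by blast+
 interpret C: module R C by fact
 note lr = lin_all[OF l(1) C C']
 fix s y assume s: "s \<in> S" and y: "y \<in>: C'" "s \<odot>\<^sub>C' y = \<zero>\<^sub>C'"
 have sR: "s \<in>: R" using S s by auto
 obtain x where x: "x \<in>: C" "y = j x" using im[OF y(1)] by auto
 have "j (s \<odot>\<^sub>C x) = j \<zero>\<^sub>C" using y(2) x lr sR by simp
 then have "s \<odot>\<^sub>C x = s \<odot>\<^sub>C \<zero>\<^sub>C" using inj_onD[OF l(2)] x sR by simp
 then have "x = \<zero>\<^sub>C" by (rule acts_bijD(2)[OF b s, rotated 2]) (use x in auto)
 then show "y = \<zero>\<^sub>C'" using x lr(4) by simp
qed

lemma killed_iso:
 assumes "module R C" "module R C'" "iso_lin R C C' j" "s \<in>: R" "\<And>x. x \<in>: C ==> s \<odot>\<^sub>C x = \<zero>\<^sub>C"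
  and y: "y \<in>: C'"
 shows "s \<odot>\<^sub>C' y = \<zero>\<^sub>C'"
proof -
 have l: "lin R C C' j" "j ` carrier C = carrier C'" using assms(3) by (auto simp: iso_lin_def bij_betw_def)
 have "y \<in> j ` carrier C" using y l(2) by simp
 then obtain x where x: "x \<in>: C" "y = j x" by auto
 show ?thesis using lin_all(3,4)[OF l(1) assms(1,2)] assms(4,5) x by metis
qed

section \<open>Divisible modules are images of localizations\<close>

definition divisible_by :: "('r, 'm, 'y) module_scheme => 'r set => bool"
 where "divisible_by E T \<longleftrightarrow> (\<forall>t\<in>T. \<forall>y\<in>carrier E. \<exists>z\<in>carrier E. t \<odot>\<^sub>E z = y)"

lemma countable_closure:
 assumes A: "countable A" "A \<subseteq> B" and g: "\<And>x y. x \<in> B ==> y \<in> B ==> countable (g x y) \<and> g x y \<subseteq> B"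
 shows "\<exists>Z. countable Z \<and> A \<subseteq> Z \<and> Z \<subseteq> B \<and> (\<forall>x\<in>Z. \<forall>y\<in>Z. g x y \<subseteq> Z)"
proof -
 define F where "F Z = Z \<union> (\<Union>x\<in>Z. \<Union>y\<in>Z. g x y)" for Z
 define Zn where "Zn n = (F ^^ n) A" for n :: nat
 have n: "countable (Zn n) \<and> Zn n \<subseteq> B" for n
 proof (induction n)
  case (Suc n)
  have "countable (F (Zn n))" unfolding F_def using Suc g by (intro countable_Un countable_UN) blast+
  moreover have "F (Zn n) \<subseteq> B" unfolding F_def using Suc g by blast
  ultimately show ?case by (simp add: Zn_def)
 qed (use A in \<open>simp add: Zn_def\<close>)
 have mono: "Zn n \<subseteq> Zn m" if "n \<le> m" for n m
  by (rule lift_Suc_mono_le[OF _ that]) (auto simp: Zn_def F_def)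
 have "g x y \<subseteq> (\<Union>n. Zn n)" if xy: "x \<in> (\<Union>n. Zn n)" "y \<in> (\<Union>n. Zn n)" for x y
 proof -
  obtain n m where "x \<in> Zn n" "y \<in> Zn m" using xy by auto
  then have "x \<in> Zn (max n m)" "y \<in> Zn (max n m)" using mono[of n "max n m"] mono[of m "max n m"] by auto
  then have "g x y \<subseteq> Zn (Suc (max n m))" by (auto simp: Zn_def F_def)
  then show ?thesis by blast
 qed
 moreover have "A \<subseteq> (\<Union>n. Zn n)" using UN_upper[of 0 UNIV Zn] by (simp add: Zn_def)
 moreover have "countable (\<Union>n. Zn n)" "(\<Union>n. Zn n) \<subseteq> B" using n by (simp, blast)
 ultimately show ?thesis by (intro exI[of _ "\<Union>n. Zn n"]) blast
qed

text \<open>Along an enumeration of a countable \<open>Z\<close>, the elements can be divided out one after the other. Every element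
 is enumerated infinitely often; this takes care of the zero divisors in \<open>Z\<close>, since the relation \<open>z r = z r'\<close>
 forces \<open>r y = r' y\<close> for each \<open>y\<close> which is a multiple of \<open>z\<close>. The sets \<open>A z\<close> restrict the choice of the value at
 \<open>1/z\<close>.\<close>

lemma (in cring) divide_successively:
 assumes Z: "submonoid Z R" "countable Z" and E: "module R E" and A: "\<And>z. z \<in> Z ==> A z \<subseteq> carrier E"
  and start: "y0 \<in> A \<one>" and down: "\<And>z w y. z \<in> Z ==> w \<in> Z ==> y \<in> A (z \<otimes> w) ==> w \<odot>\<^sub>E y \<in> A z"
  and step: "\<And>z u y. z \<in> Z ==> u \<in> Z ==> y \<in> A z ==> \<exists>y'\<in>A (z \<otimes> u). u \<odot>\<^sub>E y' = y"
 shows "\<exists>e. (\<forall>z\<in>Z. e z \<in> A z) \<and> e \<one> = y0 \<and> (\<forall>z\<in>Z. \<forall>w\<in>Z. e z = w \<odot>\<^sub>E e (z \<otimes> w))"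
proof -
 interpret E: module R E by fact
 interpret Z: localized R Z by (rule localizedI[OF Z(1)])
 define zs where "zs n = from_nat_into Z (fst (prod_decode n))" for n
 have Zne: "Z \<noteq> {}" using Z.T_one by blast
 have zsZ: "zs n \<in> Z" for n unfolding zs_def by (rule from_nat_into[OF Zne])
 have often: "\<exists>k\<ge>n. zs k = z" if "z \<in> Z" for z n
  using from_nat_into_to_nat_on[OF Z(2) that] le_prod_encode_2[of n "to_nat_on Z z"]
  by (intro exI[of _ "prod_encode (to_nat_on Z z, n)"]) (simp add: zs_def)
 define g where "g n k = rec_nat \<one> (\<lambda>i q. q \<otimes> zs (n + i)) k" for n k
 have g0: "g n 0 = \<one>" and gS: "g n (Suc k) = g n k \<otimes> zs (n + k)" for n k by (simp_all add: g_def)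
 have gZ: "g n k \<in> Z" for n k by (induction k) (simp_all add: g0 gS zsZ)
 define t where "t n = g 0 n" for n
 have tZ: "t n \<in> Z" for n by (simp add: t_def gZ)
 have tg: "t (n + k) = t n \<otimes> g n k" for n k
 proof (induction k)
  case (Suc k)
  then show ?case using tZ[of n] gZ[of n k] zsZ[of "n + k"]
   by (simp add: g0 gS t_def m_assoc)
 qed (simp add: g0 tZ)
 have "\<exists>Y. \<forall>n. (Y n \<in> A (t n) \<and> (n = 0 --> Y n = y0)) \<and> zs n \<odot>\<^sub>E Y (Suc n) = Y n"
 proof (rule dependent_nat_choice)
  show "\<exists>x. x \<in> A (t 0) \<and> (0 = 0 --> x = y0)" using start by (simp add: t_def g0)
  fix x n assume "x \<in> A (t n) \<and> (n = 0 --> x = y0)"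
  then obtain y where "y \<in> A (t n \<otimes> zs n)" "zs n \<odot>\<^sub>E y = x" using step[OF tZ[of n] zsZ[of n]] by blast
  then show "\<exists>y. (y \<in> A (t (Suc n)) \<and> (Suc n = 0 --> y = y0)) \<and> zs n \<odot>\<^sub>E y = x" by (auto simp: t_def gS)
 qed
 then obtain Y where Y: "\<And>n. Y n \<in> A (t n)" "Y 0 = y0" "\<And>n. zs n \<odot>\<^sub>E Y (Suc n) = Y n" by metis
 have Yc: "Y n \<in>: E" for n using Y(1) A[OF tZ[of n]] by blast
 have Yg: "Y n = g n k \<odot>\<^sub>E Y (n + k)" for n k
 proof (induction k)
  case (Suc k)
  have "g n (Suc k) \<odot>\<^sub>E Y (n + Suc k) = g n k \<odot>\<^sub>E (zs (n + k) \<odot>\<^sub>E Y (Suc (n + k)))"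
   using gZ[of n k] zsZ[of "n + k"] Yc[of "Suc (n + k)"] by (simp add: gS E.smult_assoc1)
  then show ?case using Suc Y(3) by simp
 qed (simp add: g0 Yc)
 have uniq: "a \<odot>\<^sub>E Y n = b \<odot>\<^sub>E Y m" if z: "z \<in> Z" and ab: "a \<in> Z" "b \<in> Z" "z \<otimes> a = t n" "z \<otimes> b = t m" for z a b n m
 proof -
  let ?r = "a \<otimes> g n m" and ?r' = "b \<otimes> g m n"
  have R: "z \<in>: R" "a \<in>: R" "b \<in>: R" "g i j \<in>: R" for i j
   using z ab gZ by auto
  have "z \<otimes> ?r = z \<otimes> ?r'"
   using R tg[of n m] tg[of m n] ab by (simp add: m_assoc[symmetric] add.commute)
  obtain k where k: "k \<ge> n + m" "zs k = z" using often[OF z] by blast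
  define j where "j = k - (n + m)"
  have YN: "Y (n + m) = (g (n + m) j \<otimes> z) \<odot>\<^sub>E Y (Suc k)"
   using Yg[of "n + m" "Suc j"] k by (simp add: gS j_def)
  have *: "c \<odot>\<^sub>E Y (n + m) = (g (n + m) j \<otimes> (z \<otimes> c)) \<odot>\<^sub>E Y (Suc k)" if "c \<in>: R" for c
   unfolding YN using that R Yc by (simp add: E.smult_assoc1[symmetric] m_ac)
  have "?r \<odot>\<^sub>E Y (n + m) = ?r' \<odot>\<^sub>E Y (n + m)"
   using R \<open>z \<otimes> ?r = z \<otimes> ?r'\<close> by (simp add: *)
  then show ?thesis using Yg[of n m] Yg[of m n] R Yc by (simp add: E.smult_assoc1 add.commute)
 qed
 have ex: "\<exists>x. \<exists>n. \<exists>a\<in>Z. z \<otimes> a = t n \<and> x = a \<odot>\<^sub>E Y n" if z: "z \<in> Z" for z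
 proof -
  obtain k where "zs k = z" using often[OF z] by blast
  then have "z \<otimes> t k = t (Suc k)" using tZ[of k] z by (simp add: t_def gS m_comm)
  then show ?thesis using tZ by blast
 qed
 define e where "e z = (SOME x. \<exists>n. \<exists>a\<in>Z. z \<otimes> a = t n \<and> x = a \<odot>\<^sub>E Y n)" for z
 have e: "\<exists>n. \<exists>a\<in>Z. z \<otimes> a = t n \<and> e z = a \<odot>\<^sub>E Y n" if "z \<in> Z" for z
  unfolding e_def using someI_ex[OF ex[OF that]] .
 have "e z \<in> A z" if z: "z \<in> Z" for z
 proof -
  obtain n a where "a \<in> Z" "z \<otimes> a = t n" "e z = a \<odot>\<^sub>E Y n" using e[OF z] by auto
  then show ?thesis using down[OF z, of a "Y n"] Y(1)[of n] by simp
 qed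
 moreover have "e \<one> = y0"
 proof -
  obtain n a where a: "a \<in> Z" "\<one> \<otimes> a = t n" "e \<one> = a \<odot>\<^sub>E Y n" using e[OF Z.T_one] by auto
  then show ?thesis using uniq[OF Z.T_one a(1) Z.T_one a(2), of 0] Yc[of 0] Y(2) by (simp add: t_def g0)
 qed
 moreover have "e z = w \<odot>\<^sub>E e (z \<otimes> w)" if z: "z \<in> Z" "w \<in> Z" for z w
 proof -
  obtain n a where a: "a \<in> Z" "z \<otimes> a = t n" "e z = a \<odot>\<^sub>E Y n" using e[OF z(1)] by auto
  obtain m b where b: "b \<in> Z" "z \<otimes> w \<otimes> b = t m" "e (z \<otimes> w) = b \<odot>\<^sub>E Y m" using e[of "z \<otimes> w"] z by auto
  have "z \<otimes> (w \<otimes> b) = t m" using b z by (simp add: m_assoc)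
  then have "e z = (w \<otimes> b) \<odot>\<^sub>E Y m" using uniq[OF z(1) a(1) _ a(2)] a(3) b z by simp
  then show ?thesis using b z Yc by (simp add: E.smult_assoc1)
 qed
 ultimately show ?thesis by blast
qed

context localized begin

lemma divisible_countable:
 assumes E: "module R E" and d: "divisible_by E T" and c: "countable T" and y: "y \<in>: E"
 shows "\<exists>e\<in>carrier (loc_hom R T E). e \<one> = y"
proof -
 interpret E: module R E by fact
 have "\<exists>e. (\<forall>z\<in>T. e z \<in>: E) \<and> e \<one> = y \<and> (\<forall>z\<in>T. \<forall>w\<in>T. e z = w \<odot>\<^sub>E e (z \<otimes> w))"
  by (rule divide_successively[OF T c E]) (use y d in \<open>simp_all add: divisible_by_def\<close>)
 then obtain e where e: "\<forall>z\<in>T. e z \<in>: E" "e \<one> = y" "\<forall>z\<in>T. \<forall>w\<in>T. e z = w \<odot>\<^sub>E e (z \<otimes> w)" by blast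
 have "restrict e T \<in>: loc_hom R T E" by (rule loc_hom_memI) (use e in blast)+
 then show ?thesis using e(2) by (intro bexI[of _ "restrict e T"]) auto
qed

end

locale section_loc = localized +
 fixes \<sigma> assumes sec: "loc_section R T \<sigma>"
begin

lemma sec_lin: "lin R (G |: L) (FM (T \<times> T)) \<sigma>"
 and sec_id: "l \<in> L ==> relations R T (\<sigma> l) = l"
 using sec by (auto simp: loc_section_def)

lemmas sec_simps = lin_sub[OF sec_lin free_T free_is_module loc_ker_submodule]
lemmas L_simps = submoduleD[OF loc_ker_submodule free_T]

definition span_of :: "'a set => ('a \<times> 'a) set set"
 where "span_of X = \<pi> ` carrier (FM X)"

definition restr :: "'a set => ('a => 'a) => 'a => 'a"
 where "restr X p = (\<lambda>x. if x \<in> X then p x else \<zero>)"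

text \<open>A set of denominators is closed if the fractions span a subring and if the section respects it. Then the
 quotient of \<open>T\<^sup>-\<^sup>1R\<close> by this subring has again projective dimension at most one.\<close>

definition closed_denoms :: "'a set => bool"
 where "closed_denoms X \<longleftrightarrow> X \<subseteq> T \<and> \<one> \<in> X \<and> (\<forall>x\<in>X. \<forall>y\<in>X. fr \<one> (x \<otimes> y) \<in> span_of X) \<and>
  (\<forall>l\<in>L. l \<in>: FM X --> (\<forall>a b. \<sigma> l (a, b) \<noteq> \<zero> --> a \<in> X \<and> a \<otimes> b \<in> X))"

lemma free_in_G: "X \<subseteq> T ==> p \<in>: FM X ==> p \<in>: G"
 using free_mono by blast

lemma free_same_ops:
 "a \<oplus>\<^bsub>FM X\<^esub> b = a \<oplus>\<^sub>G b" "r \<odot>\<^bsub>FM X\<^esub> a = r \<odot>\<^sub>G a" "\<zero>\<^bsub>FM X\<^esub> = \<zero>\<^sub>G"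
 by (simp_all add: free_ops)

lemma free_minus_same:
 "X \<subseteq> T ==> p \<in>: FM X ==> q \<in>: FM X ==> p \<ominus>\<^bsub>FM X\<^esub> q = p \<ominus>\<^sub>G q"
 using free_in_G[of X p] free_in_G[of X q] by (simp add: free_minus(1)[of p X] free_minus(1)[of p T])

lemma proj_lin: "X \<subseteq> T ==> lin R (FM X) QM \<pi>"
 using loc_proj_lin free_in_G[of X] by (simp add: lin_def free_same_ops[where X = X])

lemma span_submodule: "X \<subseteq> T ==> submodule (span_of X) R QM"
 unfolding span_of_def by (rule image_submodule[OF proj_lin free_is_module loc_module])

lemma restr_support: "{x. restr X p x \<noteq> \<zero>} \<subseteq> {x. p x \<noteq> \<zero>}"
 by (auto simp: restr_def)

lemma restr_mem: "p \<in>: G ==> restr X p \<in>: FM X"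
 using finite_subset[OF restr_support[of X p]] by (auto simp: free_module_def) (auto simp: restr_def)

lemma restr_lin: "lin R G G (restr X)"
proof (rule linI)
 show "restr X p \<in>: G" if "p \<in>: G" for p
  using that finite_subset[OF restr_support[of X p]] by (auto simp: free_module_def) (auto simp: restr_def)
qed (auto simp: free_ops restr_def)

lemma restr_id: "p \<in>: FM X ==> restr X p = p"
 by (auto simp: restr_def free_module_def)

lemma mult_lin:
 assumes "q \<in>: Q"
 shows "lin R QM QM (\<lambda>z. z \<otimes>\<^sub>Q q)"
proof -
 interpret Q: cring Q by (rule loc_cring)
 show ?thesis using assms
  by (intro linI) (auto simp: loc_module_simps Q.l_distr Q.m_assoc ring_hom_closed[OF loc_map_hom])
qed

lemma smult_frac: "r \<in>: R ==> a \<in>: R ==> s \<in> T ==> r \<odot>\<^sub>QM fr a s = fr (r \<otimes> a) s"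
 by (simp add: loc_module_simps loc_map_mult)

lemma frac_cancel: "r \<in>: R ==> s \<in> T ==> u \<in> T ==> fr (r \<otimes> u) (s \<otimes> u) = fr r s"
 by (rule frac_eqI) (auto simp: m_ac)

lemma free_sub_closed:
 assumes "X \<subseteq> T" "p \<in>: FM X"
 shows "r \<in>: R ==> r \<odot>\<^sub>G p \<in>: FM X" "q \<in>: FM X ==> p \<ominus>\<^sub>G q \<in>: FM X"
proof -
 interpret FX: module R "FM X" by (rule free_is_module)
 show "r \<in>: R ==> r \<odot>\<^sub>G p \<in>: FM X" "q \<in>: FM X ==> p \<ominus>\<^sub>G q \<in>: FM X"
  using assms FX.smult_closed[of r p] FX.minus_closed[of p q] by (simp_all add: free_minus_same free_ops)
qed

lemma affine_submodule:
 assumes N: "submodule N R QM" and q: "q0 \<in>: QM" and s: "s \<in>: R"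
  and J: "J \<subseteq> carrier R" "\<zero> \<in> J" "\<And>c d. c \<in> J ==> d \<in> J ==> c \<oplus> d \<in> J" "\<And>a c. a \<in>: R ==> c \<in> J ==> a \<otimes> c \<in> J"
 shows "submodule {c \<odot>\<^sub>QM q0 \<oplus>\<^sub>QM s \<odot>\<^sub>QM n | c n. c \<in> J \<and> n \<in> N} R QM" (is "submodule ?W R QM")
proof (rule submoduleI'[OF loc_module])
 interpret QM: module R QM by (rule loc_module)
 note Nr = submoduleD[OF N loc_module]
 have cl: "c \<in>: R" if "c \<in> J" for c using that J(1) by auto
 show "?W \<subseteq> carrier QM" using cl Nr(1) q s by auto
 have "\<zero>\<^sub>QM = \<zero> \<odot>\<^sub>QM q0 \<oplus>\<^sub>QM s \<odot>\<^sub>QM \<zero>\<^sub>QM" using q s by simp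
 then show "\<zero>\<^sub>QM \<in> ?W" using Nr(2) J(2) by blast
 fix x assume "x \<in> ?W"
 then obtain r n where x: "r \<in> J" "n \<in> N" "x = r \<odot>\<^sub>QM q0 \<oplus>\<^sub>QM s \<odot>\<^sub>QM n" by auto
 have "a \<odot>\<^sub>QM x = (a \<otimes> r) \<odot>\<^sub>QM q0 \<oplus>\<^sub>QM s \<odot>\<^sub>QM (a \<odot>\<^sub>QM n)" if "a \<in>: R" for a
  unfolding x(3) using that cl[OF x(1)] Nr(1)[OF x(2)] q s by algebra
 then show "a \<odot>\<^sub>QM x \<in> ?W" if "a \<in>: R" for a using that Nr(4)[OF that x(2)] J(4)[OF that x(1)] by blast
 fix y assume "y \<in> ?W"
 then obtain r' n' where y: "r' \<in> J" "n' \<in> N" "y = r' \<odot>\<^sub>QM q0 \<oplus>\<^sub>QM s \<odot>\<^sub>QM n'" by auto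
 have "x \<oplus>\<^sub>QM y = (r \<oplus> r') \<odot>\<^sub>QM q0 \<oplus>\<^sub>QM s \<odot>\<^sub>QM (n \<oplus>\<^sub>QM n')"
  unfolding x(3) y(3) using cl[OF x(1)] cl[OF y(1)] Nr(1)[OF x(2)] Nr(1)[OF y(2)] q s by algebra
 then show "x \<oplus>\<^sub>QM y \<in> ?W" using Nr(3)[OF x(2) y(2)] J(3)[OF x(1) y(1)] by blast
qed

lemma sec_apply:
 "l \<in> L ==> \<sigma> l i \<in>: R" "r \<in>: R ==> l \<in> L ==> \<sigma> (r \<odot>\<^sub>G l) i = r \<otimes> \<sigma> l i"
 "l \<in> L ==> l' \<in> L ==> \<sigma> (l \<oplus>\<^sub>G l') i = \<sigma> l i \<oplus> \<sigma> l' i"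
 "l \<in> L ==> l' \<in> L ==> \<sigma> (l \<ominus>\<^sub>G l') i = \<sigma> l i \<ominus> \<sigma> l' i"
proof -
 show "l \<in> L ==> \<sigma> l i \<in>: R" using sec_simps(1)[of l] by (cases i) (simp add: free_module_def)
 show "r \<in>: R ==> l \<in> L ==> \<sigma> (r \<odot>\<^sub>G l) i = r \<otimes> \<sigma> l i" using sec_simps(3)[of r l] by (simp add: free_ops)
 show "l \<in> L ==> l' \<in> L ==> \<sigma> (l \<oplus>\<^sub>G l') i = \<sigma> l i \<oplus> \<sigma> l' i" using sec_simps(2)[of l l'] by (simp add: free_ops)
 show "l \<in> L ==> l' \<in> L ==> \<sigma> (l \<ominus>\<^sub>G l') i = \<sigma> l i \<ominus> \<sigma> l' i"
  using sec_simps(6)[of l l'] free_minus(1)[OF sec_simps(1)[of l] sec_simps(1)[of l']] by simp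
qed

context
 fixes X assumes X: "closed_denoms X"
begin

lemma XT: "X \<subseteq> T" and X1: "\<one> \<in> X" and Xmult: "x \<in> X ==> y \<in> X ==> fr \<one> (x \<otimes> y) \<in> span_of X"
 and Xsec: "l \<in> L ==> l \<in>: FM X ==> \<sigma> l (a, b) \<noteq> \<zero> ==> a \<in> X \<and> a \<otimes> b \<in> X"
 using X by (auto simp: closed_denoms_def)

lemmas span_simps = submoduleD[OF span_submodule[OF XT] loc_module]

lemma span_gen: "x \<in> X ==> fr \<one> x \<in> span_of X"
 unfolding span_of_def using loc_proj_gen XT by (metis free_gen_closed imageI subsetD)

lemma span_all:
 assumes H: "submodule H R QM" and g: "\<And>x. x \<in> X ==> fr \<one> x \<in> H"
 shows "span_of X \<subseteq> H"
proof -
 have "{p \<in> carrier (FM X). \<pi> p \<in> H} = carrier (FM X)"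
  by (rule free_submodule_all[OF preimage_submodule[OF proj_lin[OF XT] free_is_module loc_module H]])
   (use g XT in auto)
 then show ?thesis by (auto simp: span_of_def)
qed

lemma span_mult:
 assumes "n \<in> span_of X" "n' \<in> span_of X"
 shows "n \<otimes>\<^sub>Q n' \<in> span_of X"
proof -
 interpret Q: cring Q by (rule loc_cring)
 have N: "span_of X \<subseteq> carrier Q" using span_simps(1) by (auto simp: loc_module_simps)
 have pre: "submodule {z \<in> carrier QM. z \<otimes>\<^sub>Q q \<in> span_of X} R QM" if "q \<in>: Q" for q
  by (rule preimage_submodule[OF mult_lin[OF that] loc_module loc_module span_submodule[OF XT]])
 have 1: "m \<otimes>\<^sub>Q fr \<one> x \<in> span_of X" if x: "x \<in> X" and m: "m \<in> span_of X" for m x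
 proof -
  have xT: "x \<in> T" using x XT by auto
  have "span_of X \<subseteq> {z \<in> carrier QM. z \<otimes>\<^sub>Q fr \<one> x \<in> span_of X}"
   by (rule span_all[OF pre]) (use x xT XT Xmult in \<open>auto simp: loc_module_simps loc_mult\<close>)
  then show ?thesis using m by blast
 qed
 have "span_of X \<subseteq> {z \<in> carrier QM. z \<otimes>\<^sub>Q n \<in> span_of X}"
 proof (rule span_all[OF pre])
  fix x assume x: "x \<in> X"
  have c: "fr \<one> x \<in>: Q" using x XT by auto
  show "fr \<one> x \<in> {z \<in> carrier QM. z \<otimes>\<^sub>Q n \<in> span_of X}"
   using 1[OF x assms(1)] c N assms(1) by (simp add: loc_module_simps Q.m_comm[of "fr \<one> x" n] subset_iff)
 qed (use N assms in auto)
 then have "n' \<otimes>\<^sub>Q n \<in> span_of X" using assms(2) by blast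
 then show ?thesis using Q.m_comm[of n n'] N assms by (simp add: subset_iff)
qed

lemma span_mult_frac: "fr \<one> s \<in> span_of X ==> fr \<one> t \<in> span_of X ==> s \<in> T ==> t \<in> T ==> fr \<one> (s \<otimes> t) \<in> span_of X"
 using span_mult[of "fr \<one> s" "fr \<one> t"] by (simp add: loc_mult)

lemma span_denominator:
 assumes "n \<in> span_of X"
 shows "\<exists>z\<in>T. fr \<one> z \<in> span_of X \<and> (\<exists>r\<in>carrier R. n = fr r z)"
proof -
 let ?W = "{q \<in> carrier QM. \<exists>z\<in>T. fr \<one> z \<in> span_of X \<and> (\<exists>r\<in>carrier R. q = fr r z)}"
 have "submodule ?W R QM"
 proof (rule submoduleI'[OF loc_module])
  interpret QM: module R QM by (rule loc_module)
  have "\<zero>\<^sub>QM = fr \<zero> \<one>" by (simp add: loc_module_simps(2) loc_zero)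
  then show "\<zero>\<^sub>QM \<in> ?W" using QM.zero_closed span_gen[OF X1] T_one zero_closed by blast
  fix x assume "x \<in> ?W"
  then obtain z r where x: "x \<in>: QM" "z \<in> T" "fr \<one> z \<in> span_of X" "r \<in>: R" "x = fr r z" by auto
  show "a \<odot>\<^sub>QM x \<in> ?W" if a: "a \<in>: R" for a
  proof (intro CollectI conjI)
   show "a \<odot>\<^sub>QM x \<in>: QM" by (rule QM.smult_closed[OF a x(1)])
   have "a \<odot>\<^sub>QM x = fr (a \<otimes> r) z" using smult_frac[OF a x(4,2)] x(5) by simp
   then show "\<exists>z\<in>T. fr \<one> z \<in> span_of X \<and> (\<exists>r\<in>carrier R. a \<odot>\<^sub>QM x = fr r z)"
    using x(2,3,4) a by (intro bexI[of _ z] conjI bexI[of _ "a \<otimes> r"]) simp_all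
  qed
  fix y assume "y \<in> ?W"
  then obtain z' r' where y: "y \<in>: QM" "z' \<in> T" "fr \<one> z' \<in> span_of X" "r' \<in>: R" "y = fr r' z'" by auto
  have "x \<oplus>\<^sub>QM y = fr (z' \<otimes> r \<oplus> z \<otimes> r') (z \<otimes> z')" using x y by (simp add: loc_module_simps loc_add)
  moreover have "z' \<otimes> r \<oplus> z \<otimes> r' \<in>: R" "z \<otimes> z' \<in> T" using x y by auto
  ultimately show "x \<oplus>\<^sub>QM y \<in> ?W" using span_mult_frac[OF x(3) y(3) x(2) y(2)] QM.a_closed[OF x(1) y(1)] by blast
 qed auto
 then have "span_of X \<subseteq> ?W" by (rule span_all) (use span_gen XT in \<open>auto simp: loc_module_simps\<close>)
 then show ?thesis using assms by blast
qed

text \<open>The images of the relations in the spanned subring, after restriction to \<open>X\<close>. The section expresses the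
 restriction of any relation by these.\<close>

definition nvec :: "'a \<times> 'a => ('a \<times> 'a) set"
 where "nvec = (\<lambda>(a, b). \<pi> (restr X (rel R a b)))"

lemma nvec_span: "i \<in> T \<times> T ==> nvec i \<in> span_of X"
 using restr_mem[of _ X] rel_closed[of _ T] by (auto simp: nvec_def span_of_def)

lemma nvec_zero: "a \<in> X ==> b \<in> T ==> a \<otimes> b \<in> X ==> nvec (a, b) = \<zero>\<^sub>QM"
 using rel_in_ker[of a b] XT rel_closed[of a X b] by (auto simp: nvec_def restr_id loc_ker_def mod_ker_def)

lemma nvec_closed: "i \<in> T \<times> T ==> nvec i \<in>: QM"
 using nvec_span span_simps(1) by blast

lemma nvec_lin: "lin R (FM (T \<times> T)) QM (lc R QM nvec)"
 by (rule lc_lin[OF loc_module nvec_closed])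

lemma sec_restr:
 assumes l: "l \<in> L"
 shows "lc R QM nvec (\<sigma> l) = \<pi> (restr X l)"
proof -
 have "lc R QM nvec q = \<pi> (restr X (relations R T q))" if q: "q \<in>: FM (T \<times> T)" for q
  by (rule free_ext[OF nvec_lin lin_comp[OF lin_comp[OF relations_lin restr_lin] loc_proj_lin] loc_module _ q])
   (auto simp: lc_gen[OF loc_module] nvec_closed relations_gen nvec_def[THEN fun_cong, of "(a, b)" for a b])
 from this[of "\<sigma> l"] show ?thesis using sec_simps(1)[OF l] sec_id[OF l] by simp
qed

lemma sec_outside:
 "k \<in> L ==> k \<in>: FM X ==> \<not> (fst i \<in> X \<and> fst i \<otimes> snd i \<in> X) ==> \<sigma> k i = \<zero>"
 using Xsec[of k "fst i" "snd i"] by auto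

lemma span_common_denominator:
 assumes "finite J" "J \<subseteq> T \<times> T"
 shows "\<exists>t\<in>T. fr \<one> t \<in> span_of X \<and> (\<forall>i\<in>J. \<exists>r\<in>carrier R. nvec i = fr r t)"
 using assms
proof (induction J rule: finite_induct)
 case empty
 then show ?case using span_gen[OF X1] by (intro bexI[of _ \<one>]) auto
next
 case (insert j J)
 then obtain t0 where t0: "t0 \<in> T" "fr \<one> t0 \<in> span_of X" "\<forall>i\<in>J. \<exists>r\<in>carrier R. nvec i = fr r t0" by auto
 obtain z r where z: "z \<in> T" "fr \<one> z \<in> span_of X" "r \<in>: R" "nvec j = fr r z"
  using span_denominator[OF nvec_span, of j] insert.prems by auto
 have "nvec j = fr (r \<otimes> t0) (t0 \<otimes> z)" using z t0 frac_cancel[of r z t0] by (simp add: m_comm)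
 moreover have "\<exists>r\<in>carrier R. nvec i = fr r (t0 \<otimes> z)" if i: "i \<in> J" for i
 proof -
  obtain r where "r \<in>: R" "nvec i = fr r t0" using t0 i by auto
  then show ?thesis using frac_cancel[of r t0 z] t0 z by (intro bexI[of _ "r \<otimes> z"]) auto
 qed
 ultimately show ?case using span_mult_frac[OF t0(2) z(2) t0(1) z(1)] t0 z by (intro bexI[of _ "t0 \<otimes> z"]) auto
qed

text \<open>Let \<open>N\<close> be the spanned subring. The elements \<open>r\<close> with \<open>r/s \<in> N\<close> form the kernel of the map from \<open>R\<close> to
 \<open>N/sN\<close>. By the choice of \<open>X\<close>, the \<open>R/sR\<close>-module \<open>N/sN\<close> is projective, and as it is a localization of \<open>R/sR\<close>, this
 kernel is generated by \<open>s\<close> and an element \<open>\<epsilon>\<close> which is idempotent modulo \<open>s\<close>. Explicitly, the section gives a dual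
 basis: if \<open>p\<close> represents an element \<open>n\<close> of \<open>N\<close> and \<open>g\<close> represents \<open>n/s\<close>, then \<open>n\<close> is congruent modulo \<open>sN\<close> to the
 combination of the vectors \<open>nvec i\<close> with the coefficients of \<open>\<sigma> (p - s g)\<close>. These coefficients for \<open>n = 1\<close> select
 finitely many \<open>i\<close>. If \<open>t\<close> is a common denominator of their vectors, then the same \<open>i\<close> suffice for \<open>n = 1/t\<close>, so
 that \<open>1/t\<close> is congruent to a multiple \<open>- c/t\<close> of itself; now \<open>\<epsilon>\<close> is \<open>1 + c\<close>. The same argument shows that \<open>R\<close> maps
 onto \<open>N/sN\<close>, which is the second statement.\<close>

lemma span_idempotent:
 assumes s: "s \<in> T"
 shows "\<exists>\<epsilon>\<in>carrier R. fr \<epsilon> s \<in> span_of X \<and> (\<forall>r\<in>carrier R. fr r s \<in> span_of X --> (\<exists>c\<in>carrier R. r = r \<otimes> \<epsilon> \<oplus> s \<otimes> c))"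
  and "u \<in> T ==> fr \<one> u \<in> span_of X ==> \<exists>r\<in>carrier R. \<exists>m\<in>span_of X. fr \<one> u = r \<odot>\<^sub>QM fr \<one> \<one> \<oplus>\<^sub>QM s \<odot>\<^sub>QM m"
proof -
 interpret G: module R G by (rule free_T)
 interpret QM: module R QM by (rule loc_module)
 interpret Q: cring Q by (rule loc_cring)
 let ?N = "span_of X" and ?Y = "\<lambda>i. fst i \<in> X \<and> fst i \<otimes> snd i \<in> X"
 have sR: "s \<in>: R" using s by simp
 have g: "gen s \<in>: G" "gen \<one> \<in>: G" using s by auto
 note eqL = ker_diff_iff[THEN iffD2]
 define l1 where "l1 = s \<odot>\<^sub>G gen s \<ominus>\<^sub>G gen \<one>"
 have l1: "l1 \<in> L" unfolding l1_def using s g frac_eqI[of s s \<one> \<one>] by (intro eqL) (auto simp: loc_proj_gen_smult)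
 have "finite {i. \<sigma> l1 i \<noteq> \<zero>}" "{i. \<sigma> l1 i \<noteq> \<zero>} \<subseteq> T \<times> T" using sec_simps(1)[OF l1] by (auto simp: free_module_def)
 from span_common_denominator[OF this] obtain t where t: "t \<in> T" "fr \<one> t \<in> ?N"
  "\<And>i. \<sigma> l1 i \<noteq> \<zero> ==> \<exists>r\<in>carrier R. nvec i = fr r t" by auto
 have tR: "t \<in>: R" using t by simp
 define J where "J = {c \<in> carrier R. \<forall>r\<in>carrier R. fr r s \<in> ?N --> (\<exists>d\<in>carrier R. r \<otimes> c = s \<otimes> d)}"
 have Jadd: "c \<oplus> c' \<in> J" if c: "c \<in> J" "c' \<in> J" for c c'
 proof -
  have "\<exists>d\<in>carrier R. r \<otimes> (c \<oplus> c') = s \<otimes> d" if r: "r \<in>: R" "fr r s \<in> ?N" for r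
  proof -
   obtain d d' where "d \<in>: R" "r \<otimes> c = s \<otimes> d" "d' \<in>: R" "r \<otimes> c' = s \<otimes> d'" using c r unfolding J_def by blast
   then show ?thesis using c r sR by (intro bexI[of _ "d \<oplus> d'"]) (auto simp: J_def r_distr)
  qed
  then show ?thesis using c by (auto simp: J_def)
 qed
 have Jmult: "a \<otimes> c \<in> J" if a: "a \<in>: R" and c: "c \<in> J" for a c
 proof -
  have "\<exists>d\<in>carrier R. r \<otimes> (a \<otimes> c) = s \<otimes> d" if r: "r \<in>: R" "fr r s \<in> ?N" for r
  proof -
   obtain d where "d \<in>: R" "r \<otimes> c = s \<otimes> d" using c r by (auto simp: J_def)
   then show ?thesis using a c r sR by (intro bexI[of _ "a \<otimes> d"]) (auto simp: J_def m_lcomm)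
  qed
  then show ?thesis using a c by (auto simp: J_def)
 qed
 have J0: "\<zero> \<in> J" using sR by (auto simp: J_def intro!: bexI[of _ \<zero>])
 define W where "W = {c \<odot>\<^sub>QM fr \<one> t \<oplus>\<^sub>QM s \<odot>\<^sub>QM n | c n. c \<in> J \<and> n \<in> ?N}"
 have tc: "fr \<one> t \<in>: QM" using t by (simp add: loc_module_simps)
 have W: "submodule W R QM"
  unfolding W_def by (rule affine_submodule[OF span_submodule[OF XT] tc sR _ J0 Jadd Jmult]) (auto simp: J_def)
 have JW: "c \<odot>\<^sub>QM fr \<one> t \<in> W" if c: "c \<in> J" for c
 proof -
  have "c \<odot>\<^sub>QM fr \<one> t = c \<odot>\<^sub>QM fr \<one> t \<oplus>\<^sub>QM s \<odot>\<^sub>QM \<zero>\<^sub>QM" using c tc sR by (simp add: J_def)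
  then show ?thesis using c span_simps(2) unfolding W_def by blast
 qed
 have NW: "s \<odot>\<^sub>QM n \<in> W" if n: "n \<in> ?N" for n
 proof -
  have "s \<odot>\<^sub>QM n = \<zero> \<odot>\<^sub>QM fr \<one> t \<oplus>\<^sub>QM s \<odot>\<^sub>QM n" using tc sR span_simps(1)[OF n] by simp
  then show ?thesis using n J0 unfolding W_def by blast
 qed
 have inv: "\<exists>c\<in>J. \<exists>m\<in>?N. fr \<one> u \<oplus>\<^sub>QM c \<odot>\<^sub>QM fr \<one> t = s \<odot>\<^sub>QM m" if u: "u \<in> T" "fr \<one> u \<in> ?N" for u
 proof -
  have uR: "u \<in>: R" using u by simp
  obtain p where p: "p \<in>: FM X" "\<pi> p = fr \<one> u" using u(2) by (auto simp: span_of_def)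
  have pG: "p \<in>: G" by (rule free_in_G[OF XT p(1)])
  have gsu: "gen (s \<otimes> u) \<in>: G" using s u by auto
  define l0 where "l0 = s \<odot>\<^sub>G gen (s \<otimes> u) \<ominus>\<^sub>G p"
  have l0: "l0 \<in> L"
   unfolding l0_def using gsu pG sR s u p frac_eqI[of s "s \<otimes> u" \<one> u] by (intro eqL) (auto simp: loc_proj_gen_smult m_comm)
  \<comment> \<open>a multiple of \<open>l0\<close> by an element of the kernel is a multiple of \<open>s\<close>, up to relations among the denominators in \<open>X\<close>\<close>
  have coeffJ: "\<sigma> l0 i \<in> J" if i: "\<not> ?Y i" for i
  proof -
   have "\<exists>d\<in>carrier R. r \<otimes> \<sigma> l0 i = s \<otimes> d" if r: "r \<in>: R" "fr r s \<in> ?N" for r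
   proof -
    have "fr r (s \<otimes> u) \<in> ?N" using span_mult[OF r(2) u(2)] r s u by (simp add: loc_mult)
    then obtain q where q: "q \<in>: FM X" "\<pi> q = fr r (s \<otimes> u)" by (auto simp: span_of_def)
    have qG: "q \<in>: G" by (rule free_in_G[OF XT q(1)])
    define l where "l = r \<odot>\<^sub>G gen (s \<otimes> u) \<ominus>\<^sub>G q"
    define k where "k = s \<odot>\<^sub>G q \<ominus>\<^sub>G r \<odot>\<^sub>G p"
    have l: "l \<in> L" unfolding l_def using r q qG gsu s u by (intro eqL) (auto simp: loc_proj_gen_smult)
    have k: "k \<in> L" unfolding k_def using r p q pG qG sR s u frac_eqI[of "s \<otimes> r" "s \<otimes> u" r u]
     by (intro eqL) (auto simp: loc_proj_simps smult_frac m_ac)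
    have kX: "k \<in>: FM X" unfolding k_def using p q r sR by (intro free_sub_closed[OF XT]) auto
    have "r \<odot>\<^sub>G (s \<odot>\<^sub>G e \<ominus>\<^sub>G p) = s \<odot>\<^sub>G (r \<odot>\<^sub>G e \<ominus>\<^sub>G q) \<oplus>\<^sub>G (s \<odot>\<^sub>G q \<ominus>\<^sub>G r \<odot>\<^sub>G p)" if "e \<in>: G" for e
     using that pG qG r(1) sR by algebra
    from this[OF gsu] have "\<sigma> (r \<odot>\<^sub>G l0) i = \<sigma> (s \<odot>\<^sub>G l \<oplus>\<^sub>G k) i" by (simp add: l0_def l_def k_def)
    then have "r \<otimes> \<sigma> l0 i = s \<otimes> \<sigma> l i"
     using l0 l k r sR L_simps(4)[OF sR l] sec_outside[OF k kX i] by (simp add: sec_apply)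
    then show ?thesis using sec_apply(1)[OF l] by blast
   qed
   then show ?thesis using sec_apply(1)[OF l0] by (auto simp: J_def)
  qed
  have sc: "\<sigma> l0 \<in>: FM (T \<times> T)" by (rule sec_simps(1)[OF l0])
  have "lc R QM nvec (\<sigma> l0) \<in> W"
  proof (rule lc_in_submodule[OF loc_module W sc nvec_closed])
   fix i assume i: "i \<in> T \<times> T"
   note nc = nvec_closed[OF i] and si = sec_apply(1)[OF l0, of i]
   show "\<sigma> l0 i \<odot>\<^sub>QM nvec i \<in> W"
   proof (cases "?Y i")
    case True
    then show ?thesis using nvec_zero[of "fst i" "snd i"] i si submoduleD(2)[OF W loc_module] by auto
   next
    case Y: False
    show ?thesis
    proof (cases "\<sigma> l1 i = \<zero>")
     case False
     then obtain r where r: "r \<in>: R" "nvec i = fr r t" using t(3) by blast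
     have "\<sigma> l0 i \<odot>\<^sub>QM nvec i = (r \<otimes> \<sigma> l0 i) \<odot>\<^sub>QM fr \<one> t" using r si t by (simp add: smult_frac m_comm)
     then show ?thesis using JW[OF Jmult[OF r(1) coeffJ[OF Y]]] by simp
    next
     case True
     define k where "k = u \<odot>\<^sub>G p \<ominus>\<^sub>G gen \<one>"
     have k: "k \<in> L" unfolding k_def using g pG uR u p frac_eqI[of u u \<one> \<one>]
      by (intro eqL) (auto simp: loc_proj_simps smult_frac)
     have kX: "k \<in>: FM X" unfolding k_def using p uR X1 by (intro free_sub_closed[OF XT]) auto
     have rl: "rel R s u \<in> L" by (rule rel_in_ker[OF s u(1)])
     have "u \<odot>\<^sub>G (s \<odot>\<^sub>G c \<ominus>\<^sub>G p) = ((s \<odot>\<^sub>G a \<ominus>\<^sub>G b) \<ominus>\<^sub>G s \<odot>\<^sub>G (a \<ominus>\<^sub>G u \<odot>\<^sub>G c)) \<ominus>\<^sub>G (u \<odot>\<^sub>G p \<ominus>\<^sub>G b)"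
      if "a \<in>: G" "b \<in>: G" "c \<in>: G" for a b c using that pG sR uR by algebra
     from this[OF g gsu] have "\<sigma> (u \<odot>\<^sub>G l0) i = \<sigma> ((l1 \<ominus>\<^sub>G s \<odot>\<^sub>G rel R s u) \<ominus>\<^sub>G k) i"
      by (simp only: l0_def l1_def k_def rel_eq[OF s T_mult[OF s u(1)] uR])
     then have te: "u \<otimes> \<sigma> l0 i = s \<otimes> (\<ominus> \<sigma> (rel R s u) i)"
      using l0 l1 k rl uR sR L_simps(4)[OF sR rl] L_simps(6)[OF l1 L_simps(4)[OF sR rl]] sec_outside[OF k kX Y] True sec_apply(1)[OF rl, of i]
      by (simp add: sec_apply minus_eq minus_zero r_minus)
     let ?c = "\<ominus> \<sigma> (rel R s u) i"
     have cR: "?c \<in>: R" using sec_apply(1)[OF rl] by simp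
     obtain w z where nz: "w \<in>: R" "z \<in> T" "nvec i = fr w z" using nc by (auto simp: loc_module_simps loc_carrier)
     have "(\<sigma> l0 i \<otimes> w) \<otimes> u = (u \<otimes> \<sigma> l0 i) \<otimes> w" using nz si uR by (simp add: m_ac)
     then have "\<sigma> l0 i \<odot>\<^sub>QM nvec i = fr ((s \<otimes> ?c) \<otimes> w) (z \<otimes> u)"
      using frac_cancel[of "\<sigma> l0 i \<otimes> w" z u] nz si u te by (simp add: smult_frac)
     also have "\<dots> = s \<odot>\<^sub>QM (?c \<odot>\<^sub>QM (fr \<one> u \<otimes>\<^sub>Q nvec i))"
      using nz u cR sR by (simp add: loc_mult smult_frac m_ac)
     finally show ?thesis using NW[OF span_simps(4)[OF cR span_mult[OF u(2) nvec_span[OF i]]]] by simp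
    qed
   qed
  qed
  then obtain c n where c: "c \<in> J" "n \<in> ?N" "lc R QM nvec (\<sigma> l0) = c \<odot>\<^sub>QM fr \<one> t \<oplus>\<^sub>QM s \<odot>\<^sub>QM n" unfolding W_def by blast
  let ?v = "\<pi> (restr X (gen (s \<otimes> u)))"
  have v: "?v \<in> ?N" using restr_mem[OF gsu, of X] by (simp add: span_of_def)
  have vc: "?v \<in>: QM" "n \<in>: QM" "c \<in>: R" "fr \<one> u \<in>: QM" using span_simps(1) v c u by (auto simp: J_def)
  have "lc R QM nvec (\<sigma> l0) = s \<odot>\<^sub>QM ?v \<ominus>\<^sub>QM fr \<one> u"
   using sec_restr[OF l0] gsu pG sR lin_all[OF restr_lin[of X] free_T free_T] restr_id[OF p(1)] p(2)
   by (simp add: l0_def loc_proj_simps)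
  then have eq: "s \<odot>\<^sub>QM ?v \<ominus>\<^sub>QM fr \<one> u = c \<odot>\<^sub>QM fr \<one> t \<oplus>\<^sub>QM s \<odot>\<^sub>QM n" using c(3) by simp
  have "f \<oplus>\<^sub>QM c \<odot>\<^sub>QM e = s \<odot>\<^sub>QM (v \<ominus>\<^sub>QM n)" if e: "s \<odot>\<^sub>QM v \<ominus>\<^sub>QM f = c \<odot>\<^sub>QM e \<oplus>\<^sub>QM s \<odot>\<^sub>QM n" and "f \<in>: QM" "e \<in>: QM" "v \<in>: QM" for e f v
  proof -
   have "f \<oplus>\<^sub>QM c \<odot>\<^sub>QM e = (s \<odot>\<^sub>QM v \<ominus>\<^sub>QM (s \<odot>\<^sub>QM v \<ominus>\<^sub>QM f)) \<oplus>\<^sub>QM c \<odot>\<^sub>QM e" using that(2-) sR vc(3) by algebra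
   also have "\<dots> = s \<odot>\<^sub>QM (v \<ominus>\<^sub>QM n)" unfolding e using that(2-) sR vc(2,3) by algebra
   finally show ?thesis .
  qed
  from this[OF eq vc(4) tc vc(1)] show ?thesis using c(1) span_simps(6)[OF v c(2)] by blast
 qed
 obtain c m where c: "c \<in> J" and m: "m \<in> ?N" and e: "fr \<one> t \<oplus>\<^sub>QM c \<odot>\<^sub>QM fr \<one> t = s \<odot>\<^sub>QM m" using inv[OF t(1,2)] by blast
 have cR: "c \<in>: R" using c by (simp add: J_def)
 have e: "(\<one> \<oplus> c) \<odot>\<^sub>QM fr \<one> t = s \<odot>\<^sub>QM m" using e tc cR by (simp add: QM.smult_l_distr)
 obtain w z where wz: "w \<in>: R" "z \<in> T" "m = fr w z"
  using span_simps(1)[OF m] by (auto simp: loc_module_simps loc_carrier)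
 have "fr (\<one> \<oplus> c) t = fr (s \<otimes> w) z" using e cR sR t wz by (simp add: smult_frac)
 then have "fr (\<one> \<oplus> c) t \<otimes>\<^sub>Q fr t s = fr (s \<otimes> w) z \<otimes>\<^sub>Q fr t s" by simp
 then have "fr ((\<one> \<oplus> c) \<otimes> t) (s \<otimes> t) = fr ((t \<otimes> w) \<otimes> s) (z \<otimes> s)" using cR s sR t tR wz by (simp add: loc_mult m_ac)
 then have "fr (\<one> \<oplus> c) s = t \<odot>\<^sub>QM m"
  using frac_cancel[of "\<one> \<oplus> c" s t] frac_cancel[of "t \<otimes> w" z s] cR s t wz by (simp add: smult_frac)
 then have "fr (\<one> \<oplus> c) s \<in> ?N" using span_simps(4)[OF tR m] by simp
 moreover have "\<exists>d\<in>carrier R. r = r \<otimes> (\<one> \<oplus> c) \<oplus> s \<otimes> d" if r: "r \<in>: R" "fr r s \<in> ?N" for r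
 proof -
  obtain d where d: "d \<in>: R" "r \<otimes> c = s \<otimes> d" using c r by (auto simp: J_def)
  have "r = r \<otimes> (\<one> \<oplus> c) \<ominus> r \<otimes> c" using r(1) cR by algebra
  then have "r = r \<otimes> (\<one> \<oplus> c) \<oplus> s \<otimes> (\<ominus> d)" using d sR by (simp add: minus_eq r_minus)
  then show ?thesis using d(1) by blast
 qed
 ultimately show "\<exists>\<epsilon>\<in>carrier R. fr \<epsilon> s \<in> ?N \<and> (\<forall>r\<in>carrier R. fr r s \<in> ?N --> (\<exists>c\<in>carrier R. r = r \<otimes> \<epsilon> \<oplus> s \<otimes> c))"
  using cR by (intro bexI[of _ "\<one> \<oplus> c"]) auto
 show "\<exists>r\<in>carrier R. \<exists>m\<in>?N. fr \<one> u = r \<odot>\<^sub>QM fr \<one> \<one> \<oplus>\<^sub>QM s \<odot>\<^sub>QM m" if u: "u \<in> T" "fr \<one> u \<in> ?N"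
 proof -
  \<comment> \<open>the claim for \<open>t\<^sup>2\<close>, multiplied by \<open>t\<close>, says that \<open>1/t\<close> is congruent to an element of \<open>R\<close>\<close>
  obtain d n where d: "d \<in> J" "n \<in> ?N" "fr \<one> (t \<otimes> t) \<oplus>\<^sub>QM d \<odot>\<^sub>QM fr \<one> t = s \<odot>\<^sub>QM n"
   using inv[of "t \<otimes> t"] span_mult_frac[OF t(2,2,1,1)] t(1) by auto
  obtain b k where b: "b \<in> J" "k \<in> ?N" "fr \<one> u \<oplus>\<^sub>QM b \<odot>\<^sub>QM fr \<one> t = s \<odot>\<^sub>QM k" using inv[OF u] by blast
  have cl: "d \<in>: R" "b \<in>: R" "n \<in>: QM" "k \<in>: QM" "fr \<one> u \<in>: QM" "fr \<one> (t \<otimes> t) \<in>: QM"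
   using d b u t span_simps(1) by (auto simp: J_def loc_module_simps)
  have tt: "t \<odot>\<^sub>QM fr \<one> (t \<otimes> t) = fr \<one> t" "t \<odot>\<^sub>QM fr \<one> t = fr \<one> \<one>"
   using t frac_cancel[of \<one> t t] frac_eqI[of t t \<one> \<one>] by (simp_all add: smult_frac)
  have "f = (b \<otimes> d) \<odot>\<^sub>QM (t \<odot>\<^sub>QM e) \<oplus>\<^sub>QM s \<odot>\<^sub>QM (k \<ominus>\<^sub>QM (b \<otimes> t) \<odot>\<^sub>QM n)"
   if 1: "t \<odot>\<^sub>QM q = e" and 2: "q \<oplus>\<^sub>QM d \<odot>\<^sub>QM e = s \<odot>\<^sub>QM n" and 3: "f \<oplus>\<^sub>QM b \<odot>\<^sub>QM e = s \<odot>\<^sub>QM k"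
    and "e \<in>: QM" "q \<in>: QM" "f \<in>: QM" for e f q
  proof -
   have "f = (f \<oplus>\<^sub>QM b \<odot>\<^sub>QM e) \<ominus>\<^sub>QM (b \<otimes> t) \<odot>\<^sub>QM (q \<oplus>\<^sub>QM d \<odot>\<^sub>QM e) \<oplus>\<^sub>QM (b \<otimes> d) \<odot>\<^sub>QM (t \<odot>\<^sub>QM e)
    \<oplus>\<^sub>QM b \<odot>\<^sub>QM (t \<odot>\<^sub>QM q \<ominus>\<^sub>QM e)" using that(4-) cl(1,2) tR by algebra
   also have "\<dots> = (b \<otimes> d) \<odot>\<^sub>QM (t \<odot>\<^sub>QM e) \<oplus>\<^sub>QM s \<odot>\<^sub>QM (k \<ominus>\<^sub>QM (b \<otimes> t) \<odot>\<^sub>QM n)"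
    unfolding 1 2 3 using that(4-) cl(1-4) tR sR by algebra
   finally show ?thesis .
  qed
  from this[OF tt(1) d(3) b(3) tc cl(6,5)] show ?thesis
   unfolding tt using span_simps(6)[OF b(2) span_simps(4)[OF m_closed[OF cl(2) tR] d(2)]] m_closed[OF cl(2,1)] by blast
 qed
qed

end
end

context section_loc begin

text \<open>A solution on \<open>X\<close> is a linear map from the span of the fractions \<open>1/x\<close>, given by the values \<open>e x\<close>.\<close>

definition solution :: "('a, 'm, 'y) module_scheme => 'a set => ('a => 'm) => bool"
 where "solution E X e \<longleftrightarrow> (\<forall>x\<in>X. e x \<in>: E) \<and> (\<forall>p\<in>L. p \<in>: FM X --> lc R E e p = \<zero>\<^sub>E)"

lemma sec_support: "l \<in> L ==> finite {i. \<sigma> l i \<noteq> \<zero>} \<and> {i. \<sigma> l i \<noteq> \<zero>} \<subseteq> T \<times> T"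
 using sec_simps(1)[of l] by (auto simp: free_module_def)

text \<open>A set of denominators which contains this set for a relation \<open>l\<close> satisfies the condition of \<open>closed_denoms\<close>
 at \<open>l\<close>.\<close>

definition sec_denoms :: "('a => 'a) => 'a set"
 where "sec_denoms l = (\<Union>i\<in>{i. \<sigma> l i \<noteq> \<zero>}. {fst i, fst i \<otimes> snd i})"

lemma sec_denoms:
 assumes "l \<in> L"
 shows "countable (sec_denoms l) \<and> sec_denoms l \<subseteq> T"
proof -
 have "fst i \<in> T \<and> fst i \<otimes> snd i \<in> T" if "\<sigma> l i \<noteq> \<zero>" for i
 proof -
  have "i \<in> T \<times> T" using sec_support[OF assms] that by blast
  then show ?thesis by (cases i) simp
 qed
 then show ?thesis using sec_support[OF assms] unfolding sec_denoms_def
  by (intro conjI countable_UN UN_least) (auto simp: countable_finite)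
qed

lemma supported_submodule:
 "submodule {l \<in> L. \<forall>a b. \<sigma> l (a, b) \<noteq> \<zero> --> a \<in> X \<and> a \<otimes> b \<in> X} R G" (is "submodule ?S R G")
proof (rule submoduleI'[OF free_T])
 show "?S \<subseteq> carrier G" using L_simps(1) by auto
 show "\<zero>\<^sub>G \<in> ?S" using L_simps(2) sec_simps(4) by (simp add: free_ops)
 fix l assume l: "l \<in> ?S"
 show "r \<odot>\<^sub>G l \<in> ?S" if r: "r \<in>: R" for r
 proof -
  have "\<sigma> l i \<noteq> \<zero>" if "\<sigma> (r \<odot>\<^sub>G l) i \<noteq> \<zero>" for i using that r l by (auto simp: sec_apply)
  then show ?thesis using l L_simps(4)[OF r, of l] by auto
 qed
 fix l' assume l': "l' \<in> ?S"
 have "\<sigma> l i \<noteq> \<zero> \<or> \<sigma> l' i \<noteq> \<zero>" if "\<sigma> (l \<oplus>\<^sub>G l') i \<noteq> \<zero>" for i using that l l' by (auto simp: sec_apply)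
 then show "l \<oplus>\<^sub>G l' \<in> ?S" using l l' L_simps(3)[of l l'] by blast
qed

lemma vanishing_submodule:
 assumes E: "module R E" and X: "X \<subseteq> T" and e: "\<And>x. x \<in> X ==> e x \<in>: E"
 shows "submodule {p \<in> carrier G. p \<in>: FM X \<and> lc R E e p = \<zero>\<^sub>E} R G"
proof (rule submoduleI'[OF free_T])
 interpret E: module R E by fact
 interpret G: module R G by (rule free_T)
 interpret FX: module R "FM X" by (rule free_is_module)
 have el: "lin R (FM X) E (lc R E e)" by (rule lc_lin[OF E e])
 note er = lin_all[OF el free_is_module E]
 let ?S = "{p \<in> carrier G. p \<in>: FM X \<and> lc R E e p = \<zero>\<^sub>E}"
 note ops = free_same_ops[where X = X, symmetric]
 show "\<zero>\<^sub>G \<in> ?S" using FX.zero_closed er(4) free_in_G[OF X] by (simp only: ops(3) mem_Collect_eq)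
 fix p assume p: "p \<in> ?S"
 show "r \<odot>\<^sub>G p \<in> ?S" if r: "r \<in>: R" for r
  unfolding ops(2) using p r er(3)[OF r, of p] free_in_G[OF X FX.smult_closed[OF r, of p]] by auto
 fix q assume q: "q \<in> ?S"
 show "p \<oplus>\<^sub>G q \<in> ?S"
  unfolding ops(1) using p q er(2)[of p q] free_in_G[OF X FX.a_closed[of p q]] by auto
qed auto

text \<open>The relations which satisfy the conditions form submodules, so that it suffices to look at generators.\<close>

lemma denoms_from_generators:
 assumes Y: "Y \<subseteq> T" "\<one> \<in> Y" and mult: "\<And>x y. x \<in> Y ==> y \<in> Y ==> fr \<one> (x \<otimes> y) \<in> span_of Y"
  and B: "B \<subseteq> L" and gen: "\<And>p. p \<in> L ==> p \<in>: FM Y ==> p \<in> gen_submodule R G B"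
  and supp: "\<And>k i. k \<in> B ==> \<sigma> k i \<noteq> \<zero> ==> fst i \<in> Y \<and> fst i \<otimes> snd i \<in> Y"
  and E: "module R E" and e: "\<And>x. x \<in> Y ==> e x \<in>: E" and van: "\<And>k. k \<in> B ==> k \<in>: FM Y \<and> lc R E e k = \<zero>\<^sub>E"
 shows "closed_denoms Y \<and> solution E Y e"
proof -
 have BG: "B \<subseteq> carrier G" using B L_simps(1) by blast
 note \<Gamma> = gen_submodule(3)[OF free_T BG]
 have "gen_submodule R G B \<subseteq> {l \<in> L. \<forall>a b. \<sigma> l (a, b) \<noteq> \<zero> --> a \<in> Y \<and> a \<otimes> b \<in> Y}"
  by (rule \<Gamma>[OF supported_submodule]) (use B supp in force)
 moreover have "gen_submodule R G B \<subseteq> {p \<in> carrier G. p \<in>: FM Y \<and> lc R E e p = \<zero>\<^sub>E}"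
  by (rule \<Gamma>[OF vanishing_submodule[OF E Y(1) e]]) (use BG van in auto)
 ultimately show ?thesis using Y mult gen e unfolding closed_denoms_def solution_def by blast
qed

text \<open>A solution vanishes on relations, and so its values depend only on the fractions.\<close>

lemma solution_unique:
 assumes E: "module R E" and X: "X \<subseteq> T" and sol: "solution E X e"
  and p: "p \<in>: FM X" "p' \<in>: FM X" "\<pi> p = \<pi> p'"
 shows "lc R E e p = lc R E e p'"
proof -
 interpret E: module R E by fact
 interpret FX: module R "FM X" by (rule free_is_module)
 interpret QM: module R QM by (rule loc_module)
 have e: "\<And>x. x \<in> X ==> e x \<in>: E" using sol by (auto simp: solution_def)
 have el: "lin R (FM X) E (lc R E e)" by (rule lc_lin[OF E e])
 note er = lin_all[OF el free_is_module E] and pr = lin_all[OF proj_lin[OF X] free_is_module loc_module]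
 let ?d = "p \<ominus>\<^bsub>FM X\<^esub> p'"
 have d: "?d \<in>: FM X" using p by simp
 have "\<pi> ?d = \<zero>\<^sub>QM" using pr(6)[OF p(1,2)] p(3) pr(1)[OF p(2)] by simp
 then have "?d \<in> L" using free_in_G[OF X d] by (simp add: loc_ker_def mod_ker_def)
 then have "lc R E e ?d = \<zero>\<^sub>E" using sol d by (auto simp: solution_def)
 then show ?thesis using er(6)[OF p(1,2)] er(1)[OF p(1)] er(1)[OF p(2)] by (simp add: E.minus_eq_zero_iff)
qed

text \<open>A closed set of denominators with a solution in a divisible module can be enlarged by any denominator \<open>t\<close>.
 The enlargement adjoins a countable monoid \<open>Z\<close> which contains \<open>t\<close> and is closed under the supports of the section.
 Over the old fractions, the new ones are divided out successively; at \<open>1/z\<close>, the admissible values are those which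
 agree with the old solution on the multiples of \<open>1/z\<close> in its domain. The element which is idempotent modulo \<open>z\<close> is
 used to correct a value which is not admissible.\<close>

lemma denoms_extend:
 assumes X: "closed_denoms X" and E: "module R E" and sol: "solution E X e" and div: "divisible_by E T" and t: "t \<in> T"
 shows "\<exists>X' e'. closed_denoms X' \<and> X \<subseteq> X' \<and> t \<in> X' \<and> solution E X' e' \<and> (\<forall>x\<in>X. e' x = e x)"
proof -
 interpret E: module R E by fact
 interpret G: module R G by (rule free_T)
 interpret QM: module R QM by (rule loc_module)
 interpret FX: module R "FM X" by (rule free_is_module)
 interpret Q: cring Q by (rule loc_cring)
 note XT = XT[OF X] and X1 = X1[OF X]
 have ec: "\<And>x. x \<in> X ==> e x \<in>: E" using sol by (auto simp: solution_def)
 have el: "lin R (FM X) E (lc R E e)" by (rule lc_lin[OF E ec])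
 note er = lin_all[OF el free_is_module E] and pr = lin_all[OF proj_lin[OF XT] free_is_module loc_module]
 note span_simps = submoduleD[OF span_submodule[OF XT] loc_module]
 have eg: "lc R E e (gen x) = e x" if "x \<in> X" for x using lc_gen[OF E, of e x] ec[OF that] by simp
 have "\<forall>z\<in>T. \<exists>\<epsilon>\<in>carrier R. fr \<epsilon> z \<in> span_of X \<and> (\<forall>r\<in>carrier R. fr r z \<in> span_of X --> (\<exists>c\<in>carrier R. r = r \<otimes> \<epsilon> \<oplus> z \<otimes> c))"
  using span_idempotent(1)[OF X] by blast
 then obtain \<epsilon> where \<epsilon>: "\<And>z. z \<in> T ==> \<epsilon> z \<in>: R" "\<And>z. z \<in> T ==> fr (\<epsilon> z) z \<in> span_of X"
  "\<And>z r. z \<in> T ==> r \<in>: R ==> fr r z \<in> span_of X ==> \<exists>c\<in>carrier R. r = r \<otimes> \<epsilon> z \<oplus> z \<otimes> c" by metis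
 have "\<forall>z\<in>T. \<exists>p\<in>carrier (FM X). \<pi> p = fr (\<epsilon> z) z" using \<epsilon>(2) unfolding span_of_def by (metis imageE)
 then obtain P where P: "\<And>z. z \<in> T ==> P z \<in>: FM X" "\<And>z. z \<in> T ==> \<pi> (P z) = fr (\<epsilon> z) z" by metis
 have PG: "P z \<in>: G" if "z \<in> T" for z by (rule free_in_G[OF XT P(1)[OF that]])
 define \<kappa> where "\<kappa> z = \<epsilon> z \<odot>\<^sub>G gen z \<ominus>\<^sub>G P z" for z
 have \<kappa>: "\<kappa> z \<in> L" if z: "z \<in> T" for z
  unfolding \<kappa>_def using z \<epsilon>(1)[OF z] PG[OF z] P(2)[OF z] by (simp add: ker_diff_iff loc_proj_gen_smult)
 define g where "g z w = insert (z \<otimes> w) (sec_denoms (rel R z w) \<union> sec_denoms (\<kappa> z))" for z w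
 have "\<exists>Z. countable Z \<and> {\<one>, t} \<subseteq> Z \<and> Z \<subseteq> T \<and> (\<forall>x\<in>Z. \<forall>y\<in>Z. g x y \<subseteq> Z)"
 proof (rule countable_closure)
  show "countable (g x y) \<and> g x y \<subseteq> T" if "x \<in> T" "y \<in> T" for x y
   using sec_denoms[OF rel_in_ker[OF that]] sec_denoms[OF \<kappa>[OF that(1)]] that by (auto simp: g_def)
 qed (use t in auto)
 then obtain Z where Zc: "countable Z" and Z1: "\<one> \<in> Z" and tZ: "t \<in> Z" and ZT: "Z \<subseteq> T" and Zg: "\<And>x y. x \<in> Z ==> y \<in> Z ==> g x y \<subseteq> Z"
  by (metis insert_subset)
 have Zm: "x \<otimes> y \<in> Z" if "x \<in> Z" "y \<in> Z" for x y using Zg[OF that] by (simp add: g_def)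
 have Zmon: "submonoid Z R" by (rule submonoid.intro) (use ZT Zm Z1 in auto)
 have zT: "z \<in> T" if "z \<in> Z" for z using that ZT by auto
 let ?X = "X \<union> Z" and ?B = "{l \<in> L. l \<in>: FM X} \<union> {rel R z w | z w. z \<in> Z \<and> w \<in> Z} \<union> \<kappa> ` Z"
 have X'T: "?X \<subseteq> T" using XT ZT by auto
 let ?\<Gamma> = "gen_submodule R G ?B"
 have BL: "?B \<subseteq> L" using zT rel_in_ker \<kappa> by auto
 then have BG: "?B \<subseteq> carrier G" using L_simps(1) by blast
 note \<Gamma> = gen_submodule[OF free_T BG] and \<Gamma>r = submoduleD[OF gen_submodule(1)[OF free_T BG] free_T]
 have \<Gamma>L: "?\<Gamma> \<subseteq> L" by (rule \<Gamma>(3)[OF loc_ker_submodule BL])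
 \<comment> \<open>the part of \<open>p\<close> outside of \<open>X\<close> is equivalent to a multiple of one \<open>e\<^sub>z\<close>, and \<open>\<epsilon> z\<close> moves this multiple back to \<open>X\<close>\<close>
 have decomp: "p \<in> ?\<Gamma>" if p: "p \<in> L" "p \<in>: FM ?X" for p
 proof -
  have pG: "p \<in>: G" using L_simps(1)[OF p(1)] .
  define a where "a = restr X p"
  have a: "a \<in>: FM X" "a \<in>: G" using restr_mem[OF pG, of X] free_in_G[OF XT] by (auto simp: a_def)
  define b where "b = p \<ominus>\<^sub>G a"
  have bG: "b \<in>: G" using pG a by (simp add: b_def)
  have be: "b = (\<lambda>x. if x \<in> X then \<zero> else p x)"
  proof
   fix x
   have "p x \<in>: R" using pG by (simp add: free_module_def)
   then show "b x = (if x \<in> X then \<zero> else p x)" unfolding b_def free_minus(1)[OF pG a(2)] by (simp add: a_def restr_def minus_eq minus_zero r_neg)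
  qed
  have bZ: "b \<in>: FM Z"
  proof -
   have "b x = \<zero>" if "x \<notin> Z" for x using that p(2) by (auto simp: be free_module_def)
   then show ?thesis using bG by (auto simp: free_module_def)
  qed
  obtain z r where z: "z \<in> Z" "r \<in>: R" "b \<ominus>\<^sub>G r \<odot>\<^sub>G gen z \<in> gen_submodule R G {rel R s t | s t. s \<in> Z \<and> t \<in> Z}"
   using common_denominator[OF Zmon ZT bZ] by auto
  have ZG: "{rel R s t | s t. s \<in> Z \<and> t \<in> Z} \<subseteq> carrier G" using BG by blast
  have "gen_submodule R G {rel R s t | s t. s \<in> Z \<and> t \<in> Z} \<subseteq> ?\<Gamma>"
   by (rule gen_submodule(3)[OF free_T ZG \<Gamma>(1)]) (use \<Gamma>(2) in blast)
  then have m1: "b \<ominus>\<^sub>G r \<odot>\<^sub>G gen z \<in> ?\<Gamma>" using z(3) by blast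
  have ez: "gen z \<in>: G" "gen \<one> \<in>: G" "rel R \<one> z \<in>: G"
   using zT[OF z(1)] rel_closed[of \<one> T z] by auto
  have zR: "z \<in>: R" using zT[OF z(1)] by simp
  have "b \<ominus>\<^sub>G r \<odot>\<^sub>G gen z \<in> L" using m1 \<Gamma>L by blast
  then have pb: "\<pi> b = fr r z" using ker_diff_iff[OF bG, of "r \<odot>\<^sub>G gen z"] loc_proj_gen_smult[OF z(2) zT[OF z(1)]] z(2) ez by simp
  have "\<pi> b = \<zero>\<^sub>QM \<ominus>\<^sub>QM \<pi> a"
   using loc_proj_simps(6)[OF pG a(2)] p(1) by (simp add: b_def loc_ker_def mod_ker_def)
  then have "fr r z \<in> span_of X" using span_simps(6)[OF span_simps(2), of "\<pi> a"] a(1) pb by (simp add: span_of_def)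
  then obtain c where c: "c \<in>: R" "r = r \<otimes> \<epsilon> z \<oplus> z \<otimes> c" using \<epsilon>(3)[OF zT[OF z(1)] z(2)] by auto
  define D where "D = (b \<ominus>\<^sub>G r \<odot>\<^sub>G gen z) \<oplus>\<^sub>G (r \<odot>\<^sub>G \<kappa> z \<ominus>\<^sub>G c \<odot>\<^sub>G rel R \<one> z)"
  have "\<kappa> z \<in> ?\<Gamma>" "rel R \<one> z \<in> ?\<Gamma>" using \<Gamma>(2) z(1) Z1 by blast+
  then have D\<Gamma>: "D \<in> ?\<Gamma>" unfolding D_def using \<Gamma>r(3)[OF m1 \<Gamma>r(6)[OF \<Gamma>r(4)[OF z(2)] \<Gamma>r(4)[OF c(1)]]] by simp
  define q where "q = (a \<oplus>\<^sub>G r \<odot>\<^sub>G P z) \<oplus>\<^sub>G c \<odot>\<^sub>G gen \<one>"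
  have rz: "rel R \<one> z = gen \<one> \<ominus>\<^sub>G z \<odot>\<^sub>G gen z" using rel_eq[of \<one> T z] zT[OF z(1)] by simp
  have alg: "(a \<oplus>\<^sub>G r \<odot>\<^sub>G P') \<oplus>\<^sub>G c \<odot>\<^sub>G e1 = p' \<ominus>\<^sub>G ((b \<ominus>\<^sub>G r \<odot>\<^sub>G e2) \<oplus>\<^sub>G (r \<odot>\<^sub>G (f \<odot>\<^sub>G e2 \<ominus>\<^sub>G P') \<ominus>\<^sub>G c \<odot>\<^sub>G (e1 \<ominus>\<^sub>G z \<odot>\<^sub>G e2)))"
   if pp: "p' = a \<oplus>\<^sub>G b" and rr: "r = r \<otimes> f \<oplus> z \<otimes> c" and cl: "P' \<in>: G" "e1 \<in>: G" "e2 \<in>: G" "f \<in>: R"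
   for P' e1 e2 p' f
  proof -
   have "(a \<oplus>\<^sub>G b) \<ominus>\<^sub>G ((b \<ominus>\<^sub>G r \<odot>\<^sub>G e2) \<oplus>\<^sub>G (r \<odot>\<^sub>G (f \<odot>\<^sub>G e2 \<ominus>\<^sub>G P') \<ominus>\<^sub>G c \<odot>\<^sub>G (e1 \<ominus>\<^sub>G z \<odot>\<^sub>G e2)))
    = ((a \<oplus>\<^sub>G r \<odot>\<^sub>G P') \<oplus>\<^sub>G c \<odot>\<^sub>G e1) \<oplus>\<^sub>G (r \<odot>\<^sub>G e2 \<ominus>\<^sub>G (r \<otimes> f \<oplus> z \<otimes> c) \<odot>\<^sub>G e2)"
    using cl a(2) bG z(2) c(1) zR by algebra
   also have "r \<odot>\<^sub>G e2 \<ominus>\<^sub>G (r \<otimes> f \<oplus> z \<otimes> c) \<odot>\<^sub>G e2 = \<zero>\<^sub>G" using rr[symmetric] cl z(2) by simp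
   finally show ?thesis unfolding pp using cl a(2) z(2) c(1) by simp
  qed
  have pab: "p = a \<oplus>\<^sub>G b" unfolding b_def using pG a(2) by algebra
  have qe: "q = p \<ominus>\<^sub>G D" unfolding q_def D_def \<kappa>_def rz by (rule alg[OF pab c(2) PG[OF zT[OF z(1)]] ez(2,1) \<epsilon>(1)[OF zT[OF z(1)]]])
  have "q \<in> L" unfolding qe using L_simps(6)[OF p(1)] D\<Gamma> \<Gamma>L by blast
  moreover have "q \<in>: FM X"
   using FX.a_closed[OF FX.a_closed[OF a(1) FX.smult_closed[OF z(2) P(1)[OF zT[OF z(1)]]]] FX.smult_closed[OF c(1) free_gen_closed[OF X1]]]
   by (simp only: q_def free_same_ops[where X = X])
  ultimately have q\<Gamma>: "q \<in> ?\<Gamma>" using \<Gamma>(2) by blast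
  have DG: "D \<in>: G" by (rule \<Gamma>r(1)[OF D\<Gamma>])
  have "p = q \<oplus>\<^sub>G D" unfolding qe using pG DG by algebra
  then show ?thesis using \<Gamma>r(3)[OF q\<Gamma> D\<Gamma>] by simp
 qed
 have mult: "fr \<one> (x \<otimes> y) \<in> span_of ?X" if xy: "x \<in> ?X" "y \<in> ?X" for x y
 proof -
  have gen: "fr \<one> x \<in> span_of ?X" if "x \<in> ?X" for x
   unfolding span_of_def using loc_proj_gen[of x] that X'T by (metis free_gen_closed imageI subsetD)
  note S' = submoduleD[OF span_submodule[OF X'T] loc_module]
  have mono: "span_of X \<subseteq> span_of ?X" unfolding span_of_def using free_mono[of X ?X] by auto
  have mixed: "fr \<one> (x \<otimes> z) \<in> span_of ?X" if x: "x \<in> X" and z: "z \<in> Z" for x z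
  proof -
   have xzT: "x \<in> T" "z \<in> T" using x z XT zT by auto
   obtain r m where rm: "r \<in>: R" "m \<in> span_of X" "fr \<one> x = r \<odot>\<^sub>QM fr \<one> \<one> \<oplus>\<^sub>QM z \<odot>\<^sub>QM m"
    using span_idempotent(2)[OF X xzT(2,1) span_gen[OF X x]] by blast
   obtain w v where wv: "w \<in>: R" "v \<in> T" "m = fr w v"
    using span_simps(1)[OF rm(2)] by (auto simp: loc_module_simps loc_carrier)
   have "fr \<one> (x \<otimes> z) = fr \<one> x \<otimes>\<^sub>Q fr \<one> z" using xzT by (simp add: loc_mult)
   also have "\<dots> = (fr r \<one> \<oplus>\<^sub>Q fr (z \<otimes> w) v) \<otimes>\<^sub>Q fr \<one> z" unfolding rm(3) using rm(1) wv xzT by (simp add: smult_frac) (simp add: loc_module_simps)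
   also have "\<dots> = fr r \<one> \<otimes>\<^sub>Q fr \<one> z \<oplus>\<^sub>Q fr (z \<otimes> w) v \<otimes>\<^sub>Q fr \<one> z" using rm(1) wv xzT by (intro Q.l_distr) auto
   also have "\<dots> = r \<odot>\<^sub>QM fr \<one> z \<oplus>\<^sub>QM m" using rm(1) wv xzT frac_cancel[of w v z] by (simp add: loc_mult smult_frac m_comm) (simp add: loc_module_simps)
   also have "\<dots> \<in> span_of ?X" by (rule S'(3)[OF S'(4)[OF rm(1) gen]]) (use z rm(2) mono in auto)
   finally show ?thesis .
  qed
  show ?thesis
  proof (cases "x \<in> X")
   case True
   then show ?thesis using xy mixed[of x y] Xmult[OF X, of x y] mono by auto
  next
   case False
   then have xZ: "x \<in> Z" using xy by auto
   show ?thesis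
   proof (cases "y \<in> X")
    case True
    then show ?thesis using mixed[OF True xZ] xZ zT XT m_comm[of x y] by auto
   next
    case False
    then show ?thesis using xy xZ gen[of "x \<otimes> y"] Zm by auto
   qed
  qed
 qed
 have supp: "fst i \<in> ?X \<and> fst i \<otimes> snd i \<in> ?X" if k: "k \<in> ?B" and i: "\<sigma> k i \<noteq> \<zero>" for k i
 proof -
  consider "k \<in> L" "k \<in>: FM X" | z w where "z \<in> Z" "w \<in> Z" "k = rel R z w \<or> k = \<kappa> z" using k Z1 by blast
  then show ?thesis
  proof cases
   case 1
   then show ?thesis using sec_outside[OF X 1, of i] i by blast
  next
   case (2 z w)
   then have "sec_denoms k \<subseteq> Z" using Zg[of z w] by (auto simp: g_def)
   then show ?thesis using i unfolding sec_denoms_def by blast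
  qed
 qed
 \<comment> \<open>the admissible values\<close>
 define A where "A z = {y \<in> carrier E. \<forall>r\<in>carrier R. \<forall>p\<in>carrier (FM X). \<pi> p = fr r z --> r \<odot>\<^sub>E y = lc R E e p}" for z
 have uniq: "lc R E e p = lc R E e p'" if "p \<in>: FM X" "p' \<in>: FM X" "\<pi> p = \<pi> p'" for p p'
  by (rule solution_unique[OF E XT sol that])
 have g1: "gen \<one> \<in>: FM X" using X1 by simp
 have pg1: "\<pi> (r \<odot>\<^bsub>FM X\<^esub> gen \<one>) = fr r \<one>" if "r \<in>: R" for r
  using that g1 by (simp add: pr smult_frac)
 have "\<exists>ez. (\<forall>z\<in>Z. ez z \<in> A z) \<and> ez \<one> = e \<one> \<and> (\<forall>z\<in>Z. \<forall>w\<in>Z. ez z = w \<odot>\<^sub>E ez (z \<otimes> w))"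
 proof (rule divide_successively[OF Zmon Zc E])
  show "A z \<subseteq> carrier E" for z by (auto simp: A_def)
  show "e \<one> \<in> A \<one>"
  proof -
   have "r \<odot>\<^sub>E e \<one> = lc R E e p" if r: "r \<in>: R" and p: "p \<in>: FM X" "\<pi> p = fr r \<one>" for r p
    using uniq[OF p(1) FX.smult_closed[OF r g1]] p(2) pg1[OF r] er(3)[OF r g1] eg[OF X1] by simp
   then show ?thesis using ec[OF X1] by (simp add: A_def)
  qed
  show "w \<odot>\<^sub>E y \<in> A z" if z: "z \<in> Z" and w: "w \<in> Z" and y: "y \<in> A (z \<otimes> w)" for z w y
  proof -
   have R: "z \<in> T" "w \<in> T" using z w zT by auto
   have yE: "y \<in>: E" using y by (simp add: A_def)
   have "r \<odot>\<^sub>E (w \<odot>\<^sub>E y) = lc R E e p" if r: "r \<in>: R" and p: "p \<in>: FM X" "\<pi> p = fr r z" for r p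
   proof -
    have "\<pi> p = fr (r \<otimes> w) (z \<otimes> w)" using p(2) frac_cancel[of r z w] r R by simp
    then have "(r \<otimes> w) \<odot>\<^sub>E y = lc R E e p" using y p(1) r R by (simp add: A_def)
    then show ?thesis using E.smult_assoc1[of r w y] r R yE by simp
   qed
   then show ?thesis using yE R by (simp add: A_def)
  qed
  show "\<exists>y'\<in>A (z \<otimes> u). u \<odot>\<^sub>E y' = y" if z: "z \<in> Z" and u: "u \<in> Z" and y: "y \<in> A z" for z u y
  proof -
   have zuT: "z \<in> T" "u \<in> T" "z \<otimes> u \<in> T" using z u zT by auto
   have R: "z \<in>: R" "u \<in>: R" using zuT by auto
   have yE: "y \<in>: E" using y by (simp add: A_def)
   let ?e = "\<epsilon> (z \<otimes> u)" and ?P = "P (z \<otimes> u)"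
   have eR: "?e \<in>: R" by (rule \<epsilon>(1)[OF zuT(3)])
   have P': "?P \<in>: FM X" "\<pi> ?P = fr ?e (z \<otimes> u)" using P zuT by auto
   let ?\<psi> = "lc R E e ?P"
   have psE: "?\<psi> \<in>: E" by (rule er(1)[OF P'(1)])
   obtain y0 where y0: "y0 \<in>: E" "u \<odot>\<^sub>E y0 = y" using div yE zuT by (auto simp: divisible_by_def)
   have zy: "z \<odot>\<^sub>E y = e \<one>"
   proof -
    have "\<pi> (gen \<one>) = fr z z" using zuT frac_eqI[of z z \<one> \<one>] by simp
    then show ?thesis using y R g1 eg[OF X1] by (simp add: A_def)
   qed
   have eu: "?e \<odot>\<^sub>E y = u \<odot>\<^sub>E ?\<psi>"
   proof -
    have "\<pi> (u \<odot>\<^bsub>FM X\<^esub> ?P) = fr ?e z"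
     using P' R eR zuT frac_cancel[of ?e z u] by (simp add: pr smult_frac m_comm)
    then have "?e \<odot>\<^sub>E y = lc R E e (u \<odot>\<^bsub>FM X\<^esub> ?P)" using y eR R P'(1) by (simp add: A_def)
    then show ?thesis using er(3)[OF R(2) P'(1)] by simp
   qed
   \<comment> \<open>expand a multiple of \<open>1/zu\<close> in the old domain by means of the idempotent\<close>
   have exp: "lc R E e p = r \<odot>\<^sub>E ?\<psi> \<oplus>\<^sub>E c \<odot>\<^sub>E e \<one>"
    if r: "r \<in>: R" "c \<in>: R" "r = r \<otimes> ?e \<oplus> (z \<otimes> u) \<otimes> c" and p: "p \<in>: FM X" "\<pi> p = fr r (z \<otimes> u)" for r c p
   proof -
    let ?p' = "r \<odot>\<^bsub>FM X\<^esub> ?P \<oplus>\<^bsub>FM X\<^esub> c \<odot>\<^bsub>FM X\<^esub> gen \<one>"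
    have p'c: "?p' \<in>: FM X" using r P' g1 by simp
    have "\<pi> ?p' = r \<odot>\<^sub>QM \<pi> ?P \<oplus>\<^sub>QM \<pi> (c \<odot>\<^bsub>FM X\<^esub> gen \<one>)"
     using pr(2)[OF FX.smult_closed[OF r(1) P'(1)] FX.smult_closed[OF r(2) g1]] pr(3)[OF r(1) P'(1)] by simp
    also have "\<dots> = fr (r \<otimes> ?e) (z \<otimes> u) \<oplus>\<^sub>QM fr c \<one>" using P'(2) r(1) eR zuT(3) pg1[OF r(2)] by (simp add: smult_frac)
    also have "\<dots> = fr (\<one> \<otimes> (r \<otimes> ?e) \<oplus> (z \<otimes> u) \<otimes> c) ((z \<otimes> u) \<otimes> \<one>)"
     unfolding loc_module_simps(3) using r(1,2) eR zuT(3) by (intro loc_add) auto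
    also have "\<dots> = fr r (z \<otimes> u)" using r eR R by simp
    finally have "\<pi> p = \<pi> ?p'" using p(2) by simp
    then have "lc R E e p = lc R E e ?p'" by (rule uniq[OF p(1) p'c])
    also have "\<dots> = r \<odot>\<^sub>E ?\<psi> \<oplus>\<^sub>E c \<odot>\<^sub>E e \<one>"
     using er(2)[OF FX.smult_closed[OF r(1) P'(1)] FX.smult_closed[OF r(2) g1]] er(3)[OF r(1) P'(1)] er(3)[OF r(2) g1] eg[OF X1] by simp
    finally show ?thesis .
   qed
   obtain c' where c': "c' \<in>: R" "?e = ?e \<otimes> ?e \<oplus> (z \<otimes> u) \<otimes> c'" using \<epsilon>(3)[OF zuT(3) eR \<epsilon>(2)[OF zuT(3)]] by auto
   have psi: "?\<psi> = ?e \<odot>\<^sub>E ?\<psi> \<oplus>\<^sub>E c' \<odot>\<^sub>E e \<one>" by (rule exp[OF eR c' P'])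
   define y' where "y' = y0 \<ominus>\<^sub>E (?e \<odot>\<^sub>E y0 \<ominus>\<^sub>E ?\<psi>)"
   have y'E: "y' \<in>: E" using y0 eR psE by (simp add: y'_def)
   have uy': "u \<odot>\<^sub>E y' = y"
   proof -
    have "u \<odot>\<^sub>E (y0 \<ominus>\<^sub>E (f \<odot>\<^sub>E y0 \<ominus>\<^sub>E q)) = (u \<odot>\<^sub>E y0) \<ominus>\<^sub>E (f \<odot>\<^sub>E (u \<odot>\<^sub>E y0) \<ominus>\<^sub>E u \<odot>\<^sub>E q)"
     if "f \<in>: R" "q \<in>: E" for f q using that y0(1) R by algebra
    from this[OF eR psE] show ?thesis unfolding y'_def y0(2) eu using yE psE R by (simp add: E.M.minus_self) (simp add: E.M.minus_eq E.M.minus_zero')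
   qed
   have ey': "?e \<odot>\<^sub>E y' = ?\<psi>"
   proof -
    have alg: "f \<odot>\<^sub>E (y0 \<ominus>\<^sub>E (f \<odot>\<^sub>E y0 \<ominus>\<^sub>E q)) = (f \<odot>\<^sub>E y0 \<ominus>\<^sub>E (f \<otimes> f) \<odot>\<^sub>E y0) \<oplus>\<^sub>E f \<odot>\<^sub>E q"
     if "f \<in>: R" "q \<in>: E" for f q using that y0(1) R by algebra
    have alg2: "f \<odot>\<^sub>E y0 \<ominus>\<^sub>E (f \<otimes> f) \<odot>\<^sub>E y0 = c' \<odot>\<^sub>E (z \<odot>\<^sub>E (u \<odot>\<^sub>E y0))" if "f = f \<otimes> f \<oplus> (z \<otimes> u) \<otimes> c'" "f \<in>: R" for f
    proof -
     have "f \<odot>\<^sub>E y0 = (f \<otimes> f \<oplus> (z \<otimes> u) \<otimes> c') \<odot>\<^sub>E y0" using that(1) by simp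
     moreover have "(f \<otimes> f \<oplus> (z \<otimes> u) \<otimes> c') \<odot>\<^sub>E y0 \<ominus>\<^sub>E (f \<otimes> f) \<odot>\<^sub>E y0 = c' \<odot>\<^sub>E (z \<odot>\<^sub>E (u \<odot>\<^sub>E y0))"
      using that(2) y0(1) R c'(1) by algebra
     ultimately show ?thesis by simp
    qed
    have "?e \<odot>\<^sub>E y' = c' \<odot>\<^sub>E e \<one> \<oplus>\<^sub>E ?e \<odot>\<^sub>E ?\<psi>"
     unfolding y'_def alg[OF eR psE] alg2[OF c'(2) eR] y0(2) zy ..
    also have "\<dots> = ?e \<odot>\<^sub>E ?\<psi> \<oplus>\<^sub>E c' \<odot>\<^sub>E e \<one>"
     by (rule E.M.a_comm) (use c'(1) ec[OF X1] eR psE in auto)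
    finally show ?thesis using psi by simp
   qed
   have "r \<odot>\<^sub>E y' = lc R E e p" if r: "r \<in>: R" and p: "p \<in>: FM X" "\<pi> p = fr r (z \<otimes> u)" for r p
   proof -
    have "fr r (z \<otimes> u) \<in> span_of X" using p by (auto simp: span_of_def)
    then obtain c where c: "c \<in>: R" "r = r \<otimes> ?e \<oplus> (z \<otimes> u) \<otimes> c" using \<epsilon>(3)[OF zuT(3) r] by auto
    have "r \<odot>\<^sub>E y' = (r \<otimes> ?e \<oplus> (z \<otimes> u) \<otimes> c) \<odot>\<^sub>E y'" using c(2) by simp
    also have "\<dots> = r \<odot>\<^sub>E (?e \<odot>\<^sub>E y') \<oplus>\<^sub>E c \<odot>\<^sub>E (z \<odot>\<^sub>E (u \<odot>\<^sub>E y'))"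
    proof -
     have "(r \<otimes> f \<oplus> (z \<otimes> u) \<otimes> c) \<odot>\<^sub>E y' = r \<odot>\<^sub>E (f \<odot>\<^sub>E y') \<oplus>\<^sub>E c \<odot>\<^sub>E (z \<odot>\<^sub>E (u \<odot>\<^sub>E y'))" if "f \<in>: R" for f
      using that r c(1) R y'E by algebra
     then show ?thesis using eR by blast
    qed
    also have "\<dots> = lc R E e p" unfolding ey' uy' zy using exp[OF r c p] by simp
    finally show ?thesis .
   qed
   then have "y' \<in> A (z \<otimes> u)" using y'E by (simp add: A_def)
   then show ?thesis using uy' by blast
  qed
 qed
 then obtain ez where ez: "\<And>z. z \<in> Z ==> ez z \<in> A z" "\<And>z w. z \<in> Z ==> w \<in> Z ==> ez z = w \<odot>\<^sub>E ez (z \<otimes> w)" by blast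
 have ezc: "ez z \<in>: E" if "z \<in> Z" for z using ez(1)[OF that] by (simp add: A_def)
 have ezX: "ez z = e z" if "z \<in> Z" "z \<in> X" for z
 proof -
  have "\<pi> (gen z) = fr \<one> z" using zT[OF that(1)] by simp
  then have "\<one> \<odot>\<^sub>E ez z = lc R E e (gen z)"
   using ez(1)[OF that(1)] free_gen_closed[OF that(2)] unfolding A_def by blast
  then show ?thesis using eg[OF that(2)] ezc[OF that(1)] by simp
 qed
 define e' where "e' x = (if x \<in> X then e x else ez x)" for x
 have e'c: "e' x \<in>: E" if "x \<in> ?X" for x using that ec ezc by (auto simp: e'_def)
 have e'Z: "e' z = ez z" if "z \<in> Z" for z using ezX that by (simp add: e'_def)
 have e'l: "lin R (FM ?X) E (lc R E e')" by (rule lc_lin[OF E e'c])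
 have e'X: "lc R E e' p = lc R E e p" if "p \<in>: FM X" for p
  by (rule lc_cong[OF E that ec]) (simp_all add: e'_def)
 note e'r = lin_all[OF e'l free_is_module E]
 have e'g: "lc R E e' (gen x) = e' x" if "x \<in> ?X" for x using lc_gen[OF E, of e' x] e'c[OF that] by simp
 interpret FX': module R "FM ?X" by (rule free_is_module)
 have van: "k \<in>: FM ?X \<and> lc R E e' k = \<zero>\<^sub>E" if k: "k \<in> ?B" for k
 proof -
  consider "k \<in> L" "k \<in>: FM X" | z w where "z \<in> Z" "w \<in> Z" "k = rel R z w" | z where "z \<in> Z" "k = \<kappa> z" using k by blast
  then show ?thesis
  proof cases
   case 1
   then show ?thesis using free_mono[of X ?X] e'X sol by (auto simp: solution_def)
  next
   case (2 z w)
   then have zw: "z \<in> ?X" "z \<otimes> w \<in> ?X" "w \<in>: R" using Zm zT by auto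
   have "lc R E e' k = ez z \<ominus>\<^sub>E w \<odot>\<^sub>E ez (z \<otimes> w)"
    using 2 zw by (simp add: rel_eq[OF zw] e'r e'g e'Z Zm)
   then show ?thesis using 2 zw ez(2)[of z w] ezc[of z] by (simp add: rel_closed)
  next
   case (3 z)
   have z: "z \<in> T" "z \<in> ?X" using 3 zT by auto
   have PX: "P z \<in>: FM ?X" using P(1)[OF z(1)] free_mono[of X ?X] by auto
   have gz: "\<epsilon> z \<odot>\<^bsub>FM ?X\<^esub> gen z \<in>: FM ?X" using z \<epsilon>(1) by simp
   have ke: "k = \<epsilon> z \<odot>\<^bsub>FM ?X\<^esub> gen z \<ominus>\<^bsub>FM ?X\<^esub> P z"
    unfolding free_minus_same[OF X'T gz PX] 3(2) \<kappa>_def by (simp only: free_same_ops[where X = ?X])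
   have "lc R E e' k = \<epsilon> z \<odot>\<^sub>E ez z \<ominus>\<^sub>E lc R E e (P z)"
    using gz PX z \<epsilon>(1)[OF z(1)] unfolding ke by (simp add: e'r e'g e'Z[OF 3(1)] e'X[OF P(1)[OF z(1)]])
   moreover have "\<epsilon> z \<odot>\<^sub>E ez z = lc R E e (P z)"
    using ez(1)[OF 3(1)] \<epsilon>(1)[OF z(1)] P[OF z(1)] unfolding A_def by blast
   ultimately show ?thesis using er(1)[OF P(1)[OF z(1)]] gz PX unfolding ke by simp
  qed
 qed
 have "closed_denoms ?X \<and> solution E ?X e'"
  by (rule denoms_from_generators[OF X'T _ mult BL decomp supp E e'c van]) (use X1 in auto)
 then show ?thesis using tZ by (intro exI[of _ ?X] exI[of _ e']) (auto simp: e'_def)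
qed

end

context section_loc begin

text \<open>Let \<open>s0\<close> kill the torsion. If \<open>r/z = 0\<close>, then \<open>r s0 = 0\<close>, and the relation \<open>r e\<^sub>z\<close> is the multiple \<open>r (e\<^sub>z -
 s0 e\<^sub>z\<^sub>s\<^sub>0)\<close>. So the relations among the denominators of a countable monoid \<open>Z\<close> are generated by countably many
 ones.\<close>

lemma initial_denoms:
 assumes E: "module R E" and div: "divisible_by E T" and y: "y \<in>: E"
  and s0: "s0 \<in> T" "\<And>s r. s \<in> T ==> r \<in>: R ==> s \<otimes> r = \<zero> ==> s0 \<otimes> r = \<zero>"
 shows "\<exists>X e. closed_denoms X \<and> solution E X e \<and> e \<one> = y"
proof -
 interpret E: module R E by fact
 interpret G: module R G by (rule free_T)
 interpret QM: module R QM by (rule loc_module)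
 define g where "g z w = insert (z \<otimes> w) (sec_denoms (rel R z w))" for z w
 have "\<exists>Z. countable Z \<and> {\<one>, s0} \<subseteq> Z \<and> Z \<subseteq> T \<and> (\<forall>x\<in>Z. \<forall>y\<in>Z. g x y \<subseteq> Z)"
 proof (rule countable_closure)
  show "countable (g x y) \<and> g x y \<subseteq> T" if "x \<in> T" "y \<in> T" for x y
   using sec_denoms[OF rel_in_ker[OF that]] that by (auto simp: g_def)
 qed (use s0 in auto)
 then obtain Z where Zc: "countable Z" and Z1: "\<one> \<in> Z" and sZ: "s0 \<in> Z" and ZT: "Z \<subseteq> T" and Zg: "\<And>x y. x \<in> Z ==> y \<in> Z ==> g x y \<subseteq> Z"
  by (metis insert_subset)
 have Zm: "x \<otimes> y \<in> Z" if "x \<in> Z" "y \<in> Z" for x y using Zg[OF that] by (simp add: g_def)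
 have Zmon: "submonoid Z R" by (rule submonoid.intro) (use ZT Zm Z1 in auto)
 have zT: "z \<in> T" if "z \<in> Z" for z using that ZT by auto
 let ?B = "{rel R z w | z w. z \<in> Z \<and> w \<in> Z}"
 let ?\<Gamma> = "gen_submodule R G ?B"
 have BL: "?B \<subseteq> L" using zT rel_in_ker by auto
 then have BG: "?B \<subseteq> carrier G" using L_simps(1) by blast
 note \<Gamma> = gen_submodule[OF free_T BG] and \<Gamma>r = submoduleD[OF gen_submodule(1)[OF free_T BG] free_T]
 have \<Gamma>L: "?\<Gamma> \<subseteq> L" by (rule \<Gamma>(3)[OF loc_ker_submodule BL])
 have gen: "p \<in> ?\<Gamma>" if p: "p \<in> L" "p \<in>: FM Z" for p
 proof -
  have pG: "p \<in>: G" using L_simps(1)[OF p(1)] .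
  obtain z r where z: "z \<in> Z" "r \<in>: R" "p \<ominus>\<^sub>G r \<odot>\<^sub>G gen z \<in> ?\<Gamma>"
   using common_denominator[OF Zmon ZT p(2)] by auto
  have zs: "z \<in> T" "s0 \<in> T" "z \<in>: R" "s0 \<in>: R" using zT[OF z(1)] s0(1) by auto
  have ez: "gen z \<in>: G" "gen (z \<otimes> s0) \<in>: G" "rel R z s0 \<in>: G"
   using zs rel_closed[of z T s0] by auto
  have "\<pi> (r \<odot>\<^sub>G gen z) = \<pi> p" using ker_diff_iff[OF pG, of "r \<odot>\<^sub>G gen z"] z(2,3) \<Gamma>L ez(1) by auto
  then have "fr r z = \<zero>\<^sub>QM" using loc_proj_gen_smult[OF z(2) zs(1)] p(1) by (simp add: loc_ker_def mod_ker_def)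
  then obtain t where "t \<in> T" "t \<otimes> r = \<zero>" using frac_eq_zero[OF z(2) zs(1)] by (auto simp: loc_module_simps(2))
  then have "r \<otimes> s0 = \<zero>" using s0(2)[OF _ z(2)] zs z(2) m_comm[of r s0] by simp
  have "r \<odot>\<^sub>G rel R z s0 = r \<odot>\<^sub>G gen z"
  proof -
   have "r \<odot>\<^sub>G (a \<ominus>\<^sub>G s0 \<odot>\<^sub>G b) = r \<odot>\<^sub>G a \<ominus>\<^sub>G (r \<otimes> s0) \<odot>\<^sub>G b" if "a \<in>: G" "b \<in>: G" for a b
    using that z(2) zs by algebra
   from this[OF ez(1,2)] show ?thesis
    using rel_eq[of z T s0] zs ez z(2) \<open>r \<otimes> s0 = \<zero>\<close> by (simp add: G.M.minus_eq G.M.minus_zero')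
  qed
  then have rz: "r \<odot>\<^sub>G gen z \<in> ?\<Gamma>" using \<Gamma>r(4)[OF z(2), of "rel R z s0"] \<Gamma>(2) z(1) sZ by auto
  have "p = (p \<ominus>\<^sub>G r \<odot>\<^sub>G e) \<oplus>\<^sub>G r \<odot>\<^sub>G e" if "e \<in>: G" for e using that pG z(2) by algebra
  from this[OF ez(1)] show ?thesis using \<Gamma>r(3)[OF z(3) rz] by simp
 qed
 have mult: "fr \<one> (x \<otimes> y) \<in> span_of Z" if "x \<in> Z" "y \<in> Z" for x y
  unfolding span_of_def using loc_proj_gen[of "x \<otimes> y"] Zm[OF that] ZT by (metis free_gen_closed imageI subsetD)
 have supp: "fst i \<in> Z \<and> fst i \<otimes> snd i \<in> Z" if k: "k \<in> ?B" and i: "\<sigma> k i \<noteq> \<zero>" for k i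
 proof -
  obtain z w where "z \<in> Z" "w \<in> Z" "k = rel R z w" using k by blast
  then have "sec_denoms k \<subseteq> Z" using Zg[of z w] by (auto simp: g_def)
  then show ?thesis using i unfolding sec_denoms_def by blast
 qed
 have "\<exists>e. (\<forall>z\<in>Z. e z \<in>: E) \<and> e \<one> = y \<and> (\<forall>z\<in>Z. \<forall>w\<in>Z. e z = w \<odot>\<^sub>E e (z \<otimes> w))"
  by (rule divide_successively[OF Zmon Zc E])
   (use y zT in \<open>auto simp: divisible_by_def intro: div[unfolded divisible_by_def, rule_format]\<close>)
 then obtain e where e: "\<And>z. z \<in> Z ==> e z \<in>: E" "e \<one> = y" "\<And>z w. z \<in> Z ==> w \<in> Z ==> e z = w \<odot>\<^sub>E e (z \<otimes> w)" by blast
 have el: "lin R (FM Z) E (lc R E e)" by (rule lc_lin[OF E e(1)])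
 note er = lin_all[OF el free_is_module E]
 have eg: "lc R E e (gen x) = e x" if "x \<in> Z" for x using lc_gen[OF E, of e x] e(1)[OF that] by simp
 interpret FZ: module R "FM Z" by (rule free_is_module)
 have van: "k \<in>: FM Z \<and> lc R E e k = \<zero>\<^sub>E" if k: "k \<in> ?B" for k
 proof -
  obtain z w where zw: "z \<in> Z" "w \<in> Z" "k = rel R z w" using k by blast
  then have zw': "z \<otimes> w \<in> Z" "w \<in>: R" using Zm zT by auto
  have "lc R E e k = e z \<ominus>\<^sub>E w \<odot>\<^sub>E e (z \<otimes> w)" using zw zw' by (simp add: rel_eq[OF zw(1) zw'] er eg)
  then show ?thesis using e(3)[OF zw(1,2)] e(1)[OF zw(1)] zw zw' by (simp add: rel_closed)
 qed
 have "closed_denoms Z \<and> solution E Z e" by (rule denoms_from_generators[OF ZT Z1 mult BL gen supp E e(1) van])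
 then show ?thesis using e(2) by blast
qed

text \<open>The pairs of a closed set of denominators and a solution on it are ordered by inclusion of graphs. All
 conditions on such a pair involve finitely many denominators at a time, and so they pass to unions of chains.\<close>

lemma denoms_chain:
 assumes E: "module R E" and C: "\<C> \<noteq> {}" and ch: "subset.chain {(\<lambda>x. (x, e x)) ` X | X e. closed_denoms X \<and> solution E X e \<and> e \<one> = y} \<C>"
 shows "\<exists>X e. \<Union>\<C> = (\<lambda>x. (x, e x)) ` X \<and> closed_denoms X \<and> solution E X e \<and> e \<one> = y"
proof -
 let ?A = "{(\<lambda>x. (x, e x)) ` X | X e. closed_denoms X \<and> solution E X e \<and> e \<one> = y}"
 define X where "X = fst ` \<Union>\<C>"
 define e where "e x = (SOME v. (x, v) \<in> \<Union>\<C>)" for x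
 have graph: "\<exists>X e. g = (\<lambda>x. (x, e x)) ` X \<and> closed_denoms X \<and> solution E X e \<and> e \<one> = y" if "g \<in> \<C>" for g
 proof -
  have "g \<in> ?A" using ch that by (simp only: subset.chain_def subset_iff)
  then show ?thesis by (rule CollectD)
 qed
 have func: "v = w" if vw: "(x, v) \<in> \<Union>\<C>" "(x, w) \<in> \<Union>\<C>" for x v w
 proof -
  obtain g where "g \<in> \<C>" "{(x, v), (x, w)} \<subseteq> g"
   using finite_subset_Union_chain[OF _ _ C ch, of "{(x, v), (x, w)}"] vw by auto
  then show ?thesis using graph[of g] by auto
 qed
 have ev: "(x, e x) \<in> \<Union>\<C>" if x: "x \<in> X" for x
  unfolding e_def by (rule someI_ex) (use x in \<open>force simp: X_def\<close>)
 have un: "\<Union>\<C> = (\<lambda>x. (x, e x)) ` X"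
 proof
  show "\<Union>\<C> \<subseteq> (\<lambda>x. (x, e x)) ` X"
  proof
   fix p assume p: "p \<in> \<Union>\<C>"
   then have "fst p \<in> X" by (simp only: X_def imageI)
   then show "p \<in> (\<lambda>x. (x, e x)) ` X" using func[of "fst p" "snd p" "e (fst p)"] ev[of "fst p"] p
    by (intro image_eqI[of _ _ "fst p"]) (simp_all add: prod_eq_iff)
  qed
 qed (use ev in blast)
 have fin: "\<exists>X' e'. Y \<subseteq> X' \<and> X' \<subseteq> X \<and> closed_denoms X' \<and> solution E X' e' \<and> e' \<one> = y \<and> (\<forall>x\<in>X'. e x = e' x)"
  if Y: "finite Y" "Y \<subseteq> X" for Y
 proof -
  obtain g where g: "g \<in> \<C>" "(\<lambda>x. (x, e x)) ` Y \<subseteq> g"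
   using finite_subset_Union_chain[OF _ _ C ch, of "(\<lambda>x. (x, e x)) ` Y"] Y ev by blast
  obtain X' e' where X': "g = (\<lambda>x. (x, e' x)) ` X'" "closed_denoms X'" "solution E X' e'" "e' \<one> = y" using graph[OF g(1)] by blast
  have mem: "(x, e' x) \<in> \<Union>\<C>" if "x \<in> X'" for x using that g(1) X'(1) by blast
  have sub: "X' \<subseteq> X" unfolding X_def using mem by (metis fst_conv image_eqI subsetI)
  have "e x = e' x" if "x \<in> X'" for x using func[OF ev mem[OF that]] that sub by blast
  moreover have "Y \<subseteq> X'" using g(2) X'(1) by auto
  ultimately show ?thesis using X' sub by blast
 qed
 have pfin: "\<exists>X' e'. p \<in>: FM X' \<and> X' \<subseteq> X \<and> closed_denoms X' \<and> solution E X' e' \<and> (\<forall>x\<in>X'. e x = e' x)"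
  if p: "p \<in>: FM X" for p
 proof -
  have "finite {x. p x \<noteq> \<zero>}" "{x. p x \<noteq> \<zero>} \<subseteq> X" using p by (auto simp: free_module_def)
  from fin[OF this] obtain X' e' where X': "{x. p x \<noteq> \<zero>} \<subseteq> X'" "X' \<subseteq> X" "closed_denoms X'" "solution E X' e'" "\<forall>x\<in>X'. e x = e' x" by blast
  moreover have "p \<in>: FM X'" using X'(1) p by (auto simp: free_module_def)
  ultimately show ?thesis by blast
 qed
 obtain X0 e0 where X0: "X0 \<subseteq> X" "closed_denoms X0" "e0 \<one> = y" "\<forall>x\<in>X0. e x = e0 x" using fin[of "{}"] by auto
 have X1: "\<one> \<in> X" "e \<one> = y" using X0 XT by (auto simp: closed_denoms_def)
 have cl: "closed_denoms X"
  unfolding closed_denoms_def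
 proof (intro conjI ballI impI allI)
  show "X \<subseteq> T" 
  proof
   fix x assume "x \<in> X"
   then obtain X' where "x \<in> X'" "closed_denoms X'" using fin[of "{x}"] by blast
   then show "x \<in> T" by (auto simp: closed_denoms_def)
  qed
  show "fr \<one> (x \<otimes> z) \<in> span_of X" if xz: "x \<in> X" "z \<in> X" for x z
  proof -
   obtain X' where X': "x \<in> X'" "z \<in> X'" "X' \<subseteq> X" "closed_denoms X'" using fin[of "{x, z}"] xz by blast
   have "span_of X' \<subseteq> span_of X" unfolding span_of_def using free_mono[OF X'(3)] by (rule image_mono)
   then show ?thesis using Xmult[OF X'(4,1,2)] by blast
  qed
  fix l a b assume l: "l \<in> L" "l \<in>: FM X" "\<sigma> l (a, b) \<noteq> \<zero>"
  obtain X' where "l \<in>: FM X'" "X' \<subseteq> X" "closed_denoms X'" using pfin[OF l(2)] by blast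
  then show "a \<in> X" "a \<otimes> b \<in> X" using Xsec[of X' l a b] l by blast+
 qed (rule X1)
 have "solution E X e"
  unfolding solution_def
 proof (intro conjI ballI impI)
  fix x assume "x \<in> X"
  then obtain X' e' where "x \<in> X'" "solution E X' e'" "\<forall>x\<in>X'. e x = e' x" using fin[of "{x}"] by blast
  then show "e x \<in>: E" by (simp add: solution_def)
 next
  fix p assume p: "p \<in> L" "p \<in>: FM X"
  obtain X' e' where X': "p \<in>: FM X'" "solution E X' e'" "\<forall>x\<in>X'. e x = e' x" using pfin[OF p(2)] by blast
  have "lc R E e p = lc R E e' p" by (rule lc_cong[OF E X'(1)]) (use X' in \<open>auto simp: solution_def\<close>)
  then show "lc R E e p = \<zero>\<^sub>E" using X' p(1) by (simp add: solution_def)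
 qed
 then show ?thesis using un cl X1 by blast
qed

text \<open>By Zorn's lemma there is a maximal solution, and as it cannot be enlarged, it is defined on all
 denominators.\<close>

lemma divisible_bounded:
 assumes E: "module R E" and div: "divisible_by E T" and y: "y \<in>: E" and b: "bounded_torsion R T"
 shows "\<exists>e\<in>carrier (loc_hom R T E). e \<one> = y"
proof -
 interpret E: module R E by fact
 let ?A = "{(\<lambda>x. (x, e x)) ` X | X e. closed_denoms X \<and> solution E X e \<and> e \<one> = y}"
 obtain s0 where s0: "s0 \<in> T" "\<forall>s\<in>T. \<forall>r\<in>carrier R. s \<otimes> r = \<zero> --> s0 \<otimes> r = \<zero>"
  using b by (auto simp: bounded_torsion_def)
 have "\<exists>g\<in>?A. \<forall>h\<in>?A. g \<subseteq> h --> h = g"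
 proof (rule subset_Zorn_nonempty)
  show "?A \<noteq> {}" using initial_denoms[OF E div y s0(1)] s0(2) by blast
  show "\<Union>\<C> \<in> ?A" if "\<C> \<noteq> {}" "subset.chain ?A \<C>" for \<C> using denoms_chain[OF E that] by blast
 qed
 then obtain g where g: "g \<in> ?A" and max: "\<And>h. h \<in> ?A ==> g \<subseteq> h ==> h = g" by (rule bexE) (simp only:)
 obtain X e where X: "g = (\<lambda>x. (x, e x)) ` X" "closed_denoms X" "solution E X e" "e \<one> = y" using CollectD[OF g] by blast
 have "t \<in> X" if t: "t \<in> T" for t
 proof -
  obtain X' e' where X': "closed_denoms X'" "X \<subseteq> X'" "t \<in> X'" "solution E X' e'" "\<forall>x\<in>X. e' x = e x"
   using denoms_extend[OF X(2) E X(3) div t] by blast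
  have "(\<lambda>x. (x, e' x)) ` X' = g"
  proof (rule max)
   have "e' \<one> = y" using X'(5) X1[OF X(2)] X(4) by simp
   then show "(\<lambda>x. (x, e' x)) ` X' \<in> ?A" using X' by blast
   show "g \<subseteq> (\<lambda>x. (x, e' x)) ` X'" unfolding X(1) using X'(2,5) by force
  qed
  then show ?thesis using X'(3) X(1) by blast
 qed
 then have XT: "X = T" using XT[OF X(2)] by blast
 have ec: "\<And>x. x \<in> T ==> e x \<in>: E" using X(3) XT by (auto simp: solution_def)
 have el: "lin R G E (lc R E e)" by (rule lc_lin[OF E ec])
 note er = lin_all[OF el free_is_module E]
 have eg: "lc R E e (gen x) = e x" if "x \<in> T" for x using lc_gen[OF E, of e x] ec[OF that] by simp
 have "restrict e T \<in>: loc_hom R T E"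
 proof (rule loc_hom_memI)
  fix s t assume st: "s \<in> T" "t \<in> T"
  interpret G: module R G by (rule free_T)
  have "lc R E e (rel R s t) = \<zero>\<^sub>E" using X(3) rel_in_ker[OF st] rel_closed[of s T t] st XT by (simp add: solution_def)
  then have "e s \<ominus>\<^sub>E t \<odot>\<^sub>E e (s \<otimes> t) = \<zero>\<^sub>E" using st rel_eq[of s T t] by (simp add: er eg)
  then show "e s = t \<odot>\<^sub>E e (s \<otimes> t)" using st ec by (simp add: E.minus_eq_zero_iff)
 qed (rule ec)
 then show ?thesis using X(4) by (intro bexI[of _ "restrict e T"]) auto
qed

end

section \<open>Extending maps from the syzygies of a free resolution\<close>

lemma (in cring) lc_family:
 assumes C: "module R C" and a: "\<And>i. i \<in> X ==> a i \<in>: C" and q: "q \<in>: FM X"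
 shows "(\<And>i. i \<in> X ==> b i \<in>: C) ==> lc R C (\<lambda>i. a i \<oplus>\<^sub>C b i) q = lc R C a q \<oplus>\<^sub>C lc R C b q"
  and "r \<in>: R ==> lc R C (\<lambda>i. r \<odot>\<^sub>C a i) q = r \<odot>\<^sub>C lc R C a q"
proof -
 interpret C: module R C by fact
 note l = lc_lin[OF C]
 show "lc R C (\<lambda>i. a i \<oplus>\<^sub>C b i) q = lc R C a q \<oplus>\<^sub>C lc R C b q" if b: "\<And>i. i \<in> X ==> b i \<in>: C"
  by (rule free_ext[OF l lin_plus[OF l l C] C _ q]) (simp_all add: lc_gen[OF C] a b)
 show "lc R C (\<lambda>i. r \<odot>\<^sub>C a i) q = r \<odot>\<^sub>C lc R C a q" if r: "r \<in>: R"
  by (rule free_ext[OF l lin_scale[OF l r C] C _ q]) (simp_all add: lc_gen[OF C] a r)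
qed

lemma (in cring) lin_lc:
 assumes C: "module R C" and g: "\<And>i. i \<in> X ==> lin R M C (g i)" and q: "q \<in>: FM X"
 shows "lin R M C (\<lambda>p. lc R C (\<lambda>i. g i p) q)"
proof (rule linI)
 fix p assume p: "p \<in>: M"
 have gc: "g i p \<in>: C" if "p \<in>: M" "i \<in> X" for i p using linD(1)[OF g] that by blast
 interpret C: module R C by (rule C)
 show "lc R C (\<lambda>i. g i p) q \<in>: C" by (rule linD(1)[OF lc_lin[OF C gc[OF p]] q])
 show "lc R C (\<lambda>i. g i (p \<oplus>\<^sub>M p')) q = lc R C (\<lambda>i. g i p) q \<oplus>\<^sub>C lc R C (\<lambda>i. g i p') q" if p': "p' \<in>: M" for p'
  using lc_cong[OF C q, of "\<lambda>i. g i (p \<oplus>\<^sub>M p')" "\<lambda>i. g i p \<oplus>\<^sub>C g i p'"] lc_family(1)[OF C gc[OF p] q gc[OF p']] p p' gc linD(2)[OF g] by auto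
 show "lc R C (\<lambda>i. g i (r \<odot>\<^sub>M p)) q = r \<odot>\<^sub>C lc R C (\<lambda>i. g i p) q" if r: "r \<in>: R" for r
  using lc_cong[OF C q, of "\<lambda>i. r \<odot>\<^sub>C g i p" "\<lambda>i. g i (r \<odot>\<^sub>M p)"] lc_family(2)[OF C gc[OF p] q r] p r gc linD(3)[OF g] by auto
qed

locale free_base = cring R for R (structure) +
 fixes W :: "'w set"
begin

abbreviation \<Phi> where "\<Phi> \<equiv> free_module R W"

lemma \<Phi>: "module R \<Phi>" by (rule free_is_module)

end

text \<open>A free resolution whose terms are all equal to one free module; \<open>K (n + 1)\<close> is the kernel of \<open>d n\<close>, and \<open>K 0\<close>
 that of the augmentation.\<close>

locale resolution = free_base R W for R :: "('a, 'b) ring_scheme" (structure) and W :: "'w set" +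
 fixes K :: "nat => ('w => 'a) set" and d :: "nat => ('w => 'a) => 'w => 'a"
 assumes K: "submodule (K n) R \<Phi>" and d: "lin R \<Phi> \<Phi> (d n)"
  and d_image: "d n ` carrier \<Phi> = K n"
  and d_ker: "p \<in>: \<Phi> ==> d n p = \<zero>\<^sub>\<Phi> \<longleftrightarrow> p \<in> K (Suc n)"
begin

text \<open>Since \<open>K n\<close> is the quotient of \<open>\<Phi>\<close> by \<open>K (n + 1)\<close>.\<close>

lemma d_factor:
 assumes C: "module R C" and h: "lin R \<Phi> C h" and z: "\<And>p. p \<in> K (Suc n) ==> h p = \<zero>\<^sub>C"
 shows "\<exists>g. lin R (\<Phi> |: K n) C g \<and> (\<forall>p\<in>carrier \<Phi>. g (d n p) = h p)"
proof (rule factor_through_surjection[OF _ _ h _ \<Phi> sub_module[OF K \<Phi>] C])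
 show "lin R \<Phi> (\<Phi> |: K n) (d n)" by (rule lin_into[OF d]) (use d_image in auto)
qed (use d_image d_ker z in auto)

text \<open>To divide a map \<open>f\<close> from \<open>K n\<close> to \<open>C\<close> by \<open>s\<close>, first make it zero modulo \<open>s\<close> and then lift it along the
 multiplication by \<open>s\<close>. The obstructions are for \<open>C/sC\<close> at \<open>K n\<close>, and for the annihilator of \<open>s\<close> in \<open>C\<close> at \<open>K (n +
 1)\<close>.\<close>

lemma ext_divisible:
 assumes C: "module R C" and s: "s \<in>: R" and y: "y \<in>: ext_mod R \<Phi> (K n) C"
  and ext_q: "extends R \<Phi> (K n) (quotient_module C ((\<lambda>x. s \<odot>\<^sub>C x) ` carrier C))"
  and ext_k: "extends R \<Phi> (K (Suc n)) (C |: {x \<in> carrier C. s \<odot>\<^sub>C x = \<zero>\<^sub>C})"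
 shows "\<exists>z\<in>carrier (ext_mod R \<Phi> (K n) C). s \<odot>\<^bsub>ext_mod R \<Phi> (K n) C\<^esub> z = y"
proof -
 interpret C: module R C by fact
 interpret F: module R \<Phi> by (rule \<Phi>)
 let ?H = "(\<lambda>x. s \<odot>\<^sub>C x) ` carrier C" and ?N = "{x \<in> carrier C. s \<odot>\<^sub>C x = \<zero>\<^sub>C}"
 note E = ext_mod[OF \<Phi> C K[of n]]
 interpret E: module R "ext_mod R \<Phi> (K n) C" by (rule E(1))
 have sl: "lin R C C (\<lambda>x. s \<odot>\<^sub>C x)" by (rule lin_scale[OF lin_id s C])
 have H: "submodule ?H R C" by (rule image_submodule[OF sl C C])
 have N: "submodule ?N R C" using ker_submodule[OF sl C C] by (simp add: mod_ker_def)
 obtain f where f: "lin R (\<Phi> |: K n) C f" "y = ext_class R \<Phi> (K n) C f" using E(3)[OF y] by blast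
 note Qm = quotient_is_module[OF C H]
 obtain g0 where g0: "lin R \<Phi> (quotient_module C ?H) g0" "\<And>k. k \<in> K n ==> g0 k = ?H +>\<^sub>C f k"
  using ext_q[unfolded extends_def, rule_format, OF lin_comp[OF f(1) quotient_proj(1)[OF C H]]] by blast
 obtain h where h: "lin R \<Phi> C h" "\<And>p. p \<in>: \<Phi> ==> ?H +>\<^sub>C h p = g0 p"
  using free_projective[OF quotient_proj(1,2)[OF C H] g0(1) C Qm] by blast
 have Kc: "k \<in>: \<Phi>" if "k \<in> K n" for k n using submoduleD(1)[OF K \<Phi> that] .
 note fr = lin_sub[OF f(1) \<Phi> C K] and hr = lin_all[OF h(1) \<Phi> C]
 have dc: "d n p \<in> K n" if "p \<in>: \<Phi>" for p using d_image that by blast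
 define u where "u p = f (d n p) \<ominus>\<^sub>C h (d n p)" for p
 have dl: "lin R \<Phi> (\<Phi> |: K n) (d n)" by (rule lin_into[OF d dc])
 have ul: "lin R \<Phi> C u" unfolding u_def by (rule lin_diff[OF lin_comp[OF dl f(1)] lin_comp[OF d h(1)] C])
 have uH: "u p \<in> ?H" if p: "p \<in>: \<Phi>" for p
  unfolding u_def quotient_coset(2)[OF C H fr(1)[OF dc[OF p]] hr(1)[OF Kc[OF dc[OF p]]], symmetric]
   g0(2)[OF dc[OF p], symmetric] by (rule h(2)[OF Kc[OF dc[OF p]], symmetric])
 obtain v where v: "lin R \<Phi> C v" "\<And>p. p \<in>: \<Phi> ==> s \<odot>\<^sub>C v p = u p"
  using free_projective[OF lin_into[OF sl, of ?H] _ lin_into[OF ul uH] C sub_module[OF H C]] by auto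
 note vr = lin_all[OF v(1) \<Phi> C]
 have vN: "v p \<in> ?N" if p: "p \<in> K (Suc n)" for p
 proof -
  have "d n p = \<zero>\<^sub>\<Phi>" using d_ker p Kc by blast
  then show ?thesis using v(2) vr(1) Kc[OF p] fr(4) hr(4) by (simp add: u_def)
 qed
 have "lin R (\<Phi> |: K (Suc n)) (C |: ?N) v"
  by (rule lin_into[OF lin_restrict[OF v(1)]]) (use Kc vN in simp_all, blast)
 then obtain e where e: "lin R \<Phi> (C |: ?N) e" "\<And>p. p \<in> K (Suc n) ==> e p = v p"
  using ext_k unfolding extends_def by blast
 have el: "lin R \<Phi> C e" by (rule lin_outof[OF e(1)]) auto
 note er = lin_all[OF el \<Phi> C]
 have "v p \<ominus>\<^sub>C e p = \<zero>\<^sub>C" if "p \<in> K (Suc n)" for p using that vr(1) Kc e(2) by simp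
 then obtain g where g: "lin R (\<Phi> |: K n) C g" "\<And>p. p \<in>: \<Phi> ==> g (d n p) = v p \<ominus>\<^sub>C e p"
  using d_factor[OF C lin_diff[OF v(1) el C]] by blast
 have "s \<odot>\<^sub>C g k = f k \<ominus>\<^sub>C h k" if "k \<in> K n" for k
 proof -
  obtain p where p: "p \<in>: \<Phi>" "k = d n p" using d_image \<open>k \<in> K n\<close> by blast
  have "s \<odot>\<^sub>C e p = \<zero>\<^sub>C" using linD(1)[OF e(1) p(1)] by simp
  moreover have "s \<odot>\<^sub>C (a \<ominus>\<^sub>C b) = s \<odot>\<^sub>C a \<ominus>\<^sub>C s \<odot>\<^sub>C b" if "a \<in>: C" "b \<in>: C" for a b
   using that s by algebra
  ultimately have "s \<odot>\<^sub>C g k = u p" using g(2) v(2) p vr(1) er(1) linD(1)[OF ul p(1)] by (simp add: C.M.minus_eq C.M.minus_zero')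
  then show ?thesis using p by (simp add: u_def)
 qed
 then have "s \<odot>\<^bsub>ext_mod R \<Phi> (K n) C\<^esub> ext_class R \<Phi> (K n) C g = y \<ominus>\<^bsub>ext_mod R \<Phi> (K n) C\<^esub> ext_class R \<Phi> (K n) C h"
  using E(6)[OF g(1) s] E(7)[OF f(1) lin_restrict[OF h(1)]] E(8)[of "\<lambda>x. s \<odot>\<^sub>C g x" "\<lambda>x. f x \<ominus>\<^sub>C h x"] Kc f(2)
  by (simp add: subset_iff)
 moreover have "ext_class R \<Phi> (K n) C h = \<zero>\<^bsub>ext_mod R \<Phi> (K n) C\<^esub>"
  using E(4)[OF lin_restrict[OF h(1)]] h(1) Kc by auto
 ultimately show ?thesis using E(2)[OF g(1)] y by (intro bexI[of _ "ext_class R \<Phi> (K n) C g"]) (auto simp: E.M.minus_eq E.M.minus_zero')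
qed

text \<open>A family of maps \<open>f u\<close>, compatible up to maps which extend to \<open>\<Phi>\<close>, is corrected to a compatible family, that
 is, a map to \<open>Hom(U\<^sup>-\<^sup>1R, C)\<close>. The section turns the errors into a cocycle, and the class of this cocycle is a map
 from \<open>\<Phi>\<close> to \<open>Ext(U\<^sup>-\<^sup>1R, C)\<close> which vanishes on \<open>K n\<close>.\<close>

lemma extend_from_family:
 assumes U: "submonoid U R" and sec: "loc_section R U \<sigma>" and C: "module R C"
  and f: "\<And>u. u \<in> U ==> lin R (\<Phi> |: K n) C (f u)"
  and g: "\<And>u t. u \<in> U ==> t \<in> U ==> lin R \<Phi> C (g u t)"
   "\<And>u t k. u \<in> U ==> t \<in> U ==> k \<in> K n ==> g u t k = f u k \<ominus>\<^sub>C t \<odot>\<^sub>C f (u \<otimes> t) k"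
  and lift: "\<And>q. lin R \<Phi> (ext_mod R (FM U) (loc_ker R U) C) q ==>
   (\<And>k. k \<in> K n ==> q k = \<zero>\<^bsub>ext_mod R (FM U) (loc_ker R U) C\<^esub>) ==>
   \<exists>q'. lin R \<Phi> (hom_module R ((FM U) |: loc_ker R U) C) q' \<and>
    (\<forall>k\<in>K n. q' k = \<zero>\<^bsub>hom_module R ((FM U) |: loc_ker R U) C\<^esub>) \<and>
    (\<forall>p\<in>carrier \<Phi>. ext_class R (FM U) (loc_ker R U) C (q' p) = q p)"
  and ext: "extends R \<Phi> (K n) (loc_hom R U C)"
 shows "\<exists>h. lin R \<Phi> C h \<and> (\<forall>k\<in>K n. h k = f \<one> k)"
proof -
 interpret U: section_loc R U \<sigma>
  by (rule section_loc.intro[OF localizedI[OF U] section_loc_axioms.intro[OF sec]])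
 interpret C: module R C by fact
 interpret G: module R U.G by (rule U.free_T)
 let ?G = U.G and ?L = U.L
 let ?GL = "?G |: ?L" and ?D = "ext_mod R ?G ?L C" and ?cl = "ext_class R ?G ?L C"
 let ?Hm = "hom_module R ?GL C"
 have GL: "module R ?GL" by (rule U.ker_module)
 have Hm: "module R ?Hm" by (rule hom_is_module[OF GL C])
 note D = ext_mod[OF U.free_T C U.loc_ker_submodule]
 interpret D: module R ?D by (rule D(1))
 have Kc: "k \<in>: \<Phi>" if "k \<in> K n" for k n using submoduleD(1)[OF K \<Phi> that] .
 have gc: "(case i of (u, t) => g u t p) \<in>: C" if "p \<in>: \<Phi>" "i \<in> U \<times> U" for i p
  using linD(1)[OF g(1)] that by auto
 have fc: "f u k \<in>: C" if "u \<in> U" "k \<in> K n" for u k using linD(1)[OF f[OF that(1)]] that(2) by simp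
 note ll = lc_lin[OF C]
 define \<Psi> where "\<Psi> p = restrict (\<lambda>l. lc R C (\<lambda>(u, t). g u t p) (\<sigma> l)) ?L" for p
 have \<Psi>v: "\<Psi> p l = lc R C (\<lambda>(u, t). g u t p) (\<sigma> l)" if "l \<in> ?L" for p l using that by (simp add: \<Psi>_def)
 have sl: "\<sigma> l \<in>: FM (U \<times> U)" if "l \<in> ?L" for l using linD(1)[OF U.sec_lin] that by simp
 have \<Psi>c: "\<Psi> p \<in>: ?Hm" if p: "p \<in>: \<Phi>" for p
  using hom_module_carrier(2)[OF GL lin_comp[OF U.sec_lin ll[OF gc[OF p]]]] by (simp add: \<Psi>_def)
 have Hev: "lin R ?Hm C (\<lambda>\<psi>. \<psi> l)" if "l \<in> ?L" for l
  using that linD(1)[OF hom_module_carrier(1)[OF GL], of _ C l] by (intro linI) (auto simp: hom_module_apply)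
 have \<Psi>l: "lin R \<Phi> ?Hm \<Psi>"
  unfolding hom_module_eq
 proof (rule lin_into_fun_module[OF _ _ \<Phi>])
  show "\<Psi> p \<in> mod_hom R ?GL C" if "p \<in>: \<Phi>" for p using \<Psi>c[OF that] by (simp add: hom_module_def)
  show "lin R \<Phi> C (\<lambda>p. \<Psi> p l)" if "l \<in>: ?GL" for l
   using lin_lc[OF C _ sl, of \<Phi> "\<lambda>(u, t). g u t" l] g(1) that by (auto simp: \<Psi>_def split_def)
 qed (auto simp: mod_hom_def PiE_def)
 have \<Psi>K: "\<Psi> k l = lc R C (\<lambda>u. f u k) l" if k: "k \<in> K n" and l: "l \<in> ?L" for k l
 proof -
  have fl: "lin R ?G C (lc R C (\<lambda>u. f u k))" by (rule ll[OF fc[OF _ k]])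
  note flr = lin_all[OF fl U.free_T C]
  have "lc R C (\<lambda>(u, t). g u t k) (\<sigma> l) = lc R C (\<lambda>u. f u k) (relations R U (\<sigma> l))"
  proof (rule free_ext[OF ll[OF gc[OF Kc[OF k]]] lin_comp[OF U.relations_lin fl] C _ sl[OF l]])
   fix i assume "i \<in> U \<times> U"
   then obtain u t where ut: "i = (u, t)" "u \<in> U" "t \<in> U" by auto
   have fg: "lc R C (\<lambda>u. f u k) (gen x) = f x k" if "x \<in> U" for x
    using lc_gen[OF C, of "\<lambda>u. f u k" x] fc[OF that k] by simp
   show "lc R C (\<lambda>(u, t). g u t k) (gen i) = lc R C (\<lambda>u. f u k) (relations R U (gen i))"
    using lc_gen[OF C, of "\<lambda>(u, t). g u t k" i] gc[OF Kc[OF k], of i] ut g(2)[OF ut(2,3) k]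
    by (simp add: U.relations_gen U.rel_eq[of u U t] flr fg)
  qed
  then show ?thesis using \<Psi>v[OF l] U.sec_id[OF l] by simp
 qed
 have cl: "lin R \<Phi> ?D (\<lambda>p. ?cl (\<Psi> p))" by (rule lin_comp[OF \<Psi>l ext_class_lin(1)[OF U.free_T C U.loc_ker_submodule]])
 have "?cl (\<Psi> k) = \<zero>\<^sub>?D" if k: "k \<in> K n" for k
 proof -
  have "lin R ?G C (lc R C (\<lambda>u. f u k))" by (rule ll[OF fc[OF _ k]])
  then show ?thesis using D(4)[OF hom_module_carrier(1)[OF GL \<Psi>c[OF Kc[OF k]]]] \<Psi>K[OF k] by auto
 qed
 from lift[OF cl this] obtain q' where q': "lin R \<Phi> ?Hm q'" "\<And>k. k \<in> K n ==> q' k = \<zero>\<^sub>?Hm"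
  "\<And>p. p \<in>: \<Phi> ==> ?cl (q' p) = ?cl (\<Psi> p)" by auto
 have "\<exists>c. lin R ?G C c \<and> (\<forall>l\<in>?L. c l = \<Psi> (gen w) l \<ominus>\<^sub>C q' (gen w) l)" if w: "w \<in> W" for w
 proof -
  have lins: "lin R ?GL C (\<Psi> (gen w))" "lin R ?GL C (q' (gen w))"
   using w by (auto intro!: hom_module_carrier(1)[OF GL] \<Psi>c linD(1)[OF q'(1)])
  have "?cl (\<lambda>l. \<Psi> (gen w) l \<ominus>\<^sub>C q' (gen w) l) = \<zero>\<^sub>?D"
   using D(7)[OF lins] q'(3) D(2)[OF lins(1)] w by simp
  then show ?thesis using D(4)[OF lin_diff[OF lins C]] by blast
 qed
 then have "\<forall>w\<in>W. \<exists>c. lin R ?G C c \<and> (\<forall>l\<in>?L. c l = \<Psi> (gen w) l \<ominus>\<^sub>C q' (gen w) l)" by blast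
 from bchoice[OF this] obtain c where c: "\<And>w. w \<in> W ==> lin R ?G C (c w)"
  "\<And>w l. w \<in> W ==> l \<in> ?L ==> c w l = \<Psi> (gen w) l \<ominus>\<^sub>C q' (gen w) l" by blast
 define h where "h u = lc R C (\<lambda>w. c w (gen u))" for u
 have hl: "lin R \<Phi> C (h u)" if "u \<in> U" for u unfolding h_def by (rule ll) (use linD(1)[OF c(1)] that in auto)
 have diff: "f u k \<ominus>\<^sub>C h u k = t \<odot>\<^sub>C (f (u \<otimes> t) k \<ominus>\<^sub>C h (u \<otimes> t) k)" if k: "k \<in> K n" and ut: "u \<in> U" "t \<in> U" for k u t
 proof -
  have ut': "u \<otimes> t \<in> U" "t \<in>: R" using ut by auto
  have rl: "rel R u t \<in> ?L" by (rule U.rel_in_ker[OF ut])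
  have "\<Psi> k (rel R u t) \<ominus>\<^sub>C q' k (rel R u t) = h u k \<ominus>\<^sub>C t \<odot>\<^sub>C h (u \<otimes> t) k"
  proof (rule free_ext[OF lin_diff[OF lin_comp[OF \<Psi>l Hev[OF rl]] lin_comp[OF q'(1) Hev[OF rl]] C]
     lin_diff[OF hl[OF ut(1)] lin_scale[OF hl[OF ut'(1)] ut'(2) C] C] C _ Kc[OF k]])
   fix w assume w: "w \<in> W"
   have hg: "h x (gen w) = c w (gen x)" if "x \<in> U" for x
    unfolding h_def using lc_gen[OF C, of "\<lambda>w. c w (gen x)" w] linD(1)[OF c(1)[OF w]] that by simp
   show "\<Psi> (gen w) (rel R u t) \<ominus>\<^sub>C q' (gen w) (rel R u t) = h u (gen w) \<ominus>\<^sub>C t \<odot>\<^sub>C h (u \<otimes> t) (gen w)"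
    using c(2)[OF w rl] ut ut' by (simp add: hg U.rel_eq[of u U t] lin_all[OF c(1)[OF w] U.free_T C])
  qed
  moreover have "\<Psi> k (rel R u t) = f u k \<ominus>\<^sub>C t \<odot>\<^sub>C f (u \<otimes> t) k"
  proof -
   have fl: "lin R ?G C (lc R C (\<lambda>u. f u k))" by (rule ll[OF fc[OF _ k]])
   have fg: "lc R C (\<lambda>u. f u k) (gen x) = f x k" if "x \<in> U" for x
    using lc_gen[OF C, of "\<lambda>u. f u k" x] fc[OF that k] by simp
   show ?thesis unfolding \<Psi>K[OF k rl] using ut ut' by (simp add: fg U.rel_eq[of u U t] lin_all[OF fl U.free_T C])
  qed
  ultimately have eq: "f u k \<ominus>\<^sub>C t \<odot>\<^sub>C f (u \<otimes> t) k = h u k \<ominus>\<^sub>C t \<odot>\<^sub>C h (u \<otimes> t) k"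
   using q'(2)[OF k] rl fc[OF ut(1) k] fc[OF ut'(1) k] ut'(2) by (simp add: hom_module_apply C.M.minus_eq C.M.minus_zero')
  have alg: "a \<ominus>\<^sub>C b = t \<odot>\<^sub>C (a' \<ominus>\<^sub>C b')" if eq: "a \<ominus>\<^sub>C t \<odot>\<^sub>C a' = b \<ominus>\<^sub>C t \<odot>\<^sub>C b'"
   and cl: "a \<in>: C" "b \<in>: C" "a' \<in>: C" "b' \<in>: C" for a b a' b'
  proof -
   have "a \<ominus>\<^sub>C b = (a \<ominus>\<^sub>C t \<odot>\<^sub>C a') \<oplus>\<^sub>C t \<odot>\<^sub>C a' \<ominus>\<^sub>C b" using cl ut'(2) by algebra
   also have "\<dots> = t \<odot>\<^sub>C (a' \<ominus>\<^sub>C b')" unfolding eq using cl ut'(2) by algebra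
   finally show ?thesis .
  qed
  show ?thesis by (rule alg[OF eq]) (use fc k ut ut' linD(1)[OF hl] Kc in auto)
 qed
 \<comment> \<open>The corrected family is compatible, and thus a map to \<open>Hom(U\<^sup>-\<^sup>1R, C)\<close>; the value at \<open>1\<close> of its extension is the extension of \<open>f 1 - h 1\<close>.\<close>
 define \<psi> where "\<psi> k = restrict (\<lambda>u. f u k \<ominus>\<^sub>C h u k) U" for k
 have dlin: "lin R (\<Phi> |: K n) C (\<lambda>k. f u k \<ominus>\<^sub>C h u k)" if "u \<in> U" for u
  by (rule lin_diff[OF f[OF that] lin_restrict[OF hl[OF that]] C]) (use Kc in auto)
 have \<psi>c: "\<psi> k \<in>: loc_hom R U C" if "k \<in> K n" for k
  unfolding \<psi>_def by (rule U.loc_hom_memI) (use linD(1)[OF dlin, of _ k] that in simp, rule diff[OF that])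
 have "lin R (\<Phi> |: K n) (loc_hom R U C) \<psi>"
  by (subst U.loc_hom_eq, rule lin_into_fun_module[OF _ _ sub_module[OF K \<Phi>]])
   (use \<psi>c dlin in \<open>auto simp: \<psi>_def U.loc_hom_mem_iff PiE_def\<close>)
 then obtain \<psi>' where \<psi>': "lin R \<Phi> (loc_hom R U C) \<psi>'" "\<And>k. k \<in> K n ==> \<psi>' k = \<psi> k"
  using ext unfolding extends_def by blast
 have "h \<one> k \<oplus>\<^sub>C \<psi>' k \<one> = f \<one> k" if k: "k \<in> K n" for k
 proof -
  have "b \<oplus>\<^sub>C (a \<ominus>\<^sub>C b) = a" if "a \<in>: C" "b \<in>: C" for a b using that by algebra
  then show ?thesis using \<psi>'(2)[OF k] fc[OF U.T_one k] linD(1)[OF hl[OF U.T_one] Kc[OF k]] by (simp add: \<psi>_def)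
 qed
 then show ?thesis using lin_plus[OF hl[OF U.T_one] lin_comp[OF \<psi>'(1) U.loc_hom_eval[OF U.T_one]] C] by blast
qed

end

text \<open>The maps from \<open>K n\<close> to \<open>C\<close> modulo those which extend to \<open>\<Phi>\<close> form the module \<open>Ext\<^sup>n\<^sup>+\<^sup>1(F, C)\<close>. It is
 divisible by \<open>U\<close>, and hence the class of \<open>f0\<close> is the value at \<open>1\<close> of a map from \<open>U\<^sup>-\<^sup>1R\<close>. Representatives \<open>f u\<close> of
 the values at \<open>1/u\<close> are compatible up to extendable maps, and they can be made compatible: the obstruction is a
 map \<open>q\<close> from \<open>\<Phi>\<close> to \<open>Ext(U\<^sup>-\<^sup>1R, C)\<close> which vanishes on \<open>K n\<close>. For \<open>n = 0\<close> the target is zero. For \<open>n = n' + 1\<close> the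
 map \<open>q\<close> factors over \<open>K n'\<close> and from there extends to \<open>\<Phi>\<close>, so that it can be lifted to homomorphisms on the
 relations of \<open>U\<close>.\<close>

lemma (in resolution) extend_step:
 assumes U: "submonoid U R" and sec: "loc_section R U \<sigma>" and small: "countable U \<or> bounded_torsion R U" and C: "module R C"
  and ext_q: "\<And>s. s \<in> U ==> extends R \<Phi> (K n) (quotient_module C ((\<lambda>x. s \<odot>\<^sub>C x) ` carrier C))"
  and ext_k: "\<And>s. s \<in> U ==> extends R \<Phi> (K (Suc n)) (C |: {x \<in> carrier C. s \<odot>\<^sub>C x = \<zero>\<^sub>C})"
  and ext_0: "n = 0 ==> loc_cotorsion R U C"
  and ext_D: "\<And>n'. n = Suc n' ==> extends R \<Phi> (K n') (ext_mod R (FM U) (loc_ker R U) C)"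
  and ext_H: "extends R \<Phi> (K n) (loc_hom R U C)"
 shows "extends R \<Phi> (K n) C"
 unfolding extends_def
proof (intro allI impI)
 fix f0 assume f0: "lin R (\<Phi> |: K n) C f0"
 interpret U: section_loc R U \<sigma>
  by (rule section_loc.intro[OF localizedI[OF U] section_loc_axioms.intro[OF sec]])
 interpret C: module R C by fact
 let ?E = "ext_mod R \<Phi> (K n) C" and ?cl = "ext_class R \<Phi> (K n) C"
 note E = ext_mod[OF \<Phi> C K[of n]]
 interpret E: module R ?E by (rule E(1))
 let ?G = U.G and ?L = U.L
 let ?GL = "?G |: ?L" and ?D = "ext_mod R ?G ?L C" and ?cD = "ext_class R ?G ?L C"
 let ?Hm = "hom_module R ?GL C"
 have Hm: "module R ?Hm" by (rule hom_is_module[OF U.ker_module C])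
 note D = ext_mod[OF U.free_T C U.loc_ker_submodule]
 have div: "divisible_by ?E U" unfolding divisible_by_def
  using ext_divisible[OF C _ _ ext_q ext_k] by auto
 have "\<exists>e\<in>carrier (loc_hom R U ?E). e \<one> = ?cl f0"
  using small by (rule disjE) (erule U.divisible_countable[OF E(1) div _ E(2)[OF f0]], erule U.divisible_bounded[OF E(1) div E(2)[OF f0]])
 then obtain e where e: "e \<in>: loc_hom R U ?E" "e \<one> = ?cl f0" by (rule bexE)
 have "\<forall>u\<in>U. \<exists>f. lin R (\<Phi> |: K n) C f \<and> e u = ?cl f \<and> (u = \<one> --> f = f0)"
  using E(3)[OF U.loc_hom_closed[OF e(1)]] e(2) f0 by metis
 from bchoice[OF this] obtain f where f: "\<And>u. u \<in> U ==> lin R (\<Phi> |: K n) C (f u)" "\<And>u. u \<in> U ==> e u = ?cl (f u)" "f \<one> = f0"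
  using U.T_one by blast
 have "\<exists>g. lin R \<Phi> C g \<and> (\<forall>k\<in>K n. g k = f u k \<ominus>\<^sub>C t \<odot>\<^sub>C f (u \<otimes> t) k)" if ut: "u \<in> U" "t \<in> U" for u t
 proof -
  have ut': "u \<otimes> t \<in> U" "t \<in>: R" using ut by auto
  have tf: "lin R (\<Phi> |: K n) C (\<lambda>k. t \<odot>\<^sub>C f (u \<otimes> t) k)" by (rule lin_scale[OF f(1)[OF ut'(1)] ut'(2) C])
  have "?cl (\<lambda>k. f u k \<ominus>\<^sub>C t \<odot>\<^sub>C f (u \<otimes> t) k) = e u \<ominus>\<^sub>?E t \<odot>\<^sub>?E e (u \<otimes> t)"
   unfolding E(7)[OF f(1)[OF ut(1)] tf] E(6)[OF f(1)[OF ut'(1)] ut'(2)] f(2)[OF ut(1)] f(2)[OF ut'(1)] ..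
  also have "\<dots> = \<zero>\<^sub>?E"
   using U.loc_hom_compat[OF e(1) ut] U.loc_hom_closed[OF e(1) ut(1)] E.minus_self by simp
  finally show ?thesis using E(4)[OF lin_diff[OF f(1)[OF ut(1)] tf C]] by blast
 qed
 then have "\<exists>g. \<forall>u\<in>U. \<forall>t\<in>U. lin R \<Phi> C (g u t) \<and> (\<forall>k\<in>K n. g u t k = f u k \<ominus>\<^sub>C t \<odot>\<^sub>C f (u \<otimes> t) k)" by metis
 then obtain g where g: "\<And>u t. u \<in> U ==> t \<in> U ==> lin R \<Phi> C (g u t)"
  "\<And>u t k. u \<in> U ==> t \<in> U ==> k \<in> K n ==> g u t k = f u k \<ominus>\<^sub>C t \<odot>\<^sub>C f (u \<otimes> t) k" by blast
 have "\<exists>h. lin R \<Phi> C h \<and> (\<forall>k\<in>K n. h k = f \<one> k)"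
 proof (rule extend_from_family[OF U sec C f(1) g _ ext_H])
  fix q assume q: "lin R \<Phi> ?D q" and qK: "\<And>k. k \<in> K n ==> q k = \<zero>\<^sub>?D"
  show "\<exists>q'. lin R \<Phi> ?Hm q' \<and> (\<forall>k\<in>K n. q' k = \<zero>\<^sub>?Hm) \<and> (\<forall>p\<in>carrier \<Phi>. ?cD (q' p) = q p)"
  proof (cases n)
   case 0
   interpret Hm: module R ?Hm by (rule Hm)
   have triv: "X = \<zero>\<^sub>?D" if "X \<in>: ?D" for X
   proof -
    obtain \<psi> where \<psi>: "lin R ?GL C \<psi>" "X = ?cD \<psi>" using D(3)[OF \<open>X \<in>: ?D\<close>] by blast
    show ?thesis unfolding \<psi>(2) D(4)[OF \<psi>(1)] using ext_0[OF 0] \<psi>(1) by (auto simp: loc_cotorsion_def extends_def)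
   qed
   have z: "?cD \<zero>\<^sub>?Hm \<in>: ?D" by (rule D(2)[OF hom_module_carrier(1)[OF U.ker_module Hm.zero_closed]])
   have "?cD \<zero>\<^sub>?Hm = q p" if "p \<in>: \<Phi>" for p using triv[OF z] triv[OF linD(1)[OF q that]] by (simp only:)
   then show ?thesis using lin_zero[OF Hm] by blast
  next
   case (Suc n')
   obtain g where g: "lin R (\<Phi> |: K n') ?D g" "\<And>p. p \<in>: \<Phi> ==> g (d n' p) = q p"
    using d_factor[OF D(1) q, of n'] qK Suc by blast
   obtain \<theta> where \<theta>: "lin R \<Phi> ?D \<theta>" "\<And>k. k \<in> K n' ==> \<theta> k = g k"
    using ext_D[OF Suc] g(1) unfolding extends_def by blast
   obtain \<theta>' where \<theta>': "lin R \<Phi> ?Hm \<theta>'" "\<And>p. p \<in>: \<Phi> ==> ?cD (\<theta>' p) = \<theta> p"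
    using free_projective[OF ext_class_lin[OF U.free_T C U.loc_ker_submodule] \<theta>(1) Hm D(1)] by blast
   have dp: "d n' p \<in>: \<Phi>" "d n' p \<in> K n'" if "p \<in>: \<Phi>" for p using d_image linD(1)[OF d] that by auto
   have "\<theta>' (d n' k) = \<zero>\<^sub>?Hm" if "k \<in> K n" for k
    using d_ker[of k n'] submoduleD(1)[OF K \<Phi> that] that Suc lin_all(4)[OF \<theta>'(1) \<Phi> Hm] by simp
   moreover have "?cD (\<theta>' (d n' p)) = q p" if "p \<in>: \<Phi>" for p
    using \<theta>'(2)[OF dp(1)[OF that]] \<theta>(2)[OF dp(2)[OF that]] g(2)[OF that] by simp
   ultimately show ?thesis using lin_comp[OF d \<theta>'(1)] by blast
  qed
 qed
 then show "\<exists>g. lin R \<Phi> C g \<and> (\<forall>x\<in>K n. g x = f0 x)" using f(3) by simp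
qed

section \<open>Induction over the multiplicative subsets\<close>

locale mult_family = cring R for R (structure) +
 fixes I :: "nat set" and S :: "nat => 'a set"
 assumes S: "i \<in> I ==> submonoid (S i) R"
begin

abbreviation P where "P \<equiv> mult_prod R S"

lemma P_submonoid: "J \<subseteq> I ==> submonoid (P J) R"
proof
 show "P J \<subseteq> carrier R" if "J \<subseteq> I" using that S[THEN submonoid.subset]
  unfolding mult_prod_def by (intro Inter_lower) (auto intro!: submonoid.intro)
qed (auto simp: mult_prod_def intro: submonoid.m_closed submonoid.one_closed)

lemma P_upper: "j \<in> J ==> S j \<subseteq> P J"
 by (auto simp: mult_prod_def)

lemma P_mono: "J \<subseteq> J' ==> P J \<subseteq> P J'"
 unfolding mult_prod_def by (rule Inter_anti_mono) blast

lemma P_least: "submonoid T R ==> (\<And>j. j \<in> J ==> S j \<subseteq> T) ==> P J \<subseteq> T"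
 unfolding mult_prod_def by (rule Inter_lower) blast

lemma P_single: "i \<in> I ==> P {i} = S i"
 using P_least[OF S, of i "{i}"] P_upper[of i "{i}"] by auto

text \<open>The products \<open>s u\<close> form a submonoid which contains all the generators.\<close>

lemma P_insert:
 assumes J: "insert a J \<subseteq> I" and x: "x \<in> P (insert a J)"
 shows "\<exists>s\<in>P J. \<exists>u\<in>S a. x = s \<otimes> u"
proof -
 interpret PJ: localized R "P J" by (rule localizedI[OF P_submonoid]) (use J in auto)
 interpret Sa: localized R "S a" by (rule localizedI[OF S]) (use J in auto)
 have "P (insert a J) \<subseteq> {s \<otimes> u | s u. s \<in> P J \<and> u \<in> S a}"
 proof (rule P_least)
  show "submonoid {s \<otimes> u | s u. s \<in> P J \<and> u \<in> S a} R"
  proof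
   fix x y assume "x \<in> {s \<otimes> u | s u. s \<in> P J \<and> u \<in> S a}" "y \<in> {s \<otimes> u | s u. s \<in> P J \<and> u \<in> S a}"
   then obtain s u s' u' where xy: "x = s \<otimes> u" "y = s' \<otimes> u'" "s \<in> P J" "u \<in> S a" "s' \<in> P J" "u' \<in> S a" by blast
   then have "x \<otimes> y = (s \<otimes> s') \<otimes> (u \<otimes> u')" by (simp add: m_ac)
   then show "x \<otimes> y \<in> {s \<otimes> u | s u. s \<in> P J \<and> u \<in> S a}" using xy PJ.T_mult Sa.T_mult by blast
  next
   have "\<one> = \<one> \<otimes> \<one>" by simp
   then show "\<one> \<in> {s \<otimes> u | s u. s \<in> P J \<and> u \<in> S a}" using PJ.T_one Sa.T_one by blast
  qed auto
  fix j assume j: "j \<in> insert a J"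
  show "S j \<subseteq> {s \<otimes> u | s u. s \<in> P J \<and> u \<in> S a}"
  proof
   fix x assume x: "x \<in> S j"
   show "x \<in> {s \<otimes> u | s u. s \<in> P J \<and> u \<in> S a}"
   proof (cases "j = a")
    case True
    then have "x = \<one> \<otimes> x" using x by simp
    then show ?thesis using x True PJ.T_one by blast
   next
    case False
    then have xP: "x \<in> P J" using j x P_upper by blast
    then have "x = x \<otimes> \<one>" by simp
    then show ?thesis using xP Sa.T_one by blast
   qed
  qed
 qed
 then show ?thesis using x by blast
qed

definition cotorsion :: "('a, 'c, 'y) module_scheme => bool"
 where "cotorsion C \<longleftrightarrow> (\<forall>J\<subseteq>I. loc_cotorsion R (P J) C)"

definition killed_by :: "('a, 'c, 'y) module_scheme => 'a => bool"
 where "killed_by C s \<longleftrightarrow> (\<forall>x\<in>carrier C. s \<odot>\<^sub>C x = \<zero>\<^sub>C)"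

text \<open>The modules over one of the rings \<open>R\<^sub>J\<^sub>,\<^sub>s\<close> are those which are \<open>split\<close> with respect to all indices. The
 induction is over the set of the other indices.\<close>

definition split :: "nat set => ('a, 'c, 'y) module_scheme => bool"
 where "split B C \<longleftrightarrow> (\<forall>i\<in>B. acts_bij C (S i) \<or> (\<exists>s\<in>S i. killed_by C s))"

text \<open>The products which omit \<open>S a\<close> can be reduced to those which contain it.\<close>

lemma cotorsion_from_index:
 assumes a: "a \<in> I" and C: "module R C" and b: "acts_bij C (S a)" and ct: "\<And>J. J \<subseteq> I ==> a \<in> J ==> loc_cotorsion R (P J) C"
 shows "cotorsion C"
 unfolding cotorsion_def
proof (intro allI impI)
 fix J assume J: "J \<subseteq> I"
 interpret PJ: localized R "P J" by (rule localizedI[OF P_submonoid[OF J]])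
 have J': "insert a J \<subseteq> I" using J a by auto
 show "loc_cotorsion R (P J) C"
  by (rule PJ.loc_cotorsion_factor[OF P_submonoid[OF J'] P_mono S[OF a] P_insert[OF J'] C b ct[OF J']]) auto
qed

text \<open>The induction hypothesis concerns modules in one fixed type and is applied to other modules along an
 injection into this type.\<close>

lemma transfer_extends:
 fixes i :: "'c => 'v"
 assumes C: "module R C" and i: "inj_on i (carrier C)" and B: "B \<subseteq> I" "split B C" and ct: "n = 0 ==> cotorsion C"
  and ext: "\<And>C'::('a, 'v) module. module R C' ==> split B C' ==> (n = (0::nat) ==> cotorsion C') ==> extends R M N C'"
 shows "extends R M N C"
proof (rule extends_iso[OF C transport(2)[OF C i] ext])
 let ?C = "transport i C"
 note C' = transport(1)[OF C i] and j = transport(2)[OF C i]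
 show "module R ?C" by fact
 show "split B ?C" unfolding split_def killed_by_def
 proof
  fix b assume b: "b \<in> B"
  have bR: "S b \<subseteq> carrier R" using S[THEN submonoid.subset] b B by blast
  show "acts_bij ?C (S b) \<or> (\<exists>s\<in>S b. \<forall>x\<in>carrier ?C. s \<odot>\<^sub>?C x = \<zero>\<^sub>?C)"
  proof (cases "acts_bij C (S b)")
   case True
   then show ?thesis using acts_bij_iso[OF C C' j _ bR] by blast
  next
   case False
   then obtain s where "s \<in> S b" "\<And>x. x \<in>: C ==> s \<odot>\<^sub>C x = \<zero>\<^sub>C" using B(2) b by (auto simp: split_def killed_by_def)
   then show ?thesis using killed_iso[OF C C' j] bR by blast
  qed
 qed
 show "cotorsion ?C" if "n = 0"
  using ct[OF that] extends_iso[OF C' iso_lin_inverse[OF C j]] unfolding cotorsion_def loc_cotorsion_def by blast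
qed

end

lemma acts_bij_quotient:
 assumes C: "module R C" and H: "submodule H R C" and b: "acts_bij C T" and T: "T \<subseteq> carrier R"
  and sat: "\<And>t x. t \<in> T ==> x \<in>: C ==> t \<odot>\<^sub>C x \<in> H ==> x \<in> H"
 shows "acts_bij (quotient_module C H) T"
proof (rule acts_bijI[OF quotient_is_module[OF C H] T])
 interpret C: module R C by fact
 note q = quotient_coset[OF C H]
 fix t X assume t: "t \<in> T" and X: "X \<in>: quotient_module C H"
 then have tR: "t \<in>: R" using T by blast
 obtain x where x: "x \<in>: C" "X = H +>\<^sub>C x" using X q(1) by blast
 obtain y where y: "y \<in>: C" "t \<odot>\<^sub>C y = x" using acts_bijD(1)[OF b t x(1)] by blast
 show "\<exists>Y\<in>carrier (quotient_module C H). t \<odot>\<^bsub>quotient_module C H\<^esub> Y = X"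
  using q(1) q(4)[OF tR y(1)] x(2) y by (intro bexI[of _ "H +>\<^sub>C y"]) auto
 show "X = \<zero>\<^bsub>quotient_module C H\<^esub>" if "t \<odot>\<^bsub>quotient_module C H\<^esub> X = \<zero>\<^bsub>quotient_module C H\<^esub>"
 proof -
  have "t \<odot>\<^sub>C x \<in> H" using quotient_proj(3)[OF C H C.smult_closed[OF tR x(1)]] that q(4)[OF tR x(1)] x(2) by simp
  then show ?thesis using quotient_proj(3)[OF C H x(1)] sat[OF t x(1)] x(2) by simp
 qed
qed

lemma inj_on_coset_representative:
 assumes C: "module R C" and H: "submodule H R C"
 shows "inj_on (\<lambda>X. SOME x. x \<in> X) (carrier (quotient_module C H))"
proof (rule inj_onI)
 interpret C: module R C by fact
 note q = quotient_coset[OF C H]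
 have rep: "(SOME x. x \<in> X) \<in>: C \<and> X = H +>\<^sub>C (SOME x. x \<in> X)" if X: "X \<in>: quotient_module C H" for X
 proof -
  obtain x where x: "x \<in>: C" "X = H +>\<^sub>C x" using X q(1) by blast
  then have "x \<in> X" using q(6)[of x x] submoduleD(2)[OF H C] C.minus_self[of x] by simp
  then have "(SOME x. x \<in> X) \<in> X" by (rule someI)
  then show ?thesis using q(6)[OF x(1)] q(2)[OF _ x(1), of "SOME x. x \<in> X"] x(2) by blast
 qed
 fix X Y assume "X \<in>: quotient_module C H" "Y \<in>: quotient_module C H" "(SOME x. x \<in> X) = (SOME x. x \<in> Y)"
 then show "X = Y" using rep by metis
qed

text \<open>The injection \<open>code\<close> makes the type \<open>'v\<close> large enough to contain, with a module \<open>C\<close>, all the modules which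
 the induction constructs from \<open>C\<close>.\<close>

locale resolution_family = resolution R W K d + mult_family R I S for R (structure) and W :: "'w set" and K d I S +
 fixes code :: "('a => 'v) => 'v"
 assumes code: "inj code" and sec: "J \<subseteq> I ==> \<exists>\<sigma>. loc_section R (P J) \<sigma>"
  and small: "i \<in> I ==> countable (S i) \<or> bounded_torsion R (S i)"
begin

text \<open>A class in \<open>Ext(U\<^sup>-\<^sup>1R, C)\<close> is coded by the values of a representative on the relations \<open>e\<^sub>s - t e\<^sub>s\<^sub>t\<close>.\<close>

lemma inj_on_loc_ext:
 fixes C :: "('a, 'v, 'y) module_scheme"
 assumes U: "submonoid U R" and C: "module R C"
 shows "\<exists>i :: _ => 'v. inj_on i (carrier (ext_mod R (FM U) (loc_ker R U) C))"
proof -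
 interpret U: localized R U by (rule localizedI[OF U])
 let ?GL = "(FM U) |: loc_ker R U" and ?D = "ext_mod R (FM U) (loc_ker R U) C"
  and ?cl = "ext_class R (FM U) (loc_ker R U) C"
 note D = ext_mod[OF U.free_T C U.loc_ker_submodule]
 have "\<forall>X\<in>carrier ?D. \<exists>f. lin R ?GL C f \<and> X = ?cl f" using D(3) by blast
 from bchoice[OF this] obtain f where f: "\<And>X. X \<in>: ?D ==> lin R ?GL C (f X)" "\<And>X. X \<in>: ?D ==> X = ?cl (f X)" by blast
 have "inj_on (\<lambda>X. code (\<lambda>s. code (\<lambda>t. f X (rel R s t)))) (carrier ?D)"
 proof (rule inj_onI)
  fix X Y assume X: "X \<in>: ?D" and Y: "Y \<in>: ?D"
   and e: "code (\<lambda>s. code (\<lambda>t. f X (rel R s t))) = code (\<lambda>s. code (\<lambda>t. f Y (rel R s t)))"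
  have "f X (rel R s t) = f Y (rel R s t)" for s t
   using e injD[OF code] by metis
  then have "f X l = f Y l" if "l \<in> loc_ker R U" for l
   using U.loc_ker_ext[OF f(1)[OF X] f(1)[OF Y] C _ that] by blast
  then show "X = Y" using D(8)[of "f X" "f Y"] f(2)[OF X] f(2)[OF Y] by simp
 qed
 then show ?thesis by blast
qed

text \<open>If \<open>C\<close> is not split at \<open>a\<close>, then \<open>C/sC\<close>, the annihilator of \<open>s\<close> in \<open>C\<close>, \<open>Hom(U\<^sup>-\<^sup>1R, C)\<close> and \<open>Ext(U\<^sup>-\<^sup>1R, C)\<close>
 are split at \<open>a\<close>, where \<open>U = S a\<close> and \<open>s\<close> is in \<open>U\<close>: the first two are killed by \<open>s\<close>, and \<open>U\<close> acts bijectively on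
 the others. The annihilator enters at \<open>K (n + 1)\<close>, where the claim holds for all modules.\<close>

theorem extends_induct:
 fixes C :: "('a, 'v) module"
 assumes base: "\<And>(C::('a, 'v) module) n. module R C ==> split I C ==> extends R \<Phi> (K n) C"
  and A: "finite A" "A \<subseteq> I" and C: "module R C" "split (I - A) C" "n = 0 ==> cotorsion C"
 shows "extends R \<Phi> (K n) C"
 using A C
proof (induction A arbitrary: C n rule: finite_induct)
 case empty
 then show ?case using base by simp
next
 case (insert a A)
 then have a: "a \<in> I" and AI: "A \<subseteq> I" by auto
 let ?U = "S a" and ?B = "I - A"
 have B: "?B \<subseteq> I" by blast
 have U: "submonoid ?U R" by (rule S[OF a])
 interpret C: module R C by (rule insert.prems)
 note C = insert.prems(2)
 interpret U: localized R ?U by (rule localizedI[OF U])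
 have SR: "S i \<subseteq> carrier R" if "i \<in> I" for i using S[THEN submonoid.subset] that by blast
 have PJ: "localized R (P J)" if "J \<subseteq> I" for J
  by (rule localizedI[OF P_submonoid[OF that]])
 obtain \<sigma> where \<sigma>: "loc_section R ?U \<sigma>" using sec[of "{a}"] a P_single by auto
 have ct: "loc_cotorsion R (P J) C" if "J \<subseteq> I" "n = 0" for J using insert.prems(4) that by (auto simp: cotorsion_def)
 \<comment> \<open>the four auxiliary modules are split at the index \<open>a\<close>, and at the indices at which \<open>C\<close> is split\<close>
 have splitI: "split ?B C'" if C': "acts_bij C' ?U \<or> (\<exists>s\<in>?U. killed_by C' s)"
  "\<And>i. i \<in> I ==> acts_bij C (S i) ==> acts_bij C' (S i)" "\<And>i s. i \<in> I ==> s \<in> S i ==> killed_by C s ==> killed_by C' s"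
  for C' :: "('a, 'c, 'z) module_scheme"
  unfolding split_def
 proof
  fix i assume i: "i \<in> ?B"
  show "acts_bij C' (S i) \<or> (\<exists>s\<in>S i. killed_by C' s)"
  proof (cases "i = a")
   case False
   then have "acts_bij C (S i) \<or> (\<exists>s\<in>S i. killed_by C s)" using insert.prems(3) i by (auto simp: split_def)
   then show ?thesis using that(2,3) i by blast
  qed (use C' in simp)
 qed
 have IH: "extends R \<Phi> (K k) C'"
  if M: "module R C'" and ex: "\<exists>j :: 'c => 'v. inj_on j (carrier C')" and sp: "split ?B C'" and ctC: "k = 0 ==> cotorsion C'" for C' :: "('a, 'c, 'z) module_scheme" and k
 proof -
  obtain j :: "'c => 'v" where j: "inj_on j (carrier C')" using ex by blast
  show ?thesis by (rule transfer_extends[OF M j B sp, of k]) (rule ctC, assumption, rule insert.IH[OF AI])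
 qed
 have exj: "\<exists>j :: 'c => 'v. inj_on j A" if "inj_on j A" for j :: "'c => 'v" and A using that by blast
 show ?case
 proof (rule extend_step[OF U \<sigma> small[OF a] C])
  fix s assume s: "s \<in> ?U"
  then have sR: "s \<in>: R" by simp
  have sl: "lin R C C (\<lambda>x. s \<odot>\<^sub>C x)" by (rule lin_scale[OF lin_id sR C])
  let ?H = "(\<lambda>x. s \<odot>\<^sub>C x) ` carrier C" and ?N = "{x \<in> carrier C. s \<odot>\<^sub>C x = \<zero>\<^sub>C}"
  have H: "submodule ?H R C" by (rule image_submodule[OF sl C C])
  have N: "submodule ?N R C" using ker_submodule[OF sl C C] by (simp add: mod_ker_def)
  note q = quotient_coset[OF C H]
  have swap: "s \<odot>\<^sub>C (t \<odot>\<^sub>C x) = t \<odot>\<^sub>C (s \<odot>\<^sub>C x)" if "t \<in>: R" "x \<in>: C" for t x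
   using that sR by (simp add: C.smult_assoc1[symmetric] m_comm)
  show "extends R \<Phi> (K n) (quotient_module C ?H)"
  proof (rule IH[OF quotient_is_module[OF C H] exj[OF inj_on_coset_representative[OF C H]] splitI])
   have "killed_by (quotient_module C ?H) s"
    unfolding killed_by_def
   proof
    fix X assume "X \<in>: quotient_module C ?H"
    then obtain x where x: "x \<in>: C" "X = ?H +>\<^sub>C x" using q(1) by blast
    show "s \<odot>\<^bsub>quotient_module C ?H\<^esub> X = \<zero>\<^bsub>quotient_module C ?H\<^esub>"
     unfolding x(2) q(4)[OF sR x(1)] using quotient_proj(3)[OF C H C.smult_closed[OF sR x(1)]] x(1) by blast
   qed
   then show "acts_bij (quotient_module C ?H) ?U \<or> (\<exists>s\<in>?U. killed_by (quotient_module C ?H) s)" using s by blast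
   show "acts_bij (quotient_module C ?H) (S i)" if i: "i \<in> I" and b: "acts_bij C (S i)" for i
   proof (rule acts_bij_quotient[OF C H b SR[OF i]])
    fix t x assume t: "t \<in> S i" and x: "x \<in>: C" "t \<odot>\<^sub>C x \<in> ?H"
    have tR: "t \<in>: R" using t SR[OF i] by blast
    obtain y where y: "y \<in>: C" "t \<odot>\<^sub>C x = s \<odot>\<^sub>C y" using x(2) by blast
    obtain y' where y': "y' \<in>: C" "t \<odot>\<^sub>C y' = y" using acts_bijD(1)[OF b t y(1)] by blast
    have "t \<odot>\<^sub>C x = t \<odot>\<^sub>C (s \<odot>\<^sub>C y')" using y(2) swap[OF tR y'(1)] y'(2) by simp
    then have "x = s \<odot>\<^sub>C y'" using acts_bijD(2)[OF b t x(1)] sR y'(1) by simp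
    then show "x \<in> ?H" using y'(1) by blast
   qed
   show "killed_by (quotient_module C ?H) t" if i: "i \<in> I" and t: "t \<in> S i" and k: "killed_by C t" for i t
    unfolding killed_by_def
   proof
    have tR: "t \<in>: R" using t SR[OF i] by blast
    fix X assume "X \<in>: quotient_module C ?H"
    then obtain x where x: "x \<in>: C" "X = ?H +>\<^sub>C x" using q(1) by blast
    show "t \<odot>\<^bsub>quotient_module C ?H\<^esub> X = \<zero>\<^bsub>quotient_module C ?H\<^esub>"
     unfolding x(2) q(4)[OF tR x(1)] q(5) using k x(1) by (simp add: killed_by_def)
   qed
   show "cotorsion (quotient_module C ?H)" if "n = 0"
    unfolding cotorsion_def
   proof (intro allI impI)
    fix J assume J: "J \<subseteq> I"
    obtain \<tau> where "loc_section R (P J) \<tau>" using sec[OF J] by blast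
    from localized.loc_cotorsion_quotient[OF PJ[OF J] this ct[OF J that] C quotient_is_module[OF C H] quotient_proj(1,2)[OF C H]]
    show "loc_cotorsion R (P J) (quotient_module C ?H)" .
   qed
  qed
  show "extends R \<Phi> (K (Suc n)) (C |: ?N)"
  proof (rule IH[OF sub_module[OF N C] exj[OF inj_on_id2] splitI])
   have "killed_by (C |: ?N) s" by (simp add: killed_by_def)
   then show "acts_bij (C |: ?N) ?U \<or> (\<exists>s\<in>?U. killed_by (C |: ?N) s)" using s by blast
   show "acts_bij (C |: ?N) (S i)" if i: "i \<in> I" and b: "acts_bij C (S i)" for i
   proof (rule acts_bijI[OF sub_module[OF N C] SR[OF i]])
    fix t x assume t: "t \<in> S i" and x: "x \<in>: (C |: ?N)"
    have tR: "t \<in>: R" using t SR[OF i] by blast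
    obtain y where y: "y \<in>: C" "t \<odot>\<^sub>C y = x" using acts_bijD(1)[OF b t, of x] x by auto
    have "t \<odot>\<^sub>C (s \<odot>\<^sub>C y) = t \<odot>\<^sub>C \<zero>\<^sub>C" using swap[OF tR y(1)] y(2) x tR by simp
    then have "s \<odot>\<^sub>C y = \<zero>\<^sub>C" using acts_bijD(2)[OF b t] sR y(1) by simp
    then show "\<exists>y\<in>carrier (C |: ?N). t \<odot>\<^bsub>C |: ?N\<^esub> y = x" using y by auto
    show "x = \<zero>\<^bsub>C |: ?N\<^esub>" if "t \<odot>\<^bsub>C |: ?N\<^esub> x = \<zero>\<^bsub>C |: ?N\<^esub>"
     using acts_bijD(2)[OF b t, of x "\<zero>\<^sub>C"] x that tR by simp
   qed
  qed (auto simp: killed_by_def)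
 next
  show "loc_cotorsion R ?U C" if "n = 0" using ct[of "{a}"] a P_single that by simp
 next
  let ?D = "ext_mod R (FM ?U) (loc_ker R ?U) C"
  note D = ext_mod[OF U.free_T C U.loc_ker_submodule]
  have b: "acts_bij ?D ?U" by (rule U.loc_ext_acts_bij[OF C])
  fix n' assume "n = Suc n'"
  show "extends R \<Phi> (K n') ?D"
  proof (rule IH[OF D(1) inj_on_loc_ext[OF U C] splitI])
   show "acts_bij ?D (S i)" if "i \<in> I" "acts_bij C (S i)" for i
    by (rule ext_mod_acts_bij[OF U.free_T C U.loc_ker_submodule that(2) SR[OF that(1)]])
   show "killed_by ?D t" if "i \<in> I" "t \<in> S i" "killed_by C t" for i t
    unfolding killed_by_def using ext_mod_killed[OF U.free_T C U.loc_ker_submodule, of t] that SR by (auto simp: killed_by_def)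
   show "cotorsion ?D"
   proof (rule cotorsion_from_index[OF a D(1) b])
    fix J assume J: "J \<subseteq> I" "a \<in> J"
    obtain \<tau> where "loc_section R (P J) \<tau>" using sec[OF J(1)] by blast
    then show "loc_cotorsion R (P J) ?D" by (rule localized.loc_cotorsion_loc_ext[OF PJ[OF J(1)] U P_upper[OF J(2)] C _ \<sigma>])
   qed
  qed (use b in simp)
 next
  let ?H = "loc_hom R ?U C"
  have b: "acts_bij ?H ?U" by (rule U.loc_hom_acts_bij[OF C])
  show "extends R \<Phi> (K n) ?H"
  proof (rule IH[OF U.loc_hom_module[OF C] exj[OF inj_on_subset[OF code subset_UNIV]] splitI])
   show "acts_bij ?H (S i)" if "i \<in> I" "acts_bij C (S i)" for i
    by (rule U.loc_hom_acts_bij_inherit[OF C that(2) SR[OF that(1)]])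
   show "killed_by ?H t" if "i \<in> I" "t \<in> S i" "killed_by C t" for i t
    unfolding killed_by_def
   proof
    interpret H: module R ?H by (rule U.loc_hom_module[OF C])
    have tR: "t \<in>: R" using that SR by blast
    fix c assume c: "c \<in>: ?H"
    show "t \<odot>\<^sub>?H c = \<zero>\<^sub>?H"
     by (rule U.loc_hom_eqI[OF H.smult_closed[OF tR c] H.zero_closed])
      (use that(3) U.loc_hom_closed[OF c] in \<open>simp add: killed_by_def U.loc_hom_simps\<close>)
   qed
   show "cotorsion ?H" if n: "n = 0"
    by (rule cotorsion_from_index[OF a U.loc_hom_module[OF C] b])
     (rule localized.loc_cotorsion_loc_hom[OF PJ U P_upper C ct[OF _ n]])
  qed (use b in simp)
 qed
qed

end

section \<open>Tensor products\<close>

locale tensor_context = R: cring R + A: cring A for R :: "('r, 'x) ring_scheme" (structure) and A :: "('a, 'w) ring_scheme" +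
 fixes \<phi> and M :: "('a, 'm, 'y) module_scheme" and N :: "('r, 'n, 'z) module_scheme"
 assumes \<phi>: "\<phi> \<in> ring_hom R A" and M: "module A M" and N: "module R N"
begin

abbreviation TL where "TL \<equiv> free_module A (carrier M \<times> carrier N)"
abbreviation \<Gamma> where "\<Gamma> \<equiv> gen_submodule A TL (tensor_rels R A \<phi> M N)"
abbreviation MN where "MN \<equiv> tensor R A \<phi> M N"
abbreviation pt where "pt \<equiv> pure_tensor R A \<phi> M N"

lemma TL: "module A TL" by (rule A.free_is_module)

lemma rels_closed: "tensor_rels R A \<phi> M N \<subseteq> carrier TL"
proof -
 interpret M: module A M by (rule M)
 interpret N: module R N by (rule N)
 interpret TL: module A TL by (rule TL)
 show ?thesis using ring_hom_closed[OF \<phi>] by (auto simp: tensor_rels_def Let_def)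
qed

lemmas \<Gamma> = gen_submodule[OF TL rels_closed]

lemma MN: "module A MN"
 unfolding tensor_def Let_def by (rule quotient_is_module[OF TL \<Gamma>(1)])

lemma pt_coset: "pt x y = \<Gamma> +>\<^sub>TL free_gen A (x, y)"
 by (simp add: pure_tensor_def Let_def)

lemma class_lin: "lin A TL MN (\<lambda>l. \<Gamma> +>\<^sub>TL l)" and class_surj: "(\<lambda>l. \<Gamma> +>\<^sub>TL l) ` carrier TL = carrier MN"
 unfolding tensor_def Let_def by (rule quotient_proj[OF TL \<Gamma>(1)])+

lemma class_eq: "l \<ominus>\<^sub>TL l' \<in> tensor_rels R A \<phi> M N ==> l \<in>: TL ==> l' \<in>: TL ==> \<Gamma> +>\<^sub>TL l = \<Gamma> +>\<^sub>TL l'"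
 using quotient_coset(2)[OF TL \<Gamma>(1)] \<Gamma>(2) by blast

lemma pt_closed: "x \<in>: M ==> y \<in>: N ==> pt x y \<in>: MN"
 using linD(1)[OF class_lin] by (simp add: pt_coset)

lemma pt_rules:
 assumes x: "x \<in>: M" and y: "y \<in>: N"
 shows "x' \<in>: M ==> pt (x \<oplus>\<^sub>M x') y = pt x y \<oplus>\<^sub>MN pt x' y"
  and "y' \<in>: N ==> pt x (y \<oplus>\<^sub>N y') = pt x y \<oplus>\<^sub>MN pt x y'"
  and "a \<in>: A ==> pt (a \<odot>\<^sub>M x) y = a \<odot>\<^sub>MN pt x y"
  and "r \<in>: R ==> pt (\<phi> r \<odot>\<^sub>M x) y = pt x (r \<odot>\<^sub>N y)"
proof -
 interpret M: module A M by (rule M)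
 interpret N: module R N by (rule N)
 interpret TL: module A TL by (rule TL)
 let ?\<delta> = "\<lambda>x y. free_gen A (x, y)"
 note l2 = linD(2)[OF class_lin, symmetric] and l3 = linD(3)[OF class_lin, symmetric]
 have g: "?\<delta> x y \<in>: TL" if "x \<in>: M" "y \<in>: N" for x y using that by simp
 show "pt (x \<oplus>\<^sub>M x') y = pt x y \<oplus>\<^sub>MN pt x' y" if "x' \<in>: M"
  unfolding pt_coset l2[OF g[OF x y] g[OF that y]] by (rule class_eq, unfold tensor_rels_def Let_def, rule UnI1, rule UnI1, rule UnI1) (use x y that in auto)
 show "pt x (y \<oplus>\<^sub>N y') = pt x y \<oplus>\<^sub>MN pt x y'" if "y' \<in>: N"
  unfolding pt_coset l2[OF g[OF x y] g[OF x that]] by (rule class_eq, unfold tensor_rels_def Let_def, rule UnI1, rule UnI1, rule UnI2) (use x y that in auto)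
 show "pt (a \<odot>\<^sub>M x) y = a \<odot>\<^sub>MN pt x y" if "a \<in>: A"
  unfolding pt_coset l3[OF that g[OF x y]] by (rule class_eq, unfold tensor_rels_def Let_def, rule UnI1, rule UnI2) (use x y that in auto)
 show "pt (\<phi> r \<odot>\<^sub>M x) y = pt x (r \<odot>\<^sub>N y)" if "r \<in>: R"
  unfolding pt_coset by (rule class_eq, unfold tensor_rels_def Let_def, rule UnI2) (use x y that ring_hom_closed[OF \<phi>] in auto)
qed

lemma tensor_all:
 assumes H: "submodule H A MN" and p: "\<And>x y. x \<in>: M ==> y \<in>: N ==> pt x y \<in> H"
 shows "H = carrier MN"
proof -
 have "{l \<in> carrier TL. \<Gamma> +>\<^sub>TL l \<in> H} = carrier TL"
 proof (rule A.free_submodule_all[OF preimage_submodule[OF class_lin TL MN H]])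
  show "free_gen A i \<in> {l \<in> carrier TL. \<Gamma> +>\<^sub>TL l \<in> H}" if "i \<in> carrier M \<times> carrier N" for i
   using p[of "fst i" "snd i", unfolded pt_coset] that by (cases i) simp
 qed
 then have "carrier MN \<subseteq> H" unfolding class_surj[symmetric] by (intro image_subsetI) blast
 then show ?thesis using submoduleD(1)[OF H MN] by blast
qed

text \<open>The linear map on formal sums which is given by \<open>b\<close> vanishes on the defining relations of the tensor
 product.\<close>

lemma tensor_lift:
 assumes X: "module A X" and b: "\<And>x y. x \<in>: M ==> y \<in>: N ==> b x y \<in>: X"
  "\<And>x x' y. x \<in>: M ==> x' \<in>: M ==> y \<in>: N ==> b (x \<oplus>\<^sub>M x') y = b x y \<oplus>\<^sub>X b x' y"
  "\<And>x y y'. x \<in>: M ==> y \<in>: N ==> y' \<in>: N ==> b x (y \<oplus>\<^sub>N y') = b x y \<oplus>\<^sub>X b x y'"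
  "\<And>a x y. a \<in>: A ==> x \<in>: M ==> y \<in>: N ==> b (a \<odot>\<^sub>M x) y = a \<odot>\<^sub>X b x y"
  "\<And>r x y. r \<in>: R ==> x \<in>: M ==> y \<in>: N ==> b (\<phi> r \<odot>\<^sub>M x) y = b x (r \<odot>\<^sub>N y)"
 shows "\<exists>\<beta>. lin A MN X \<beta> \<and> (\<forall>l\<in>carrier TL. \<beta> (\<Gamma> +>\<^sub>TL l) = lc A X (\<lambda>(x, y). b x y) l)"
proof -
 interpret X: module A X by (rule X)
 interpret M: module A M by (rule M)
 interpret N: module R N by (rule N)
 interpret TL: module A TL by (rule TL)
 let ?h = "lc A X (\<lambda>(x, y). b x y)"
 have hl: "lin A TL X ?h" by (rule A.lc_lin[OF X]) (use b(1) in auto)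
 note hr = lin_all[OF hl TL X]
 have hg: "?h (free_gen A (x, y)) = b x y" if "x \<in>: M" "y \<in>: N" for x y
  using A.lc_gen[OF X, of "\<lambda>(x, y). b x y" "(x, y)"] b(1)[OF that] by simp
 have "tensor_rels R A \<phi> M N \<subseteq> mod_ker TL X ?h"
 proof
  fix l assume l: "l \<in> tensor_rels R A \<phi> M N"
  have bal: "\<phi> r \<odot>\<^sub>X b x y = b x (r \<odot>\<^sub>N y)" if "r \<in>: R" "x \<in>: M" "y \<in>: N" for r x y
   using b(4)[OF ring_hom_closed[OF \<phi> that(1)] that(2,3)] b(5)[OF that] by simp
  have "?h l = \<zero>\<^sub>X"
   using l ring_hom_closed[OF \<phi>] unfolding tensor_rels_def Let_def by (auto simp: hr hg b(1-4) bal)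
  then show "l \<in> mod_ker TL X ?h" using rels_closed l by (auto simp: mod_ker_def)
 qed
 then have "\<Gamma> \<subseteq> mod_ker TL X ?h" by (rule \<Gamma>(3)[OF ker_submodule[OF hl TL X]])
 then show ?thesis
  using quotient_lift[OF TL \<Gamma>(1) X hl] by (auto simp: tensor_def Let_def mod_ker_def)
qed

end

text \<open>If \<open>\<Phi> \<rightarrow> F\<close> is a presentation with kernel \<open>K\<close>, then \<open>A \<otimes> F\<close> is the quotient of \<open>A \<otimes> \<Phi>\<close> by the \<open>A\<close>-span of \<open>K\<close>.
 The inverse map takes \<open>a \<otimes> x\<close> to the class of \<open>a p\<close>, where \<open>p\<close> is a preimage of \<open>x\<close>.\<close>

definition base_map :: "('r => 'a) => ('w => 'r) => 'w => 'a"
 where "base_map \<phi> p = (\<lambda>w. \<phi> (p w))"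

definition base_span :: "('a, 'x) ring_scheme => ('r => 'a) => 'w set => ('w => 'r) set => ('w => 'a) set"
 where "base_span A \<phi> W K = lc A (free_module A W) (base_map \<phi>) ` carrier (free_module A K)"

locale base_change = free_base R W + A: cring A for R :: "('r, 'x) ring_scheme" (structure) and W :: "'w set" and A :: "('a, 'v) ring_scheme" +
 fixes \<phi>
 assumes \<phi>: "\<phi> \<in> ring_hom R A"
begin

abbreviation A\<Phi> where "A\<Phi> \<equiv> free_module A W"
abbreviation rs where "rs \<equiv> restrict_scalars \<phi>"
abbreviation bm where "bm \<equiv> base_map \<phi>"

lemma A\<Phi>: "module A A\<Phi>" by (rule A.free_is_module)

lemma \<phi>_simps: "r \<in>: R ==> \<phi> r \<in>: A" "\<phi> \<zero> = \<zero>\<^sub>A" "\<phi> \<one> = \<one>\<^sub>A"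
 using ring_hom_closed[OF \<phi>] ring_hom_zero[OF \<phi> ring_axioms A.ring_axioms] ring_hom_one[OF \<phi>] by auto

lemma res: "module A D ==> module R (rs D)"
 by (rule restrict_scalars_module[OF is_cring \<phi>])

lemma res_lin: "lin A D D' f ==> lin R (rs D) (rs D') f"
 using \<phi>_simps(1) by (simp add: lin_def)

lemma base_map_lin: "lin R \<Phi> (rs A\<Phi>) bm"
proof (rule linI)
 fix p assume p: "p \<in>: \<Phi>"
 have "{w. \<phi> (p w) \<noteq> \<zero>\<^sub>A} \<subseteq> {w. p w \<noteq> \<zero>}" using \<phi>_simps(2) by auto
 then show "bm p \<in>: rs A\<Phi>"
  using p \<phi>_simps finite_subset by (fastforce simp: free_module_def base_map_def)
qed (auto simp: free_ops A.free_ops base_map_def free_module_def ring_hom_add[OF \<phi>] ring_hom_mult[OF \<phi>])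

lemma base_map_gen: "bm (gen w) = free_gen A w"
 using \<phi>_simps by (auto simp: base_map_def free_gen_def)

lemma base_map_closed: "p \<in>: \<Phi> ==> bm p \<in>: A\<Phi>"
 using linD(1)[OF base_map_lin] by simp

text \<open>An \<open>R\<close>-linear map from \<open>\<Phi>\<close> to an \<open>A\<close>-module extends to an \<open>A\<close>-linear map.\<close>

lemma base_extend:
 assumes D: "module A D" and u: "lin R \<Phi> (rs D) u" and p: "p \<in>: \<Phi>"
 shows "lc A D (\<lambda>w. u (gen w)) (bm p) = u p"
proof -
 have uw: "u (gen w) \<in>: D" if "w \<in> W" for w using linD(1)[OF u] that by simp
 have l: "lin A A\<Phi> D (lc A D (\<lambda>w. u (gen w)))" by (rule A.lc_lin[OF D uw])
 show ?thesis
  by (rule free_ext[OF lin_comp[OF base_map_lin res_lin[OF l]] u res[OF D] _ p])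
   (use A.lc_gen[OF D, of "\<lambda>w. u (gen w)"] uw in \<open>simp add: base_map_gen\<close>)
qed

context
 fixes K assumes K: "submodule K R \<Phi>"
begin

lemma span_lin: "lin A (free_module A K) A\<Phi> (lc A A\<Phi> bm)"
 by (rule A.lc_lin[OF A\<Phi> base_map_closed[OF submoduleD(1)[OF K \<Phi>]]])

lemma span_gen: "k \<in> K ==> lc A A\<Phi> bm (free_gen A k) = bm k"
 using A.lc_gen[OF A\<Phi>, of "bm" k] base_map_closed[OF submoduleD(1)[OF K \<Phi>]] by blast

lemma span_sub: "submodule (base_span A \<phi> W K) A A\<Phi>"
 unfolding base_span_def by (rule image_submodule[OF span_lin A.free_is_module A\<Phi>])

lemma span_base: "k \<in> K ==> bm k \<in> base_span A \<phi> W K"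
 unfolding base_span_def using span_gen by (intro image_eqI[of _ _ "free_gen A k"]) auto

lemma span_least:
 assumes H: "submodule H A A\<Phi>" and k: "\<And>k. k \<in> K ==> bm k \<in> H"
 shows "base_span A \<phi> W K \<subseteq> H"
proof -
 have "{c \<in> carrier (free_module A K). lc A A\<Phi> bm c \<in> H} = carrier (free_module A K)"
  by (rule A.free_submodule_all[OF preimage_submodule[OF span_lin A.free_is_module A\<Phi> H]])
   (use k span_gen in auto)
 then show ?thesis by (auto simp: base_span_def)
qed

lemma tensor_presentation:
 assumes F: "module R F" and \<delta>: "lin R \<Phi> F \<delta>" "\<delta> ` carrier \<Phi> = carrier F"
  and ker: "\<And>p. p \<in>: \<Phi> ==> \<delta> p = \<zero>\<^sub>F \<longleftrightarrow> p \<in> K"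
 shows "\<exists>q. lin A A\<Phi> (tensor R A \<phi> (ring_as_module A (\<lambda>a. a)) F) q \<and>
  q ` carrier A\<Phi> = carrier (tensor R A \<phi> (ring_as_module A (\<lambda>a. a)) F) \<and>
  (\<forall>p\<in>carrier A\<Phi>. q p = \<zero>\<^bsub>tensor R A \<phi> (ring_as_module A (\<lambda>a. a)) F\<^esub> \<longleftrightarrow> p \<in> base_span A \<phi> W K)"
proof -
 let ?AM = "ring_as_module A (\<lambda>a. a)"
 have AM: "module A ?AM" by (rule ring_as_module_self[OF A.is_cring])
 have AMs: "carrier ?AM = carrier A" "\<And>x y. x \<oplus>\<^sub>?AM y = x \<oplus>\<^sub>A y" "\<And>x y. x \<odot>\<^sub>?AM y = x \<otimes>\<^sub>A y"
  by (simp_all add: ring_as_module_def)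
 interpret T: tensor_context R A \<phi> ?AM F
  by (rule tensor_context.intro[OF is_cring A.is_cring tensor_context_axioms.intro[OF \<phi> AM F]])
 interpret TM: module A T.MN by (rule T.MN)
 interpret F: module R F by (rule F)
 interpret P: module R \<Phi> by (rule \<Phi>)
 interpret AP: module A A\<Phi> by (rule A\<Phi>)
 note \<delta>r = lin_all[OF \<delta>(1) \<Phi> F]
 have one: "\<one>\<^sub>A \<in>: ?AM" by (simp add: AMs)
 have pt1: "lin R F (rs T.MN) (T.pt \<one>\<^sub>A)"
 proof (rule linI)
  show "T.pt \<one>\<^sub>A (r \<odot>\<^sub>F x) = r \<odot>\<^bsub>rs T.MN\<^esub> T.pt \<one>\<^sub>A x" if "r \<in>: R" "x \<in>: F" for r x
   using T.pt_rules(3)[OF one that(2) \<phi>_simps(1)[OF that(1)]] T.pt_rules(4)[OF one that(2,1)]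
   by (simp add: AMs)
 qed (simp_all add: T.pt_closed[OF one] T.pt_rules(2)[OF one])
 have ul: "lin R \<Phi> (rs T.MN) (\<lambda>p. T.pt \<one>\<^sub>A (\<delta> p))" by (rule lin_comp[OF \<delta>(1) pt1])
 let ?q = "lc A T.MN (\<lambda>w. T.pt \<one>\<^sub>A (\<delta> (gen w)))"
 have ql: "lin A A\<Phi> T.MN ?q" by (rule A.lc_lin[OF T.MN]) (use linD(1)[OF ul] in auto)
 have qb: "?q (bm p) = T.pt \<one>\<^sub>A (\<delta> p)" if "p \<in>: \<Phi>" for p by (rule base_extend[OF T.MN ul that])
 have onto: "?q ` carrier A\<Phi> = carrier T.MN"
 proof (rule T.tensor_all[OF image_submodule[OF ql A\<Phi> T.MN]])
  fix a x assume a: "a \<in>: ?AM" and x: "x \<in>: F"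
  obtain p where p: "p \<in>: \<Phi>" "x = \<delta> p" using \<delta>(2) x by blast
  have "T.pt a x = a \<odot>\<^bsub>T.MN\<^esub> ?q (bm p)"
   using T.pt_rules(3)[OF one x a[unfolded AMs(1)]] qb[OF p(1)] p(2) a by (simp add: AMs)
  also have "\<dots> = ?q (a \<odot>\<^sub>A\<Phi> bm p)" using linD(3)[OF ql _ base_map_closed[OF p(1)]] a by (simp add: AMs)
  finally show "T.pt a x \<in> ?q ` carrier A\<Phi>" using AP.smult_closed[OF _ base_map_closed[OF p(1)]] a by (auto simp: AMs)
 qed
 let ?M = "base_span A \<phi> W K"
 let ?B = "quotient_module A\<Phi> ?M"
 have B: "module A ?B" by (rule quotient_is_module[OF A\<Phi> span_sub])
 note pr = quotient_proj[OF A\<Phi> span_sub] and co = quotient_coset[OF A\<Phi> span_sub]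
 interpret B: module A ?B by (rule B)
 have "\<forall>x\<in>carrier F. \<exists>p\<in>carrier \<Phi>. \<delta> p = x" unfolding \<delta>(2)[symmetric] by blast
 then obtain s where s: "\<And>x. x \<in>: F ==> s x \<in>: \<Phi>" "\<And>x. x \<in>: F ==> \<delta> (s x) = x" by metis
 define c where "c p = ?M +>\<^sub>A\<Phi> bm p" for p
 have cl: "lin R \<Phi> (rs ?B) c" unfolding c_def by (rule lin_comp[OF base_map_lin res_lin[OF pr(1)]])
 note cr = lin_all[OF cl \<Phi> res[OF B]]
 have cs: "c p = c p'" if "p \<in>: \<Phi>" "p' \<in>: \<Phi>" "\<delta> p = \<delta> p'" for p p'
 proof -
  have d: "p \<ominus>\<^sub>\<Phi> p' \<in> K" using ker[of "p \<ominus>\<^sub>\<Phi> p'"] that \<delta>r by simp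
  have z: "c (p \<ominus>\<^sub>\<Phi> p') = \<zero>\<^sub>?B" unfolding c_def pr(3)[OF base_map_closed[OF P.minus_closed[OF that(1,2)]]] by (rule span_base[OF d])
  interpret RB: module R "rs ?B" by (rule res[OF B])
  show ?thesis using cr(6)[OF that(1,2)] z cr(1)[OF that(1)] cr(1)[OF that(2)]
   RB.minus_eq_zero_iff[of "c p" "c p'"] by simp
 qed
 have sl: "lin R F (rs ?B) (\<lambda>x. c (s x))"
 proof (rule linI)
  show "c (s (x \<oplus>\<^sub>F y)) = c (s x) \<oplus>\<^bsub>rs ?B\<^esub> c (s y)" if "x \<in>: F" "y \<in>: F" for x y
   using cs[of "s (x \<oplus>\<^sub>F y)" "s x \<oplus>\<^sub>\<Phi> s y"] cr(2)[OF s(1)[OF that(1)] s(1)[OF that(2)]] s that \<delta>r(2) by simp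
  show "c (s (r \<odot>\<^sub>F x)) = r \<odot>\<^bsub>rs ?B\<^esub> c (s x)" if "r \<in>: R" "x \<in>: F" for r x
   using cs[of "s (r \<odot>\<^sub>F x)" "r \<odot>\<^sub>\<Phi> s x"] cr(3)[OF that(1) s(1)[OF that(2)]] s that \<delta>r(3) by simp
 qed (use cr(1) s in simp)
 note slr = linD[OF sl, unfolded restrict_scalars_simps]
 have "\<exists>\<beta>. lin A T.MN ?B \<beta> \<and> (\<forall>l\<in>carrier T.TL. \<beta> (T.\<Gamma> +>\<^bsub>T.TL\<^esub> l) = lc A ?B (\<lambda>(a, x). a \<odot>\<^sub>?B c (s x)) l)"
  by (rule T.tensor_lift[OF B])
   (use slr \<phi>_simps(1) in \<open>auto simp: AMs B.smult_l_distr B.smult_r_distr B.smult_assoc1 A.m_comm\<close>)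
 then obtain \<beta> where \<beta>: "lin A T.MN ?B \<beta>" "\<And>l. l \<in>: T.TL ==> \<beta> (T.\<Gamma> +>\<^bsub>T.TL\<^esub> l) = lc A ?B (\<lambda>(a, x). a \<odot>\<^sub>?B c (s x)) l" by blast
 have \<beta>q: "\<beta> (?q p) = ?M +>\<^sub>A\<Phi> p" if p: "p \<in>: A\<Phi>" for p
 proof (rule A.free_ext[OF lin_comp[OF ql \<beta>(1)] pr(1) B _ p])
  fix w assume w: "w \<in> W"
  have x: "\<delta> (gen w) \<in>: F" using \<delta>r(1) w by simp
  have "\<beta> (?q (free_gen A w)) = \<beta> (T.pt \<one>\<^sub>A (\<delta> (gen w)))" using qb[of "gen w"] w by (simp add: base_map_gen)
  also have "\<dots> = c (s (\<delta> (gen w)))"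
   using \<beta>(2)[of "free_gen A (\<one>\<^sub>A, \<delta> (gen w))"] x slr(1)[OF x]
    A.lc_gen[OF B, of "\<lambda>(a, x). a \<odot>\<^sub>?B c (s x)" "(\<one>\<^sub>A, \<delta> (gen w))"]
   by (simp add: AMs T.pt_coset)
  also have "\<dots> = c (gen w)" by (rule cs) (use s x w in auto)
  finally show "\<beta> (?q (free_gen A w)) = ?M +>\<^sub>A\<Phi> free_gen A w" by (simp add: c_def base_map_gen)
 qed
 have "?M \<subseteq> mod_ker A\<Phi> T.MN ?q"
 proof (rule span_least[OF ker_submodule[OF ql A\<Phi> T.MN]])
  fix k assume k: "k \<in> K"
  have kc: "k \<in>: \<Phi>" by (rule submoduleD(1)[OF K \<Phi> k])
  have "?q (bm k) = T.pt \<one>\<^sub>A \<zero>\<^sub>F" using qb[OF kc] ker[OF kc] k by simp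
  also have "\<dots> = \<zero>\<^bsub>T.MN\<^esub>" using lin_all(4)[OF pt1 F res[OF T.MN]] by simp
  finally show "bm k \<in> mod_ker A\<Phi> T.MN ?q" using base_map_closed[OF kc] by (simp add: mod_ker_def)
 qed
 moreover have "p \<in> ?M" if "p \<in>: A\<Phi>" "?q p = \<zero>\<^bsub>T.MN\<^esub>" for p
  using \<beta>q[OF that(1)] lin_all(4)[OF \<beta>(1) T.MN B] that(2) pr(3)[OF that(1)] by simp
 ultimately show ?thesis using ql onto by (intro exI[of _ ?q]) (auto simp: mod_ker_def)
qed

end
end

section \<open>Base change of a resolution of a flat module\<close>

lemma (in cring) free_coeff: "p \<in>: FM X ==> p x \<in>: R"
 by (simp add: free_module_def)

text \<open>The map \<open>\<rho>\<close> is a retraction onto the kernel of \<open>q\<close>, and \<open>1 - \<rho>\<close> descends to a section of \<open>q\<close>.\<close>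

lemma (in cring) projective_iff_retraction:
 assumes X: "module R X" and q: "lin R (FM W) X q" "q ` carrier (FM W) = carrier X"
 shows "projective_module R X \<longleftrightarrow> (\<exists>\<rho>. lin R (FM W) (FM W) \<rho> \<and>
  (\<forall>p\<in>carrier (FM W). q (\<rho> p) = \<zero>\<^sub>X \<and> (q p = \<zero>\<^sub>X --> \<rho> p = p)))" (is "_ = (\<exists>\<rho>. ?P \<rho>)")
proof
 let ?F = "FM W"
 have F: "module R ?F" by (rule free_is_module)
 interpret F: module R ?F by (rule F)
 interpret X: module R X by (rule X)
 note qr = lin_all[OF q(1) F X]
 { assume P: "projective_module R X"
  obtain h where h: "lin R X ?F h" "\<And>x. x \<in>: X ==> q (h x) = x"
   using projective_lift[OF P F X q lin_id] by blast
  note hr = lin_all[OF h(1) X F]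
  have "?P (\<lambda>p. p \<ominus>\<^sub>?F h (q p))"
   using lin_diff[OF lin_id lin_comp[OF q(1) h(1)] F] h(2)
   by (auto simp: qr hr X.minus_self) (simp add: F.M.minus_eq F.M.minus_zero')
  then show "\<exists>\<rho>. ?P \<rho>" by blast }
 assume "\<exists>\<rho>. ?P \<rho>"
 then obtain \<rho> where \<rho>: "lin R ?F ?F \<rho>" "\<And>p. p \<in>: ?F ==> q (\<rho> p) = \<zero>\<^sub>X" "\<And>p. p \<in>: ?F ==> q p = \<zero>\<^sub>X ==> \<rho> p = p" by blast
 show "projective_module R X"
  unfolding projective_module_def
 proof (intro conjI allI impI X)
  fix M :: "('a, 'c => 'a) module" and N :: "('a, 'c) module" and g f
  assume M: "module R M" and N: "module R N" and gh: "g \<in> mod_hom R M N" "g ` carrier M = carrier N" and fh: "f \<in> mod_hom R X N"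
  note g = mod_hom_lin[OF gh(1)] and f = mod_hom_lin[OF fh]
  interpret N: module R N by (rule N)
  obtain h where h: "lin R ?F M h" "\<And>p. p \<in>: ?F ==> g (h p) = f (q p)"
   using free_projective[OF g gh(2) lin_comp[OF q(1) f] M N] by blast
  have dl: "lin R ?F ?F (\<lambda>p. p \<ominus>\<^sub>?F \<rho> p)" by (rule lin_diff[OF lin_id \<rho>(1) F])
  obtain k where k: "lin R X M k" "\<And>p. p \<in>: ?F ==> k (q p) = h (p \<ominus>\<^sub>?F \<rho> p)"
   using factor_through_surjection[OF q lin_comp[OF dl h(1)] _ F X M] \<rho>(3) lin_all(4)[OF h(1) F M] F.minus_self by auto
  have "g (k x) = f x" if x: "x \<in>: X" for x
  proof -
   obtain p where p: "p \<in>: ?F" "x = q p" using q(2) x by blast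
   show ?thesis using p k(2) h(2) \<rho>(2) linD(1)[OF \<rho>(1)] by (simp add: qr X.M.minus_eq X.M.minus_zero')
  qed
  then show "\<exists>h\<in>mod_hom R X M. \<forall>x\<in>carrier X. g (h x) = f x" using lin_mod_hom[OF X k(1)] by (intro bexI) auto
 qed
qed

context resolution begin

text \<open>Villamayor's criterion for the flatness of \<open>\<Phi>/N\<close>.\<close>

definition fixable :: "('w => 'a) set => bool"
 where "fixable N \<longleftrightarrow> (\<forall>X. finite X --> X \<subseteq> N --> (\<exists>\<theta>. lin R \<Phi> \<Phi> \<theta> \<and> (\<forall>p\<in>carrier \<Phi>. \<theta> p \<in> N) \<and> (\<forall>x\<in>X. \<theta> x = x)))"

lemma fixableD:
 assumes "fixable N" "finite X" "X \<subseteq> N"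
 obtains \<theta> where "lin R \<Phi> \<Phi> \<theta>" "\<And>p. p \<in>: \<Phi> ==> \<theta> p \<in> N" "\<And>x. x \<in> X ==> \<theta> x = x"
proof -
 have "\<exists>\<theta>. lin R \<Phi> \<Phi> \<theta> \<and> (\<forall>p\<in>carrier \<Phi>. \<theta> p \<in> N) \<and> (\<forall>x\<in>X. \<theta> x = x)"
  using assms(1)[unfolded fixable_def, rule_format, OF assms(2,3)] .
 then show ?thesis using that by (elim exE conjE) simp
qed

lemma K_sub: "k \<in> K n ==> k \<in>: \<Phi>"
 by (rule submoduleD(1)[OF K \<Phi>])

lemma d_mem: "p \<in>: \<Phi> ==> d n p \<in> K n"
 using d_image by blast

lemma d_onto: "lin R \<Phi> (\<Phi> |: K n) (d n)" "d n ` carrier \<Phi> = carrier (\<Phi> |: K n)"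
 using lin_into[OF d d_mem] d_image by auto

text \<open>If \<open>\<theta>\<close> fixes \<open>d n e\<^sub>w\<close> for all generators from a finite set, then \<open>e\<^sub>w - \<theta>' (d n e\<^sub>w)\<close> is in the next kernel,
 for each lift \<open>\<theta>'\<close> of \<open>\<theta>\<close> along \<open>d n\<close>.\<close>

lemma fixable_lift:
 assumes "fixable (K n)" and Y: "finite Y" "Y \<subseteq> W"
 shows "\<exists>\<theta>. lin R \<Phi> \<Phi> \<theta> \<and> (\<forall>w\<in>Y. gen w \<ominus>\<^sub>\<Phi> \<theta> (d n (gen w)) \<in> K (Suc n))"
proof -
 interpret F: module R \<Phi> by (rule \<Phi>)
 let ?Z = "(\<lambda>w. d n (gen w)) ` Y"
 have Z: "finite ?Z" "?Z \<subseteq> K n" using Y d_mem by auto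
 obtain \<theta> where \<theta>: "lin R \<Phi> \<Phi> \<theta>" "\<And>p. p \<in>: \<Phi> ==> \<theta> p \<in> K n" "\<And>z. z \<in> ?Z ==> \<theta> z = z"
  by (rule fixableD[OF assms(1) Z]) (rule that)
 obtain \<theta>' where \<theta>': "lin R \<Phi> \<Phi> \<theta>'" "\<And>p. p \<in>: \<Phi> ==> d n (\<theta>' p) = \<theta> p"
  using free_projective[OF d_onto lin_into[OF \<theta>(1,2)] \<Phi> sub_module[OF K \<Phi>]] by blast
 have "gen w \<ominus>\<^sub>\<Phi> \<theta>' (d n (gen w)) \<in> K (Suc n)" if w: "w \<in> Y" for w
 proof -
  have c: "gen w \<in>: \<Phi>" "d n (gen w) \<in>: \<Phi>" "\<theta>' (d n (gen w)) \<in>: \<Phi>"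
   using w Y(2) linD(1)[OF d] linD(1)[OF \<theta>'(1)] by auto
  have "d n (gen w \<ominus>\<^sub>\<Phi> \<theta>' (d n (gen w))) = \<zero>\<^sub>\<Phi>"
   unfolding lin_all(6)[OF d \<Phi> \<Phi> c(1,3)] \<theta>'(2)[OF c(2)] using \<theta>(3) w F.minus_self[OF c(2)] by simp
  then show ?thesis using d_ker[OF F.minus_closed[OF c(1,3)]] by blast
 qed
 then show ?thesis using \<theta>'(1) by blast
qed

text \<open>The map of the previous lemma fixes the elements of \<open>K (n + 1)\<close> with support in \<open>Y\<close>; on all other generators
 it may be replaced by zero, which puts its values into \<open>K (n + 1)\<close>.\<close>

lemma fixable_Suc:
 assumes fx: "fixable (K n)"
 shows "fixable (K (Suc n))"
 unfolding fixable_def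
proof (intro allI impI)
 fix X assume X: "finite X" "X \<subseteq> K (Suc n)"
 interpret F: module R \<Phi> by (rule \<Phi>)
 let ?Y = "\<Union>x\<in>X. {w. x w \<noteq> \<zero>}"
 have XF: "x \<in>: \<Phi>" if "x \<in> X" for x using X(2) K_sub that by blast
 then have "finite {w. x w \<noteq> \<zero>}" "{w. x w \<noteq> \<zero>} \<subseteq> W" if "x \<in> X" for x using that by (auto simp: free_module_def)
 then have Y: "finite ?Y" "?Y \<subseteq> W" using X(1) by blast+
 obtain \<theta> where \<theta>: "lin R \<Phi> \<Phi> \<theta>" "\<And>w. w \<in> ?Y ==> gen w \<ominus>\<^sub>\<Phi> \<theta> (d n (gen w)) \<in> K (Suc n)"
  using fixable_lift[OF fx Y] by blast
 define v where "v w = gen w \<ominus>\<^sub>\<Phi> \<theta> (d n (gen w))" for w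
 define v' where "v' w = (if w \<in> ?Y then v w else \<zero>\<^sub>\<Phi>)" for w
 have vl: "lin R \<Phi> \<Phi> (\<lambda>p. p \<ominus>\<^sub>\<Phi> \<theta> (d n p))" by (rule lin_diff[OF lin_id lin_comp[OF d \<theta>(1)] \<Phi>])
 have vc: "v w \<in>: \<Phi>" if "w \<in> W" for w unfolding v_def using linD(1)[OF vl] that by simp
 have v': "v' w \<in> K (Suc n)" for w using \<theta>(2) submoduleD(2)[OF K \<Phi>] by (simp add: v'_def v_def)
 have "lc R \<Phi> v' p \<in> K (Suc n)" if "p \<in>: \<Phi>" for p
  by (rule lc_in_submodule[OF \<Phi> K that K_sub[OF v']])
   (rule submoduleD(4)[OF K \<Phi> free_coeff[OF that] v'])
 moreover have "lc R \<Phi> v' x = x" if x: "x \<in> X" for x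
 proof -
  have "lc R \<Phi> v' x = lc R \<Phi> v x" by (rule lc_cong[OF \<Phi> XF[OF x] vc]) (use x in \<open>auto simp: v'_def\<close>)
  also have "\<dots> = x \<ominus>\<^sub>\<Phi> \<theta> (d n x)"
   by (rule free_ext[OF lc_lin[OF \<Phi> vc] vl \<Phi> _ XF[OF x]]) (use lc_gen[OF \<Phi>, of v] vc in \<open>simp_all add: v_def[symmetric]\<close>)
  also have "\<dots> = x" using d_ker[OF XF[OF x], of n] X(2) x lin_all(4)[OF \<theta>(1) \<Phi> \<Phi>] XF[OF x]
   by (auto simp: F.M.minus_eq F.M.minus_zero')
  finally show ?thesis .
 qed
 ultimately show "\<exists>\<theta>. lin R \<Phi> \<Phi> \<theta> \<and> (\<forall>p\<in>carrier \<Phi>. \<theta> p \<in> K (Suc n)) \<and> (\<forall>x\<in>X. \<theta> x = x)"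
  by (intro exI[of _ "lc R \<Phi> v'"] conjI ballI lc_lin[OF \<Phi> K_sub[OF v']])
qed

end

locale base_resolution = base_change R W A \<phi> + resolution R W K d
 for R :: "('r, 'x) ring_scheme" (structure) and W :: "'w set" and A :: "('a, 'v) ring_scheme" and \<phi> and K d
begin

abbreviation MA where "MA n \<equiv> base_span A \<phi> W (K n)"
abbreviation dA where "dA n \<equiv> lc A A\<Phi> (\<lambda>w. bm (d n (free_gen R w)))"

lemma dA: "lin A A\<Phi> A\<Phi> (dA n)" "p \<in>: \<Phi> ==> dA n (bm p) = bm (d n p)"
 using A.lc_lin[OF A\<Phi>, of W "\<lambda>w. bm (d n (gen w))"] base_map_closed[OF linD(1)[OF d]]
  base_extend[OF A\<Phi> lin_comp[OF d base_map_lin], of p] by auto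

lemma dA_image: "dA n ` carrier A\<Phi> = MA n"
proof
 have "dA n p \<in> MA n" if "p \<in>: A\<Phi>" for p
  by (rule A.lc_in_submodule[OF A\<Phi> span_sub[OF K] that base_map_closed[OF linD(1)[OF d]]])
   (simp_all add: submoduleD(4)[OF span_sub[OF K] A\<Phi> A.free_coeff[OF that] span_base[OF K d_mem]])
 then show "dA n ` carrier A\<Phi> \<subseteq> MA n" by blast
 show "MA n \<subseteq> dA n ` carrier A\<Phi>"
 proof (rule span_least[OF K image_submodule[OF dA(1) A\<Phi> A\<Phi>]])
  fix k assume "k \<in> K n"
  then obtain p where "p \<in>: \<Phi>" "k = d n p" using d_image by blast
  then show "bm k \<in> dA n ` carrier A\<Phi>" using dA(2) base_map_closed by (metis imageI)
 qed
qed

text \<open>The base change of the resolution is exact. If \<open>d\<close> vanishes on \<open>p\<close>, then \<open>p\<close> is the sum of the elements \<open>p w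
 (e\<^sub>w - \<theta> (d e\<^sub>w))\<close>, where \<open>\<theta>\<close> is chosen for the support of \<open>p\<close>.\<close>

lemma dA_ker:
 assumes fx: "fixable (K n)" and p: "p \<in>: A\<Phi>"
 shows "dA n p = \<zero>\<^sub>A\<Phi> \<longleftrightarrow> p \<in> MA (Suc n)"
proof
 interpret AF: module A A\<Phi> by (rule A\<Phi>)
 interpret F: module R \<Phi> by (rule \<Phi>)
 note dr = lin_all[OF dA(1) A\<Phi> A\<Phi>]
 have "MA (Suc n) \<subseteq> mod_ker A\<Phi> A\<Phi> (dA n)"
 proof (rule span_least[OF K ker_submodule[OF dA(1) A\<Phi> A\<Phi>]])
  fix k assume k: "k \<in> K (Suc n)"
  interpret RA: module R "rs A\<Phi>" by (rule res[OF A\<Phi>])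
  show "bm k \<in> mod_ker A\<Phi> A\<Phi> (dA n)"
   using dA(2)[OF K_sub[OF k], of n] d_ker[OF K_sub[OF k], of n] k base_map_closed[OF K_sub[OF k]]
    lin_all(4)[OF base_map_lin \<Phi> res[OF A\<Phi>]] by (simp add: mod_ker_def)
 qed
 then show "p \<in> MA (Suc n) ==> dA n p = \<zero>\<^sub>A\<Phi>" by (auto simp: mod_ker_def)
 assume z: "dA n p = \<zero>\<^sub>A\<Phi>"
 let ?Y = "{w. p w \<noteq> \<zero>\<^sub>A}"
 have Y: "finite ?Y" "?Y \<subseteq> W" using p by (auto simp: free_module_def)
 obtain \<theta> where \<theta>: "lin R \<Phi> \<Phi> \<theta>" "\<And>w. w \<in> ?Y ==> gen w \<ominus>\<^sub>\<Phi> \<theta> (d n (gen w)) \<in> K (Suc n)"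
  using fixable_lift[OF fx Y] by blast
 have vl: "lin R \<Phi> \<Phi> (\<lambda>p. p \<ominus>\<^sub>\<Phi> \<theta> (d n p))" by (rule lin_diff[OF lin_id lin_comp[OF d \<theta>(1)] \<Phi>])
 define v where "v w = bm (gen w \<ominus>\<^sub>\<Phi> \<theta> (d n (gen w)))" for w
 have vc: "v w \<in>: A\<Phi>" if "w \<in> W" for w unfolding v_def using linD(1)[OF vl] that by (intro base_map_closed) simp
 let ?\<theta> = "lc A A\<Phi> (\<lambda>w. bm (\<theta> (gen w)))"
 have \<theta>l: "lin A A\<Phi> A\<Phi> ?\<theta>" by (rule A.lc_lin[OF A\<Phi>]) (use base_map_closed[OF linD(1)[OF \<theta>(1)]] in auto)
 have \<theta>b: "?\<theta> (bm x) = bm (\<theta> x)" if "x \<in>: \<Phi>" for x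
  using base_extend[OF A\<Phi> lin_comp[OF \<theta>(1) base_map_lin] that] by simp
 have "lc A A\<Phi> v p = p \<ominus>\<^sub>A\<Phi> ?\<theta> (dA n p)"
 proof (rule A.free_ext[OF A.lc_lin[OF A\<Phi> vc] lin_diff[OF lin_id lin_comp[OF dA(1) \<theta>l] A\<Phi>] A\<Phi> _ p])
  fix w assume w: "w \<in> W"
  have g: "gen w \<in>: \<Phi>" "d n (gen w) \<in>: \<Phi>" "\<theta> (d n (gen w)) \<in>: \<Phi>"
   using w linD(1)[OF d] linD(1)[OF \<theta>(1)] by auto
  show "lc A A\<Phi> v (free_gen A w) = free_gen A w \<ominus>\<^sub>A\<Phi> ?\<theta> (dA n (free_gen A w))"
   using A.lc_gen[OF A\<Phi>, of v w] vc[OF w] dA(2)[OF g(1), of n] \<theta>b[OF g(2)] lin_all(6)[OF base_map_lin \<Phi> res[OF A\<Phi>] g(1,3)]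
    base_map_closed[OF g(3)] w by (simp add: v_def base_map_gen)
 qed
 also have "\<dots> = p" using z lin_all(4)[OF \<theta>l A\<Phi> A\<Phi>] p by (simp add: AF.M.minus_eq AF.M.minus_zero')
 finally have e: "lc A A\<Phi> v p = p" .
 have "lc A A\<Phi> v p \<in> MA (Suc n)"
 proof (rule A.lc_in_submodule[OF A\<Phi> span_sub[OF K] p vc])
  fix w assume w: "w \<in> W"
  show "p w \<odot>\<^sub>A\<Phi> v w \<in> MA (Suc n)"
  proof (cases "w \<in> ?Y")
   case True
   then show ?thesis using submoduleD(4)[OF span_sub[OF K] A\<Phi> _ span_base[OF K \<theta>(2)[OF True]]] A.free_coeff[OF p]
    by (simp add: v_def)
  next
   case False
   then show ?thesis using submoduleD(2)[OF span_sub[OF K] A\<Phi>] vc[OF w] by simp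
  qed
 qed
 then show "p \<in> MA (Suc n)" using e by simp
qed

text \<open>In an exact sequence of free modules, if one of the kernels is a direct summand, then so are all the later
 ones: for a lift \<open>l\<close> of the retraction \<open>\<rho>\<close> along \<open>d\<close>, the next retraction is \<open>1 - l d\<close>.\<close>

lemma retraction_all:
 assumes fx: "fixable (K 0)" and r: "\<exists>\<rho>. lin A A\<Phi> A\<Phi> \<rho> \<and> (\<forall>p\<in>carrier A\<Phi>. \<rho> p \<in> MA 0 \<and> (p \<in> MA 0 --> \<rho> p = p))"
 shows "fixable (K n) \<and> (\<exists>\<rho>. lin A A\<Phi> A\<Phi> \<rho> \<and> (\<forall>p\<in>carrier A\<Phi>. \<rho> p \<in> MA n \<and> (p \<in> MA n --> \<rho> p = p)))"
proof (induction n)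
 case (Suc n)
 interpret AF: module A A\<Phi> by (rule A\<Phi>)
 note fx = Suc[THEN conjunct1]
 obtain \<rho> where \<rho>: "lin A A\<Phi> A\<Phi> \<rho>" "\<And>p. p \<in>: A\<Phi> ==> \<rho> p \<in> MA n" "\<And>p. p \<in>: A\<Phi> ==> p \<in> MA n ==> \<rho> p = p"
  using Suc by blast
 have on: "lin A A\<Phi> (A\<Phi> |: MA n) (dA n)" "dA n ` carrier A\<Phi> = carrier (A\<Phi> |: MA n)"
  using lin_into[OF dA(1), of n "MA n"] dA_image by auto
 obtain l where l: "lin A A\<Phi> A\<Phi> l" "\<And>p. p \<in>: A\<Phi> ==> dA n (l p) = \<rho> p"
  using A.free_projective[OF on lin_into[OF \<rho>(1,2)] A\<Phi> sub_module[OF span_sub[OF K] A\<Phi>]] by blast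
 have rl: "lin A A\<Phi> A\<Phi> (\<lambda>p. p \<ominus>\<^sub>A\<Phi> l (dA n p))" by (rule lin_diff[OF lin_id lin_comp[OF dA(1) l(1)] A\<Phi>])
 have "p \<ominus>\<^sub>A\<Phi> l (dA n p) \<in> MA (Suc n)" if p: "p \<in>: A\<Phi>" for p
 proof -
  have c: "dA n p \<in>: A\<Phi>" "dA n p \<in> MA n" "l (dA n p) \<in>: A\<Phi>"
   using linD(1)[OF dA(1) p] linD(1)[OF l(1)] dA_image[of n] p by auto
  have "dA n (p \<ominus>\<^sub>A\<Phi> l (dA n p)) = \<zero>\<^sub>A\<Phi>"
   unfolding lin_all(6)[OF dA(1) A\<Phi> A\<Phi> p c(3)] l(2)[OF c(1)] \<rho>(3)[OF c(1,2)] by (rule AF.minus_self[OF c(1)])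
  then show ?thesis using dA_ker[OF fx linD(1)[OF rl p]] by blast
 qed
 moreover have "p \<ominus>\<^sub>A\<Phi> l (dA n p) = p" if "p \<in>: A\<Phi>" "p \<in> MA (Suc n)" for p
  using dA_ker[OF fx that(1)] that lin_all(4)[OF l(1) A\<Phi> A\<Phi>] by (simp add: AF.M.minus_eq AF.M.minus_zero')
 ultimately show ?case using fixable_Suc[OF fx] rl by blast
qed (use assms in blast)

text \<open>A map from \<open>K n\<close> to an \<open>A\<close>-module extends to the span of \<open>K n\<close> in \<open>A \<otimes> \<Phi>\<close>: it is given, on any finite subset
 of \<open>K n\<close>, by a map which is defined on \<open>\<Phi>\<close>.\<close>

lemma extends_base:
 assumes fx: "fixable (K n)" and \<rho>: "lin A A\<Phi> A\<Phi> \<rho>" "\<And>p. p \<in>: A\<Phi> ==> \<rho> p \<in> MA n" "\<And>p. p \<in>: A\<Phi> ==> p \<in> MA n ==> \<rho> p = p"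
  and D: "module A D"
 shows "extends R \<Phi> (K n) (rs D)"
 unfolding extends_def
proof (intro allI impI)
 fix f assume f: "lin R (\<Phi> |: K n) (rs D) f"
 let ?AK = "free_module A (K n)" and ?D = "rs D"
 have AK: "module A ?AK" by (rule A.free_is_module)
 interpret D: module A D by (rule D)
 have fc: "f k \<in>: D" if "k \<in> K n" for k using linD(1)[OF f] that by simp
 note bc = base_map_closed[OF K_sub]
 note sp = span_lin[OF K]
 have spc: "lin A ?AK (A\<Phi> |: MA n) (lc A A\<Phi> bm)"
  by (rule lin_into[OF sp]) (auto simp: base_span_def)
 have "\<exists>g. lin A (A\<Phi> |: MA n) D g \<and> (\<forall>c\<in>carrier ?AK. g (lc A A\<Phi> bm c) = lc A D f c)"
 proof (rule factor_through_surjection[OF spc _ A.lc_lin[OF D fc] _ AK sub_module[OF span_sub[OF K] A\<Phi>] D])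
  fix c assume c: "c \<in>: ?AK" "lc A A\<Phi> bm c = \<zero>\<^bsub>A\<Phi> |: MA n\<^esub>"
  have cs: "finite {k. c k \<noteq> \<zero>\<^sub>A}" "{k. c k \<noteq> \<zero>\<^sub>A} \<subseteq> K n" using c(1) by (auto simp: free_module_def)
  obtain \<theta> where \<theta>: "lin R \<Phi> \<Phi> \<theta>" "\<And>p. p \<in>: \<Phi> ==> \<theta> p \<in> K n"
   "\<And>k. k \<in> {k. c k \<noteq> \<zero>\<^sub>A} ==> \<theta> k = k" by (rule fixableD[OF fx cs]) (rule that)
  have ul: "lin R \<Phi> ?D (\<lambda>p. f (\<theta> p))" by (rule lin_comp[OF lin_into[OF \<theta>(1,2)] f])
  let ?g = "lc A D (\<lambda>w. f (\<theta> (gen w)))"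
  have gl: "lin A A\<Phi> D ?g" by (rule A.lc_lin[OF D]) (use fc \<theta>(2) in auto)
  have gb: "?g (bm p) = f (\<theta> p)" if "p \<in>: \<Phi>" for p using base_extend[OF D ul that] by simp
  have "lc A D f c = lc A D (\<lambda>k. f (\<theta> k)) c"
   by (rule A.lc_cong[OF D c(1)]) (use fc \<theta>(2) K_sub \<theta>(3) in \<open>auto simp del: \<theta>(2)\<close>)
  also have "\<dots> = ?g (lc A A\<Phi> bm c)"
  proof (rule A.free_ext[OF A.lc_lin[OF D] lin_comp[OF sp gl] D _ c(1)])
   show "f (\<theta> k) \<in>: D" if "k \<in> K n" for k using fc \<theta>(2) K_sub that by blast
   then show "lc A D (\<lambda>k. f (\<theta> k)) (free_gen A k) = ?g (lc A A\<Phi> bm (free_gen A k))" if "k \<in> K n" for k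
    using A.lc_gen[OF D, of "\<lambda>k. f (\<theta> k)" k] span_gen[OF K that] gb[OF K_sub[OF that]] that by simp
  qed
  also have "\<dots> = \<zero>\<^sub>D" using c(2) lin_all(4)[OF gl A\<Phi> D] by simp
  finally show "lc A D f c = \<zero>\<^sub>D" .
 qed (auto simp: base_span_def)
 then obtain g where g: "lin A (A\<Phi> |: MA n) D g" "\<And>c. c \<in>: ?AK ==> g (lc A A\<Phi> bm c) = lc A D f c" by blast
 have "g (\<rho> (bm k)) = f k" if k: "k \<in> K n" for k
  using \<rho>(3)[OF bc[OF k] span_base[OF K k]] g(2)[of "free_gen A k"] span_gen[OF K k] A.lc_gen[OF D, of f k] fc[OF k] k by simp
 then show "\<exists>g. lin R \<Phi> ?D g \<and> (\<forall>x\<in>K n. g x = f x)"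
  using lin_comp[OF base_map_lin res_lin[OF lin_comp[OF lin_into[OF \<rho>(1,2)] g(1)]]] by blast
qed

end

section \<open>Modules over a quotient of a localization\<close>

context localized begin

context
 fixes X assumes X: "X \<subseteq> carrier R"
begin

abbreviation qideal where "qideal \<equiv> genideal Q (loc_map R T ` X)"
abbreviation qring where "qring \<equiv> Q Quot qideal"
abbreviation cl where "cl r t \<equiv> qideal +>\<^sub>Q fr r t"
abbreviation qmap where "qmap r \<equiv> qideal +>\<^sub>Q loc_map R T r"

lemma qideal: "ideal qideal Q"
proof -
 interpret Q: cring Q by (rule loc_cring)
 show ?thesis using X ring_hom_closed[OF loc_map_hom] by (intro Q.genideal_ideal) auto
qed

lemma qring: "cring qring" and qmap_hom: "qmap \<in> ring_hom R qring" and cl_hom: "(+>\<^sub>Q) qideal \<in> ring_hom Q qring"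
 using ideal.quotient_is_cring[OF qideal loc_cring] ideal.rcos_ring_hom[OF qideal] ring_hom_trans[OF loc_map_hom ideal.rcos_ring_hom[OF qideal]]
 by (auto simp: comp_def)

lemma qring_cases:
 assumes "a \<in>: qring"
 obtains r t where "r \<in>: R" "t \<in> T" "a = cl r t"
 using assms by (auto simp: FactRing_def A_RCOSETS_def' loc_carrier)

lemma qmap_unit:
 assumes "t \<in> T"
 shows "cl \<one> t \<in>: qring" "cl \<one> t \<otimes>\<^sub>qring qmap t = \<one>\<^sub>qring"
proof -
 have c: "fr \<one> t \<in>: Q" "loc_map R T t \<in>: Q" using assms ring_hom_closed[OF loc_map_hom] by auto
 show "cl \<one> t \<in>: qring" using ring_hom_closed[OF cl_hom c(1)] .
 have "fr \<one> t \<otimes>\<^sub>Q loc_map R T t = \<one>\<^sub>Q" using assms frac_eqI[of t t \<one> \<one>] by (simp add: loc_map_def loc_mult loc_one)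
 then show "cl \<one> t \<otimes>\<^sub>qring qmap t = \<one>\<^sub>qring" using ring_hom_mult[OF cl_hom c] ring_hom_one[OF cl_hom] by simp
qed

lemma qmap_zero: "x \<in> X ==> qmap x = \<zero>\<^sub>qring"
proof -
 assume x: "x \<in> X"
 interpret Q: cring Q by (rule loc_cring)
 interpret I: ideal qideal Q by (rule qideal)
 have "loc_map R T x \<in> qideal" using Q.genideal_self[of "loc_map R T ` X"] x X ring_hom_closed[OF loc_map_hom] by auto
 then show ?thesis using I.a_rcos_const by (simp add: FactRing_def)
qed

lemma qmodule_acts_bij:
 assumes D: "module qring D"
 shows "acts_bij (restrict_scalars qmap D) T"
proof (rule acts_bijI)
 interpret D: module qring D by (rule D)
 show "module R (restrict_scalars qmap D)" by (rule restrict_scalars_module[OF is_cring qmap_hom D])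
 fix t x assume t: "t \<in> T" and "x \<in>: restrict_scalars qmap D"
 then have x: "x \<in>: D" and qt: "qmap t \<in>: qring" using ring_hom_closed[OF qmap_hom] by auto
 note u = qmap_unit[OF t]
 have 1: "qmap t \<odot>\<^sub>D (cl \<one> t \<odot>\<^sub>D x) = x" "cl \<one> t \<odot>\<^sub>D (qmap t \<odot>\<^sub>D x) = x"
  using D.smult_assoc1[OF qt u(1) x] D.smult_assoc1[OF u(1) qt x] u(2) D.R.m_comm[OF u(1) qt] x by simp_all
 then show "\<exists>y\<in>carrier (restrict_scalars qmap D). t \<odot>\<^bsub>restrict_scalars qmap D\<^esub> y = x"
  using D.smult_closed[OF u(1) x] by auto
 show "x = \<zero>\<^bsub>restrict_scalars qmap D\<^esub>" if "t \<odot>\<^bsub>restrict_scalars qmap D\<^esub> x = \<zero>\<^bsub>restrict_scalars qmap D\<^esub>"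
  using that 1(2) D.smult_r_null[OF u(1)] by simp
qed auto

text \<open>The fractions with a numerator which kills \<open>C\<close> form an ideal of \<open>T\<^sup>-\<^sup>1R\<close>, and it contains the generators of
 the ideal in question.\<close>

lemma qideal_kills:
 assumes C: "module R C" and b: "acts_bij C T" and k: "\<And>x c. x \<in> X ==> c \<in>: C ==> x \<odot>\<^sub>C c = \<zero>\<^sub>C"
  and r: "r \<in>: R" "t \<in> T" "fr r t \<in> qideal" and c: "c \<in>: C"
 shows "r \<odot>\<^sub>C c = \<zero>\<^sub>C"
proof -
 interpret C: module R C by fact
 interpret Q: cring Q by (rule loc_cring)
 let ?N = "{fr r t | r t. r \<in>: R \<and> t \<in> T \<and> (\<forall>c\<in>carrier C. r \<odot>\<^sub>C c = \<zero>\<^sub>C)}"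
 have NI: "fr r t \<in> ?N" if "r \<in>: R" "t \<in> T" "\<forall>c\<in>carrier C. r \<odot>\<^sub>C c = \<zero>\<^sub>C" for r t using that by blast
 have mult: "q \<otimes>\<^sub>Q n \<in> ?N" if n: "n \<in> ?N" and q: "q \<in>: Q" for n q
 proof -
  obtain r t where rt: "n = fr r t" "r \<in>: R" "t \<in> T" "\<forall>c\<in>carrier C. r \<odot>\<^sub>C c = \<zero>\<^sub>C" using n by blast
  obtain r' t' where q': "r' \<in>: R" "t' \<in> T" "q = fr r' t'" using q by (rule loc_cases)
  show ?thesis unfolding rt(1) q'(3) loc_mult[OF q'(1,2) rt(2,3)] by (rule NI) (use rt q' in \<open>auto simp: C.smult_assoc1\<close>)
 qed
 have "ideal ?N Q"
 proof (rule idealI[OF Q.ring_axioms])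
  show "subgroup ?N (add_monoid Q)"
  proof (rule subgroup.intro)
   show "?N \<subseteq> carrier (add_monoid Q)" by auto
   show "\<one>\<^bsub>add_monoid Q\<^esub> \<in> ?N" using NI[of \<zero> \<one>] by (simp add: loc_zero)
   show "inv\<^bsub>add_monoid Q\<^esub> n \<in> ?N" if n: "n \<in> ?N" for n
   proof -
    have "n \<in>: Q" using n by auto
    then have "(\<ominus>\<^sub>Q \<one>\<^sub>Q) \<otimes>\<^sub>Q n = \<ominus>\<^sub>Q n" by (simp add: Q.l_minus)
    then have "\<ominus>\<^sub>Q n \<in> ?N" using mult[OF n, of "\<ominus>\<^sub>Q \<one>\<^sub>Q"] by simp
    then show ?thesis by (simp add: a_inv_def)
   qed
   fix n n' assume "n \<in> ?N" "n' \<in> ?N"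
   then obtain r t r' t' where rt: "n = fr r t" "r \<in>: R" "t \<in> T" "\<forall>c\<in>carrier C. r \<odot>\<^sub>C c = \<zero>\<^sub>C"
    "n' = fr r' t'" "r' \<in>: R" "t' \<in> T" "\<forall>c\<in>carrier C. r' \<odot>\<^sub>C c = \<zero>\<^sub>C" by blast
   have "fr (t' \<otimes> r \<oplus> t \<otimes> r') (t \<otimes> t') \<in> ?N"
    by (rule NI) (use rt in \<open>auto simp: C.smult_assoc1 C.smult_l_distr\<close>)
   then show "n \<otimes>\<^bsub>add_monoid Q\<^esub> n' \<in> ?N" using rt by (simp add: loc_add)
  qed
  show "q \<otimes>\<^sub>Q n \<in> ?N" if "n \<in> ?N" "q \<in>: Q" for n q using mult that .
  then show "n \<otimes>\<^sub>Q q \<in> ?N" if n: "n \<in> ?N" and q: "q \<in>: Q" for n q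
  proof -
   have "n \<in>: Q" using n by auto
   then show ?thesis using mult[OF n q] Q.m_comm[of n q] q by simp
  qed
 qed
 moreover have "loc_map R T ` X \<subseteq> ?N"
 proof
  fix q assume "q \<in> loc_map R T ` X"
  then obtain x where "x \<in> X" "q = fr x \<one>" by (auto simp: loc_map_def)
  then show "q \<in> ?N" using NI[of x \<one>] X k by auto
 qed
 ultimately have "qideal \<subseteq> ?N" by (rule Q.genideal_minimal)
 then have "fr r t \<in> ?N" using r(3) by blast
 then obtain r' t' where n: "fr r t = fr r' t'" "r' \<in>: R" "t' \<in> T" "\<forall>c\<in>carrier C. r' \<odot>\<^sub>C c = \<zero>\<^sub>C" by blast
 obtain u where u: "u \<in> T" "u \<otimes> (t' \<otimes> r) = u \<otimes> (t \<otimes> r')" using n(1) frac_eq_iff[OF r(1,2) n(2,3)] by blast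
 have "(u \<otimes> t') \<odot>\<^sub>C (r \<odot>\<^sub>C c) = (u \<otimes> (t' \<otimes> r)) \<odot>\<^sub>C c" using u(1) n r(1) c by (simp add: C.smult_assoc1)
 also have "\<dots> = (u \<otimes> t') \<odot>\<^sub>C \<zero>\<^sub>C" unfolding u(2) using u(1) n r c by (simp add: C.smult_assoc1)
 finally show ?thesis using acts_bijD(2)[OF b, of "u \<otimes> t'" "r \<odot>\<^sub>C c" "\<zero>\<^sub>C"] u(1) n(3) r(1) c by simp
qed

text \<open>The class of \<open>r/t\<close> takes \<open>c\<close> to the unique \<open>y\<close> with \<open>t y = r c\<close>.\<close>

lemma qmodule_exists:
 fixes C :: "('a, 'c, 'y) module_scheme"
 assumes C: "module R C" and b: "acts_bij C T" and k: "\<And>x c. x \<in> X ==> c \<in>: C ==> x \<odot>\<^sub>C c = \<zero>\<^sub>C"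
 shows "\<exists>D :: (_, 'c) module. module qring D \<and> iso_lin R C (restrict_scalars qmap D) (\<lambda>x. x)"
proof -
 interpret C: module R C by fact
 interpret Q: cring Q by (rule loc_cring)
 interpret A: cring qring by (rule qring)
 have uniq: "\<exists>!y. y \<in>: C \<and> (\<forall>r\<in>carrier R. \<forall>t\<in>T. a = cl r t --> t \<odot>\<^sub>C y = r \<odot>\<^sub>C c)"
  if a: "a \<in>: qring" and c: "c \<in>: C" for a c
 proof -
  obtain r t where rt: "r \<in>: R" "t \<in> T" "a = cl r t" using a by (rule qring_cases)
  obtain y where y: "y \<in>: C" "t \<odot>\<^sub>C y = r \<odot>\<^sub>C c" using acts_bijD(1)[OF b rt(2)] rt(1) c by blast
  have ex: "t' \<odot>\<^sub>C y = r' \<odot>\<^sub>C c" if r': "r' \<in>: R" "t' \<in> T" "a = cl r' t'" for r' t'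
  proof -
   have "fr r t \<ominus>\<^sub>Q fr r' t' \<in> qideal" using Q.quotient_eq_iff_same_a_r_cos[OF qideal] rt r' by auto
   moreover have "fr r t \<ominus>\<^sub>Q fr r' t' = fr (t' \<otimes> r \<ominus> t \<otimes> r') (t \<otimes> t')"
   proof -
    have "fr (t' \<otimes> r \<ominus> t \<otimes> r') (t \<otimes> t') \<oplus>\<^sub>Q fr r' t' = fr r t"
    proof -
     have "t \<otimes> (t' \<otimes> (t' \<otimes> r \<ominus> t \<otimes> r') \<oplus> (t \<otimes> t') \<otimes> r') = ((t \<otimes> t') \<otimes> t') \<otimes> r" using rt(1) r'(1) T_closed[OF rt(2)] T_closed[OF r'(2)] by algebra
     then show ?thesis using rt r' by (simp add: loc_add) (rule frac_eqI, auto)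
    qed
    moreover have "(x \<oplus>\<^sub>Q y) \<ominus>\<^sub>Q y = x" if "x \<in>: Q" "y \<in>: Q" for x y using that by algebra
    ultimately show ?thesis using rt r' frac_closed[of "t' \<otimes> r \<ominus> t \<otimes> r'" "t \<otimes> t'"] by (metis T_closed T_mult frac_closed m_closed minus_closed)
   qed
   ultimately have z: "(t' \<otimes> r \<ominus> t \<otimes> r') \<odot>\<^sub>C c = \<zero>\<^sub>C"
    using qideal_kills[OF C b k _ _ _ c, of "t' \<otimes> r \<ominus> t \<otimes> r'" "t \<otimes> t'"] rt r' by auto
   have R: "t \<in>: R" "t' \<in>: R" using rt r' by auto
   have "(t' \<otimes> r \<ominus> t \<otimes> r') \<odot>\<^sub>C c = t' \<odot>\<^sub>C (r \<odot>\<^sub>C c) \<ominus>\<^sub>C t \<odot>\<^sub>C (r' \<odot>\<^sub>C c)" using R rt(1) r'(1) c by algebra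
   then have "t' \<odot>\<^sub>C (r \<odot>\<^sub>C c) = t \<odot>\<^sub>C (r' \<odot>\<^sub>C c)"
    using z R rt(1) r'(1) c C.minus_eq_zero_iff[of "t' \<odot>\<^sub>C (r \<odot>\<^sub>C c)" "t \<odot>\<^sub>C (r' \<odot>\<^sub>C c)"] by simp
   moreover have "t \<odot>\<^sub>C (t' \<odot>\<^sub>C y) = t' \<odot>\<^sub>C (t \<odot>\<^sub>C y)" using R y(1) by algebra
   ultimately have "t \<odot>\<^sub>C (t' \<odot>\<^sub>C y) = t \<odot>\<^sub>C (r' \<odot>\<^sub>C c)" using y(2) by simp
   then show ?thesis using acts_bijD(2)[OF b rt(2)] R r'(1) c y(1) by simp
  qed
  show ?thesis
  proof (rule ex1I[of _ y])
   show "y' = y" if "y' \<in>: C \<and> (\<forall>r\<in>carrier R. \<forall>t\<in>T. a = cl r t --> t \<odot>\<^sub>C y' = r \<odot>\<^sub>C c)" for y'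
    using acts_bijD(2)[OF b rt(2) _ y(1), of y'] that rt y(2) by simp
  qed (use y(1) ex in blast)
 qed
 define act where "act a c = (THE y. y \<in>: C \<and> (\<forall>r\<in>carrier R. \<forall>t\<in>T. a = cl r t --> t \<odot>\<^sub>C y = r \<odot>\<^sub>C c))" for a c
 have act: "act a c \<in>: C" "r \<in>: R ==> t \<in> T ==> a = cl r t ==> t \<odot>\<^sub>C act a c = r \<odot>\<^sub>C c"
  if "a \<in>: qring" "c \<in>: C" for a c r t
  using theI'[OF uniq[OF that]] unfolding act_def by blast+
 have cl: "cl r t \<in>: qring" if "r \<in>: R" "t \<in> T" for r t using ring_hom_closed[OF cl_hom] that by simp
 have act': "act (cl r t) c = y" if "r \<in>: R" "t \<in> T" "c \<in>: C" "y \<in>: C" "t \<odot>\<^sub>C y = r \<odot>\<^sub>C c" for r t c y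
  using acts_bijD(2)[OF b that(2) act(1)[OF cl[OF that(1,2)] that(3)] that(4)] act(2)[OF cl[OF that(1,2)] that(3,1,2) refl] that(5) by simp
 define D where "D = \<lparr>carrier = carrier C, mult = mult C, one = \<one>\<^sub>C, zero = \<zero>\<^sub>C, add = add C, smult = act\<rparr>"
 have Ds: "carrier D = carrier C" "\<zero>\<^sub>D = \<zero>\<^sub>C" "\<And>x y. x \<oplus>\<^sub>D y = x \<oplus>\<^sub>C y" "\<And>a x. a \<odot>\<^sub>D x = act a x" by (simp_all add: D_def)
 have "module qring D"
 proof (rule moduleI[OF qring])
  show "abelian_group D" by (rule abelian_groupI) (auto simp: Ds C.M.a_ac intro!: bexI[of _ "\<ominus>\<^sub>C x" for x] C.M.l_neg)
  show "\<one>\<^sub>qring \<odot>\<^sub>D c = c" if "c \<in>: D" for c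
   using act'[of \<one> \<one> c c] that ring_hom_one[OF cl_hom] by (simp add: Ds loc_one)
  fix a c assume a: "a \<in>: qring" and c': "c \<in>: D"
  then have c: "c \<in>: C" by (simp add: Ds)
  obtain r t where rt: "r \<in>: R" "t \<in> T" "a = cl r t" using a by (rule qring_cases)
  note y = act(1)[OF a c] act(2)[OF a c rt]
  show "a \<odot>\<^sub>D c \<in>: D" by (simp add: Ds y)
  show "a \<odot>\<^sub>D (c \<oplus>\<^sub>D e) = a \<odot>\<^sub>D c \<oplus>\<^sub>D a \<odot>\<^sub>D e" if "e \<in>: D" for e
  proof -
   have e: "e \<in>: C" using that by (simp add: Ds)
   show ?thesis unfolding Ds rt(3) by (rule act'[OF rt(1,2)])
    (use c e rt y act(1)[OF a e] act(2)[OF a e rt] in \<open>simp_all add: C.smult_r_distr\<close>)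
  qed
  fix a' assume a': "a' \<in>: qring"
  obtain r' t' where rt': "r' \<in>: R" "t' \<in> T" "a' = cl r' t'" using a' by (rule qring_cases)
  note y' = act(1)[OF a' c] act(2)[OF a' c rt']
  have R: "t \<in>: R" "t' \<in>: R" using rt rt' by auto
  have fc: "fr r t \<in>: Q" "fr r' t' \<in>: Q" using rt rt' by auto
  show "(a \<oplus>\<^sub>qring a') \<odot>\<^sub>D c = a \<odot>\<^sub>D c \<oplus>\<^sub>D a' \<odot>\<^sub>D c"
  proof -
   have "a \<oplus>\<^sub>qring a' = cl (t' \<otimes> r \<oplus> t \<otimes> r') (t \<otimes> t')" using ring_hom_add[OF cl_hom fc] rt rt' by (simp add: loc_add)
   moreover have "(t \<otimes> t') \<odot>\<^sub>C (y \<oplus>\<^sub>C y') = t' \<odot>\<^sub>C (t \<odot>\<^sub>C y) \<oplus>\<^sub>C t \<odot>\<^sub>C (t' \<odot>\<^sub>C y')" if "y \<in>: C" "y' \<in>: C" for y y'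
    using that R by algebra
   moreover have "(t' \<otimes> r \<oplus> t \<otimes> r') \<odot>\<^sub>C c = t' \<odot>\<^sub>C (r \<odot>\<^sub>C c) \<oplus>\<^sub>C t \<odot>\<^sub>C (r' \<odot>\<^sub>C c)" using c R rt(1) rt'(1) by algebra
   ultimately show ?thesis using act'[of "t' \<otimes> r \<oplus> t \<otimes> r'" "t \<otimes> t'" c "act a c \<oplus>\<^sub>C act a' c"] y y' rt rt' c by (simp add: Ds)
  qed
  show "(a \<otimes>\<^sub>qring a') \<odot>\<^sub>D c = a \<odot>\<^sub>D (a' \<odot>\<^sub>D c)"
  proof -
   note z = act(1)[OF a y'(1)] act(2)[OF a y'(1) rt]
   have "a \<otimes>\<^sub>qring a' = cl (r \<otimes> r') (t \<otimes> t')" using ring_hom_mult[OF cl_hom fc] rt rt' by (simp add: loc_mult)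
   moreover have "(t \<otimes> t') \<odot>\<^sub>C act a (act a' c) = (r \<otimes> r') \<odot>\<^sub>C c"
   proof -
    have "(t \<otimes> t') \<odot>\<^sub>C w = t' \<odot>\<^sub>C (t \<odot>\<^sub>C w)" "t' \<odot>\<^sub>C (r \<odot>\<^sub>C w) = r \<odot>\<^sub>C (t' \<odot>\<^sub>C w)" if "w \<in>: C" for w
     using that R rt(1) by algebra+
    then show ?thesis using z y' rt(1) rt'(1) c by (simp add: C.smult_assoc1)
   qed
   ultimately show ?thesis using act'[of "r \<otimes> r'" "t \<otimes> t'" c] z rt rt' c by (simp add: Ds)
  qed
 qed
 moreover have "qmap r \<odot>\<^sub>D c = r \<odot>\<^sub>C c" if "r \<in>: R" "c \<in>: C" for r c
  using act'[of r \<one> c "r \<odot>\<^sub>C c"] that by (simp add: Ds loc_map_def)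
 ultimately show ?thesis by (intro exI[of _ D]) (auto simp: iso_lin_def lin_def bij_betw_def Ds)
qed

end
end

section \<open>Flat modules\<close>

lemma lin_finsum:
 assumes f: "lin R M N f" and mods: "module R M" "module R N" and "finite Y" "g \<in> Y \<rightarrow> carrier M"
 shows "f (\<Oplus>\<^sub>M w\<in>Y. g w) = (\<Oplus>\<^sub>N w\<in>Y. f (g w))"
 using assms(4,5)
proof (induction Y rule: finite_induct)
 interpret M: module R M by fact
 interpret N: module R N by fact
 note fr = lin_all[OF f mods]
 { case empty
  then show ?case using fr(4) by simp }
 case (insert w Y)
 then show ?case using fr(1,2) by (subst M.finsum_insert N.finsum_insert; auto simp: Pi_iff)+
qed

text \<open>The map \<open>h \<otimes> F\<close> is defined by its values on classes of formal sums; it agrees with the map which is provided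
 by the universal property.\<close>

lemma tensor_map_linear:
 assumes R: "cring R" and mods: "module R M" "module R M'" "module R F" and h: "h \<in> mod_hom R M M'"
 shows "lin R (tensorR R M F) (tensorR R M' F) (tensor_map R M M' F h)"
  and "x \<in>: M ==> y \<in>: F ==>
   tensor_map R M M' F h (pure_tensor R R (\<lambda>r. r) M F x y) = pure_tensor R R (\<lambda>r. r) M' F (h x) y"
proof -
 have id: "(\<lambda>r. r) \<in> ring_hom R R" by (auto simp: ring_hom_def)
 interpret T: tensor_context R R "\<lambda>r. r" M F by (rule tensor_context.intro[OF R R tensor_context_axioms.intro[OF id mods(1,3)]])
 interpret T': tensor_context R R "\<lambda>r. r" M' F by (rule tensor_context.intro[OF R R tensor_context_axioms.intro[OF id mods(2,3)]])
 interpret TL: module R T.TL by (rule T.TL)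
 note hr = linD[OF mod_hom_lin[OF h]]
 let ?b = "\<lambda>x y. T'.pt (h x) y"
 have bc: "?b x y \<in>: T'.MN" if "x \<in>: M" "y \<in>: F" for x y using T'.pt_closed hr(1) that by blast
 have "\<exists>\<beta>. lin R T.MN T'.MN \<beta> \<and> (\<forall>l\<in>carrier T.TL. \<beta> (T.\<Gamma> +>\<^bsub>T.TL\<^esub> l) = lc R T'.MN (\<lambda>(x, y). ?b x y) l)"
 proof (rule T.tensor_lift[OF T'.MN bc])
  fix r x y assume a: "r \<in>: R" "x \<in>: M" "y \<in>: F"
  show "?b (r \<odot>\<^sub>M x) y = ?b x (r \<odot>\<^sub>F y)" using T'.pt_rules(4)[OF hr(1)[OF a(2)] a(3,1)] hr(3)[OF a(1,2)] by simp
 qed (use T'.pt_rules(1-3) hr in simp_all)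
 then obtain \<beta> where \<beta>: "lin R T.MN T'.MN \<beta>" "\<And>l. l \<in>: T.TL ==> \<beta> (T.\<Gamma> +>\<^bsub>T.TL\<^esub> l) = lc R T'.MN (\<lambda>(x, y). ?b x y) l" by blast
 note co = quotient_coset[OF T.TL T.\<Gamma>(1)]
 have tm: "tensor_map R M M' F h X = \<beta> X" if X: "X \<in>: T.MN" for X
 proof -
  obtain l where l: "l \<in>: T.TL" "X = T.\<Gamma> +>\<^bsub>T.TL\<^esub> l" using X T.class_surj by blast
  let ?f = "free_lift R (carrier M \<times> carrier F) T'.MN (\<lambda>(x, y). ?b x y)"
  have 1: "?f l' = \<beta> X" if l': "l' \<in> X" for l'
  proof -
   have "l' \<in>: T.TL" "l' \<ominus>\<^bsub>T.TL\<^esub> l \<in> T.\<Gamma>" using l' co(6)[OF l(1), of l'] l(2) by auto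
   then show ?thesis using \<beta>(2)[of l'] co(2)[OF _ l(1), of l'] l(2) by (simp add: free_lift_lc)
  qed
  have "l \<in> X" using co(6)[OF l(1), of l] l submoduleD(2)[OF T.\<Gamma>(1) T.TL] TL.minus_self[OF l(1)] by simp
  then have "?f ` X = {\<beta> X}" using 1 by blast
  then show ?thesis using X by (simp add: tensor_map_def)
 qed
 show "lin R T.MN T'.MN (tensor_map R M M' F h)" using lin_cong[of T.MN "tensor_map R M M' F h" \<beta>] tm T.MN \<beta>(1) by blast
 show "tensor_map R M M' F h (T.pt x y) = T'.pt (h x) y" if "x \<in>: M" "y \<in>: F"
  using tm[OF T.pt_closed[OF that]] \<beta>(2)[of "free_gen R (x, y)"] T.pt_coset[of x y] bc[OF that] that
   T.R.lc_gen[OF T'.MN, of "\<lambda>(x, y). ?b x y" "(x, y)"] by simp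
qed

text \<open>The equational criterion in a form which does not mention tensors: a relation with coefficients in an ideal
 is respected by all bilinear maps on the product of the ideal \<open>I\<close> and \<open>F\<close>. Indeed, \<open>I \<otimes> F\<close> embeds into \<open>R \<otimes> F =
 F\<close>. The ideal and the ring are transported to the type in which flatness is tested.\<close>

lemma flat_relation:
 fixes F :: "('r, 'f, 'y) module_scheme"
 assumes R: "cring R" and flat: "flat_module TYPE('u) R F" and emb: "carrier R \<lesssim> (UNIV :: 'u set)"
  and I: "submodule I R (ring_as_module R (\<lambda>r. r))" and Y: "finite Y" "\<And>w. w \<in> Y ==> a w \<in> I" "\<And>w. w \<in> Y ==> x w \<in>: F"
  and rel: "(\<Oplus>\<^sub>F w\<in>Y. a w \<odot>\<^sub>F x w) = \<zero>\<^sub>F"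
  and X: "module R X" and b: "\<And>a y. a \<in> I ==> y \<in>: F ==> b a y \<in>: X"
   "\<And>a a' y. a \<in> I ==> a' \<in> I ==> y \<in>: F ==> b (a \<oplus>\<^sub>R a') y = b a y \<oplus>\<^sub>X b a' y"
   "\<And>a y y'. a \<in> I ==> y \<in>: F ==> y' \<in>: F ==> b a (y \<oplus>\<^sub>F y') = b a y \<oplus>\<^sub>X b a y'"
   "\<And>r a y. r \<in>: R ==> a \<in> I ==> y \<in>: F ==> b (r \<otimes>\<^sub>R a) y = r \<odot>\<^sub>X b a y"
   "\<And>r a y. r \<in>: R ==> a \<in> I ==> y \<in>: F ==> b (r \<otimes>\<^sub>R a) y = b a (r \<odot>\<^sub>F y)"
 shows "(\<Oplus>\<^sub>X w\<in>Y. b (a w) (x w)) = \<zero>\<^sub>X"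
proof -
 interpret R: cring R by fact
 let ?RM = "ring_as_module R (\<lambda>r. r)"
 have RM: "module R ?RM" by (rule ring_as_module_self[OF R])
 have RMs: "carrier ?RM = carrier R" "\<And>x y. x \<oplus>\<^sub>?RM y = x \<oplus>\<^sub>R y" "\<And>x y. x \<odot>\<^sub>?RM y = x \<otimes>\<^sub>R y" by (simp_all add: ring_as_module_def)
 have F: "module R F" using flat by (simp add: flat_module_def)
 interpret F: module R F by fact
 interpret X: module R X by fact
 note Ir = submoduleD[OF I RM, unfolded RMs]
 obtain j :: "_ => 'u" where j: "inj_on j (carrier R)" using emb by (auto simp: lepoll_def)
 let ?IM = "?RM |: I"
 have IM: "module R ?IM" by (rule sub_module[OF I RM])
 have jI: "inj_on j (carrier ?IM)" and jR: "inj_on j (carrier ?RM)" using inj_on_subset[OF j] Ir(1) j by (auto simp: RMs)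
 define M where "M = transport j ?IM"
 define M' where "M' = transport j ?RM"
 have M: "module R M" and M': "module R M'" and i: "iso_lin R ?IM M j" and i': "iso_lin R ?RM M' j"
  unfolding M_def M'_def by (rule transport[OF IM jI] transport[OF RM jR])+
 define k where "k = the_inv_into (carrier ?IM) j"
 have k: "iso_lin R M ?IM k" unfolding k_def by (rule iso_lin_inverse[OF IM i])
 have kj: "k (j r) = r" if "r \<in> I" for r unfolding k_def using the_inv_into_f_f[OF jI] that by simp
 have jl: "lin R ?RM M' j" and kl: "lin R M ?IM k" using i' k by (auto simp: iso_lin_def)
 have jM: "j r \<in>: M" if "r \<in> I" for r using i that by (auto simp: iso_lin_def lin_def)
 define h where "h = restrict (\<lambda>x. j (k x)) (carrier M)"
 have jl': "lin R ?IM M' j" using lin_restrict[OF jl, of I] Ir(1) by (auto simp: RMs)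
 have h: "h \<in> mod_hom R M M'" unfolding h_def by (rule lin_mod_hom[OF M lin_comp[OF kl jl']])
 have hj: "h (j r) = j r" if "r \<in> I" for r using jM[OF that] kj[OF that] by (simp add: h_def)
 have "inj_on h (carrier M)"
 proof (rule inj_onI)
  fix x y assume xy: "x \<in>: M" "y \<in>: M" "h x = h y"
  then obtain r r' where r: "r \<in> I" "x = j r" "r' \<in> I" "y = j r'" by (auto simp: M_def transport_def Let_def)
  then show "x = y" using xy(3) hj by simp
 qed
 then have inj: "inj_on (tensor_map R M M' F h) (carrier (tensorR R M F))"
  using flat M M' h unfolding flat_module_def by blast
 have id: "(\<lambda>r. r) \<in> ring_hom R R" by (auto simp: ring_hom_def)
 interpret T: tensor_context R R "\<lambda>r. r" M F by (rule tensor_context.intro[OF R R tensor_context_axioms.intro[OF id M F]])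
 interpret T': tensor_context R R "\<lambda>r. r" M' F by (rule tensor_context.intro[OF R R tensor_context_axioms.intro[OF id M' F]])
 interpret MN: module R T.MN by (rule T.MN)
 interpret MN': module R T'.MN by (rule T'.MN)
 note tm = tensor_map_linear[OF R M M' F h]
 let ?\<tau> = "\<Oplus>\<^bsub>T.MN\<^esub>w\<in>Y. T.pt (j (a w)) (x w)"
 have aR: "a w \<in>: R" if "w \<in> Y" for w using Ir(1) Y(2) that by blast
 have pc: "(\<lambda>w. T.pt (j (a w)) (x w)) \<in> Y \<rightarrow> carrier T.MN" using T.pt_closed jM Y by blast
 have j1: "j \<one>\<^sub>R \<in>: M'" using linD(1)[OF jl] by (simp add: RMs)
 have one: "lin R F T'.MN (T'.pt (j \<one>\<^sub>R))"
  by (rule linI) (use T'.pt_closed[OF j1] T'.pt_rules(2)[OF j1] T'.pt_rules(3,4)[OF j1] in simp_all)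
 have "tensor_map R M M' F h ?\<tau> = (\<Oplus>\<^bsub>T'.MN\<^esub>w\<in>Y. tensor_map R M M' F h (T.pt (j (a w)) (x w)))"
  by (rule lin_finsum[OF tm(1) T.MN T'.MN Y(1) pc])
 also have "\<dots> = (\<Oplus>\<^bsub>T'.MN\<^esub>w\<in>Y. T'.pt (j \<one>\<^sub>R) (a w \<odot>\<^sub>F x w))"
 proof (rule MN'.finsum_cong')
  show "tensor_map R M M' F h (T.pt (j (a w)) (x w)) = T'.pt (j \<one>\<^sub>R) (a w \<odot>\<^sub>F x w)" if w: "w \<in> Y" for w
  proof -
   have "j (a w) = a w \<odot>\<^sub>M' j \<one>\<^sub>R" using linD(3)[OF jl aR[OF w], of "\<one>\<^sub>R"] aR[OF w] by (simp add: RMs)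
   then show ?thesis using tm(2)[OF jM[OF Y(2)[OF w]] Y(3)[OF w]] hj[OF Y(2)[OF w]] T'.pt_rules(4)[OF j1 Y(3)[OF w] aR[OF w]] by simp
  qed
 qed (use linD(1)[OF one] aR Y(3) in auto)
 also have "\<dots> = T'.pt (j \<one>\<^sub>R) (\<Oplus>\<^sub>F w\<in>Y. a w \<odot>\<^sub>F x w)"
  by (rule lin_finsum[OF one F T'.MN Y(1), symmetric]) (use aR Y(3) in auto)
 also have "\<dots> = tensor_map R M M' F h \<zero>\<^bsub>T.MN\<^esub>" unfolding rel using lin_all(4)[OF one F T'.MN] lin_all(4)[OF tm(1) T.MN T'.MN] by simp
 finally have \<tau>: "?\<tau> = \<zero>\<^bsub>T.MN\<^esub>" by (rule inj_onD[OF inj]) (use MN.finsum_closed[OF pc] in auto)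
 note kr = linD[OF kl, simplified RMs, simplified]
 have "\<exists>\<beta>. lin R T.MN X \<beta> \<and> (\<forall>l\<in>carrier T.TL. \<beta> (T.\<Gamma> +>\<^bsub>T.TL\<^esub> l) = lc R X (\<lambda>(m, y). b (k m) y) l)"
  by (rule T.tensor_lift[OF X]) (use kr b in \<open>simp_all add: RMs\<close>)
 then obtain \<beta> where \<beta>: "lin R T.MN X \<beta>" "\<And>l. l \<in>: T.TL ==> \<beta> (T.\<Gamma> +>\<^bsub>T.TL\<^esub> l) = lc R X (\<lambda>(m, y). b (k m) y) l" by blast
 have \<beta>p: "\<beta> (T.pt (j r) y) = b r y" if "r \<in> I" "y \<in>: F" for r y
  using \<beta>(2)[of "free_gen R (j r, y)"] T.pt_coset[of "j r" y] jM[OF that(1)] that b(1)[OF that] kj[OF that(1)]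
   R.lc_gen[OF X, of "\<lambda>(m, y). b (k m) y" "(j r, y)"] by simp
 have "(\<Oplus>\<^sub>X w\<in>Y. b (a w) (x w)) = (\<Oplus>\<^sub>X w\<in>Y. \<beta> (T.pt (j (a w)) (x w)))"
  by (rule X.M.finsum_cong') (use b(1) Y \<beta>p in auto)
 also have "\<dots> = \<beta> ?\<tau>" by (rule lin_finsum[OF \<beta>(1) T.MN X Y(1) pc, symmetric])
 also have "\<dots> = \<zero>\<^sub>X" unfolding \<tau> by (rule lin_all(4)[OF \<beta>(1) T.MN X])
 finally show ?thesis .
qed

locale presentation = free_base R W for R :: "('r, 'x) ring_scheme" (structure) and W :: "'w set" +
 fixes F :: "('r, 'f, 'y) module_scheme" and \<delta> :: "('w => 'r) => 'f"
 assumes F: "module R F" and \<delta>: "lin R \<Phi> F \<delta>" "\<delta> ` carrier \<Phi> = carrier F"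
begin

abbreviation K0 where "K0 \<equiv> mod_ker \<Phi> F \<delta>"

lemma K0: "submodule K0 R \<Phi>" by (rule ker_submodule[OF \<delta>(1) \<Phi> F])

text \<open>Here \<open>N\<close> is the set of those combinations of elements of the kernel whose coefficients are the coordinates of
 \<open>k\<close>. The criterion is applied to the ideal \<open>I\<close> of all \<open>a\<close> with \<open>a K \<subseteq> N\<close>, which contains the coordinates of \<open>k\<close>:
 the map \<open>a \<otimes> x \<mapsto> a p\<close>, where \<open>p\<close> is a preimage of \<open>x\<close>, is a well-defined map from \<open>I \<otimes> F\<close> to \<open>\<Phi>/N\<close>. It takes the
 relation in \<open>F\<close> which \<open>k\<close> expresses to the class of \<open>k\<close>, so that \<open>k\<close> is in \<open>N\<close>; this is an equation \<open>k = \<theta> k\<close>.\<close>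

lemma flat_fixes_element:
 assumes flat: "flat_module TYPE('u) R F" and emb: "carrier R \<lesssim> (UNIV :: 'u set)" and k: "k \<in> K0"
 shows "\<exists>\<theta>. lin R \<Phi> \<Phi> \<theta> \<and> (\<forall>p\<in>carrier \<Phi>. \<theta> p \<in> K0) \<and> \<theta> k = k"
proof -
 interpret P: module R \<Phi> by (rule \<Phi>)
 interpret F: module R F by (rule F)
 note Kr = submoduleD[OF K0 \<Phi>] and \<delta>r = lin_all[OF \<delta>(1) \<Phi> F]
 have kc: "k \<in>: \<Phi>" by (rule Kr(1)[OF k])
 have kw: "k w \<in>: R" for w by (rule free_coeff[OF kc])
 let ?N = "{lc R \<Phi> \<kappa> k | \<kappa>. \<forall>w. \<kappa> w \<in> K0}"
 have NI: "lc R \<Phi> \<kappa> k \<in> ?N" if "\<And>w. \<kappa> w \<in> K0" for \<kappa> using that by blast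
 have N: "submodule ?N R \<Phi>"
 proof (rule submoduleI'[OF \<Phi>])
  show "?N \<subseteq> carrier \<Phi>" using lc_closed[OF \<Phi> kc Kr(1)] by blast
  show "\<zero>\<^sub>\<Phi> \<in> ?N" using NI[of "\<lambda>w. \<zero>\<^sub>\<Phi>"] Kr(2) lc_zero[OF \<Phi> kc, of "\<lambda>w. \<zero>\<^sub>\<Phi>"] by simp
  fix n assume "n \<in> ?N"
  then obtain \<kappa> where n: "n = lc R \<Phi> \<kappa> k" "\<And>w. \<kappa> w \<in> K0" by blast
  show "r \<odot>\<^sub>\<Phi> n \<in> ?N" if r: "r \<in>: R" for r
   unfolding n(1) lc_family(2)[OF \<Phi> Kr(1)[OF n(2)] kc r, symmetric] by (rule NI) (rule Kr(4)[OF r n(2)])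
  fix n' assume "n' \<in> ?N"
  then obtain \<kappa>' where n': "n' = lc R \<Phi> \<kappa>' k" "\<And>w. \<kappa>' w \<in> K0" by blast
  show "n \<oplus>\<^sub>\<Phi> n' \<in> ?N"
   unfolding n(1) n'(1) lc_family(1)[OF \<Phi> Kr(1)[OF n(2)] kc Kr(1)[OF n'(2)], symmetric] by (rule NI) (rule Kr(3)[OF n(2) n'(2)])
 qed
 note Nr = submoduleD[OF N \<Phi>]
 have coord: "k w \<odot>\<^sub>\<Phi> x \<in> ?N" if x: "x \<in> K0" for w x
 proof (cases "k w = \<zero>")
  case False
  let ?\<kappa> = "\<lambda>v. if v = w then x else \<zero>\<^sub>\<Phi>"
  have fin: "finite {v. k v \<noteq> \<zero>}" using kc by (simp add: free_module_def)
  have "lc R \<Phi> ?\<kappa> k = (\<Oplus>\<^sub>\<Phi> v\<in>{v. k v \<noteq> \<zero>}. if w = v then k v \<odot>\<^sub>\<Phi> x else \<zero>\<^sub>\<Phi>)"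
   unfolding lc_def by (rule P.M.finsum_cong') (use kw Kr(1)[OF x] in auto)
  also have "\<dots> = k w \<odot>\<^sub>\<Phi> x" using False kw Kr(1)[OF x] by (intro P.M.finsum_singleton[OF _ fin]) auto
  finally show ?thesis using NI[of ?\<kappa>] x Kr(2) by auto
 qed (use Nr(2) Kr(1)[OF x] in simp)
 define I where "I = {a \<in> carrier R. \<forall>x\<in>K0. a \<odot>\<^sub>\<Phi> x \<in> ?N}"
 have I: "submodule I R (ring_as_module R (\<lambda>r. r))"
  by (rule submoduleI'[OF ring_as_module_self[OF is_cring]])
   (use Nr(2-4) Kr(1) in \<open>auto simp: I_def ring_as_module_def P.smult_l_distr P.smult_assoc1\<close>)
 note pr = quotient_proj[OF \<Phi> N]
 let ?X = "quotient_module \<Phi> ?N"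
 have X: "module R ?X" by (rule quotient_is_module[OF \<Phi> N])
 interpret X: module R ?X by (rule X)
 let ?c = "\<lambda>p. ?N +>\<^sub>\<Phi> p"
 note cr = lin_all[OF pr(1) \<Phi> X]
 have cs: "?c (a \<odot>\<^sub>\<Phi> p) = ?c (a \<odot>\<^sub>\<Phi> p')" if a: "a \<in> I" and p: "p \<in>: \<Phi>" "p' \<in>: \<Phi>" "\<delta> p = \<delta> p'" for a p p'
 proof -
  have aR: "a \<in>: R" using a by (simp add: I_def)
  have "p \<ominus>\<^sub>\<Phi> p' \<in> K0" using p by (simp add: mod_ker_def \<delta>r F.minus_self)
  then have "a \<odot>\<^sub>\<Phi> (p \<ominus>\<^sub>\<Phi> p') \<in> ?N" using a by (simp add: I_def)
  moreover have "a \<odot>\<^sub>\<Phi> (p \<ominus>\<^sub>\<Phi> p') = a \<odot>\<^sub>\<Phi> p \<ominus>\<^sub>\<Phi> a \<odot>\<^sub>\<Phi> p'" using aR p(1,2) by algebra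
  ultimately show ?thesis using quotient_coset(2)[OF \<Phi> N P.smult_closed[OF aR p(1)] P.smult_closed[OF aR p(2)]] by simp
 qed
 have "\<forall>y\<in>carrier F. \<exists>p\<in>carrier \<Phi>. \<delta> p = y" unfolding \<delta>(2)[symmetric] by blast
 then obtain s where s: "\<And>y. y \<in>: F ==> s y \<in>: \<Phi>" "\<And>y. y \<in>: F ==> \<delta> (s y) = y" by metis
 have IR: "a \<in>: R" if "a \<in> I" for a using that by (simp add: I_def)
 let ?Y = "{w. k w \<noteq> \<zero>}"
 have Y: "finite ?Y" "?Y \<subseteq> W" using kc by (auto simp: free_module_def)
 have g: "gen w \<in>: \<Phi>" "\<delta> (gen w) \<in>: F" if "w \<in> ?Y" for w using \<delta>r(1) Y(2) that by auto
 have kI: "k w \<in> I" for w using kw coord by (simp add: I_def)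
 have ke: "k = (\<Oplus>\<^sub>\<Phi> w\<in>?Y. k w \<odot>\<^sub>\<Phi> gen w)"
  using free_ext[OF lc_lin[OF \<Phi>, of W "gen"] lin_id \<Phi> _ kc] lc_gen[OF \<Phi>, of "gen"] by (simp add: lc_def)
 have kg: "(\<lambda>w. k w \<odot>\<^sub>\<Phi> gen w) \<in> ?Y \<rightarrow> carrier \<Phi>" using g kw by auto
 have "(\<Oplus>\<^sub>F w\<in>?Y. k w \<odot>\<^sub>F \<delta> (gen w)) = \<delta> (\<Oplus>\<^sub>\<Phi> w\<in>?Y. k w \<odot>\<^sub>\<Phi> gen w)"
  unfolding lin_finsum[OF \<delta>(1) \<Phi> F Y(1) kg] by (rule F.M.finsum_cong') (use g kw \<delta>r(3) in auto)
 also have "\<dots> = \<zero>\<^sub>F" using ke k by (simp add: mod_ker_def)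
 finally have rel: "(\<Oplus>\<^sub>F w\<in>?Y. k w \<odot>\<^sub>F \<delta> (gen w)) = \<zero>\<^sub>F" .
 have "(\<Oplus>\<^sub>?X w\<in>?Y. ?c (k w \<odot>\<^sub>\<Phi> s (\<delta> (gen w)))) = \<zero>\<^sub>?X"
 proof (rule flat_relation[OF is_cring flat emb I Y(1) kI g(2) rel X])
  fix a y assume a: "a \<in> I" and y: "y \<in>: F"
  note aR = IR[OF a] and sy = s[OF y]
  show "?c (a \<odot>\<^sub>\<Phi> s y) \<in>: ?X" by (rule cr(1)[OF P.smult_closed[OF aR sy(1)]])
  show "?c ((a \<oplus> a') \<odot>\<^sub>\<Phi> s y) = ?c (a \<odot>\<^sub>\<Phi> s y) \<oplus>\<^sub>?X ?c (a' \<odot>\<^sub>\<Phi> s y)" if "a' \<in> I" for a'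
   using IR[OF that] aR sy(1) by (simp only: P.smult_l_distr cr(2) P.smult_closed)
  show "?c (a \<odot>\<^sub>\<Phi> s (y \<oplus>\<^sub>F y')) = ?c (a \<odot>\<^sub>\<Phi> s y) \<oplus>\<^sub>?X ?c (a \<odot>\<^sub>\<Phi> s y')" if y': "y' \<in>: F" for y'
  proof -
   have "?c (a \<odot>\<^sub>\<Phi> s (y \<oplus>\<^sub>F y')) = ?c (a \<odot>\<^sub>\<Phi> (s y \<oplus>\<^sub>\<Phi> s y'))" by (rule cs[OF a]) (use s y y' \<delta>r(2) in simp_all)
   then show ?thesis using aR sy(1) s(1)[OF y'] by (simp only: P.smult_r_distr cr(2) P.smult_closed)
  qed
  fix r assume r: "r \<in>: R"
  show ra: "?c ((r \<otimes> a) \<odot>\<^sub>\<Phi> s y) = r \<odot>\<^sub>?X ?c (a \<odot>\<^sub>\<Phi> s y)"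
   using r aR sy(1) by (simp only: P.smult_assoc1 cr(3) P.smult_closed)
  have "?c (a \<odot>\<^sub>\<Phi> s (r \<odot>\<^sub>F y)) = ?c (a \<odot>\<^sub>\<Phi> (r \<odot>\<^sub>\<Phi> s y))" by (rule cs[OF a]) (use s y r \<delta>r(3) in simp_all)
  then show "?c ((r \<otimes> a) \<odot>\<^sub>\<Phi> s y) = ?c (a \<odot>\<^sub>\<Phi> s (r \<odot>\<^sub>F y))"
   using r aR sy(1) m_comm[OF r aR] by (simp only: P.smult_assoc1[symmetric])
 qed
 also have "(\<Oplus>\<^sub>?X w\<in>?Y. ?c (k w \<odot>\<^sub>\<Phi> s (\<delta> (gen w)))) = (\<Oplus>\<^sub>?X w\<in>?Y. ?c (k w \<odot>\<^sub>\<Phi> gen w))"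
 proof (rule X.M.finsum_cong')
  show "?c (k w \<odot>\<^sub>\<Phi> s (\<delta> (gen w))) = ?c (k w \<odot>\<^sub>\<Phi> gen w)" if "w \<in> ?Y" for w
   by (rule cs[OF kI s(1)[OF g(2)[OF that]] g(1)[OF that] s(2)[OF g(2)[OF that]]])
 qed (use kg cr(1) in auto)
 also have "\<dots> = ?c k" using lin_finsum[OF pr(1) \<Phi> X Y(1) kg] ke by simp
 finally have "k \<in> ?N" using pr(3)[OF kc] by simp
 then obtain \<kappa> where \<kappa>: "k = lc R \<Phi> \<kappa> k" "\<And>w. \<kappa> w \<in> K0" by blast
 have "lc R \<Phi> \<kappa> p \<in> K0" if "p \<in>: \<Phi>" for p
  by (rule lc_in_submodule[OF \<Phi> K0 that Kr(1)[OF \<kappa>(2)]]) (rule Kr(4)[OF free_coeff[OF that] \<kappa>(2)])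
 then show ?thesis by (intro exI[of _ "lc R \<Phi> \<kappa>"] conjI ballI lc_lin[OF \<Phi> Kr(1)[OF \<kappa>(2)]] \<kappa>(1)[symmetric])
qed

text \<open>If \<open>\<theta>\<close> fixes \<open>X\<close> and \<open>\<eta>\<close> fixes \<open>k - \<theta> k\<close>, then \<open>\<theta> + \<eta> (1 - \<theta>)\<close> fixes \<open>X\<close> and \<open>k\<close>.\<close>

lemma flat_fixes_finite:
 assumes flat: "flat_module TYPE('u) R F" and emb: "carrier R \<lesssim> (UNIV :: 'u set)" and X: "finite X" "X \<subseteq> K0"
 shows "\<exists>\<theta>. lin R \<Phi> \<Phi> \<theta> \<and> (\<forall>p\<in>carrier \<Phi>. \<theta> p \<in> K0) \<and> (\<forall>x\<in>X. \<theta> x = x)"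
 using X
proof (induction X rule: finite_induct)
 case empty
 then show ?case using lin_zero[OF \<Phi>] submoduleD(2)[OF K0 \<Phi>] by (intro exI[of _ "\<lambda>_. \<zero>\<^sub>\<Phi>"]) auto
next
 case (insert k X)
 interpret P: module R \<Phi> by (rule \<Phi>)
 note Kr = submoduleD[OF K0 \<Phi>]
 obtain \<theta> where \<theta>: "lin R \<Phi> \<Phi> \<theta>" "\<And>p. p \<in>: \<Phi> ==> \<theta> p \<in> K0" "\<forall>x\<in>X. \<theta> x = x" using insert by auto
 have kc: "k \<in>: \<Phi>" "\<theta> k \<in>: \<Phi>" using insert.prems Kr(1) \<theta>(2) by auto
 have "k \<ominus>\<^sub>\<Phi> \<theta> k \<in> K0" by (rule Kr(6)) (use insert.prems \<theta>(2)[OF kc(1)] in auto)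
 from flat_fixes_element[OF flat emb this] obtain \<eta> where \<eta>: "lin R \<Phi> \<Phi> \<eta>" "\<And>p. p \<in>: \<Phi> ==> \<eta> p \<in> K0" "\<eta> (k \<ominus>\<^sub>\<Phi> \<theta> k) = k \<ominus>\<^sub>\<Phi> \<theta> k" by blast
 have dl: "lin R \<Phi> \<Phi> (\<lambda>p. p \<ominus>\<^sub>\<Phi> \<theta> p)" by (rule lin_diff[OF lin_id \<theta>(1) \<Phi>])
 have l: "lin R \<Phi> \<Phi> (\<lambda>p. \<theta> p \<oplus>\<^sub>\<Phi> \<eta> (p \<ominus>\<^sub>\<Phi> \<theta> p))" by (rule lin_plus[OF \<theta>(1) lin_comp[OF dl \<eta>(1)] \<Phi>])
 have m: "\<theta> p \<oplus>\<^sub>\<Phi> \<eta> (p \<ominus>\<^sub>\<Phi> \<theta> p) \<in> K0" if "p \<in>: \<Phi>" for p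
  by (rule Kr(3)[OF \<theta>(2)[OF that] \<eta>(2)[OF linD(1)[OF dl that]]])
 have "\<theta> k \<oplus>\<^sub>\<Phi> (k \<ominus>\<^sub>\<Phi> \<theta> k) = k" using kc by algebra
 moreover have "\<theta> x \<oplus>\<^sub>\<Phi> \<eta> (x \<ominus>\<^sub>\<Phi> \<theta> x) = x" if "x \<in> X" for x
 proof -
  have "x \<in>: \<Phi>" using insert.prems Kr(1) that by blast
  then show ?thesis using \<theta>(3) that lin_all(4)[OF \<eta>(1) \<Phi> \<Phi>] by (simp add: P.minus_self)
 qed
 ultimately show ?case using l m \<eta>(3) by (intro exI[of _ "\<lambda>p. \<theta> p \<oplus>\<^sub>\<Phi> \<eta> (p \<ominus>\<^sub>\<Phi> \<theta> p)"]) auto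
qed

end

section \<open>Projectivity of the base change\<close>

text \<open>The test modules for strong flatness have their elements in an infinite type. The cardinality estimates show
 that the modules which occur below embed into this type.\<close>

lemma infinite_pairing:
 assumes "infinite (UNIV :: 'u set)"
 shows "\<exists>g :: 'u \<times> 'u => 'u. inj g"
 using card_of_Times_same_infinite[OF assms] card_of_ordIso[of "UNIV \<times> UNIV" "UNIV :: 'u set"] by (auto simp: bij_betw_def)

lemma infinite_list_coding:
 assumes inf: "infinite (UNIV :: 'u set)"
 shows "\<exists>h :: 'u list => 'u. inj h"
proof -
 obtain g :: "'u \<times> 'u => 'u" where g: "inj g" using infinite_pairing[OF inf] by blast
 obtain n :: "nat => 'u" where n: "inj n" using infinite_countable_subset[OF inf] by blast
 define f where "f = rec_list (n 0) (\<lambda>x _ y. g (x, y))"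
 have f: "xs = ys" if "length xs = length ys" "f xs = f ys" for xs ys
  using that by (induction xs ys rule: list_induct2) (auto simp: f_def dest: injD[OF g])
 have "inj (\<lambda>xs. g (n (length xs), f xs))"
  by (rule injI) (use f in \<open>auto dest!: injD[OF g] injD[OF n]\<close>)
 then show ?thesis by blast
qed

lemma free_module_lepoll:
 fixes A :: "('a, 'x) ring_scheme" and W :: "'w set"
 assumes inf: "infinite (UNIV :: 'u set)" and A: "carrier A \<lesssim> (UNIV :: 'u set)" and W: "W \<lesssim> (UNIV :: 'u set)"
 shows "carrier (free_module A W) \<lesssim> (UNIV :: 'u set)"
proof -
 obtain g :: "'u \<times> 'u => 'u" where g: "inj g" using infinite_pairing[OF inf] by blast
 obtain h :: "'u list => 'u" where h: "inj h" using infinite_list_coding[OF inf] by blast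
 obtain i :: "'a => 'u" and j :: "'w => 'u" where i: "inj_on i (carrier A)" and j: "inj_on j W" using A W by (auto simp: lepoll_def)
 define G where "G p = {(w, p w) | w. p w \<noteq> \<zero>\<^sub>A}" for p :: "'w => 'a"
 define e where "e = (\<lambda>(w, a). g (j w, i a))"
 have ei: "inj_on e (W \<times> carrier A)" unfolding e_def by (rule inj_onI) (auto dest!: injD[OF g] inj_onD[OF i] inj_onD[OF j])
 have "\<exists>xs. set xs = e ` G p" if "p \<in>: free_module A W" for p
 proof (rule finite_list)
  have "G p = (\<lambda>w. (w, p w)) ` {w. p w \<noteq> \<zero>\<^sub>A}" by (auto simp: G_def)
  then show "finite (e ` G p)" using that by (simp add: free_module_def)
 qed
 then obtain l where l: "\<And>p. p \<in>: free_module A W ==> set (l p) = e ` G p" by metis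
 have "inj_on (\<lambda>p. h (l p)) (carrier (free_module A W))"
 proof (rule inj_onI)
  fix p q assume p: "p \<in>: free_module A W" and q: "q \<in>: free_module A W" and "h (l p) = h (l q)"
  then have "e ` G p = e ` G q" using l[OF p] l[OF q] injD[OF h] by metis
  moreover have "G p \<subseteq> W \<times> carrier A" "G q \<subseteq> W \<times> carrier A" using p q by (auto simp: G_def free_module_def)
  ultimately have eq: "G p = G q" using inj_on_image_eq_iff[OF ei] by blast
  show "p = q"
  proof
   fix w
   have "(w, p w) \<in> G p \<longleftrightarrow> (w, p w) \<in> G q" "(w, q w) \<in> G p \<longleftrightarrow> (w, q w) \<in> G q" using eq by simp_all
   then show "p w = q w" by (auto simp: G_def)
  qed
 qed
 then show ?thesis by (auto simp: lepoll_def)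
qed

locale rjs = mult_family R "{1..m}" S for R :: "('r, 'x) ring_scheme" (structure) and m S +
 fixes J s
 assumes J: "J \<subseteq> {1..m}" and s: "k \<in> {1..m} - J ==> s k \<in> S k"
begin

abbreviation A where "A \<equiv> RJs m R S J s"
abbreviation \<phi> where "\<phi> \<equiv> RJs_map m R S J s"

lemma sX: "s ` ({1..m} - J) \<subseteq> carrier R"
 using s S[THEN submonoid.subset] by blast

lemma loc: "localized R (P J)"
 by (rule localizedI[OF P_submonoid[OF J]])

lemma ideal_eq: "RJs_ideal m R S J s = genideal (localization R (P J)) (loc_map R (P J) ` s ` ({1..m} - J))"
 by (simp add: RJs_ideal_def Let_def image_image)

lemma A_cring: "cring A" and \<phi>_hom: "\<phi> \<in> ring_hom R A"
 using localized.qring[OF loc sX] localized.qmap_hom[OF loc sX] by (auto simp: RJs_def RJs_map_def[abs_def] ideal_eq)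

lemma A_lepoll:
 assumes inf: "infinite (UNIV :: 'u set)" and R: "carrier R \<lesssim> (UNIV :: 'u set)"
 shows "carrier A \<lesssim> (UNIV :: 'u set)"
proof -
 interpret localized R "P J" by (rule loc)
 obtain g :: "'u \<times> 'u => 'u" where g: "inj g" using infinite_pairing[OF inf] by blast
 obtain i :: "_ => 'u" where i: "inj_on i (carrier R)" using R by (auto simp: lepoll_def)
 have "\<forall>a\<in>carrier A. \<exists>x. a = RJs_ideal m R S J s +>\<^sub>Q fr (fst x) (snd x) \<and> fst x \<in>: R \<and> snd x \<in>: R"
 proof
  fix a assume "a \<in>: A"
  then obtain r t where "r \<in>: R" "t \<in> P J" "a = RJs_ideal m R S J s +>\<^sub>Q fr r t"
   by (auto simp: RJs_def FactRing_def A_RCOSETS_def' loc_carrier)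
  then show "\<exists>x. a = RJs_ideal m R S J s +>\<^sub>Q fr (fst x) (snd x) \<and> fst x \<in>: R \<and> snd x \<in>: R"
   by (intro exI[of _ "(r, t)"]) simp
 qed
 then obtain x where x: "\<And>a. a \<in>: A ==> a = RJs_ideal m R S J s +>\<^sub>Q fr (fst (x a)) (snd (x a))"
  "\<And>a. a \<in>: A ==> fst (x a) \<in>: R \<and> snd (x a) \<in>: R" by metis
 have "inj_on (\<lambda>a. g (i (fst (x a)), i (snd (x a)))) (carrier A)"
 proof (rule inj_onI)
  fix a b assume ab: "a \<in>: A" "b \<in>: A" "g (i (fst (x a)), i (snd (x a))) = g (i (fst (x b)), i (snd (x b)))"
  then have "fst (x a) = fst (x b)" "snd (x a) = snd (x b)" using injD[OF g ab(3)] inj_onD[OF i] x(2) by auto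
  then show "a = b" using x(1)[OF ab(1)] x(1)[OF ab(2)] by simp
 qed
 then show ?thesis by (auto simp: lepoll_def)
qed

text \<open>If \<open>J'\<close> is contained in \<open>J\<close>, then \<open>P J'\<close> acts bijectively on \<open>D\<close>. Otherwise it contains one of the elements
 \<open>s k\<close>, which kill \<open>D\<close>.\<close>

lemma A_module_cotorsion:
 assumes D: "module A D"
 shows "cotorsion (restrict_scalars \<phi> D)"
 unfolding cotorsion_def
proof (intro allI impI)
 fix J' assume J': "J' \<subseteq> {1..m}"
 interpret PJ': localized R "P J'" by (rule localizedI[OF P_submonoid[OF J']])
 let ?C = "restrict_scalars \<phi> D"
 have C: "module R ?C" by (rule restrict_scalars_module[OF is_cring \<phi>_hom D])
 show "loc_cotorsion R (P J') ?C"
 proof (cases "J' \<subseteq> J")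
  case True
  have "acts_bij ?C (P J)"
   using localized.qmodule_acts_bij[OF loc sX] D by (simp add: RJs_def RJs_map_def[abs_def] ideal_eq)
  then show ?thesis using PJ'.loc_cotorsion_bij[OF C] P_mono[OF True] by (auto simp: acts_bij_def)
 next
  case False
  then obtain k where k: "k \<in> J'" "k \<in> {1..m} - J" using J' by blast
  interpret D: module A D by (rule D)
  have "\<phi> (s k) = \<zero>\<^sub>A" using localized.qmap_zero[OF loc sX, of "s k"] k by (simp add: RJs_def RJs_map_def ideal_eq)
  then show ?thesis using PJ'.loc_cotorsion_killed[OF C, of "s k"] s[OF k(2)] P_upper[OF k(1)] by auto
 qed
qed

text \<open>The \<open>A\<close>-span of the kernel of a presentation is a cotorsion module. A strongly flat module has no extensions
 by it, and this provides a retraction of \<open>A \<otimes> \<Phi>\<close> onto the span.\<close>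

lemma strongly_flat_projective:
 fixes F :: "('r, 'f, 'y) module_scheme"
 assumes sf: "strongly_flat TYPE('u) m R S F" and inf: "infinite (UNIV :: 'u set)"
  and emb: "carrier R \<lesssim> (UNIV :: 'u set)" "carrier F \<lesssim> (UNIV :: 'u set)"
 shows "projective_module A (RJs_tensor m R S J s F)"
proof -
 have F: "module R F" using sf by (simp add: strongly_flat_def)
 interpret base_change R "carrier F" A \<phi>
  by (rule base_change.intro[OF free_base.intro[OF is_cring] A_cring base_change_axioms.intro[OF \<phi>_hom]])
 interpret presentation R "carrier F" F "lc R F (\<lambda>x. x)"
  by (rule presentation.intro[OF free_base.intro[OF is_cring] presentation_axioms.intro[OF F carrier_presentation[OF F]]])
 let ?M = "base_span A \<phi> (carrier F) K0"
 let ?D = "A\<Phi> |: ?M"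
 note Ms = span_sub[OF K0]
 have D: "module A ?D" by (rule sub_module[OF Ms A\<Phi>])
 let ?C = "restrict_scalars \<phi> ?D"
 have C: "module R ?C" by (rule res[OF D])
 obtain i :: "_ => 'u" where i: "inj_on i (carrier A\<Phi>)"
  using free_module_lepoll[OF inf A_lepoll[OF inf emb(1)] emb(2)] by (auto simp: lepoll_def)
 have iC: "inj_on i (carrier ?C)" by (rule inj_on_subset[OF i]) (use submoduleD(1)[OF Ms A\<Phi>] in auto)
 note C' = transport[OF C iC]
 have "weakly_cotorsion m R S (transport i ?C)"
  unfolding weakly_cotorsion_def
 proof (intro conjI allI impI)
  fix J' assume J': "J' \<subseteq> {1..m}"
  interpret PJ': localized R "P J'" by (rule localizedI[OF P_submonoid[OF J']])
  have "loc_cotorsion R (P J') ?C" using A_module_cotorsion[OF D] J' unfolding cotorsion_def by blast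
  then show "Ext1_vanishes R (loc_module R (P J')) (transport i ?C)"
   unfolding PJ'.loc_cotorsion_Ext1[OF C'(1)] loc_cotorsion_def by (rule extends_iso[OF C'(1) iso_lin_inverse[OF C C'(2)]])
 qed (rule C'(1))
 then have "Ext1_vanishes R F (transport i ?C)" using sf by (simp add: strongly_flat_def)
 then have "extends R \<Phi> K0 ?C"
  unfolding Ext1_vanishes_free_presentation[OF F C'(1) \<delta>] by (rule extends_iso[OF C C'(2)])
 moreover have "lin R (\<Phi> |: K0) ?C (base_map \<phi>)"
  using lin_restrict[OF base_map_lin, of K0] submoduleD(1)[OF K0 \<Phi>] span_base[OF K0] by (auto simp: lin_def)
 ultimately obtain g where g: "lin R \<Phi> ?C g" "\<And>k. k \<in> K0 ==> g k = base_map \<phi> k" unfolding extends_def by blast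
 let ?\<rho> = "lc A ?D (\<lambda>w. g (gen w))"
 have \<rho>: "lin A A\<Phi> ?D ?\<rho>" by (rule A.lc_lin[OF D]) (use linD(1)[OF g(1)] in auto)
 have \<rho>': "lin A A\<Phi> A\<Phi> ?\<rho>" by (rule lin_outof[OF \<rho>]) (use submoduleD(1)[OF Ms A\<Phi>] in auto)
 have "?M \<subseteq> {p \<in> carrier A\<Phi>. ?\<rho> p = p}"
 proof (rule span_least[OF K0 equalizer_submodule[OF \<rho>' lin_id A\<Phi> A\<Phi>]])
  fix k assume k: "k \<in> K0"
  have kc: "k \<in>: \<Phi>" by (rule submoduleD(1)[OF K0 \<Phi> k])
  show "base_map \<phi> k \<in> {p \<in> carrier A\<Phi>. ?\<rho> p = p}" using base_extend[OF D g(1) kc] g(2)[OF k] base_map_closed[OF kc] by simp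
 qed
 then have id: "?\<rho> p = p" if "p \<in> ?M" for p using that by blast
 have ker: "lc R F (\<lambda>x. x) p = \<zero>\<^sub>F \<longleftrightarrow> p \<in> K0" if "p \<in>: \<Phi>" for p using that by (simp add: mod_ker_def)
 interpret T: tensor_context R A \<phi> "ring_as_module A (\<lambda>a. a)" F
  by (rule tensor_context.intro[OF is_cring A_cring tensor_context_axioms.intro[OF \<phi>_hom ring_as_module_self[OF A_cring] F]])
 obtain q where q: "lin A A\<Phi> T.MN q" "q ` carrier A\<Phi> = carrier T.MN" "\<forall>p\<in>carrier A\<Phi>. q p = \<zero>\<^bsub>T.MN\<^esub> \<longleftrightarrow> p \<in> ?M"
  using tensor_presentation[OF K0 F \<delta> ker] by blast
 have "\<forall>p\<in>carrier A\<Phi>. q (?\<rho> p) = \<zero>\<^bsub>T.MN\<^esub> \<and> (q p = \<zero>\<^bsub>T.MN\<^esub> --> ?\<rho> p = p)"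
  using q(3) linD(1)[OF \<rho>] linD(1)[OF \<rho>'] id by simp
 then show ?thesis
  using A.projective_iff_retraction[OF T.MN q(1,2)] \<rho>' by (auto simp: RJs_tensor_def Let_def)
qed

end

section \<open>The theorem\<close>

text \<open>A set \<open>W\<close> of generators which is large enough provides all terms of a free resolution.\<close>

lemma (in presentation) resolution_exists:
 assumes emb: "carrier \<Phi> \<lesssim> W"
 shows "\<exists>K d. K 0 = K0 \<and> resolution R W K d"
proof -
 obtain i where i: "inj_on i (carrier \<Phi>)" "i ` carrier \<Phi> \<subseteq> W" using emb by (auto simp: lepoll_def)
 define v where "v N w = (if w \<in> i ` N then the_inv_into (carrier \<Phi>) i w else \<zero>\<^sub>\<Phi>)" for N w
 define D where "D N = lc R \<Phi> (v N)" for N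
 define K where "K = rec_nat K0 (\<lambda>_ N. mod_ker \<Phi> \<Phi> (D N))"
 have vN: "v N w \<in> N" if "submodule N R \<Phi>" for N w
  using submoduleD(1,2)[OF that \<Phi>] the_inv_into_f_f[OF i(1)] by (auto simp: v_def)
 have Dl: "lin R \<Phi> \<Phi> (D N)" if N: "submodule N R \<Phi>" for N
  unfolding D_def by (rule lc_lin[OF \<Phi> submoduleD(1)[OF N \<Phi> vN[OF N]]])
 have Dim: "D N ` carrier \<Phi> = N" if N: "submodule N R \<Phi>" for N
 proof
  note Nr = submoduleD[OF N \<Phi>]
  show "D N ` carrier \<Phi> \<subseteq> N"
  proof (rule image_subsetI)
   fix p assume p: "p \<in>: \<Phi>"
   show "D N p \<in> N" unfolding D_def by (rule lc_in_submodule[OF \<Phi> N p Nr(1)[OF vN[OF N]] Nr(4)[OF free_coeff[OF p] vN[OF N]]])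
  qed
  show "N \<subseteq> D N ` carrier \<Phi>"
  proof
   fix k assume k: "k \<in> N"
   have "D N (gen (i k)) = k"
    unfolding D_def using lc_gen[OF \<Phi>, of "v N" "i k"] Nr(1)[OF k] the_inv_into_f_f[OF i(1) Nr(1)[OF k]] k by (simp add: v_def)
   moreover have "gen (i k) \<in>: \<Phi>" using i(2) Nr(1)[OF k] by auto
   ultimately show "k \<in> D N ` carrier \<Phi>" by (metis imageI)
  qed
 qed
 have Ks: "submodule (K n) R \<Phi>" for n by (induction n) (simp_all add: K_def K0 ker_submodule[OF Dl \<Phi> \<Phi>])
 have "resolution R W K (\<lambda>n. D (K n))"
  by (rule resolution.intro[OF free_base_axioms resolution_axioms.intro[OF Ks Dl[OF Ks] Dim[OF Ks]]]) (simp add: K_def mod_ker_def)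
 moreover have "K 0 = K0" by (simp add: K_def)
 ultimately show ?thesis by blast
qed

lemma (in mult_family) acts_bij_product:
 assumes C: "module R C" and J: "J \<subseteq> I" "\<And>i. i \<in> J ==> acts_bij C (S i)"
 shows "acts_bij C (P J)"
proof -
 interpret C: module R C by fact
 let ?T = "{t \<in> carrier R. bij_betw (\<lambda>x. t \<odot>\<^sub>C x) (carrier C) (carrier C)}"
 have "submonoid ?T R"
 proof
  fix t u assume t: "t \<in> ?T" and u: "u \<in> ?T"
  have "bij_betw ((\<lambda>x. t \<odot>\<^sub>C x) \<circ> (\<lambda>x. u \<odot>\<^sub>C x)) (carrier C) (carrier C)" by (rule bij_betw_trans) (use t u in auto)
  moreover have "bij_betw (\<lambda>x. (t \<otimes> u) \<odot>\<^sub>C x) (carrier C) (carrier C) \<longleftrightarrow> bij_betw ((\<lambda>x. t \<odot>\<^sub>C x) \<circ> (\<lambda>x. u \<odot>\<^sub>C x)) (carrier C) (carrier C)"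
   by (rule bij_betw_cong) (use t u in \<open>simp add: C.smult_assoc1\<close>)
  ultimately show "t \<otimes> u \<in> ?T" using t u by simp
 next
  have "bij_betw (\<lambda>x. \<one> \<odot>\<^sub>C x) (carrier C) (carrier C) \<longleftrightarrow> bij_betw (\<lambda>x. x) (carrier C) (carrier C)" by (rule bij_betw_cong) simp
  then show "\<one> \<in> ?T" using bij_betw_id[of "carrier C"] by (simp add: id_def)
 qed auto
 moreover have "S j \<subseteq> ?T" if "j \<in> J" for j using J that S[THEN submonoid.subset, of j] by (auto simp: acts_bij_def)
 ultimately have "P J \<subseteq> ?T" by (rule P_least)
 then show ?thesis by (auto simp: acts_bij_def)
qed

lemma (in resolution) fixable_kernel:
 assumes "presentation R W F \<delta>" "K 0 = mod_ker \<Phi> F \<delta>" and flat: "flat_module TYPE('u) R F" "carrier R \<lesssim> (UNIV :: 'u set)"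
 shows "fixable (K 0)"
 unfolding fixable_def assms(2) using presentation.flat_fixes_finite[OF assms(1) flat] by blast

text \<open>A module at which every index is split is a module over one of the rings \<open>R\<^sub>J\<^sub>,\<^sub>s\<close>: take for \<open>J\<close> the set of
 indices at which \<open>S j\<close> acts bijectively, and for \<open>s k\<close> an element which kills the module. Over this ring the
 resolution of \<open>F\<close> splits.\<close>

lemma split_extends:
 fixes R :: "('r, 'x) ring_scheme"
 assumes mf: "mult_family R {1..m} S" and res: "resolution R W K d" and pr: "presentation R W F \<delta>" and K0: "K 0 = mod_ker (free_module R W) F \<delta>"
  and flat: "flat_module TYPE('u) R F" "carrier R \<lesssim> (UNIV :: 'u set)"
  and proj: "\<And>J s. J \<subseteq> {1..m} ==> (\<And>k. k \<in> {1..m} - J ==> s k \<in> S k) ==> projective_module (RJs m R S J s) (RJs_tensor m R S J s F)"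
  and C: "module R C" and sp: "mult_family.split S {1..m} C"
 shows "extends R (free_module R W) (K n) C"
proof -
 interpret M: mult_family R "{1..m}" S by (rule mf)
 interpret pr: presentation R W F \<delta> by (rule pr)
 define J where "J = {i \<in> {1..m}. acts_bij C (S i)}"
 define s where "s k = (SOME x. x \<in> S k \<and> M.killed_by C x)" for k
 have J: "J \<subseteq> {1..m}" by (auto simp: J_def)
 have "s k \<in> S k \<and> M.killed_by C (s k)" if k: "k \<in> {1..m} - J" for k
 proof -
  have "\<exists>x. x \<in> S k \<and> M.killed_by C x" using sp k unfolding M.split_def J_def by blast
  then show ?thesis unfolding s_def by (rule someI_ex)
 qed
 then have s: "\<And>k. k \<in> {1..m} - J ==> s k \<in> S k" "\<And>k. k \<in> {1..m} - J ==> M.killed_by C (s k)" by blast+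
 interpret r: rjs R m S J s by (rule rjs.intro[OF mf rjs_axioms.intro[OF J s(1)]])
 interpret b: base_resolution R W r.A r.\<phi> K d
  by (rule base_resolution.intro[OF base_change.intro[OF pr.free_base_axioms r.A_cring base_change_axioms.intro[OF r.\<phi>_hom]] res])
 have fx: "b.fixable (K 0)" by (rule b.fixable_kernel[OF pr K0 flat])
 interpret T: tensor_context R r.A r.\<phi> "ring_as_module r.A (\<lambda>a. a)" F
  by (rule tensor_context.intro[OF M.is_cring r.A_cring tensor_context_axioms.intro[OF r.\<phi>_hom ring_as_module_self[OF r.A_cring] pr.F]])
 have ker: "\<delta> p = \<zero>\<^sub>F \<longleftrightarrow> p \<in> K 0" if "p \<in>: pr.\<Phi>" for p using that by (simp add: K0 mod_ker_def)
 obtain q where q: "lin r.A b.A\<Phi> T.MN q" "q ` carrier b.A\<Phi> = carrier T.MN" "\<forall>p\<in>carrier b.A\<Phi>. q p = \<zero>\<^bsub>T.MN\<^esub> \<longleftrightarrow> p \<in> b.MA 0"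
  using b.tensor_presentation[OF b.K pr.F pr.\<delta> ker] by blast
 have "projective_module r.A T.MN" using proj[OF J s(1)] by (simp add: RJs_tensor_def Let_def)
 then obtain \<rho> where \<rho>: "lin r.A b.A\<Phi> b.A\<Phi> \<rho>" "\<forall>p\<in>carrier b.A\<Phi>. q (\<rho> p) = \<zero>\<^bsub>T.MN\<^esub> \<and> (q p = \<zero>\<^bsub>T.MN\<^esub> --> \<rho> p = p)"
  unfolding b.A.projective_iff_retraction[OF T.MN q(1,2)] by blast
 have "\<exists>\<rho>. lin r.A b.A\<Phi> b.A\<Phi> \<rho> \<and> (\<forall>p\<in>carrier b.A\<Phi>. \<rho> p \<in> b.MA 0 \<and> (p \<in> b.MA 0 --> \<rho> p = p))"
  using q(3) \<rho> linD(1)[OF \<rho>(1)] by (intro exI[of _ \<rho>]) simp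
 from b.retraction_all[OF fx this, of n] obtain \<rho> where \<rho>: "b.fixable (K n)" "lin r.A b.A\<Phi> b.A\<Phi> \<rho>"
  "\<And>p. p \<in>: b.A\<Phi> ==> \<rho> p \<in> b.MA n" "\<And>p. p \<in>: b.A\<Phi> ==> p \<in> b.MA n ==> \<rho> p = p" by blast
 have "acts_bij C (M.P J)" by (rule M.acts_bij_product[OF C J]) (simp add: J_def)
 moreover have "x \<odot>\<^sub>C c = \<zero>\<^sub>C" if "x \<in> s ` ({1..m} - J)" "c \<in>: C" for x c using s(2) that by (auto simp: M.killed_by_def)
 ultimately obtain D :: "(_, _) module" where D: "module r.A D" "iso_lin R C (restrict_scalars r.\<phi> D) (\<lambda>x. x)"
  using localized.qmodule_exists[OF r.loc r.sX C] by (auto simp: RJs_def RJs_map_def[abs_def] r.ideal_eq)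
 show ?thesis by (rule extends_iso[OF C D(2) b.extends_base[OF \<rho> D(1)]])
qed

theorem theorem1p10:
  fixes R :: "('r, 'x) ring_scheme"
    and F :: "('r, 'f, 'y) module_scheme"
    and S :: "nat \<Rightarrow> 'r set"
    and m :: nat
  assumes "cring R"
    and "\<And>j. j \<in> {1..m} \<Longrightarrow> submonoid (S j) R"
    and "\<And>J. J \<subseteq> {1..m} \<Longrightarrow> proj_dim_le_one R (loc_module R (mult_prod R S J))"
    and "\<And>j. j \<in> {1..m} \<Longrightarrow> countable (S j) \<or> bounded_torsion R (S j)"
    and "infinite (UNIV :: 'u set)"
    and "carrier R \<lesssim> (UNIV :: 'u set)"
    and "carrier F \<lesssim> (UNIV :: 'u set)"
    and "flat_module TYPE('u) R F"
  shows "strongly_flat TYPE('u) m R S F \<longleftrightarrow>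
    (\<forall>J\<subseteq>{1..m}. \<forall>s. (\<forall>k\<in>{1..m} - J. s k \<in> S k) \<longrightarrow>
       projective_module (RJs m R S J s) (RJs_tensor m R S J s F))"
proof
 have mf: "mult_family R {1..m} S" by (rule mult_family.intro[OF assms(1) mult_family_axioms.intro[OF assms(2)]])
 { assume sf: "strongly_flat TYPE('u) m R S F"
  show "\<forall>J\<subseteq>{1..m}. \<forall>s. (\<forall>k\<in>{1..m} - J. s k \<in> S k) --> projective_module (RJs m R S J s) (RJs_tensor m R S J s F)"
  proof (intro allI impI)
   fix J s assume J: "J \<subseteq> {1..m}" and s: "\<forall>k\<in>{1..m} - J. s k \<in> S k"
   have "rjs R m S J s" by (rule rjs.intro[OF mf rjs_axioms.intro[OF J]]) (use s in blast)
   then show "projective_module (RJs m R S J s) (RJs_tensor m R S J s F)"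
    by (rule rjs.strongly_flat_projective[OF _ sf assms(5-7)])
  qed }
 assume proj: "\<forall>J\<subseteq>{1..m}. \<forall>s. (\<forall>k\<in>{1..m} - J. s k \<in> S k) --> projective_module (RJs m R S J s) (RJs_tensor m R S J s F)"
 interpret mult_family R "{1..m}" S by (rule mf)
 interpret fb: free_base R "UNIV :: 'u set" by (rule free_base.intro[OF assms(1)])
 have F: "module R F" using assms(8) by (simp add: flat_module_def)
 interpret F: module R F by (rule F)
 obtain j :: "'f => 'u" where j: "inj_on j (carrier F)" using assms(7) by (auto simp: lepoll_def)
 define v where "v w = (if w \<in> j ` carrier F then the_inv_into (carrier F) j w else \<zero>\<^sub>F)" for w
 have v: "v w \<in>: F" "x \<in>: F ==> v (j x) = x" for w x using the_inv_into_f_f[OF j] by (auto simp: v_def)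
 have \<delta>l: "lin R fb.\<Phi> F (lc R F v)" by (rule lc_lin[OF F v(1)])
 have onto: "lc R F v ` carrier fb.\<Phi> = carrier F"
 proof
  show "lc R F v ` carrier fb.\<Phi> \<subseteq> carrier F" using linD(1)[OF \<delta>l] by blast
  show "carrier F \<subseteq> lc R F v ` carrier fb.\<Phi>"
  proof
   fix x assume "x \<in>: F"
   then have "lc R F v (free_gen R (j x)) = x" using lc_gen[OF F, of v "j x"] v by simp
   then show "x \<in> lc R F v ` carrier fb.\<Phi>" by (metis UNIV_I free_gen_closed imageI)
  qed
 qed
 interpret p: presentation R "UNIV :: 'u set" F "lc R F v" by (rule presentation.intro[OF fb.free_base_axioms presentation_axioms.intro[OF F \<delta>l onto]])
 have "carrier fb.\<Phi> \<lesssim> (UNIV :: 'u set)" by (rule free_module_lepoll[OF assms(5,6)]) (simp add: lepoll_refl)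
 then obtain K d where K: "K 0 = p.K0" and res: "resolution R (UNIV :: 'u set) K d" using p.resolution_exists by blast
 define code where "code c l = c (hd l) (tl l)" for c :: "'r => 'r list => 'u" and l
 have code: "inj code"
 proof (rule injI, intro ext)
  fix c c' a l assume "code c = code c'"
  from fun_cong[OF this, of "a # l"] show "c a l = c' a l" by (simp add: code_def)
 qed
 interpret rf: resolution_family R "UNIV :: 'u set" K d "{1..m}" S code
  by (rule resolution_family.intro[OF res mf resolution_family_axioms.intro[OF code
    localized.proj_dim_section[OF localized.intro[OF assms(1) localized_axioms.intro[OF P_submonoid]] assms(3)] assms(4)]])
 show "strongly_flat TYPE('u) m R S F"
  unfolding strongly_flat_def
 proof (intro conjI allI impI F)
  fix C :: "('r, 'u) module" assume wc: "weakly_cotorsion m R S C"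
  have C: "module R C" using wc by (simp add: weakly_cotorsion_def)
  have ct: "cotorsion C"
   unfolding cotorsion_def
  proof (intro allI impI)
   fix J assume J: "J \<subseteq> {1..m}"
   show "loc_cotorsion R (P J) C"
    using wc J localized.loc_cotorsion_Ext1[OF localized.intro[OF assms(1) localized_axioms.intro[OF P_submonoid[OF J]]] C]
    unfolding weakly_cotorsion_def by blast
  qed
  have "extends R fb.\<Phi> (K 0) C"
  proof (rule transfer_extends[OF C, of "\<lambda>x (l :: 'r list). x" "{}" 0])
   fix C' :: "('r, 'r list => 'u) module" assume C': "module R C'" "(0::nat) = 0 ==> cotorsion C'"
   show "extends R fb.\<Phi> (K 0) C'"
   proof (rule rf.extends_induct[OF _ _ _ C'(1), of "{1..m}"])
    show "extends R fb.\<Phi> (K n) C" if "module R C" "split {1..m} C" for C :: "('r, 'r list => 'u) module" and n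
     by (rule split_extends[OF mf res p.presentation_axioms K assms(8,6) _ that]) (use proj in blast)
   qed (use C'(2) in \<open>auto simp: split_def\<close>)
  qed (use ct in \<open>auto simp: split_def inj_on_def fun_eq_iff\<close>)
  then show "Ext1_vanishes R F C" unfolding K using Ext1_vanishes_free_presentation[OF F C \<delta>l onto] by blast
 qed
qed

end
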